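(* Let $T=\mathbb{C}/(\mathbb{Z}\omega_1+\mathbb{Z}\omega_2)$ be a flat torus with $\mathrm{Im}\,(\omega_2/\omega_1)>0$ and area $|T|=1$. Let $p_1=0$ and let $p_2$ be one of $\frac{\omega_1}{2}$, $\frac{\omega_2}{2}$, $\frac{\omega_1+\omega_2}{2}$. There exists a small $\epsilon_0>0$ such that for each $\epsilon\in(0,\epsilon_0)$, setting $\rho=16\pi+\epsilon$, there exist $\lambda=\lambda(\epsilon)>0$ and a solution $u_\lambda$ of $$\Delta u+\rho\left(\frac{e^{u}}{\int_T e^{u}}-1\right)=0\quad\text{in } T$$ such that $u_\lambda(z)=u_\lambda(-z)$ and, as $\epsilon\to 0$: $$\epsilon=(32\pi+o(1))\,\lambda e^{-\lambda},$$ $$u_\lambda(p_i)\to+\infty\ \text{ for } i=1,2,\qquad u_\lambda(x)\to-\infty\ \text{ for all } x\in T\setminus\{p_1,p_2\},$$ and $$\frac{\rho}{\int_T e^{u_\lambda}}\,e^{u_\lambda}\to 8\pi(\delta_{p_1}+\delta_{p_2})\quad\text{in the sense of measures.}$$ *)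

theory Defs
  imports "HOL-Analysis.Analysis"
begin

definition lattice :: "complex \<Rightarrow> complex \<Rightarrow> complex set" where
  "lattice \<omega>1 \<omega>2 = {of_int m * \<omega>1 + of_int n * \<omega>2 | m n :: int. True}"

text \<open>
  Functions on the torus \<open>T = \<complex> / (\<int>\<omega>1 + \<int>\<omega>2)\<close> are represented by their lifts,
  the lattice-periodic functions on the plane. Points of \<open>T\<close> are represented by complex numbers,
  two of which give the same point iff their difference is in the lattice.
\<close>

definition lattice_periodic :: "complex \<Rightarrow> complex \<Rightarrow> (complex \<Rightarrow> 'a) \<Rightarrow> bool" where
  "lattice_periodic \<omega>1 \<omega>2 f \<longleftrightarrow> (\<forall>z. \<forall>l \<in> lattice \<omega>1 \<omega>2. f (z + l) = f z)"

definition cell :: "complex \<Rightarrow> complex \<Rightarrow> complex set" where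
  "cell \<omega>1 \<omega>2 = {of_real s * \<omega>1 + of_real t * \<omega>2 | s t :: real. s \<in> {0..<1} \<and> t \<in> {0..<1}}"

text \<open>The area measure of the flat torus, carried by the half-open fundamental cell, which contains
  exactly one representative of each point.\<close>

definition torus_measure :: "complex \<Rightarrow> complex \<Rightarrow> complex measure" where
  "torus_measure \<omega>1 \<omega>2 = restrict_space lborel (cell \<omega>1 \<omega>2)"

definition C1_map :: "('a::euclidean_space \<Rightarrow> real) \<Rightarrow> bool" where
  "C1_map u \<longleftrightarrow> u differentiable_on UNIV \<and>
     (\<forall>v. continuous_on UNIV (\<lambda>z. frechet_derivative u (at z) v))"

definition C2_map :: "('a::euclidean_space \<Rightarrow> real) \<Rightarrow> bool" where
  "C2_map u \<longleftrightarrow> C1_map u \<and> (\<forall>v. C1_map (\<lambda>z. frechet_derivative u (at z) v))"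

text \<open>For \<open>'a = complex\<close> the basis is \<open>{1, \<i>}\<close>, so this is the sum of the two pure second partial
  derivatives.\<close>

definition laplacian :: "('a::euclidean_space \<Rightarrow> real) \<Rightarrow> 'a \<Rightarrow> real" where
  "laplacian u z =
     (\<Sum>b\<in>Basis. frechet_derivative (\<lambda>w. frechet_derivative u (at w) b) (at z) b)"

definition torus_mean_field_solution ::
    "complex \<Rightarrow> complex \<Rightarrow> real \<Rightarrow> (complex \<Rightarrow> real) \<Rightarrow> bool" where
  "torus_mean_field_solution \<omega>1 \<omega>2 \<rho> u \<longleftrightarrow>
     lattice_periodic \<omega>1 \<omega>2 u \<and> C2_map u \<and>
     (\<forall>z. laplacian u z +
        \<rho> * (exp (u z) / (\<integral>w. exp (u w) \<partial>torus_measure \<omega>1 \<omega>2) - 1) = 0)"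

text \<open>Convergence in the sense of measures on the compact space \<open>T\<close>: convergence of the integrals
  of every continuous function on \<open>T\<close>.\<close>

definition torus_measures_tendsto ::
    "complex \<Rightarrow> complex \<Rightarrow> ('i \<Rightarrow> complex measure) \<Rightarrow> complex measure \<Rightarrow> 'i filter \<Rightarrow> bool" where
  "torus_measures_tendsto \<omega>1 \<omega>2 \<mu> \<nu> F \<longleftrightarrow>
     (\<forall>f :: complex \<Rightarrow> real. continuous_on UNIV f \<and> lattice_periodic \<omega>1 \<omega>2 f \<longrightarrow>
        ((\<lambda>i. \<integral>z. f z \<partial>\<mu> i) \<longlongrightarrow> (\<integral>z. f z \<partial>\<nu>)) F)"

end

theory Submission
 imports Defs "HOL-Complex_Analysis.Complex_Analysis" "HOL-Real_Asymp.Real_Asymp"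
begin

text \<open>
Since \<open>2 * p2\<close> is a period, functions that are moreover \<open>p2\<close>-periodic live on a torus of half the
area, on which one has to produce a single bubble of mass near \<open>8 * pi\<close>.
A theta function with zeros at the lattice, gauged by a Gaussian, gives a periodic weight \<open>P\<close> comparable with
\<open>\<bar>z\<bar>\<^sup>2\<close> at the lattice, for which \<open>V s = ln (8 * s) - 2 * ln (s + P)\<close> solves the equation up to a small error.
On even functions the linearised operator at \<open>V s\<close> is coercive up to a factor logarithmic in \<open>s\<close>, modulo a
Lagrange multiplier for the constants; a contraction then yields, for every small \<open>s\<close>, a solution with parameter
\<open>8 * pi / area + g s\<close>, where \<open>g s > 0\<close> because of the sign of the error tested against the dilation mode.
As \<open>g\<close> is continuous and tends to \<open>0\<close>, every small \<open>\<epsilon>\<close> is attained, and \<open>lam\<close> may be defined by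
\<open>\<epsilon> = 32 * pi * lam * exp (- lam)\<close> exactly.
\<close>

text \<open>Off the lattice \<open>ln P\<close> has constant Laplacian, which says that the squared
  gradient of \<open>P\<close> is \<open>P (lap P + kp P)\<close>. Every function of
  \<open>s + P\<close> then has an explicit Laplacian in \<open>P\<close> and \<open>lap P\<close>;
  since it integrates to 0, suitable choices of the function give the integral bounds on the bubble.
  The obstacle is the dilation mode, nearly in the kernel of the linearisation. It is not projected
  out: it is close to 1 away from the bubble, so the mean-zero condition bounds its coefficient, at
  the price of the logarithm. No inverse of the linearised operator is built: the iteration keeps
  \<open>eV * w\<close> on the right-hand side, and coercivity makes the map itself contract by
  \<open>1 - const / ln (1/s)\<close>. All errors are powers of \<open>s\<close>, so logarithms are
  harmless; 7/8 stands for an exponent below 1 in place of \<open>s ln (1/s)\<close>. Constants such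
  as 5/2 (sharp value 4) and 5/4 stay below the sharp ones, which leaves room for the gap between
  \<open>P\<close> and \<open>|z|^2\<close>. At fixed \<open>s\<close> a stability estimate for the
  parameter covers all small solutions, so an arbitrary choice of solution still gives a continuous
  \<open>g\<close>.\<close>

abbreviation cont :: "('a::topological_space => 'b::topological_space) => bool" where "cont == continuous_on UNIV"

lemmas sqr = power2_eq_square
lemmas icont = integrable_continuous_interval
lemmas Per_def = lattice_periodic_def
lemmas HK_combine = Henstock_Kurzweil_Integration.integral_combine
lemmas HK_add = Henstock_Kurzweil_Integration.integral_add
lemmas integral_ge_0 = Bochner_Integration.integral_nonneg
lemmas integral_eqI = Bochner_Integration.integral_cong

lemma periodic_of_int:
 fixes f :: "complex => 'a"
 assumes "!!z. f (z + w) = f z"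
 shows "f (z + of_int n * w) = f z"
proof -
 have nat: "f (z + of_nat k * w) = f z" for k z
 proof (induction k arbitrary: z)
  case (Suc k)
  have "f (z + of_nat (Suc k) * w) = f ((z + of_nat k * w) + w)" by (simp add: algebra_simps)
  then show ?case using assms Suc by simp
 qed simp
 show ?thesis
 proof (cases n rule: int_cases2)
  case (nonneg k) then show ?thesis using nat[of z k] by simp
 next
  case (nonpos k)
  then show ?thesis using nat[of "z - of_nat k * w" k] by simp
 qed
qed

lemma lattice_periodicI:
 assumes "!!z. f (z + o1) = f z" "!!z. f (z + o2) = f z"
 shows "lattice_periodic o1 o2 f"
 unfolding Per_def lattice_def
proof clarify
 fix z m n
 have "f (z + (of_int m * o1 + of_int n * o2)) = f ((z + of_int m * o1) + of_int n * o2)"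
  by (simp add: algebra_simps)
 also have "... = f z"
  using periodic_of_int[of f o1] periodic_of_int[of f o2] assms by simp
 finally show "f (z + (of_int m * o1 + of_int n * o2)) = f z" .
qed

section \<open>Infinite products and the theta function\<close>

definition qpoch :: "complex => complex => complex" where
 "qpoch q X = (\<Prod>n. 1 - q ^ n * X)"

lemma qpoch_convergent:
 fixes q X :: complex
 assumes "norm q < 1"
 shows "convergent_prod (%n. 1 - q ^ n * X)"
proof -
 have "summable (%n. norm q ^ n * norm X)"
  using assms by (intro summable_mult2 summable_geometric) simp
 then have "abs_convergent_prod (%n. 1 - q ^ n * X)"
  using abs_convergent_prod_conv_summable[of "%n. 1 - q ^ n * X"] by (simp add: norm_mult norm_power)
 then show ?thesis by (rule abs_convergent_prod_imp_convergent_prod)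
qed

lemma qpoch_holomorphic:
 assumes "norm q < 1"
 shows "qpoch q holomorphic_on UNIV"
proof (rule holomorphic_uniform_sequence[where f = "%N X. \<Prod>n<N. 1 - q ^ n * X"])
 fix X :: complex
 have "uniformly_convergent_on (cball X 1) (%N Y. \<Prod>n<N. 1 + (- (q ^ n * Y)))"
 proof (rule Infinite_Products.uniformly_convergent_on_prod)
  show "uniformly_convergent_on (cball X 1) (%N Y. \<Sum>n<N. norm (- (q ^ n * Y)))"
  proof (rule Weierstrass_m_test'[where M = "%n. norm q ^ n * (norm X + 1)"])
   fix n Y assume "Y : cball X 1"
   then have "norm Y <= norm X + 1"
    using norm_triangle_ineq2[of Y X] by (simp add: dist_norm norm_minus_commute)
   then show "norm (norm (- (q ^ n * Y))) <= norm q ^ n * (norm X + 1)"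
    by (simp add: norm_mult norm_power mult_left_mono)
  qed (use assms in \<open>auto intro!: summable_mult2\<close>)
 qed (auto intro!: continuous_intros)
 then obtain l where l: "uniform_limit (cball X 1) (%N Y. \<Prod>n<N. 1 - q ^ n * Y) l sequentially"
  by (auto simp: uniformly_convergent_on_def)
 have "l Y = qpoch q Y" if "Y : cball X 1" for Y
 proof -
  have "(%N. \<Prod>n<N. 1 - q ^ n * Y) \<longlonglongrightarrow> l Y"
   using tendsto_uniform_limitI[OF l that] .
  moreover have "(%N. \<Prod>n<N. 1 - q ^ n * Y) \<longlonglongrightarrow> qpoch q Y"
   unfolding qpoch_def
   using convergent_prod_LIMSEQ[OF qpoch_convergent[OF assms, of Y]]
   by (subst LIMSEQ_lessThan_iff_atMost)
  ultimately show ?thesis using LIMSEQ_unique by blast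
 qed
 then have "uniform_limit (cball X 1) (%N Y. \<Prod>n<N. 1 - q ^ n * Y) (qpoch q) sequentially"
  using uniform_limit_cong'[THEN iffD1, OF refl _ l] by blast
 then show "EX d>0. cball X d \<subseteq> UNIV & uniform_limit (cball X d) (%N X. \<Prod>n<N. 1 - q ^ n * X) (qpoch q) sequentially"
  by (intro exI[of _ 1]) auto
qed (auto intro!: holomorphic_intros)

lemma qpoch_rec:
 assumes "norm q < 1"
 shows "qpoch q X = (1 - X) * qpoch q (q * X)"
proof -
 have 1: "(%n. \<Prod>i\<le>n. 1 - q ^ i * X) \<longlonglongrightarrow> qpoch q X" for X
  unfolding qpoch_def by (rule convergent_prod_LIMSEQ[OF qpoch_convergent[OF assms]])
 have "(%n. (1 - X) * (\<Prod>i\<le>n. 1 - q ^ i * (q * X))) \<longlonglongrightarrow> (1 - X) * qpoch q (q * X)"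
  by (intro tendsto_intros 1)
 moreover have "(1 - X) * (\<Prod>i\<le>n. 1 - q ^ i * (q * X)) = (\<Prod>i\<le>Suc n. 1 - q ^ i * X)" for n
  unfolding prod.atMost_Suc_shift by (simp add: mult_ac)
 ultimately have "(%n. \<Prod>i\<le>Suc n. 1 - q ^ i * X) \<longlonglongrightarrow> (1 - X) * qpoch q (q * X)" by simp
 then show ?thesis using LIMSEQ_Suc[OF 1] LIMSEQ_unique by blast
qed

lemma qpoch_eq_0_iff:
 assumes "norm q < 1"
 shows "qpoch q X = 0 \<longleftrightarrow> (EX n. q ^ n * X = 1)"
proof
 show "EX n. q ^ n * X = 1" if "qpoch q X = 0"
  using prodinf_nonzero[OF qpoch_convergent[OF assms, of X]] that unfolding qpoch_def by force
next
 assume "EX n. q ^ n * X = 1"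
 then obtain n where n: "q ^ n * X = 1" by auto
 have "qpoch q X = (\<Prod>i<m. 1 - q ^ i * X) * qpoch q (q ^ m * X)" for m
 proof (induction m)
  case (Suc m)
  then show ?case using qpoch_rec[OF assms, of "q ^ m * X"] by (simp add: mult_ac)
 qed simp
 from this[of "Suc n"] show "qpoch q X = 0" using n by simp
qed

text \<open>With \<open>q = exp (2 pi i ta)\<close> this is the odd Jacobi theta function in triple
  product form, up to a constant factor; \<open>qpoch q X\<close> is the q-Pochhammer symbol
  \<open>(X; q)_infinity\<close>.\<close>

definition theta :: "complex => complex => complex" where
 "theta ta u = (let X = exp (2 * pi * \<i> * u); q = exp (2 * pi * \<i> * ta)
  in exp (- (pi * \<i> * u)) * (qpoch q X * qpoch q (q / X)))"

context
 fixes ta :: complex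
 assumes ta: "Im ta > 0"
begin

lemma nome_less_1: "norm (exp (2 * pi * \<i> * ta)) < 1"
 using ta by (simp add: norm_exp_eq_Re)

lemma theta_holomorphic: "theta ta holomorphic_on UNIV"
proof -
 note h = holomorphic_on_compose_gen[OF _ qpoch_holomorphic[OF nome_less_1] subset_UNIV, unfolded o_def]
 show ?thesis
  unfolding theta_def Let_def by (intro holomorphic_intros h) auto
qed

text \<open>Peeling the factor \<open>1 - 1/X\<close> off \<open>qpoch q (1/X)\<close> and giving it
  back to the other product as \<open>1 - X\<close> costs exactly \<open>- 1/X\<close>, which the
  exponential prefactor absorbs. The shift by \<open>ta\<close> below rests on the same
  exchange.\<close>

lemma theta_minus: "theta ta (- u) = - theta ta u"
proof -
 define q where "q = exp (2 * pi * \<i> * ta)"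
 define X where "X = exp (2 * pi * \<i> * u)"
 have q: "norm q < 1" unfolding q_def by (rule nome_less_1)
 have X: "X ~= 0" and Xm: "exp (2 * pi * \<i> * (- u)) = 1 / X"
  by (auto simp: X_def exp_minus field_simps)
 have e: "exp (pi * \<i> * u) = exp (- (pi * \<i> * u)) * X"
  unfolding X_def exp_add[symmetric] by (rule arg_cong[of _ _ exp]) simp
 have "theta ta (- u) = exp (pi * \<i> * u) * (qpoch q (1 / X) * qpoch q (q * X))"
  unfolding theta_def Let_def q_def[symmetric] Xm by simp
 also have "qpoch q (1 / X) = (1 - 1 / X) * qpoch q (q / X)"
  using qpoch_rec[OF q, of "1 / X"] by simp
 also have "exp (pi * \<i> * u) * ((1 - 1 / X) * qpoch q (q / X) * qpoch q (q * X)) =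
   - (exp (- (pi * \<i> * u)) * ((1 - X) * qpoch q (q * X) * qpoch q (q / X)))"
  unfolding e using X by (simp add: field_simps)
 also have "... = - theta ta u"
  unfolding theta_def Let_def q_def[symmetric] X_def[symmetric] qpoch_rec[OF q, of X] by simp
 finally show ?thesis .
qed

lemma theta_plus_1: "theta ta (u + 1) = - theta ta u"
proof -
 have "exp (2 * pi * \<i> * (u + 1)) = exp (2 * pi * \<i> * u)"
  by (simp add: distrib_left exp_add)
 moreover have "exp (- (pi * \<i> * (u + 1))) = - exp (- (pi * \<i> * u))"
  by (simp add: distrib_left exp_diff exp_minus)
 ultimately show ?thesis by (simp add: theta_def Let_def)
qed

lemma theta_plus_tau: "theta ta (u + ta) = - exp (- (pi * \<i> * ta) - 2 * pi * \<i> * u) * theta ta u"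
proof -
 define q where "q = exp (2 * pi * \<i> * ta)"
 define X where "X = exp (2 * pi * \<i> * u)"
 have q: "norm q < 1" and q0: "q ~= 0" unfolding q_def by (rule nome_less_1, simp)
 have X: "X ~= 0" and Xq: "exp (2 * pi * \<i> * (u + ta)) = q * X"
  by (auto simp: X_def q_def exp_add distrib_left)
 have e: "exp (- (pi * \<i> * ta) - 2 * pi * \<i> * u) = exp (- (pi * \<i> * ta)) / X"
  by (simp add: X_def exp_diff)
 have e': "exp (- (pi * \<i> * (u + ta))) = exp (- (pi * \<i> * ta)) * exp (- (pi * \<i> * u))"
  by (simp add: exp_add[symmetric] algebra_simps)
 have "theta ta (u + ta) = exp (- (pi * \<i> * (u + ta))) * (qpoch q (q * X) * qpoch q (1 / X))"
  unfolding theta_def Let_def q_def[symmetric] Xq using q0 by simp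
 also have "qpoch q (1 / X) = (1 - 1 / X) * qpoch q (q / X)"
  using qpoch_rec[OF q, of "1 / X"] by simp
 also have "exp (- (pi * \<i> * (u + ta))) * (qpoch q (q * X) * ((1 - 1 / X) * qpoch q (q / X))) =
  - (exp (- (pi * \<i> * ta)) / X) * (exp (- (pi * \<i> * u)) * ((1 - X) * qpoch q (q * X) * qpoch q (q / X)))"
  unfolding e' using X by (simp add: field_simps)
 also have "... = - (exp (- (pi * \<i> * ta)) / X) * theta ta u"
  unfolding theta_def Let_def q_def[symmetric] X_def[symmetric] qpoch_rec[OF q, of X] by simp
 finally show ?thesis unfolding e .
qed

lemma theta_eq_0_iff: "theta ta u = 0 \<longleftrightarrow> (EX m n :: int. u = of_int m + of_int n * ta)"
proof -
 define q where "q = exp (2 * pi * \<i> * ta)"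
 define X where "X = exp (2 * pi * \<i> * u)"
 have q: "norm q < 1" and q0: "q ~= 0" unfolding q_def by (rule nome_less_1, simp)
 have X: "X ~= 0" by (simp add: X_def)
 have c: "2 * pi * \<i> * x = of_int (2 * m) * pi * \<i> \<longleftrightarrow> x = of_int m" for x and m :: int
 proof -
  have "of_int (2 * m) * pi * \<i> = 2 * pi * \<i> * of_int m" by simp
  then show ?thesis by (metis mult_cancel_left mult_eq_0_iff complex_i_not_zero of_real_eq_0_iff pi_neq_zero zero_neq_numeral)
 qed
 have e1: "q ^ n * X = 1 \<longleftrightarrow> (EX m::int. u = of_int m + of_int (- int n) * ta)" for n
 proof -
  have "q ^ n * X = exp (2 * pi * \<i> * (of_nat n * ta + u))"
   unfolding q_def X_def exp_of_nat_mult[symmetric] exp_add[symmetric] by (simp add: algebra_simps)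
  then have "q ^ n * X = 1 \<longleftrightarrow> (EX m::int. 2 * pi * \<i> * (of_nat n * ta + u) = of_int (2 * m) * pi * \<i>)"
   using exp_eq[of _ 0] by (simp add: mult_ac)
  also have "... \<longleftrightarrow> (EX m::int. of_nat n * ta + u = of_int m)"
   unfolding c ..
  also have "... \<longleftrightarrow> (EX m::int. u = of_int m + of_int (- int n) * ta)"
   by (intro ex_cong1) (auto simp: algebra_simps)
  finally show ?thesis .
 qed
 have e2: "q ^ n * (q / X) = 1 \<longleftrightarrow> (EX m::int. u = of_int m + of_int (int (Suc n)) * ta)" for n
 proof -
  have "q ^ n * (q / X) = exp (2 * pi * \<i> * (of_nat (Suc n) * ta - u))"
  proof -
   have "q ^ n * (q / X) = q ^ Suc n / X" by simp
   also have "... = exp (2 * pi * \<i> * (of_nat (Suc n) * ta - u))"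
    unfolding q_def X_def exp_of_nat_mult[symmetric] exp_diff[symmetric]
    by (rule arg_cong[of _ _ exp]) (simp add: algebra_simps)
   finally show ?thesis .
  qed
  then have "q ^ n * (q / X) = 1 \<longleftrightarrow> (EX m::int. 2 * pi * \<i> * (of_nat (Suc n) * ta - u) = of_int (2 * m) * pi * \<i>)"
   using exp_eq[of _ 0] by (simp add: mult_ac)
  also have "... \<longleftrightarrow> (EX m::int. of_nat (Suc n) * ta - u = of_int m)"
   unfolding c ..
  also have "... \<longleftrightarrow> (EX m::int. u = of_int m + of_int (int (Suc n)) * ta)"
  proof safe
   fix m assume "of_nat (Suc n) * ta - u = of_int m"
   then have "u = of_int (- m) + of_int (int (Suc n)) * ta" by (auto simp: algebra_simps)
   then show "EX m::int. u = of_int m + of_int (int (Suc n)) * ta" by blast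
  next
   fix m :: int assume "u = of_int m + of_int (int (Suc n)) * ta"
   then show "EX k::int. of_nat (Suc n) * ta - (of_int m + of_int (int (Suc n)) * ta) = of_int k"
    by (intro exI[of _ "- m"]) simp
  qed
  finally show ?thesis .
 qed
 \<comment> \<open>The two products own complementary halves of the lattice:
   \<open>qpoch q X\<close> the rows \<open>n <= 0\<close>, \<open>qpoch q (q / X)\<close> the rows
   \<open>n >= 1\<close>.\<close>
 have "theta ta u = 0 \<longleftrightarrow> qpoch q X = 0 | qpoch q (q / X) = 0"
  by (simp add: theta_def Let_def q_def X_def)
 also have "... \<longleftrightarrow> (EX n. q ^ n * X = 1) | (EX n. q ^ n * (q / X) = 1)"
  unfolding qpoch_eq_0_iff[OF q] ..
 also have "... \<longleftrightarrow> (EX m n :: int. u = of_int m + of_int n * ta)"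
 proof (intro iffI)
  assume "EX m n :: int. u = of_int m + of_int n * ta"
  then obtain m n :: int where mn: "u = of_int m + of_int n * ta" by auto
  show "(EX n. q ^ n * X = 1) | (EX n. q ^ n * (q / X) = 1)"
  proof (cases "n <= 0")
   case True
   then have "n = - int (nat (- n))" by simp
   then have "q ^ nat (- n) * X = 1" unfolding e1 using mn by metis
   then show ?thesis by blast
  next
   case False
   then have "n = int (Suc (nat (n - 1)))" by simp
   then have "q ^ nat (n - 1) * (q / X) = 1" unfolding e2 using mn by metis
   then show ?thesis by blast
  qed
 qed (unfold e1 e2, blast)
 finally show ?thesis .
qed

text \<open>Near 0 only the factor \<open>1 - X\<close> vanishes, and simply. The cofactor
  \<open>G\<close> takes the value \<open>qpoch q q\<close> squared at 0, nonzero because no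
  positive power of \<open>q\<close> equals 1.\<close>

lemma deriv_theta_0: "deriv (theta ta) 0 ~= 0"
proof -
 define q where "q = exp (2 * pi * \<i> * ta)"
 have q: "norm q < 1" unfolding q_def by (rule nome_less_1)
 define G where "G u = qpoch q (q * exp (2 * pi * \<i> * u)) * qpoch q (q / exp (2 * pi * \<i> * u))" for u
 have th: "theta ta = (%u. exp (- (pi * \<i> * u)) * (1 - exp (2 * pi * \<i> * u)) * G u)"
  unfolding theta_def Let_def q_def[symmetric] G_def
  by (intro ext) (subst qpoch_rec[OF q], simp)
 note h = holomorphic_on_compose_gen[OF _ qpoch_holomorphic[OF q] subset_UNIV, unfolded o_def]
 have "G holomorphic_on UNIV" unfolding G_def by (intro holomorphic_intros h) auto
 then have "(G has_field_derivative deriv G 0) (at 0)"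
  using holomorphic_derivI by blast
 then have "((%u. exp (- (pi * \<i> * u)) * (1 - exp (2 * pi * \<i> * u)) * G u) has_field_derivative - (2 * pi * \<i>) * G 0) (at 0)"
  by (auto intro!: derivative_eq_intros)
 then have "deriv (theta ta) 0 = - (2 * pi * \<i>) * G 0" unfolding th by (rule DERIV_imp_deriv)
 moreover have "G 0 ~= 0"
 proof -
  have "q ^ n * q ~= 1" for n
  proof
   assume "q ^ n * q = 1"
   then have "norm q ^ Suc n = 1" by (metis norm_one norm_power power_Suc2)
   then show False using q power_less_one_iff[of "norm q" "Suc n"] by simp
  qed
  then show ?thesis using qpoch_eq_0_iff[OF q, of q] by (simp add: G_def)
 qed
 ultimately show ?thesis by simp
qed

end

text \<open>The exponential factor rotates the Gaussian weight of the theta function, which decays only in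
 the direction of \<open>\<i> o1\<close>, into the isotropic one.\<close>

lemma sigma_exists:
 assumes "Im (o2 / o1) > 0"
 obtains sg where "sg holomorphic_on UNIV" "!!z. sg (- z) = - sg z" "deriv sg 0 = 1"
  "!!z. sg z = 0 \<longleftrightarrow> z : lattice o1 o2"
  "lattice_periodic o1 o2 (%z. (norm (sg z))^2 * exp (- (pi / Im (cnj o1 * o2)) * (norm z)^2))"
proof -
 define ta where "ta = o2 / o1"
 have ta: "Im ta > 0" unfolding ta_def by (rule assms)
 have w1: "o1 ~= 0" using assms by (metis div_by_0 less_irrefl zero_complex.sel(2))
 have w2: "o2 = ta * o1" using w1 by (simp add: ta_def)
 define t where "t = Im ta"
 have A: "Im (cnj o1 * o2) = t * (norm o1)^2"
  unfolding w2 t_def cmod_power2 by (simp add: algebra_simps sqr)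
 define C where "C = inverse (deriv (theta ta) 0 / o1)"
 define sg where "sg z = C * (theta ta (z / o1) * exp (pi / (2 * t) * (z / o1)^2))" for z
 have C0: "C ~= 0" using deriv_theta_0[OF ta] w1 by (simp add: C_def)
 note h = holomorphic_on_compose_gen[OF _ theta_holomorphic[OF ta] subset_UNIV, unfolded o_def]
 have hol: "sg holomorphic_on UNIV" unfolding sg_def by (intro holomorphic_intros h) (use w1 in auto)
 have odd: "sg (- z) = - sg z" for z
  using theta_minus[OF ta, of "z / o1"] by (simp add: sg_def)
 have "(theta ta has_field_derivative deriv (theta ta) 0) (at (0 / o1))"
  using holomorphic_derivI[OF theta_holomorphic[OF ta], of 0] by simp
 then have "(theta ta \<circ> (%z. z / o1) has_field_derivative deriv (theta ta) 0 * (1 / o1)) (at 0)"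
  by (rule DERIV_chain) (auto intro!: derivative_eq_intros simp: w1)
 then have d: "((%z. theta ta (z / o1)) has_field_derivative deriv (theta ta) 0 / o1) (at 0)"
  by (simp add: o_def)
 have "theta ta 0 = 0" using theta_minus[OF ta, of 0] by simp
 then have "(sg has_field_derivative C * (deriv (theta ta) 0 / o1)) (at 0)"
  unfolding sg_def by (use ta in \<open>auto intro!: derivative_eq_intros d simp: w1 t_def\<close>)
 then have "deriv sg 0 = 1"
  using C0 unfolding C_def by (auto dest!: DERIV_imp_deriv)
 moreover have "sg z = 0 \<longleftrightarrow> z : lattice o1 o2" for z
  using C0 w1 unfolding sg_def lattice_def by (auto simp: theta_eq_0_iff[OF ta] w2 field_simps)
 moreover have "lattice_periodic o1 o2 (%z. (norm (sg z))^2 * exp (- (pi / Im (cnj o1 * o2)) * (norm z)^2))"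
 proof -
  define g where "g z = (norm C)^2 * ((norm (theta ta (z / o1)))^2 * exp (- (2 * pi / t) * (Im (z / o1))^2))" for z
  have "(norm (sg z))^2 * exp (- (pi / Im (cnj o1 * o2)) * (norm z)^2) = g z" for z
  proof -
   define u where "u = z / o1"
   have nz: "(norm z)^2 = (norm u)^2 * (norm o1)^2"
    using w1 by (simp add: u_def norm_divide power_divide)
   have "(norm (sg z))^2 * exp (- (pi / Im (cnj o1 * o2)) * (norm z)^2) =
    (norm C)^2 * ((norm (theta ta u))^2 * (exp (Re (pi / (2 * t) * u^2)) ^ 2 * exp (- (pi / t) * (norm u)^2)))"
    unfolding sg_def u_def[symmetric] norm_mult power_mult_distrib A nz norm_exp_eq_Re using w1 ta by (simp add: t_def)
   \<comment> \<open>Since \<open>Re (u^2) - |u|^2 = - 2 (Im u)^2\<close>, the isotropic Gaussian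
     and the exponential factor combine to a Gaussian in \<open>Im u\<close> alone, the one that
     compensates the quasi-periodicity of theta.\<close>
   also have "exp (Re (pi / (2 * t) * u^2)) ^ 2 * exp (- (pi / t) * (norm u)^2) = exp (- (2 * pi / t) * (Im u)^2)"
    unfolding exp_double[symmetric] exp_add[symmetric] cmod_power2
    using ta by (intro arg_cong[of _ _ exp]) (simp add: t_def field_simps sqr)
   finally show ?thesis by (simp add: g_def u_def)
  qed
  moreover have "lattice_periodic o1 o2 g"
  proof (rule lattice_periodicI)
   fix z
   show "g (z + o1) = g z"
    using w1 theta_plus_1[OF ta, of "z / o1"] by (simp add: g_def add_divide_distrib)
   define u where "u = z / o1"
   have "norm (theta ta (u + ta)) = exp (pi * t + 2 * pi * Im u) * norm (theta ta u)"
    unfolding theta_plus_tau[OF ta] by (simp add: norm_mult norm_exp_eq_Re t_def)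
   then have "(norm (theta ta (u + ta)))^2 * exp (- (2 * pi / t) * (Im (u + ta))^2) =
    (norm (theta ta u))^2 * (exp (2 * (pi * t + 2 * pi * Im u)) * exp (- (2 * pi / t) * (Im u + t)^2))"
    unfolding exp_double by (simp add: power_mult_distrib t_def)
   also have "exp (2 * (pi * t + 2 * pi * Im u)) * exp (- (2 * pi / t) * (Im u + t)^2) =
    exp (- (2 * pi / t) * (Im u)^2)"
    unfolding exp_add[symmetric]
    using ta by (intro arg_cong[of _ _ exp]) (simp add: t_def field_simps sqr)
   finally show "g (z + o2) = g z"
    using w1 by (simp add: g_def u_def w2 add_divide_distrib)
  qed
  ultimately show ?thesis by simp
 qed
 ultimately show ?thesis using that hol odd by blast
qed

section \<open>Differential calculus in the plane\<close>

definition dx :: "(complex => real) => complex => real" where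
 "dx f z = frechet_derivative f (at z) 1"

definition dy :: "(complex => real) => complex => real" where
 "dy f z = frechet_derivative f (at z) \<i>"

text \<open>Fixing the basis 1, i turns the sum, product and chain rules into identities between
  pairs of reals.\<close>

definition has_grad :: "(complex => real) => real => real => complex => bool" where
 "has_grad f a b z \<longleftrightarrow> (f has_derivative (%h. Re h * a + Im h * b)) (at z)"

definition C1 :: "(complex => real) => bool" where
 "C1 f \<longleftrightarrow> (ALL z. f differentiable at z) & cont (dx f) & cont (dy f)"

definition C2 :: "(complex => real) => bool" where
 "C2 f \<longleftrightarrow> C1 f & C1 (dx f) & C1 (dy f)"

definition lap :: "(complex => real) => complex => real" where
 "lap f z = dx (dx f) z + dy (dy f) z"

lemma has_grad_dx: "has_grad f a b z ==> dx f z = a"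
 and has_grad_dy: "has_grad f a b z ==> dy f z = b"
 unfolding has_grad_def dx_def dy_def by (auto dest!: frechet_derivative_at[symmetric])

lemma frechet_dx_dy:
 assumes "f differentiable at z"
 shows "frechet_derivative f (at z) h = Re h * dx f z + Im h * dy f z"
proof -
 interpret linear "frechet_derivative f (at z)"
  by (rule linear_frechet_derivative[OF assms])
 have "h = Re h *\<^sub>R 1 + Im h *\<^sub>R \<i>" by (simp add: complex_eq_iff)
 then have "frechet_derivative f (at z) h = frechet_derivative f (at z) (Re h *\<^sub>R 1 + Im h *\<^sub>R \<i>)" by simp
 then show ?thesis unfolding add scale by (simp add: dx_def dy_def)
qed

lemma differentiable_has_grad:
 assumes "f differentiable at z"
 shows "has_grad f (dx f z) (dy f z) z"
proof -
 have "frechet_derivative f (at z) = (%h. Re h * dx f z + Im h * dy f z)"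
  using frechet_dx_dy[OF assms] by auto
 then show ?thesis
  using frechet_derivative_works[of f "at z"] assms by (simp add: has_grad_def)
qed

lemma C1_has_grad: "C1 f ==> has_grad f (dx f z) (dy f z) z"
 by (auto simp: C1_def intro: differentiable_has_grad)

lemma C1_cont: "C1 f ==> cont f"
 by (auto simp: C1_def intro!: differentiable_imp_continuous_on simp: differentiable_on_def)

lemma C1_cont_dx: "C1 f ==> cont (dx f)"
 and C1_cont_dy: "C1 f ==> cont (dy f)"
 by (auto simp: C1_def)

lemma C1I:
 assumes "!!z. has_grad f (fx z) (fy z) z" "cont fx" "cont fy"
 shows "C1 f" "dx f = fx" "dy f = fy"
proof -
 show 1: "dx f = fx" "dy f = fy" using assms(1) has_grad_dx has_grad_dy by blast+
 show "C1 f" unfolding C1_def 1 using assms by (auto simp: has_grad_def differentiable_def)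
qed

lemma has_grad_const: "has_grad (%z. c) 0 0 z"
 by (simp add: has_grad_def)

lemma has_grad_add: "has_grad f a b z ==> has_grad g a' b' z ==> has_grad (%z. f z + g z) (a + a') (b + b') z"
 unfolding has_grad_def by (auto intro!: derivative_eq_intros simp: algebra_simps)

lemma has_grad_mult: "has_grad f a b z ==> has_grad g a' b' z ==>
 has_grad (%z. f z * g z) (f z * a' + g z * a) (f z * b' + g z * b) z"
 unfolding has_grad_def by (auto intro!: derivative_eq_intros simp: algebra_simps)

lemma has_grad_compose:
 assumes "has_grad f a b z" "(ph has_real_derivative d) (at (f z))"
 shows "has_grad (%z. ph (f z)) (d * a) (d * b) z"
 using has_derivative_compose[OF assms(1)[unfolded has_grad_def], of ph "(*) d"] assms(2)
 unfolding has_grad_def has_field_derivative_def by (simp add: distrib_left mult_ac)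

lemma C1_const: "C1 (%z. c)" "dx (%z. c) = (%z. 0)" "dy (%z. c) = (%z. 0)"
 by (rule C1I[OF has_grad_const] continuous_on_const)+

lemma C1_add:
 assumes "C1 f" "C1 g"
 shows "C1 (%z. f z + g z)" "dx (%z. f z + g z) = (%z. dx f z + dx g z)"
  "dy (%z. f z + g z) = (%z. dy f z + dy g z)"
 by (rule C1I[OF has_grad_add[OF assms[THEN C1_has_grad]]];
   intro continuous_intros assms C1_cont_dx C1_cont_dy)+

lemma C1_mult:
 assumes "C1 f" "C1 g"
 shows "C1 (%z. f z * g z)" "dx (%z. f z * g z) = (%z. f z * dx g z + g z * dx f z)"
  "dy (%z. f z * g z) = (%z. f z * dy g z + g z * dy f z)"
 by (rule C1I[OF has_grad_mult[OF assms[THEN C1_has_grad]]];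
   intro continuous_intros assms C1_cont_dx C1_cont_dy C1_cont)+

lemma C1_cmult:
 assumes "C1 f"
 shows "C1 (%z. c * f z)" "dx (%z. c * f z) = (%z. c * dx f z)" "dy (%z. c * f z) = (%z. c * dy f z)"
 using C1_mult[OF C1_const(1)[of c] assms] by (simp_all add: C1_const)

lemma C1_compose:
 assumes "C1 f" "!!z. (ph has_real_derivative ph' (f z)) (at (f z))" "continuous_on (range f) ph'"
 shows "C1 (%z. ph (f z))" "dx (%z. ph (f z)) = (%z. ph' (f z) * dx f z)"
  "dy (%z. ph (f z)) = (%z. ph' (f z) * dy f z)"
proof -
 have c: "cont (%z. ph' (f z))"
  using continuous_on_compose[OF C1_cont[OF assms(1)] assms(3)] by (simp add: o_def)
 show "C1 (%z. ph (f z))" "dx (%z. ph (f z)) = (%z. ph' (f z) * dx f z)"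
  "dy (%z. ph (f z)) = (%z. ph' (f z) * dy f z)"
  by (rule C1I[OF has_grad_compose[OF C1_has_grad[OF assms(1)] assms(2)]];
    intro continuous_intros assms C1_cont_dx C1_cont_dy c)+
qed

lemma C1_sub:
 assumes "C1 f" "C1 g"
 shows "C1 (%z. f z - g z)" "dx (%z. f z - g z) = (%z. dx f z - dx g z)"
  "dy (%z. f z - g z) = (%z. dy f z - dy g z)"
 using C1_add[OF assms(1) C1_cmult(1)[OF assms(2), of "-1"]] C1_cmult(2,3)[OF assms(2), of "-1"] by simp_all

lemma C2_C1: "C2 f ==> C1 f" and C2_dx: "C2 f ==> C1 (dx f)" and C2_dy: "C2 f ==> C1 (dy f)"
 by (auto simp: C2_def)

lemma C2_cont: "C2 f ==> cont f"
 by (simp add: C2_C1 C1_cont)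

lemma C2_cont_lap: "C2 f ==> cont (lap f)"
 unfolding lap_def[abs_def] by (intro continuous_intros C1_cont_dx C1_cont_dy C2_dx C2_dy)

lemma C2_const: "C2 (%z. c)" "lap (%z. c) = (%z. 0)"
 by (auto simp: C2_def C1_const lap_def[abs_def])

lemma C2_add:
 assumes "C2 f" "C2 g"
 shows "C2 (%z. f z + g z)" "lap (%z. f z + g z) = (%z. lap f z + lap g z)"
 using assms by (auto simp: C2_def C1_add lap_def[abs_def])

lemma C2_cmult:
 assumes "C2 f"
 shows "C2 (%z. c * f z)" "lap (%z. c * f z) = (%z. c * lap f z)"
 using assms by (auto simp: C2_def C1_cmult lap_def[abs_def] algebra_simps)

lemma C2_sub:
 assumes "C2 f" "C2 g"
 shows "C2 (%z. f z - g z)" "lap (%z. f z - g z) = (%z. lap f z - lap g z)"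
 using C2_add[OF assms(1) C2_cmult(1)[OF assms(2), of "-1"]] C2_cmult(2)[OF assms(2), of "-1"] by simp_all

lemma C2_compose:
 assumes f: "C2 f" and 1: "!!z. (ph has_real_derivative ph' (f z)) (at (f z))"
  and 2: "!!z. (ph' has_real_derivative ph'' (f z)) (at (f z))" and c: "continuous_on (range f) ph''"
 shows "C2 (%z. ph (f z))"
  "lap (%z. ph (f z)) = (%z. ph' (f z) * lap f z + ph'' (f z) * ((dx f z)^2 + (dy f z)^2))"
proof -
 have c': "continuous_on (range f) ph'"
  using DERIV_isCont[OF 2] by (auto intro!: continuous_at_imp_continuous_on)
 note A = C1_compose[OF C2_C1[OF f] 1 c'] and B = C1_compose[OF C2_C1[OF f] 2 c]
 show "C2 (%z. ph (f z))"
  unfolding C2_def A(2,3) by (intro conjI A(1) C1_mult B(1) C2_dx C2_dy f)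
 show "lap (%z. ph (f z)) = (%z. ph' (f z) * lap f z + ph'' (f z) * ((dx f z)^2 + (dy f z)^2))"
  unfolding lap_def[abs_def] A(2,3) C1_mult(2)[OF B(1) C2_dx[OF f]] C1_mult(3)[OF B(1) C2_dy[OF f]] B(2,3)
  by (auto simp: algebra_simps sqr)
qed

text \<open>By linearity the derivative in any direction is a fixed combination of the two partials;
  this links the working notions \<open>C1\<close>, \<open>C2\<close> and \<open>lap\<close> to
  those of the statement.\<close>

lemma C1_C1_map:
 assumes "C1 f"
 shows "C1_map f"
 unfolding C1_map_def
proof (intro conjI allI)
 show "f differentiable_on UNIV" using assms by (auto simp: C1_def differentiable_on_def)
 fix v
 have eq: "(%z. frechet_derivative f (at z) v) = (%z. Re v * dx f z + Im v * dy f z)"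
  using assms by (auto simp: C1_def frechet_dx_dy)
 show "cont (%z. frechet_derivative f (at z) v)"
  unfolding eq using assms by (auto simp: C1_def intro!: continuous_intros)
qed

lemma C2_C2_map:
 assumes "C2 f"
 shows "C2_map f" "laplacian f z = lap f z"
proof -
 show "C2_map f" unfolding C2_map_def
 proof (intro conjI allI)
  show "C1_map f" using assms by (simp add: C2_C1 C1_C1_map)
  fix v
  have "(%z. frechet_derivative f (at z) v) = (%z. Re v * dx f z + Im v * dy f z)"
   using C2_C1[OF assms] by (auto simp: C1_def frechet_dx_dy)
  then show "C1_map (%z. frechet_derivative f (at z) v)"
   using C1_add(1)[OF C1_cmult(1)[OF C2_dx] C1_cmult(1)[OF C2_dy], OF assms assms] by (simp add: C1_C1_map)
 qed
 have ne: "(1::complex) ~= \<i>" by (auto simp: complex_eq_iff)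
 show "laplacian f z = lap f z"
  unfolding laplacian_def lap_def Basis_complex_def using ne by (simp add: dx_def[abs_def] dy_def[abs_def])
qed

lemma has_grad_shift:
 assumes "has_grad f a b (z + l)"
 shows "has_grad (%z. f (z + l)) a b z"
proof -
 have "((%z. z + l) has_derivative (%h. h)) (at z)" by (auto intro!: derivative_eq_intros)
 from has_derivative_compose[OF this, of f] show ?thesis using assms unfolding has_grad_def by simp
qed

lemma has_grad_reflect:
 assumes "has_grad f a b (- z)"
 shows "has_grad (%z. f (- z)) (- a) (- b) z"
proof -
 have "((%z. - z) has_derivative (%h. - h)) (at z)" by (auto intro!: derivative_eq_intros)
 from has_derivative_compose[OF this assms[unfolded has_grad_def]] show ?thesis unfolding has_grad_def by simp
qed

lemma C1_periodic:
 assumes "C1 f" "lattice_periodic w1 w2 f"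
 shows "lattice_periodic w1 w2 (dx f)" "lattice_periodic w1 w2 (dy f)"
proof -
 have "dx f (z + l) = dx f z & dy f (z + l) = dy f z" if "l : lattice w1 w2" for z l
 proof -
  have "(%z. f (z + l)) = f" using assms(2) that by (auto simp: Per_def)
  then have "has_grad f (dx f (z + l)) (dy f (z + l)) z"
   using has_grad_shift[OF C1_has_grad[OF assms(1), of "z + l"]] by simp
  then show ?thesis using has_grad_dx has_grad_dy by metis
 qed
 then show "lattice_periodic w1 w2 (dx f)" "lattice_periodic w1 w2 (dy f)"
  by (auto simp: Per_def)
qed

lemma C1_reflect:
 assumes "C1 f" "!!z. f (- z) = c * f z"
 shows "dx f (- z) = - c * dx f z" "dy f (- z) = - c * dy f z"
proof -
 have "has_grad (%z. f (- z)) (- dx f (- z)) (- dy f (- z)) z"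
  using has_grad_reflect[OF C1_has_grad[OF assms(1)], of z] .
 moreover have "has_grad (%z. f (- z)) (c * dx f z) (c * dy f z) z"
  using C1_has_grad[OF C1_cmult(1)[OF assms(1)], of c z] unfolding C1_cmult(2,3)[OF assms(1)] assms(2) .
 ultimately have "- dx f (- z) = c * dx f z" "- dy f (- z) = c * dy f z"
  by (metis has_grad_dx, metis has_grad_dy)
 then show "dx f (- z) = - c * dx f z" "dy f (- z) = - c * dy f z" by simp_all
qed

lemma C2_periodic:
 assumes "C2 f" "lattice_periodic w1 w2 f"
 shows "lattice_periodic w1 w2 (lap f)"
 using C1_periodic(1)[OF C2_dx C1_periodic(1)[OF C2_C1]] C1_periodic(2)[OF C2_dy C1_periodic(2)[OF C2_C1]] assms
 by (simp add: Per_def lap_def)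

lemma C2_even:
 assumes "C2 f" "!!z. f (- z) = f z"
 shows "lap f (- z) = lap f z"
proof -
 have 1: "dx f (- z) = - dx f z" "dy f (- z) = - dy f z" for z
  using C1_reflect[OF C2_C1[OF assms(1)], of 1] assms by auto
 show ?thesis
  using C1_reflect(1)[OF C2_dx[OF assms(1)], of "-1" z] C1_reflect(2)[OF C2_dy[OF assms(1)], of "-1" z] 1
  by (simp add: lap_def)
qed

lemma C1_bound_diff:
 assumes "C1 f" and "convex S" "x : S" "y : S" and B: "!!z. z : S ==> abs (dx f z) + abs (dy f z) <= B"
 shows "abs (f x - f y) <= B * norm (x - y)"
proof -
 have "norm (f x - f y) <= B * norm (x - y)"
 proof (rule differentiable_bound[OF assms(2), of f "%z h. Re h * dx f z + Im h * dy f z"])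
  fix z assume z: "z : S"
  show "(f has_derivative (%h. Re h * dx f z + Im h * dy f z)) (at z within S)"
   using C1_has_grad[OF assms(1), of z] unfolding has_grad_def by (rule has_derivative_at_withinI)
  show "onorm (%h. Re h * dx f z + Im h * dy f z) <= B"
  proof (rule onorm_le)
   fix h
   have "abs (Re h * dx f z + Im h * dy f z) <= abs (Re h) * abs (dx f z) + abs (Im h) * abs (dy f z)"
    by (rule order_trans[OF abs_triangle_ineq]) (simp add: abs_mult)
   also have "... <= norm h * abs (dx f z) + norm h * abs (dy f z)"
    by (intro add_mono mult_right_mono abs_Re_le_cmod abs_Im_le_cmod) auto
   also have "... <= B * norm h"
    using mult_right_mono[OF B[OF z] norm_ge_zero[of h]] by (simp add: algebra_simps)
   finally show "norm (Re h * dx f z + Im h * dy f z) <= B * norm h" by simp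
  qed
 qed (use assms in auto)
 then show ?thesis by simp
qed

lemma continuous_bounded_cball:
 fixes f :: "complex => real"
 assumes "cont f"
 obtains B where "B > 0" "!!z. z : cball 0 r ==> abs (f z) <= B"
proof -
 have "bounded (f ` cball 0 r)"
  using assms by (intro compact_imp_bounded compact_continuous_image) (auto intro: continuous_on_subset)
 then obtain B where "B > 0" "!!x. x : f ` cball 0 r ==> norm x <= B" by (auto simp: bounded_pos)
 then show ?thesis using that by auto
qed

lemma C1_lipschitz_cball:
 assumes "C1 f"
 obtains C where "C > 0" "!!z w :: complex. z : cball 0 r ==> w : cball 0 r ==> abs (f z - f w) <= C * norm (z - w)"
proof -
 obtain A where A: "A > 0" "!!z. z : cball 0 r ==> abs (dx f z) <= A"
  using continuous_bounded_cball[OF C1_cont_dx[OF assms]] by blast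
 obtain B where B: "B > 0" "!!z. z : cball 0 r ==> abs (dy f z) <= B"
  using continuous_bounded_cball[OF C1_cont_dy[OF assms]] by blast
 show ?thesis
 proof (rule that[of "A + B"])
  show "abs (f z - f w) <= (A + B) * norm (z - w)" if "z : cball 0 r" "w : cball 0 r" for z w
   by (rule C1_bound_diff[OF assms convex_cball that]) (use A B in \<open>auto intro: add_mono\<close>)
 qed (use A B in auto)
qed

text \<open>The gradient of an even function is odd, hence 0 at the origin, and it is Lipschitz on
  the unit disc; so it is \<open>O(|z|)\<close> and the increment is quadratic.\<close>

lemma C2_even_taylor:
 assumes "C2 f" "!!z. f (- z) = f z"
 obtains C where "C > 0" "!!z. norm z <= 1 ==> abs (f z - f 0) <= C * (norm z)^2"
proof -
 have odd: "dx f (- z) = - dx f z" "dy f (- z) = - dy f z" for z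
  using C1_reflect[OF C2_C1[OF assms(1)], of 1] assms by auto
 have 0: "dx f 0 = 0" "dy f 0 = 0" using odd[of 0] by auto
 obtain A where A: "A > 0" "!!z w. z : cball 0 1 ==> w : cball 0 1 ==> abs (dx f z - dx f w) <= A * norm (z - w)"
  using C1_lipschitz_cball[OF C2_dx[OF assms(1)]] by blast
 obtain B where B: "B > 0" "!!z w. z : cball 0 1 ==> w : cball 0 1 ==> abs (dy f z - dy f w) <= B * norm (z - w)"
  using C1_lipschitz_cball[OF C2_dy[OF assms(1)]] by blast
 show ?thesis
 proof (rule that[of "A + B"])
  fix z :: complex assume z: "norm z <= 1"
  have "abs (f z - f 0) <= ((A + B) * norm z) * norm (z - 0)"
  proof (rule C1_bound_diff[OF C2_C1[OF assms(1)] convex_cball[of 0 "norm z"]])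
   fix w :: complex assume "w : cball 0 (norm z)"
   then have w: "norm w <= norm z" by simp
   then have "abs (dx f w) <= A * norm w" "abs (dy f w) <= B * norm w"
    using A(2)[of w 0] B(2)[of w 0] 0 z by auto
   moreover have "A * norm w <= A * norm z" "B * norm w <= B * norm z"
    using A(1) B(1) w by (auto intro: mult_left_mono)
   ultimately show "abs (dx f w) + abs (dy f w) <= (A + B) * norm z" by (simp add: algebra_simps)
  qed auto
  then show "abs (f z - f 0) <= (A + B) * (norm z)^2" by (simp add: sqr mult.assoc)
 qed (use A B in auto)
qed

section \<open>Gaussian pairings of entire functions and the periodic weight\<close>

definition gauss_pair :: "real => (complex => complex) => (complex => complex) => complex => real" where
 "gauss_pair c h k z = Re (h z * cnj (k z)) * exp (- c * (norm z)^2)"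

abbreviation entire :: "(complex => complex) => bool" where
 "entire h \<equiv> h holomorphic_on UNIV"

abbreviation zmul :: "(complex => complex) => complex => complex" where
 "zmul h \<equiv> (%z. z * h z)"

lemma entire_deriv: "entire h ==> entire (deriv h)"
 by (rule holomorphic_deriv) auto

lemma entire_zmul: "entire h ==> entire (zmul h)"
 by (intro holomorphic_intros)

lemma entire_has_deriv: "entire h ==> (h has_field_derivative deriv h z) (at z)"
 by (rule holomorphic_derivI) auto

lemma deriv_zmul: "entire h ==> deriv (zmul h) = (%z. h z + z * deriv h z)"
 by (auto intro!: ext DERIV_imp_deriv derivative_eq_intros entire_has_deriv)

lemma entire_cont: "entire h ==> cont h"
 by (rule holomorphic_on_imp_continuous_on)

lemma continuous_gauss_pair:
 assumes "entire h" "entire k"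
 shows "cont (gauss_pair c h k)"
 unfolding gauss_pair_def[abs_def] using assms[THEN entire_cont] by (intro continuous_intros)

text \<open>Linear combinations of such pairings are closed under both partial derivatives; a factor
  i on the first entry encodes the imaginary part. Hence \<open>P\<close>, \<open>lap P\<close> and
  \<open>lap (lap P)\<close> are all computed by this lemma and the next.\<close>

lemma gauss_pair_C1:
 assumes h: "entire h" and k: "entire k"
 shows "C1 (gauss_pair c h k)"
  "dx (gauss_pair c h k) = (%z. gauss_pair c (deriv h) k z - c * gauss_pair c h (zmul k) z
    + (gauss_pair c h (deriv k) z - c * gauss_pair c (zmul h) k z))"
  "dy (gauss_pair c h k) = (%z. gauss_pair c (%z. \<i> * deriv h z) k z - c * gauss_pair c (%z. \<i> * h z) (zmul k) z
    - (gauss_pair c (%z. \<i> * h z) (deriv k) z - c * gauss_pair c (%z. \<i> * (z * h z)) k z))"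
proof -
 let ?a = "%z. gauss_pair c (deriv h) k z - c * gauss_pair c h (zmul k) z
    + (gauss_pair c h (deriv k) z - c * gauss_pair c (zmul h) k z)"
 let ?b = "%z. gauss_pair c (%z. \<i> * deriv h z) k z - c * gauss_pair c (%z. \<i> * h z) (zmul k) z
    - (gauss_pair c (%z. \<i> * h z) (deriv k) z - c * gauss_pair c (%z. \<i> * (z * h z)) k z)"
 have 1: "has_grad (gauss_pair c h k) (?a z) (?b z) z" for z
 proof -
  have dh: "(h has_derivative (%v. deriv h z * v)) (at z)" and dk: "(k has_derivative (%v. deriv k z * v)) (at z)"
   using entire_has_deriv[OF h, of z] entire_has_deriv[OF k, of z] by (simp_all add: has_field_derivative_def)
  have "((%z. Re (h z * cnj (k z)) * exp (- c * ((Re z)^2 + (Im z)^2))) has_derivative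
    (%v. Re (h z * cnj (deriv k z * v) + deriv h z * v * cnj (k z)) * exp (- c * ((Re z)^2 + (Im z)^2))
      + Re (h z * cnj (k z)) * (exp (- c * ((Re z)^2 + (Im z)^2)) * (- c * (2 * Re z * Re v + 2 * Im z * Im v))))) (at z)"
   by (auto intro!: derivative_eq_intros dh dk simp: algebra_simps)
  moreover have "(%v. Re (h z * cnj (deriv k z * v) + deriv h z * v * cnj (k z)) * exp (- c * ((Re z)^2 + (Im z)^2))
      + Re (h z * cnj (k z)) * (exp (- c * ((Re z)^2 + (Im z)^2)) * (- c * (2 * Re z * Re v + 2 * Im z * Im v)))) =
    (%v. Re v * ?a z + Im v * ?b z)"
   unfolding gauss_pair_def cmod_power2 by (rule ext) (simp add: algebra_simps)
  ultimately show ?thesis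
   unfolding has_grad_def gauss_pair_def[abs_def] cmod_power2 by simp
 qed
 have 2: "cont ?a" "cont ?b"
  by (intro continuous_intros continuous_gauss_pair holomorphic_intros entire_deriv entire_zmul h k)+
 show "C1 (gauss_pair c h k)" "dx (gauss_pair c h k) = ?a" "dy (gauss_pair c h k) = ?b"
  by (rule C1I[OF 1 2])+
qed

text \<open>The Laplacian is \<open>4 d dbar\<close>, where \<open>d\<close> differentiates
  \<open>h\<close> and \<open>dbar\<close> the conjugate of \<open>k\<close>, each with one extra
  term from the Gaussian; the second derivatives of \<open>h\<close> and \<open>k\<close> cancel in
  the sum.\<close>

lemma gauss_pair_C2:
 assumes h: "entire h" and k: "entire k"
 shows "C2 (gauss_pair c h k)"
  "lap (gauss_pair c h k) = (%z. 4 * (gauss_pair c (deriv h) (deriv k) z - c * gauss_pair c h (zmul (deriv k)) z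
   - c * gauss_pair c (%z. h z + z * deriv h z) k z + c^2 * gauss_pair c (zmul h) (zmul k) z))"
proof -
 have ih: "entire (%z. \<i> * f z)" if "entire f" for f using that by (intro holomorphic_intros)
 have di: "deriv (%z. \<i> * f z) = (%z. \<i> * deriv f z)" if "entire f" for f
  using that by (auto intro!: ext DERIV_imp_deriv derivative_eq_intros entire_has_deriv)
 note e = h k entire_deriv entire_zmul ih
 show "C2 (gauss_pair c h k)"
  unfolding C2_def gauss_pair_C1(2,3)[OF h k]
  by (intro conjI gauss_pair_C1(1) C1_add(1) C1_sub(1) C1_cmult(1) e)
 note c1 = gauss_pair_C1[where c = c]
 have x: "dx (dx (gauss_pair c h k)) = (%z. dx (gauss_pair c (deriv h) k) z - c * dx (gauss_pair c h (zmul k)) z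
    + (dx (gauss_pair c h (deriv k)) z - c * dx (gauss_pair c (zmul h) k) z))"
  unfolding gauss_pair_C1(2)[OF h k]
  by (simp add: C1_add C1_sub C1_cmult c1(1) e)
 have y: "dy (dy (gauss_pair c h k)) = (%z. dy (gauss_pair c (%z. \<i> * deriv h z) k) z - c * dy (gauss_pair c (%z. \<i> * h z) (zmul k)) z
    - (dy (gauss_pair c (%z. \<i> * h z) (deriv k)) z - c * dy (gauss_pair c (%z. \<i> * (z * h z)) k) z))"
  unfolding gauss_pair_C1(3)[OF h k]
  by (simp add: C1_add C1_sub C1_cmult c1(1) e)
 show "lap (gauss_pair c h k) = (%z. 4 * (gauss_pair c (deriv h) (deriv k) z - c * gauss_pair c h (zmul (deriv k)) z
   - c * gauss_pair c (%z. h z + z * deriv h z) k z + c^2 * gauss_pair c (zmul h) (zmul k) z))"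
  unfolding lap_def[abs_def] x y c1(2)[OF entire_deriv[OF h] k] c1(2)[OF h entire_zmul[OF k]]
   c1(2)[OF h entire_deriv[OF k]] c1(2)[OF entire_zmul[OF h] k]
   c1(3)[OF ih[OF entire_deriv[OF h]] k] c1(3)[OF ih[OF h] entire_zmul[OF k]]
   c1(3)[OF ih[OF h] entire_deriv[OF k]] c1(3)[OF ih[OF entire_zmul[OF h]] k]
   deriv_zmul[OF h] deriv_zmul[OF k] di[OF h] di[OF entire_deriv[OF h]] di[OF entire_zmul[OF h]]
   gauss_pair_def
  by (rule ext) (simp add: algebra_simps sqr)
qed

lemma Im_cnj_mult_pos:
 assumes "Im (o2 / o1) > 0"
 shows "Im (cnj o1 * o2) > 0"
proof -
 have "o1 ~= 0" using assms by auto
 then have "cnj o1 * o2 = of_real ((norm o1)^2) * (o2 / o1)"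
  unfolding complex_norm_square by simp
 moreover have "Im (of_real r * w) = r * Im w" for r w by simp
 ultimately have eq: "Im (cnj o1 * o2) = (norm o1)^2 * Im (o2 / o1)" by metis
 have "(norm o1)^2 > 0" using \<open>o1 ~= 0\<close> by simp
 then show ?thesis unfolding eq using assms by (rule mult_pos_pos)
qed

text \<open>\<open>P = |sg|^2 exp (- c |z|^2)\<close> with \<open>c = pi / area\<close>. Off the
  zeros \<open>ln |sg|^2\<close> is harmonic, so \<open>ln P\<close> has Laplacian
  \<open>- 4 c = - kp\<close>, and multiplied by \<open>P^2\<close> this is the gradient identity.
  The value of \<open>lap (lap P)\<close> at 0 stems from the Taylor term \<open>- c |z|^4\<close>,
  since \<open>sg\<close> is odd with derivative 1 at 0.\<close>

lemma weight_exists: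
 assumes "Im (o2 / o1) > 0" and kp: "kp = 4 * pi / Im (cnj o1 * o2)"
 obtains P where "lattice_periodic o1 o2 P" "!!z. P (- z) = P z" "!!z. 0 <= P z"
  "!!z. P z = 0 \<longleftrightarrow> z : lattice o1 o2" "C2 P" "C2 (lap P)"
  "!!z. (dx P z)^2 + (dy P z)^2 = P z * (lap P z + kp * P z)"
  "lap P 0 = 4" "lap (lap P) 0 = - 16 * kp"
  "EX C>0. ALL z. norm z <= 1 --> abs (P z - (norm z)\<^sup>2) <= C * (norm z) ^ 4"
proof -
 obtain sg where hol: "entire sg" and odd: "!!z. sg (- z) = - sg z" and d1: "deriv sg 0 = 1"
  and zero: "!!z. sg z = 0 \<longleftrightarrow> z : lattice o1 o2"
  and per: "lattice_periodic o1 o2 (%z. (norm (sg z))^2 * exp (- (pi / Im (cnj o1 * o2)) * (norm z)^2))"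
  by (rule sigma_exists[OF assms(1)]) blast
 define c where "c = kp / 4"
 have c: "c = pi / Im (cnj o1 * o2)" unfolding c_def kp by (metis nonzero_mult_div_cancel_left times_divide_eq_right zero_neq_numeral divide_divide_eq_left mult.commute)
 have kpc: "kp = 4 * c" by (simp add: c_def)
 define P where "P = gauss_pair c sg sg"
 have P: "P z = (norm (sg z))^2 * exp (- c * (norm z)^2)" for z
  unfolding P_def gauss_pair_def complex_norm_square[symmetric] by simp
 have s0: "sg 0 = 0" using odd[of 0] by simp
 have um: "(uminus has_field_derivative - 1) (at z)" for z :: complex
  by (rule DERIV_minus[OF DERIV_ident])
 have d_even: "deriv sg (- z) = deriv sg z" for z
 proof -
  have "((%z. sg (- z)) has_field_derivative deriv sg (- z) * (- 1)) (at z)"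
   using DERIV_chain[of sg "deriv sg (- z)" uminus z "- 1" UNIV] entire_has_deriv[OF hol, of "- z"]
    um by (simp add: o_def)
  moreover have "((%z. sg (- z)) has_field_derivative - deriv sg z) (at z)"
   unfolding odd by (intro derivative_intros entire_has_deriv hol)
  ultimately show ?thesis using DERIV_unique by fastforce
 qed
 have d2: "deriv (deriv sg) 0 = 0"
 proof -
  have h: "(deriv sg has_field_derivative deriv (deriv sg) 0) (at 0)"
   by (rule entire_has_deriv[OF entire_deriv[OF hol]])
  then have "((%z. deriv sg (- z)) has_field_derivative deriv (deriv sg) 0 * (- 1)) (at 0)"
   using DERIV_chain[of "deriv sg" "deriv (deriv sg) 0" uminus 0 "- 1" UNIV] um by (simp add: o_def)
  then have "deriv (deriv sg) 0 * (- 1) = deriv (deriv sg) 0"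
   unfolding d_even using h DERIV_unique by blast
  then show ?thesis by simp
 qed
 note C2P = gauss_pair_C2[OF hol hol, of c, folded P_def]
 \<comment> \<open>The four pairings complete to a square: \<open>deriv sg - c cnj z sg\<close> is
   the covariant derivative of \<open>sg\<close> for the Gaussian weight.\<close>
 have S: "lap P z = 4 * exp (- c * (norm z)^2) * ((norm (deriv sg z - c * cnj z * sg z))^2 - c * (norm (sg z))^2)" for z
  unfolding C2P(2) gauss_pair_def cmod_power2 by (simp add: algebra_simps sqr)
 note e = hol entire_deriv[OF hol] entire_zmul[OF hol] entire_zmul[OF entire_deriv[OF hol]]
 have e': "entire (%z. sg z + z * deriv sg z)" by (intro holomorphic_intros e)
 note S' = gauss_pair_C2[of _ _ c, OF e(2,2)] gauss_pair_C2[of _ _ c, OF e(1,4)] gauss_pair_C2[of _ _ c, OF e' e(1)]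
  gauss_pair_C2[of _ _ c, OF e(3,3)]
 note l = C2_cmult C2_add C2_sub
 have C2S: "C2 (lap P)" unfolding C2P(2) by (intro l(1,3,5) S'(1,3,5,7))
 have lS: "lap (lap P) z = 4 * (lap (gauss_pair c (deriv sg) (deriv sg)) z - c * lap (gauss_pair c sg (zmul (deriv sg))) z
   - c * lap (gauss_pair c (%z. sg z + z * deriv sg z) sg) z + c^2 * lap (gauss_pair c (zmul sg) (zmul sg)) z)" for z
  unfolding C2P(2) by (simp add: l S'(1,3,5,7))
 have d': "deriv (%z. sg z + z * deriv sg z) 0 = 2"
  by (rule DERIV_imp_deriv) (auto intro!: derivative_eq_intros e[THEN entire_has_deriv] simp: d1)
 have lS0: "lap (lap P) 0 = - 16 * kp"
  unfolding lS S'(2,4,6,8) gauss_pair_def deriv_zmul[OF hol] deriv_zmul[OF e(2)]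
  using d' by (simp add: s0 d1 d2 kpc)
 \<comment> \<open>Dividing out the simple zero leaves an even entire \<open>g\<close> with
   \<open>g 0 = 1\<close>. So \<open>P / |z|^2\<close> is even with value 1 at 0 and has no linear
   Taylor term, which gives the fourth-order error.\<close>
 define g where "g z = (if z = 0 then deriv sg 0 else (sg z - sg 0) / (z - 0))" for z
 have g: "entire g" unfolding g_def by (rule pole_lemma) (use hol in auto)
 have g1: "sg z = z * g z" for z by (simp add: g_def s0)
 have g2: "g (- z) = g z" for z by (simp add: g_def odd s0)
 obtain C where C: "C > 0" "!!z. norm z <= 1 ==> abs (gauss_pair c g g z - gauss_pair c g g 0) <= C * (norm z)^2"
  using C2_even_taylor[OF gauss_pair_C2(1)[OF g g, of c]] by (auto simp: gauss_pair_def g2)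
 have "abs (P z - (norm z)\<^sup>2) <= C * (norm z) ^ 4" if "norm z <= 1" for z
 proof -
  have "gauss_pair c g g 0 = 1" by (simp add: gauss_pair_def g_def d1)
  moreover have "P z = (norm z)^2 * gauss_pair c g g z"
   unfolding P g1 gauss_pair_def complex_norm_square[symmetric] by (simp add: norm_mult power_mult_distrib)
  ultimately have "abs (P z - (norm z)\<^sup>2) = (norm z)^2 * abs (gauss_pair c g g z - gauss_pair c g g 0)"
   by (simp add: abs_mult[of "(norm z)^2", symmetric, simplified] algebra_simps)
  also have "... <= (norm z)^2 * (C * (norm z)^2)" by (intro mult_left_mono C that) auto
  finally show ?thesis by (simp add: power4_eq_xxxx sqr algebra_simps)
 qed
 then have near: "EX C>0. ALL z. norm z <= 1 --> abs (P z - (norm z)\<^sup>2) <= C * (norm z) ^ 4" using C(1) by blast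
 have grad: "(dx P z)^2 + (dy P z)^2 = P z * (lap P z + kp * P z)" for z
 proof -
  define m where "m = deriv sg z - c * cnj z * sg z"
  define E where "E = exp (- c * (norm z)^2)"
  have x: "dx P z = 2 * E * Re (m * cnj (sg z))"
   unfolding P_def gauss_pair_C1(2)[OF hol hol] gauss_pair_def m_def E_def by (simp add: algebra_simps)
  have y: "dy P z = - 2 * E * Im (m * cnj (sg z))"
   unfolding P_def gauss_pair_C1(3)[OF hol hol] gauss_pair_def m_def E_def by (simp add: algebra_simps)
  have "(dx P z)^2 + (dy P z)^2 = 4 * E^2 * (norm (m * cnj (sg z)))^2"
   unfolding x y cmod_power2 by (simp only: power_mult_distrib power2_minus distrib_left) simp
  also have "... = P z * (lap P z + kp * P z)"
   unfolding P S kpc m_def[symmetric] E_def[symmetric] norm_mult complex_mod_cnj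
   by (simp add: algebra_simps sqr)
  finally show ?thesis .
 qed
 show ?thesis
 proof (rule that[of P])
  show "lattice_periodic o1 o2 P" using per unfolding P[abs_def] c .
  show "P (- z) = P z" for z by (simp add: P odd)
  show "0 <= P z" for z by (simp add: P)
  show "P z = 0 \<longleftrightarrow> z : lattice o1 o2" for z by (simp add: P zero)
  show "lap P 0 = 4" by (simp add: S s0 d1)
 qed (fact C2P(1) C2S grad lS0 near)+
qed

section \<open>Integration on the torus\<close>

text \<open>The image of planar Lebesgue measure under \<open>Complex\<close> agrees with
  \<open>lborel\<close> on boxes, hence everywhere; then Tonelli applies.\<close>

lemma nn_integral_complex:
 assumes [measurable]: "f : borel_measurable (borel :: complex measure)"
 shows "(\<integral>\<^sup>+z. f z \<partial>lborel) = (\<integral>\<^sup>+x. \<integral>\<^sup>+y. f (Complex x y) \<partial>lborel \<partial>lborel)"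
proof -
 have C: "(%p. Complex (fst p) (snd p)) = (%p. complex_of_real (fst p) + \<i> * complex_of_real (snd p))"
  by (auto simp: complex_eq_iff)
 have [measurable]: "(%p. Complex (fst p) (snd p)) : borel \<rightarrow>\<^sub>M borel"
  unfolding C by (intro borel_measurable_continuous_onI continuous_intros)
 have [measurable]: "(%p. Complex (fst p) (snd p)) : borel \<Otimes>\<^sub>M borel \<rightarrow>\<^sub>M borel"
  unfolding borel_prod by measurable
 let ?N = "distr (lborel :: (real \<times> real) measure) borel (%p. Complex (fst p) (snd p))"
 have "lborel = ?N"
 proof (rule lborel_eqI)
  fix l u :: complex
  assume le: "!!b. b : Basis ==> l \<bullet> b <= u \<bullet> b"
  have "(%p. Complex (fst p) (snd p)) -` box l u \<inter> space lborel = box (Re l, Im l) (Re u, Im u)"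
   by (auto simp: box_def Basis_complex_def Basis_prod_def inner_complex_def)
  then have "emeasure ?N (box l u) = emeasure lborel (box (Re l, Im l) (Re u, Im u))"
   by (subst emeasure_distr) auto
  also have "... = (\<Prod>b\<in>Basis. ((Re u, Im u) - (Re l, Im l)) \<bullet> b)"
   using le[of 1] le[of \<i>] by (subst emeasure_lborel_box) (auto simp: Basis_complex_def Basis_prod_def inner_complex_def)
  also have "(\<Prod>b\<in>Basis. ((Re u, Im u) - (Re l, Im l)) \<bullet> b) = (Re u - Re l) * (Im u - Im l)"
   by (simp add: Basis_prod_def prod.insert_remove)
  also have "... = (\<Prod>b\<in>Basis. (u - l) \<bullet> b)"
   by (simp add: Basis_complex_def inner_complex_def complex_eq_iff)
  finally show "emeasure ?N (box l u) = (\<Prod>b\<in>Basis. (u - l) \<bullet> b)" by simp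
 qed simp
 then have "(\<integral>\<^sup>+z. f z \<partial>lborel) = (\<integral>\<^sup>+z. f z \<partial>?N)" by simp
 also have "... = (\<integral>\<^sup>+p. f (Complex (fst p) (snd p)) \<partial>lborel)"
  by (subst nn_integral_distr) auto
 also have "... = (\<integral>\<^sup>+p. f (Complex (fst p) (snd p)) \<partial>(lborel \<Otimes>\<^sub>M lborel))"
  by (simp add: lborel_prod)
 also have "... = (\<integral>\<^sup>+x. \<integral>\<^sup>+y. f (Complex x y) \<partial>lborel \<partial>lborel)"
  by (subst lborel.nn_integral_fst[symmetric]) auto
 finally show ?thesis .
qed

text \<open>The linear map with columns \<open>w1\<close>, \<open>w2\<close> is factored into
  one-dimensional affine substitutions: scale \<open>x\<close> by \<open>Re w1\<close>, shear and
  scale \<open>y\<close> by \<open>a / Re w1\<close>, then exchange the order and shear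
  \<open>s\<close> by \<open>c t\<close>. The Jacobians multiply to \<open>a\<close>.\<close>

lemma nn_integral_linear_aux:
 assumes [measurable]: "f : borel_measurable (borel :: complex measure)" and re: "Re w1 ~= 0"
  and a: "Im (cnj w1 * w2) ~= 0"
 shows "(\<integral>\<^sup>+z. f z \<partial>lborel) =
  ennreal (abs (Im (cnj w1 * w2))) * (\<integral>\<^sup>+s. \<integral>\<^sup>+t. f (of_real s * w1 + of_real t * w2) \<partial>lborel \<partial>lborel)"
proof -
 define a where "a = Im (cnj w1 * w2)"
 define c where "c = Re w2 / Re w1"
 have [measurable]: "(%p. Complex (g p) (h p)) : borel_measurable M"
  if "g : borel_measurable M" "h : borel_measurable M" for g h and M :: "'b measure"
  unfolding Complex_eq using that by measurable
 have "(\<integral>\<^sup>+z. f z \<partial>lborel) = (\<integral>\<^sup>+x. \<integral>\<^sup>+y. f (Complex x y) \<partial>lborel \<partial>lborel)"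
  by (rule nn_integral_complex) fact
 also have "... = ennreal (abs (Re w1)) * (\<integral>\<^sup>+s. \<integral>\<^sup>+y. f (Complex (Re w1 * s) y) \<partial>lborel \<partial>lborel)"
  by (subst nn_integral_real_affine[where c = "Re w1" and t = 0]) (use re in auto)
 also have "(%s. \<integral>\<^sup>+y. f (Complex (Re w1 * s) y) \<partial>lborel) =
  (%s. ennreal (abs (a / Re w1)) * (\<integral>\<^sup>+t. f (Complex (Re w1 * s) (s * Im w1 + (a / Re w1) * t)) \<partial>lborel))"
  by (rule ext, subst nn_integral_real_affine[where c = "a / Re w1" and t = "_ * Im w1"])
   (use re a in \<open>auto simp: a_def\<close>)
 also have "(\<integral>\<^sup>+s. ennreal (abs (a / Re w1)) * (\<integral>\<^sup>+t. f (Complex (Re w1 * s) (s * Im w1 + (a / Re w1) * t)) \<partial>lborel) \<partial>lborel)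
  = ennreal (abs (a / Re w1)) * (\<integral>\<^sup>+s. \<integral>\<^sup>+t. f (Complex (Re w1 * s) (s * Im w1 + (a / Re w1) * t)) \<partial>lborel \<partial>lborel)"
  by (rule nn_integral_cmult) measurable
 also have "(\<integral>\<^sup>+s. \<integral>\<^sup>+t. f (Complex (Re w1 * s) (s * Im w1 + (a / Re w1) * t)) \<partial>lborel \<partial>lborel)
  = (\<integral>\<^sup>+t. \<integral>\<^sup>+s. f (Complex (Re w1 * s) (s * Im w1 + (a / Re w1) * t)) \<partial>lborel \<partial>lborel)"
  by (rule lborel_pair.Fubini'[symmetric]) measurable
 also have "(%t. \<integral>\<^sup>+s. f (Complex (Re w1 * s) (s * Im w1 + (a / Re w1) * t)) \<partial>lborel) =
  (%t. \<integral>\<^sup>+s. f (of_real s * w1 + of_real t * w2) \<partial>lborel)"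
 proof
  fix t
  have "(\<integral>\<^sup>+s. f (Complex (Re w1 * s) (s * Im w1 + (a / Re w1) * t)) \<partial>lborel) =
   (\<integral>\<^sup>+s. f (Complex (Re w1 * (c * t + 1 * s)) ((c * t + 1 * s) * Im w1 + (a / Re w1) * t)) \<partial>lborel)"
   by (subst nn_integral_real_affine[where c = 1 and t = "c * t"]) auto
  also have "(%s. f (Complex (Re w1 * (c * t + 1 * s)) ((c * t + 1 * s) * Im w1 + (a / Re w1) * t))) =
    (%s. f (of_real s * w1 + of_real t * w2))"
   by (intro ext arg_cong[of _ _ f]) (use re in \<open>simp add: complex_eq_iff c_def a_def field_simps\<close>)
  finally show "(\<integral>\<^sup>+s. f (Complex (Re w1 * s) (s * Im w1 + (a / Re w1) * t)) \<partial>lborel) =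
    (\<integral>\<^sup>+s. f (of_real s * w1 + of_real t * w2) \<partial>lborel)" .
 qed
 also have "(\<integral>\<^sup>+t. \<integral>\<^sup>+s. f (of_real s * w1 + of_real t * w2) \<partial>lborel \<partial>lborel) =
  (\<integral>\<^sup>+s. \<integral>\<^sup>+t. f (of_real s * w1 + of_real t * w2) \<partial>lborel \<partial>lborel)"
  by (rule lborel_pair.Fubini') measurable
 also have "ennreal (abs (Re w1)) * (ennreal (abs (a / Re w1)) * X) = ennreal (abs a) * X" for X
  using re by (simp add: mult.assoc[symmetric] ennreal_mult[symmetric] abs_mult abs_divide)
 finally show ?thesis unfolding a_def .
qed

lemma nn_integral_linear:
 assumes [measurable]: "f : borel_measurable (borel :: complex measure)" and a: "Im (cnj w1 * w2) ~= 0"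
 shows "(\<integral>\<^sup>+z. f z \<partial>lborel) =
  ennreal (abs (Im (cnj w1 * w2))) * (\<integral>\<^sup>+s. \<integral>\<^sup>+t. f (of_real s * w1 + of_real t * w2) \<partial>lborel \<partial>lborel)"
proof (cases "Re w1 = 0")
 case False then show ?thesis using nn_integral_linear_aux[of f w1 w2] assms by simp
next
 \<comment> \<open>With \<open>Re w1 = 0\<close> the nonzero determinant forces \<open>Re w2\<close>
   to be nonzero, so the roles of \<open>w1\<close> and \<open>w2\<close> are exchanged.\<close>
 case True
 have a': "Im (cnj w2 * w1) = - Im (cnj w1 * w2)" by simp
 have "Re w2 ~= 0" using a True by auto
 then have "(\<integral>\<^sup>+z. f z \<partial>lborel) =
  ennreal (abs (Im (cnj w2 * w1))) * (\<integral>\<^sup>+s. \<integral>\<^sup>+t. f (of_real s * w2 + of_real t * w1) \<partial>lborel \<partial>lborel)"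
  using nn_integral_linear_aux[of f w2 w1] assms unfolding a' by simp
 also have "(\<integral>\<^sup>+s. \<integral>\<^sup>+t. f (of_real s * w2 + of_real t * w1) \<partial>lborel \<partial>lborel) =
   (\<integral>\<^sup>+t. \<integral>\<^sup>+s. f (of_real s * w2 + of_real t * w1) \<partial>lborel \<partial>lborel)"
  by (rule lborel_pair.Fubini'[symmetric]) measurable
 finally show ?thesis unfolding a' abs_minus by (simp only: add.commute)
qed

lemma nn_integral_rotate:
 assumes [measurable]: "f : borel_measurable (borel :: complex measure)"
 shows "(\<integral>\<^sup>+z. f (cis tt * z) \<partial>lborel) = (\<integral>\<^sup>+z. f z \<partial>lborel)"
proof -
 have 1: "Im (cnj (cis tt) * (\<i> * cis tt)) = 1"
  by (simp add: cis.code sqr[symmetric])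
 have "(\<integral>\<^sup>+z. f z \<partial>lborel) =
   (\<integral>\<^sup>+s. \<integral>\<^sup>+t. f (of_real s * cis tt + of_real t * (\<i> * cis tt)) \<partial>lborel \<partial>lborel)"
  using nn_integral_linear[of f "cis tt" "\<i> * cis tt"] unfolding 1 by simp
 also have "... = (\<integral>\<^sup>+s. \<integral>\<^sup>+t. f (cis tt * Complex s t) \<partial>lborel \<partial>lborel)"
  by (simp add: Complex_eq algebra_simps)
 also have "... = (\<integral>\<^sup>+z. f (cis tt * z) \<partial>lborel)"
  by (rule nn_integral_complex[symmetric]) measurable
 finally show ?thesis by simp
qed

section \<open>Lattice coordinates, fundamental domains and unfolding\<close>

locale torus =
 fixes o1 o2 :: complex
 assumes Im_pos: "Im (o2 / o1) > 0"
begin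

definition area :: real where "area = Im (cnj o1 * o2)"

lemma area_pos: "area > 0"
 unfolding area_def by (rule Im_cnj_mult_pos[OF Im_pos])

abbreviation L :: "complex set" where "L \<equiv> lattice o1 o2"
abbreviation D :: "complex set" where "D \<equiv> cell o1 o2"
abbreviation M :: "complex measure" where "M \<equiv> torus_measure o1 o2"
abbreviation Per :: "(complex => 'a) => bool" where "Per \<equiv> lattice_periodic o1 o2"

definition cx :: "complex => real" where "cx z = - Im (cnj o2 * z) / area"
definition cy :: "complex => real" where "cy z = Im (cnj o1 * z) / area"

lemma cxy_lincomb: "cx (of_real s * o1 + of_real t * o2) = s" "cy (of_real s * o1 + of_real t * o2) = t"
proof -
 have "- Im (cnj o2 * (of_real s * o1 + of_real t * o2)) = s * area"
  "Im (cnj o1 * (of_real s * o1 + of_real t * o2)) = t * area"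
  by (simp_all add: area_def algebra_simps)
 then show "cx (of_real s * o1 + of_real t * o2) = s" "cy (of_real s * o1 + of_real t * o2) = t"
  using area_pos by (simp_all add: cx_def cy_def)
qed

lemma lincomb_cxy: "of_real (cx z) * o1 + of_real (cy z) * o2 = z"
proof -
 have 1: "of_real (cx z * area) * o1 + of_real (cy z * area) * o2 = of_real area * z"
  using area_pos by (simp add: cx_def cy_def) (simp add: area_def complex_eq_iff algebra_simps)
 have "of_real area * (of_real (cx z) * o1 + of_real (cy z) * o2) = of_real area * z"
  unfolding 1[symmetric] by (simp add: algebra_simps)
 then show ?thesis using area_pos by simp
qed

lemma cxy_add: "cx (z + w) = cx z + cx w" "cy (z + w) = cy z + cy w"
 by (simp_all add: cx_def cy_def algebra_simps add_divide_distrib diff_divide_distrib)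

lemma cxy_diff: "cx (z - w) = cx z - cx w" "cy (z - w) = cy z - cy w"
 by (simp_all add: cx_def cy_def algebra_simps add_divide_distrib diff_divide_distrib)

lemma cxy_minus: "cx (- w) = - cx w" "cy (- w) = - cy w"
 unfolding cx_def cy_def by (simp_all add: minus_divide_left)

lemma D_iff: "z : D \<longleftrightarrow> cx z : {0..<1} & cy z : {0..<1}"
 unfolding cell_def using lincomb_cxy cxy_lincomb by (auto, metis)

lemma L_iff: "z : L \<longleftrightarrow> cx z : \<int> & cy z : \<int>"
proof
 assume "z : L"
 then obtain m n :: int where "z = of_real (of_int m) * o1 + of_real (of_int n) * o2"
  by (auto simp: lattice_def)
 then show "cx z : \<int> & cy z : \<int>" by (simp only: cxy_lincomb Ints_of_int)
next
 assume "cx z : \<int> & cy z : \<int>"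
 then obtain m n :: int where "cx z = of_int m" "cy z = of_int n" by (auto elim!: Ints_cases)
 then have "z = of_int m * o1 + of_int n * o2" using lincomb_cxy[of z] by simp
 then show "z : L" unfolding lattice_def by blast
qed

lemma L_0: "0 : L" and L_add: "l : L ==> l' : L ==> l + l' : L" and L_minus: "l : L ==> - l : L"
 and L_diff: "l : L ==> l' : L ==> l - l' : L"
 by (auto simp: L_iff cxy_add cxy_diff cxy_minus) (simp_all add: cx_def cy_def)

lemma continuous_cxy: "cont cx" "cont cy"
 unfolding cx_def[abs_def] cy_def[abs_def] using area_pos by (auto intro!: continuous_intros)

lemma D_borel [measurable]: "D : sets borel"
proof -
 have [measurable]: "cx : borel_measurable borel" "cy : borel_measurable borel"
  using continuous_cxy by (auto intro: borel_measurable_continuous_onI)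
 have "D = {z : space borel. cx z : {0..<1} & cy z : {0..<1}}" by (auto simp: D_iff)
 also have "... : sets borel" by measurable
 finally show ?thesis .
qed

lemma norm_D: "z : D ==> norm z <= norm o1 + norm o2"
 by (auto simp: cell_def norm_mult intro!: order_trans[OF norm_triangle_ineq] add_mono mult_left_le_one_le)

lemma ex_lattice_shift: "EX l:L. z - l : D"
proof -
 define l where "l = of_real (of_int \<lfloor>cx z\<rfloor>) * o1 + of_real (of_int \<lfloor>cy z\<rfloor>) * o2"
 have c: "cx l = of_int \<lfloor>cx z\<rfloor>" "cy l = of_int \<lfloor>cy z\<rfloor>" unfolding l_def cxy_lincomb by simp_all
 have "l : L" by (simp add: L_iff c)
 moreover have "z - l : D" unfolding D_iff cxy_diff c by (auto; linarith)
 ultimately show ?thesis by blast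
qed

lemma lattice_shift_unique:
 assumes "l : L" "l' : L" "z - l : D" "z - l' : D"
 shows "l = l'"
proof -
 have e: "x = (y::real)" if xy: "x : \<int>" "y : \<int>" "a - x : {0..<1}" "a - y : {0..<1}" for x y a
 proof -
  have "abs (x - y) < 1" "x - y : \<int>" using xy by auto
  then show ?thesis using Ints_nonzero_abs_less1 by force
 qed
 have "cx l = cx l'" "cy l = cy l'"
  using assms e[of "cx l" "cx l'" "cx z"] e[of "cy l" "cy l'" "cy z"] by (auto simp: L_iff D_iff cxy_diff)
 then show ?thesis using lincomb_cxy by metis
qed

lemma ex1_lattice_shift: "\<exists>!l. l : L & z - l : D"
 using ex_lattice_shift[of z] lattice_shift_unique[of _ _ z] by blast

text \<open>An enumeration by natural numbers turns sums over the lattice into series, which may be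
  exchanged with integrals of nonnegative functions.\<close>

definition lat :: "nat => complex" where
 "lat n = of_int (int_decode (fst (prod_decode n))) * o1 + of_int (int_decode (snd (prod_decode n))) * o2"

lemma bij_lat: "bij_betw lat UNIV L"
 unfolding bij_betw_def
proof
 have c: "cx (lat n) = of_int (int_decode (fst (prod_decode n)))" "cy (lat n) = of_int (int_decode (snd (prod_decode n)))" for n
  using cxy_lincomb[of "of_int (int_decode (fst (prod_decode n)))" "of_int (int_decode (snd (prod_decode n)))"]
  by (simp_all add: lat_def)
 show "inj lat"
 proof
  fix m n assume "lat m = lat n"
  then have "int_decode (fst (prod_decode m)) = int_decode (fst (prod_decode n))"
   "int_decode (snd (prod_decode m)) = int_decode (snd (prod_decode n))" using c by (metis of_int_eq_iff)+
  then show "m = n" by (metis bij_int_decode bij_is_inj inv_f_f prod_eq_iff prod_decode_inverse)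
 qed
 show "range lat = L"
 proof
  show "range lat \<subseteq> L" unfolding lat_def lattice_def by blast
  show "L \<subseteq> range lat"
  proof
   fix z assume "z : L"
   then obtain m n where "z = of_int m * o1 + of_int n * o2" by (auto simp: lattice_def)
   then have "z = lat (prod_encode (int_encode m, int_encode n))" by (simp add: lat_def)
   then show "z : range lat" by blast
  qed
 qed
qed

lemma Per_add: "Per f ==> l : L ==> f (z + l) = f z"
 by (simp add: Per_def)

lemma Per_diff: "Per f ==> l : L ==> f (z - l) = f z"
 by (metis Per_add L_minus diff_conv_add_uminus)

lemma suminf_indicator_single:
 assumes "\<exists>!n. P n"
 shows "(\<Sum>n. of_bool (P n) :: ennreal) = 1"
proof -
 obtain n where n: "P n" and u: "!!m. P m ==> m = n" using assms by blast
 have "P m \<longleftrightarrow> m = n" for m using n u by blast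
 then have "(%m. of_bool (P m) :: ennreal) = (%m. if m = n then 1 else 0)" by (simp add: of_bool_def)
 then show ?thesis using sums_single[of n "%_. 1 :: ennreal"] by (simp add: sums_iff)
qed

text \<open>The multiplicity with which \<open>S\<close> covers the class of \<open>w\<close>: 1 for
  a fundamental domain, at most 1 for a set that embeds in the torus.\<close>

definition lat_count :: "complex set => complex => ennreal" where
 "lat_count S w = (\<Sum>n. indicator S (w + lat n))"

lemma nn_integral_shift:
 assumes [measurable]: "f : borel_measurable (borel :: complex measure)"
 shows "(\<integral>\<^sup>+z. f (c + z) \<partial>lborel) = (\<integral>\<^sup>+z. f z \<partial>lborel)"
 by (subst (2) lborel_distr_plus[of c, symmetric]) (simp add: nn_integral_distr)

text \<open>The translates of the cell partition the plane. Inserting this partition of unity and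
  translating each piece back by \<open>lat n\<close> moves the mass of \<open>S\<close> into the
  cell, counted with multiplicity.\<close>

lemma nn_integral_unfold:
 assumes [measurable]: "f : borel_measurable (borel :: complex measure)" "S : sets borel" and per: "Per f"
 shows "(\<integral>\<^sup>+z. f z * indicator S z \<partial>lborel) = (\<integral>\<^sup>+z. f z * indicator D z * lat_count S z \<partial>lborel)"
proof -
 have 1: "(\<Sum>n. indicator D (z - lat n) :: ennreal) = 1" for z
 proof -
  obtain l where l: "l : L" "z - l : D" and u: "!!m. m : L ==> z - m : D ==> m = l"
   using ex1_lattice_shift[of z] by blast
  obtain n where n: "lat n = l" using bij_lat l(1) unfolding bij_betw_def by (metis imageE)
  have "\<exists>!n. z - lat n : D"
  proof (rule ex1I[of _ n])
   show "z - lat n : D" using l n by simp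
   fix m assume "z - lat m : D"
   then have "lat m = l" using u bij_lat unfolding bij_betw_def by blast
   then show "m = n" using n bij_lat unfolding bij_betw_def inj_def by auto
  qed
  from suminf_indicator_single[OF this] show ?thesis by (simp add: indicator_def)
 qed
 have "(\<integral>\<^sup>+z. f z * indicator S z \<partial>lborel) = (\<integral>\<^sup>+z. (\<Sum>n. f z * indicator S z * indicator D (z - lat n)) \<partial>lborel)"
  by (simp add: 1)
 also have "... = (\<Sum>n. \<integral>\<^sup>+z. f z * indicator S z * indicator D (z - lat n) \<partial>lborel)"
  by (rule nn_integral_suminf) measurable
 also have "... = (\<Sum>n. \<integral>\<^sup>+w. f w * indicator S (w + lat n) * indicator D w \<partial>lborel)"
 proof (intro arg_cong[of _ _ suminf] ext)
  fix n
  have "lat n : L" using bij_lat unfolding bij_betw_def by blast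
  then have f: "f (lat n + w) = f w" for w using Per_add[OF per, of "lat n" w] by (simp add: add.commute)
  have "(\<integral>\<^sup>+z. f z * indicator S z * indicator D (z - lat n) \<partial>lborel) =
   (\<integral>\<^sup>+w. f (lat n + w) * indicator S (lat n + w) * indicator D (lat n + w - lat n) \<partial>lborel)"
   by (rule nn_integral_shift[symmetric]) measurable
  then show "(\<integral>\<^sup>+z. f z * indicator S z * indicator D (z - lat n) \<partial>lborel) =
   (\<integral>\<^sup>+w. f w * indicator S (w + lat n) * indicator D w \<partial>lborel)" unfolding f by (simp add: add.commute)
 qed
 also have "... = (\<integral>\<^sup>+w. (\<Sum>n. f w * indicator S (w + lat n) * indicator D w) \<partial>lborel)"
  by (rule nn_integral_suminf[symmetric]) measurable
 also have "... = (\<integral>\<^sup>+z. f z * indicator D z * lat_count S z \<partial>lborel)"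
  unfolding lat_count_def by (simp add: mult_ac)
 finally show ?thesis .
qed

lemma lat_count_fundamental:
 assumes "!!z. \<exists>!l. l : L & z + l : S"
 shows "lat_count S z = 1"
proof -
 obtain l where l: "l : L" "z + l : S" and u: "!!m. m : L ==> z + m : S ==> m = l"
  using assms[of z] by blast
 obtain n where n: "lat n = l" using bij_lat l(1) unfolding bij_betw_def by (metis imageE)
 have "\<exists>!n. z + lat n : S"
 proof (rule ex1I[of _ n])
  show "z + lat n : S" using l n by simp
  fix m assume "z + lat m : S"
  then have "lat m = l" using u bij_lat unfolding bij_betw_def by blast
  then show "m = n" using n bij_lat unfolding bij_betw_def inj_def by auto
 qed
 from suminf_indicator_single[OF this] show ?thesis by (simp add: indicator_def lat_count_def)
qed

lemma lat_count_packing: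
 assumes "!!z l l'. l : L ==> l' : L ==> z + l : S ==> z + l' : S ==> l = l'"
 shows "lat_count S z <= 1"
proof (cases "EX n. z + lat n : S")
 case True
 then obtain n where n: "z + lat n : S" ..
 have "\<exists>!n. z + lat n : S"
 proof (rule ex1I[of _ n])
  show "z + lat n : S" by (rule n)
  fix m assume "z + lat m : S"
  then have "lat m = lat n" using assms n bij_lat unfolding bij_betw_def by blast
  then show "m = n" using bij_lat unfolding bij_betw_def inj_def by auto
 qed
 from suminf_indicator_single[OF this] show ?thesis by (simp add: indicator_def lat_count_def)
next
 case False
 then show ?thesis by (simp add: lat_count_def indicator_def)
qed

lemma nn_integral_M: "(\<integral>\<^sup>+z. f z \<partial>M) = (\<integral>\<^sup>+z. f z * indicator D z \<partial>lborel)"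
 unfolding torus_measure_def by (rule nn_integral_restrict_space) simp

lemma nn_integral_fundamental:
 assumes "f : borel_measurable (borel :: complex measure)" "S : sets borel" "Per f"
  and "!!z. \<exists>!l. l : L & z + l : S"
 shows "(\<integral>\<^sup>+z. f z * indicator S z \<partial>lborel) = (\<integral>\<^sup>+z. f z \<partial>M)"
 unfolding nn_integral_unfold[OF assms(1-3)] nn_integral_M lat_count_fundamental[OF assms(4)] by simp

lemma nn_integral_packing:
 assumes "f : borel_measurable (borel :: complex measure)" "S : sets borel" "Per f"
  and "!!z l l'. l : L ==> l' : L ==> z + l : S ==> z + l' : S ==> l = l'"
 shows "(\<integral>\<^sup>+z. f z * indicator S z \<partial>lborel) <= (\<integral>\<^sup>+z. f z \<partial>M)"
 unfolding nn_integral_unfold[OF assms(1-3)] nn_integral_M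
 by (intro nn_integral_mono) (use mult_left_mono[OF lat_count_packing[OF assms(4)]] in fastforce)

end

context torus
begin

lemma space_M: "space M = D" and sets_M: "sets M = sets (restrict_space borel D)"
 by (simp add: torus_measure_def space_restrict_space)
  (unfold torus_measure_def, rule sets_restrict_space_cong, simp)

lemma borel_M [measurable_dest]: "f : borel_measurable borel ==> f : borel_measurable M"
 unfolding torus_measure_def by (rule measurable_restrict_space1) simp

lemma cont_M: "cont f ==> f : borel_measurable M"
 for f :: "complex => 'b :: {second_countable_topology, topological_space}"
 by (intro borel_M borel_measurable_continuous_onI)

lemma emeasure_D: "emeasure lborel D = ennreal area"
proof -
 have "emeasure lborel D = (\<integral>\<^sup>+z. indicator D z \<partial>lborel)" by simp
 also have "... = ennreal area * (\<integral>\<^sup>+s. \<integral>\<^sup>+t. indicator D (of_real s * o1 + of_real t * o2) \<partial>lborel \<partial>lborel)"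
  using area_pos by (subst nn_integral_linear[of _ o1 o2]) (auto simp: area_def)
 also have "(%s t. indicator D (of_real s * o1 + of_real t * o2) :: ennreal) = (%s t. indicator {0..<1} s * indicator {0..<1} t)"
  unfolding fun_eq_iff by (auto simp: indicator_def D_iff cxy_lincomb)
 finally show ?thesis by (simp add: nn_integral_cmult nn_integral_multc)
qed

lemma emeasure_M: "emeasure M D = ennreal area"
 unfolding torus_measure_def by (subst emeasure_restrict_space) (auto simp: emeasure_D)

lemma measure_M: "measure M D = area"
 using emeasure_M area_pos by (simp add: measure_def)

lemma finite_measure_M: "finite_measure M"
 by (rule finite_measureI) (simp add: space_M emeasure_M)

sublocale M: finite_measure M by (rule finite_measure_M)

abbreviation tint :: "(complex => real) => real" (binder "\<integral>" 10) where
 "tint f == integral\<^sup>L M f"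

lemma measure_space_M: "measure M (space M) = area" by (simp add: space_M measure_M)

lemma Per_compact_bounded:
 fixes f :: "complex => real"
 assumes "cont f" "Per f"
 obtains B where "B > 0" "!!z. abs (f z) <= B"
proof -
 obtain B where B: "B > 0" "!!z. z : cball 0 (norm o1 + norm o2) ==> abs (f z) <= B"
  using continuous_bounded_cball[OF assms(1)] by blast
 have "abs (f z) <= B" for z
 proof -
  obtain l where l: "l : L" "z - l : D" using ex_lattice_shift by blast
  then have "abs (f (z - l)) <= B" using B(2)[of "z - l"] norm_D by auto
  then show ?thesis using Per_diff[OF assms(2) l(1)] by simp
 qed
 then show ?thesis using that B by blast
qed

lemma int_cont:
 fixes f :: "complex => real"
 assumes "cont f"
 shows "integrable M f"
proof -
 obtain B where B: "B > 0" "!!z. z : cball 0 (norm o1 + norm o2) ==> abs (f z) <= B"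
  using continuous_bounded_cball[OF assms(1)] by blast
 have "AE z in M. norm (f z) <= B"
  by (rule AE_I2) (use B norm_D in \<open>auto simp: space_M\<close>)
 then show ?thesis by (rule M.integrable_const_bound) (rule cont_M[OF assms])
qed

text \<open>A translated cell is again a fundamental domain, and a periodic function has the same
  integral over all of these.\<close>

lemma nn_translate:
 assumes [measurable]: "f : borel_measurable (borel :: complex measure)" and per: "Per f"
 shows "(\<integral>\<^sup>+z. f (h + z) \<partial>M) = (\<integral>\<^sup>+z. f z \<partial>M)"
proof -
 let ?S = "{w. w - h : D}"
 have "?S = {w : space borel. w - h : D}" by simp
 also have "... : sets borel" by measurable
 finally have [measurable]: "?S : sets borel" .
 have "(\<integral>\<^sup>+z. f (h + z) \<partial>M) = (\<integral>\<^sup>+z. f (h + z) * indicator ?S (h + z) \<partial>lborel)"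
  unfolding nn_integral_M by (simp add: indicator_def)
 also have "... = (\<integral>\<^sup>+z. f z * indicator ?S z \<partial>lborel)"
  by (rule nn_integral_shift) measurable
 also have "... = (\<integral>\<^sup>+z. f z \<partial>M)"
 proof (rule nn_integral_fundamental[OF _ _ per])
  fix z
  obtain l where l: "l : L" "z - h - l : D" and u: "!!m. m : L ==> z - h - m : D ==> m = l"
   using ex1_lattice_shift[of "z - h"] by blast
  show "\<exists>!l. l : L & z + l : ?S"
  proof (rule ex1I[of _ "- l"])
   show "- l : L & z + - l : ?S" using l L_minus by (simp add: algebra_simps)
   fix m assume "m : L & z + m : ?S"
   then have "- m = l" using L_minus by (intro u) (auto simp: algebra_simps)
   then show "m = - l" by auto
  qed
 qed measurable
 finally show ?thesis .
qed

lemma nn_reflect: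
 assumes [measurable]: "f : borel_measurable (borel :: complex measure)" and per: "Per f"
 shows "(\<integral>\<^sup>+z. f (h - z) \<partial>M) = (\<integral>\<^sup>+z. f z \<partial>M)"
proof -
 let ?S = "{w. h - w : D}"
 have "?S = {w : space borel. h - w : D}" by simp
 also have "... : sets borel" by measurable
 finally have [measurable]: "?S : sets borel" .
 \<comment> \<open>\<open>cis pi = -1\<close>: the reflection is the rotation by pi, for which
   invariance is already known.\<close>
 have neg: "(\<integral>\<^sup>+z. g (cis pi * z) \<partial>lborel) = (\<integral>\<^sup>+z. g z \<partial>lborel)"
  if "g : borel_measurable (borel :: complex measure)" for g
  by (rule nn_integral_rotate[OF that])
 have "(\<integral>\<^sup>+z. f (h - z) \<partial>M) = (\<integral>\<^sup>+z. f (h + cis pi * z) * indicator ?S (h + cis pi * z) \<partial>lborel)"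
  unfolding nn_integral_M by (simp add: indicator_def)
 also have "... = (\<integral>\<^sup>+z. f (h + z) * indicator ?S (h + z) \<partial>lborel)"
  by (rule neg[of "%z. f (h + z) * indicator ?S (h + z)"]) measurable
 also have "... = (\<integral>\<^sup>+z. f z * indicator ?S z \<partial>lborel)"
  by (rule nn_integral_shift) measurable
 also have "... = (\<integral>\<^sup>+z. f z \<partial>M)"
 proof (rule nn_integral_fundamental[OF _ _ per])
  fix z
  show "\<exists>!l. l : L & z + l : ?S" using ex1_lattice_shift[of "h - z"] by (simp add: algebra_simps)
 qed measurable
 finally show ?thesis .
qed

lemma integral_transform:
 fixes f :: "complex => real"
 assumes nn: "!!g :: complex => ennreal. g : borel_measurable borel ==> Per g ==> (\<integral>\<^sup>+z. g (T z) \<partial>M) = (\<integral>\<^sup>+z. g z \<partial>M)"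
  and [measurable]: "T : borel \<rightarrow>\<^sub>M borel" "f : borel_measurable borel" and per: "Per f" and int: "integrable M f"
 shows "integrable M (%z. f (T z))" "(\<integral>z. f (T z)) = (\<integral>z. f z)"
proof -
 have p: "Per (%z. ph (f z))" for ph :: "real => ennreal" using per by (auto simp: Per_def)
 have n: "(\<integral>\<^sup>+z. ennreal (norm (f (T z))) \<partial>M) = (\<integral>\<^sup>+z. ennreal (norm (f z)) \<partial>M)"
  by (rule nn[of "%z. ennreal (norm (f z))", OF _ p]) measurable
 show *: "integrable M (%z. f (T z))"
  using int unfolding integrable_iff_bounded n by (auto intro!: borel_M)
 have "(\<integral>\<^sup>+z. ennreal (f (T z)) \<partial>M) = (\<integral>\<^sup>+z. ennreal (f z) \<partial>M)"
  by (rule nn[of "%z. ennreal (f z)", OF _ p]) measurable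
 moreover have "(\<integral>\<^sup>+z. ennreal (- f (T z)) \<partial>M) = (\<integral>\<^sup>+z. ennreal (- f z) \<partial>M)"
  by (rule nn[of "%z. ennreal (- f z)", OF _ p]) measurable
 ultimately show "(\<integral>z. f (T z)) = (\<integral>z. f z)"
  unfolding real_lebesgue_integral_def[OF *] real_lebesgue_integral_def[OF int] by simp
qed

lemma integral_translate:
 fixes f :: "complex => real"
 assumes "f : borel_measurable borel" "Per f" "integrable M f"
 shows "(\<integral>z. f (h + z)) = (\<integral>z. f z)"
 using integral_transform[where T = "%z. h + z" and f = f, OF nn_translate _ assms] by simp_all

lemma integral_reflect:
 fixes f :: "complex => real"
 assumes "f : borel_measurable borel" "Per f" "integrable M f"
 shows "(\<integral>z. f (h - z)) = (\<integral>z. f z)"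
 using integral_transform[where T = "%z. h - z" and f = f, OF nn_reflect _ assms] by simp_all

lemma C1_global_lipschitz:
 assumes "C1 f" "Per f"
 obtains B where "B > 0" "!!z w. abs (f z - f w) <= B * norm (z - w)"
proof -
 obtain A where A: "A > 0" "!!z. abs (dx f z) <= A"
  using Per_compact_bounded[OF C1_cont_dx C1_periodic(1), OF assms(1) assms] by blast
 obtain B where B: "B > 0" "!!z. abs (dy f z) <= B"
  using Per_compact_bounded[OF C1_cont_dy C1_periodic(2), OF assms(1) assms] by blast
 show ?thesis
  by (rule that[of "A + B"]) (use A B in \<open>auto intro!: C1_bound_diff[OF assms(1), of UNIV] add_mono\<close>)
qed

text \<open>Translation invariance makes every difference quotient integrate to 0, and the global
  Lipschitz bound dominates the passage to the derivative. This takes the place of a divergence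
  theorem with cancelling boundary terms on the cell.\<close>

lemma integral_directional_0:
 assumes "C1 f" "Per f"
 shows "(\<integral>z. Re v * dx f z + Im v * dy f z) = 0"
proof -
 obtain B where B: "B > 0" "!!z w. abs (f z - f w) <= B * norm (z - w)"
  using C1_global_lipschitz[OF assms] by blast
 note c = C1_cont[OF assms(1)]
 have cs: "cont (%z. f (h + z))" for h
  by (intro continuous_on_compose2[OF c] continuous_intros) auto
 define q where "q n z = real (Suc n) * (f (of_real (inverse (real (Suc n))) * v + z) - f z)" for n z
 have q0: "(\<integral>z. q n z) = 0" for n
  unfolding q_def using integral_translate[OF borel_measurable_continuous_onI[OF c] assms(2) int_cont[OF c]]
  by (simp add: int_cont c cs)
 have "(%n. \<integral>z. q n z) \<longlonglongrightarrow> (\<integral>z. Re v * dx f z + Im v * dy f z)"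
 proof (rule integral_dominated_convergence[where w = "%_. B * norm v"])
  show "(%z. Re v * dx f z + Im v * dy f z) : borel_measurable M"
   by (intro cont_M continuous_intros C1_cont_dx C1_cont_dy assms)
  show "q n : borel_measurable M" for n
   unfolding q_def[abs_def] by (intro cont_M continuous_intros c cs)
  show "AE z in M. norm (q n z) <= B * norm v" for n
  proof (rule AE_I2)
   fix z
   have "norm (q n z) = real (Suc n) * abs (f (of_real (inverse (real (Suc n))) * v + z) - f z)"
    unfolding q_def by (simp add: abs_mult)
   also have "... <= real (Suc n) * (B * norm (of_real (inverse (real (Suc n))) * v + z - z))"
    by (intro mult_left_mono B) auto
   also have "norm (of_real (inverse (real (Suc n))) * v + z - z) = inverse (real (Suc n)) * norm v"
    by (simp only: add_diff_cancel_right' norm_mult norm_of_real) simp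
   also have "real (Suc n) * (B * (inverse (real (Suc n)) * norm v)) = B * norm v" by (simp del: of_nat_Suc)
   finally show "norm (q n z) <= B * norm v" .
  qed
  show "AE z in M. (%n. q n z) \<longlonglongrightarrow> Re v * dx f z + Im v * dy f z"
  proof (rule AE_I2)
   fix z
   have p: "((%t. z + t *\<^sub>R v) has_derivative (%t. t *\<^sub>R v)) (at 0)"
    by (auto intro!: derivative_eq_intros)
   have g: "(f has_derivative (%h. Re h * dx f z + Im h * dy f z)) (at (z + 0 *\<^sub>R v))"
    using C1_has_grad[OF assms(1), of z] unfolding has_grad_def by simp
   have "((%t. f (z + t *\<^sub>R v)) has_derivative (%t. t * (Re v * dx f z + Im v * dy f z))) (at 0)"
    using has_derivative_compose[OF p g] by (simp add: algebra_simps)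
   then have "((%t. f (z + t *\<^sub>R v)) has_real_derivative (Re v * dx f z + Im v * dy f z)) (at 0)"
    unfolding has_field_derivative_def by (rule has_derivative_eq_rhs) (auto simp: mult.commute)
   then have l: "((%t. (f (z + t *\<^sub>R v) - f z) / t) \<longlongrightarrow> Re v * dx f z + Im v * dy f z) (at 0)"
    by (simp add: DERIV_def)
   have "filterlim (%n. inverse (real (Suc n))) (at 0) sequentially"
    unfolding filterlim_at using LIMSEQ_inverse_real_of_nat by auto
   from filterlim_compose[OF l this] show "(%n. q n z) \<longlonglongrightarrow> Re v * dx f z + Im v * dy f z"
    by (simp add: q_def scaleR_conv_of_real divide_inverse add.commute mult.commute del: of_nat_Suc)
  qed
 qed simp
 then show ?thesis unfolding q0 by (simp add: LIMSEQ_const_iff)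
qed

lemma integral_dx_0: "C1 f ==> Per f ==> (\<integral>z. dx f z) = 0"
 and integral_dy_0: "C1 f ==> Per f ==> (\<integral>z. dy f z) = 0"
 using integral_directional_0[of f 1] integral_directional_0[of f \<i>] by simp_all

lemma Per_mult: "Per f ==> Per g ==> Per (%z. f z * g z)"
 and Per_add': "Per p ==> Per q ==> Per (%z. p z + q z)"
 and Per_sub: "Per p ==> Per q ==> Per (%z. p z - q z)"
 and Per_const: "Per (%z. c)"
 and Per_compose: "Per h ==> Per (%z. ph (h z))"
 for f g :: "complex => 'b :: times" and p q :: "complex => 'c :: {plus, minus}"
 by (auto simp: Per_def)

definition dir :: "(complex => real) => (complex => real) => real" where
 "dir f g = (\<integral>z. dx f z * dx g z + dy f z * dy g z)"

lemma green:
 assumes f: "C1 f" "Per f" and g: "C2 g" "Per g"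
 shows "(\<integral>z. f z * lap g z) = - dir f g"
proof -
 note P = C1_periodic[OF C2_C1[OF g(1)] g(2)]
 note c = C1_mult[OF f(1) C2_dx[OF g(1)]] C1_mult[OF f(1) C2_dy[OF g(1)]]
 have "(\<integral>z. dx (%z. f z * dx g z) z) = 0" "(\<integral>z. dy (%z. f z * dy g z) z) = 0"
  by (intro integral_dx_0 integral_dy_0 c Per_mult f P)+
 moreover have i: "integrable M (%z. dx (%z. f z * dx g z) z)" "integrable M (%z. dy (%z. f z * dy g z) z)"
  by (intro int_cont C1_cont_dx C1_cont_dy c)+
 ultimately have "(\<integral>z. dx (%z. f z * dx g z) z + dy (%z. f z * dy g z) z) = 0" by simp
 also have "(%z. dx (%z. f z * dx g z) z + dy (%z. f z * dy g z) z) =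
  (%z. f z * lap g z + (dx f z * dx g z + dy f z * dy g z))"
  unfolding c lap_def by (auto simp: algebra_simps)
 also have "(\<integral>z. f z * lap g z + (dx f z * dx g z + dy f z * dy g z)) = (\<integral>z. f z * lap g z) + dir f g"
  unfolding dir_def
  by (intro Bochner_Integration.integral_add int_cont continuous_intros C1_cont C2_cont_lap C1_cont_dx C1_cont_dy f g C2_C1)
 finally show ?thesis by simp
qed

lemma green_sym:
 assumes f: "C2 f" "Per f" and g: "C2 g" "Per g"
 shows "(\<integral>z. f z * lap g z) = (\<integral>z. g z * lap f z)"
 using green[OF C2_C1 _ g] green[OF C2_C1 _ f] f g by (simp add: dir_def mult.commute)

lemma integral_lap_0:
 assumes "C2 g" "Per g"
 shows "(\<integral>z. lap g z) = 0"
 using green_sym[OF assms C2_const(1)[of 1] Per_const] by (simp add: C2_const)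

lemma dir_nonneg: "dir f f >= 0"
 unfolding dir_def by (intro integral_ge_0) simp

end

lemma Cauchy_Schwarz_integral:
 fixes f g :: "'a => real"
 assumes [measurable]: "f : borel_measurable N" "g : borel_measurable N"
  and f2: "integrable N (%x. (f x)^2)" and g2: "integrable N (%x. (g x)^2)"
 shows "integrable N (%x. f x * g x)" "(\<integral>x. abs (f x * g x) \<partial>N)^2 <= (\<integral>x. (f x)^2 \<partial>N) * (\<integral>x. (g x)^2 \<partial>N)"
  "(\<integral>x. f x * g x \<partial>N)^2 <= (\<integral>x. (f x)^2 \<partial>N) * (\<integral>x. (g x)^2 \<partial>N)"
proof -
 show i: "integrable N (%x. f x * g x)"
 proof (rule Bochner_Integration.integrable_bound[OF Bochner_Integration.integrable_add[OF f2 g2]])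
  show "AE x in N. norm (f x * g x) <= norm ((f x)^2 + (g x)^2)"
  proof (rule AE_I2)
   fix x
   have "2 * abs (f x) * abs (g x) <= (f x)^2 + (g x)^2"
    using sum_squares_bound[of "abs (f x)" "abs (g x)"] by simp
   moreover have "0 <= abs (f x) * abs (g x)" by simp
   ultimately have "abs (f x) * abs (g x) <= (f x)^2 + (g x)^2" by linarith
   then show "norm (f x * g x) <= norm ((f x)^2 + (g x)^2)"
    by (simp add: abs_mult)
  qed
 qed measurable
 have "ennreal ((\<integral>x. abs (f x * g x) \<partial>N)^2) = (\<integral>\<^sup>+x. ennreal (abs (f x)) * ennreal (abs (g x)) \<partial>N)^2"
  using nn_integral_eq_integral[OF integrable_abs[OF i]]
  by (simp add: ennreal_mult'[symmetric] abs_mult ennreal_power)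
 also have "... <= (\<integral>\<^sup>+x. ennreal (abs (f x)) ^ 2 \<partial>N) * (\<integral>\<^sup>+x. ennreal (abs (g x)) ^ 2 \<partial>N)"
  by (rule Cauchy_Schwarz_nn_integral) measurable
 also have "... = ennreal ((\<integral>x. (f x)^2 \<partial>N) * (\<integral>x. (g x)^2 \<partial>N))"
  using nn_integral_eq_integral[OF f2] nn_integral_eq_integral[OF g2]
  by (simp add: ennreal_power ennreal_mult')
 finally show *: "(\<integral>x. abs (f x * g x) \<partial>N)^2 <= (\<integral>x. (f x)^2 \<partial>N) * (\<integral>x. (g x)^2 \<partial>N)"
  by (subst (asm) ennreal_le_iff) (auto intro!: mult_nonneg_nonneg)
 have "abs (\<integral>x. f x * g x \<partial>N) <= (\<integral>x. abs (f x * g x) \<partial>N)" by (rule integral_abs_bound)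
 then have "(\<integral>x. f x * g x \<partial>N)^2 <= (\<integral>x. abs (f x * g x) \<partial>N)^2"
  by (rule power2_le_iff_abs_le[THEN iffD2, rotated]) simp
 with * show "(\<integral>x. f x * g x \<partial>N)^2 <= (\<integral>x. (f x)^2 \<partial>N) * (\<integral>x. (g x)^2 \<partial>N)" by linarith
qed

text \<open>Integrate \<open>(g - k)^2 >= 0\<close> with \<open>k\<close> the mean of
  \<open>g\<close>.\<close>

lemma Jensen_square_integral:
 fixes g :: "real => real"
 assumes "continuous_on {a..b} g" "a <= b"
 shows "(integral {a..b} g)^2 <= (b - a) * integral {a..b} (%t. (g t)^2)"
proof (cases "a = b")
 case False
 then have ab: "a < b" using assms by simp
 define k where "k = integral {a..b} g / (b - a)"
 have i: "g integrable_on {a..b}" "(%t. (g t)^2) integrable_on {a..b}"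
  using assms by (auto intro!: icont continuous_intros)
 have h: "((%t. 2 * k * g t - k\<^sup>2) has_integral 2 * k * integral {a..b} g - k\<^sup>2 * (b - a)) {a..b}"
  using has_integral_diff[OF has_integral_mult_right[OF integrable_integral[OF i(1)], of "2 * k"] has_integral_const_real[of "k^2" a b]]
   ab by (simp add: mult.commute)
 have "2 * k * integral {a..b} g - k\<^sup>2 * (b - a) <= integral {a..b} (%t. (g t)^2)"
 proof (rule has_integral_le[OF h integrable_integral[OF i(2)]])
  fix t
  have "0 <= (g t - k)^2" by simp
  then show "2 * k * g t - k\<^sup>2 <= (g t)^2" by (simp add: power2_diff algebra_simps)
 qed
 moreover have "2 * k * integral {a..b} g - k\<^sup>2 * (b - a) = (integral {a..b} g)^2 / (b - a)"
 proof -
  have "k * (b - a) = integral {a..b} g" using ab by (simp add: k_def)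
  then have "2 * k * integral {a..b} g - k\<^sup>2 * (b - a) = k * integral {a..b} g"
   by (simp add: sqr mult.assoc)
  then show ?thesis by (simp add: k_def sqr)
 qed
 ultimately have "(integral {a..b} g)^2 / (b - a) <= integral {a..b} (%t. (g t)^2)" by linarith
 then show ?thesis using ab by (simp add: pos_divide_le_eq mult.commute)
qed (use assms in simp)

section \<open>Circular averages\<close>

lemma integral_period_shift:
 fixes g :: "real => real"
 assumes c: "cont g" and per: "!!t. g (t + T) = g t" and a: "0 <= a" "a <= T"
 shows "integral {a..a + T} g = integral {0..T} g"
proof -
 have i: "g integrable_on {x..y}" for x y
  by (rule icont[OF continuous_on_subset[OF c]]) simp
 have "integral {a..a + T} g = integral {a..T} g + integral {T..a + T} g"
  using HK_combine[of a T "a + T" g] i a by simp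
 also have "integral {T..a + T} g = integral {0..a} (%t. g (t + T))"
  using integral_shift[of 0 T a g] continuous_on_subset[OF c] by (simp add: o_def)
 also have "... = integral {0..a} g" by (simp add: per)
 also have "integral {a..T} g + integral {0..a} g = integral {0..T} g"
  using HK_combine[of 0 a T g] i a by simp
 finally show ?thesis .
qed

definition circ :: "(complex => real) => real => real" where
 "circ f r = integral {0..2 * pi} (%tt. f (of_real r * cis tt)) / (2 * pi)"

lemma circ_integrand_cont:
 assumes "cont f"
 shows "continuous_on S (%tt. f (of_real r * cis tt))"
 by (intro continuous_on_compose2[OF assms] continuous_intros) auto

lemma circ_has_integral:
 assumes "cont f"
 shows "((%tt. f (of_real r * cis tt)) has_integral 2 * pi * circ f r) {0..2 * pi}"
 using integrable_integral[OF icont[OF circ_integrand_cont[OF assms, of "{0..2 * pi}" r]]]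
 by (simp add: circ_def)

lemma continuous_circ:
 assumes "cont f"
 shows "cont (circ f)"
proof -
 have "cont (%r. integral (cbox 0 (2 * pi)) (%tt. f (of_real r * cis tt)))"
  by (rule integral_continuous_on_param)
   (auto simp: case_prod_unfold intro!: continuous_on_compose2[OF assms] continuous_intros)
 then show ?thesis unfolding circ_def[abs_def] by (simp add: continuous_on_divide)
qed

lemma circ_rotate:
 assumes "cont f"
 shows "integral {0..2 * pi} (%tt. f (cis tt * z)) = 2 * pi * circ f (norm z)"
proof -
 obtain a where a: "0 <= a" "a < 2 * pi" "z = of_real (norm z) * cis a"
 proof (cases "z = 0")
  case True then show ?thesis using that[of 0] by simp
 next
  case False
  then show ?thesis using that[of "Arg2pi z"] Arg2pi_ge_0[of z] Arg2pi_lt_2pi[of z] Arg2pi_eq[of z]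
   by (simp add: cis_conv_exp)
 qed
 let ?g = "%tt. f (of_real (norm z) * cis tt)"
 have g: "(%tt. f (cis tt * z)) = (%tt. ?g (tt + a))"
 proof
  fix tt
  have "of_real (norm z) * cis (tt + a) = cis tt * (of_real (norm z) * cis a)"
   by (simp add: cis_mult[symmetric])
  then show "f (cis tt * z) = ?g (tt + a)" using a(3) by simp
 qed
 have "integral {0..2 * pi} (%tt. ?g (tt + a)) = integral {a..a + 2 * pi} ?g"
  using integral_shift[of 0 a "2 * pi" ?g] circ_integrand_cont[OF assms] by (simp add: add.commute o_def)
 also have "... = integral {0..2 * pi} ?g"
  using a by (intro integral_period_shift circ_integrand_cont assms) (auto simp: cis_mult[symmetric])
 finally show ?thesis unfolding g by (simp add: circ_def)
qed

text \<open>The image of area under the norm is determined by its values on discs, and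
  \<open>pi a^2\<close> is the primitive of the density \<open>2 pi r\<close>.\<close>

lemma nn_integral_radial:
 assumes [measurable]: "g : borel_measurable (borel :: real measure)"
 shows "(\<integral>\<^sup>+z. g (norm (z::complex)) \<partial>lborel) = (\<integral>\<^sup>+r. ennreal (2 * pi * r) * indicator {0..} r * g r \<partial>lborel)"
proof -
 let ?d = "%r::real. ennreal (2 * pi * r) * indicator {0..} r"
 have [measurable]: "?d : borel_measurable borel" by measurable
 have n: "(norm :: complex => real) : lborel \<rightarrow>\<^sub>M borel" by simp
 have ball: "emeasure (distr (lborel :: complex measure) borel norm) {..a} = ennreal (pi * a^2)" if "0 <= a" for a
 proof -
  have "emeasure (distr (lborel :: complex measure) borel norm) {..a} = emeasure lborel (cball (0::complex) a)"
   by (subst emeasure_distr[OF n]) (auto simp: cball_def intro!: arg_cong[of _ _ "emeasure lborel"])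
  then show ?thesis using that by (simp add: emeasure_cball unit_ball_vol_2)
 qed
 have neg: "emeasure (distr (lborel :: complex measure) borel norm) {..a} = 0" if "a < 0" for a
 proof -
  have "norm -` {..a} = ({} :: complex set)" using that by (auto dest: order_trans[OF norm_ge_zero])
  then show ?thesis by (subst emeasure_distr[OF n]) auto
 qed
 have "distr (lborel :: complex measure) borel norm = density lborel ?d"
 proof (rule measure_eqI_generator_eq[where E = "range atMost" and \<Omega> = UNIV and A = "%i. {..real i}"])
  show "Int_stable (range (atMost :: real => _))"
   by (auto simp: Int_stable_def)
  show "(\<Union>i. {..real i}) = UNIV" using real_arch_simple by auto
  show "emeasure (distr (lborel :: complex measure) borel norm) {..real i} ~= \<infinity>" for i
   by (simp add: ball)
  show "emeasure (distr (lborel :: complex measure) borel norm) X = emeasure (density lborel ?d) X"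
   if "X : range atMost" for X
  proof -
   obtain a where X: "X = {..a}" using \<open>X : range atMost\<close> by auto
   have "emeasure (density lborel ?d) X = (\<integral>\<^sup>+r. ?d r * indicator {..a} r \<partial>lborel)"
    unfolding X by (rule emeasure_density) auto
   also have "... = (\<integral>\<^sup>+r. ennreal (2 * pi * r) * indicator {0..a} r \<partial>lborel)"
    by (rule nn_integral_cong) (auto simp: indicator_def)
   also have "... = emeasure (distr (lborel :: complex measure) borel norm) X"
   proof (cases "0 <= a")
    case True
    have "(\<integral>\<^sup>+r. ennreal (2 * pi * r) * indicator {0..a} r \<partial>lborel) = ennreal (pi * a^2 - pi * 0^2)"
     by (rule nn_integral_FTC_Icc) (use True in \<open>auto intro!: derivative_eq_intros\<close>)
    then show ?thesis unfolding X ball[OF True] by simp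
   next
    case False
    then show ?thesis unfolding X using neg[of a] by simp
   qed
   finally show ?thesis by simp
  qed
 qed (auto simp: borel_eq_atMost)
 then have "(\<integral>\<^sup>+r. g r \<partial>distr (lborel :: complex measure) borel norm) = (\<integral>\<^sup>+r. g r \<partial>density lborel ?d)" by simp
 then show ?thesis by (simp add: nn_integral_distr nn_integral_density)
qed

text \<open>Averaging over all rotations, which preserve the integral, replaces \<open>f\<close> by
  its circle mean. That is a function of the norm alone, so the radial formula suffices in place of
  a polar change of variables.\<close>

lemma nn_integral_annulus:
 assumes c: "cont f" and f0: "!!z. 0 <= f z" and a: "0 <= al"
 shows "(\<integral>\<^sup>+z. ennreal (f z) * indicator {z. norm z : {al..be}} z \<partial>lborel) =
  ennreal (2 * pi * integral {al..be} (%r. r * circ f r))"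
proof -
 have [measurable]: "f : borel_measurable borel" by (rule borel_measurable_continuous_onI[OF c])
 have [measurable]: "circ f : borel_measurable borel"
  by (rule borel_measurable_continuous_onI[OF continuous_circ[OF c]])
 have [measurable]: "cis : borel_measurable borel"
  by (rule borel_measurable_continuous_onI) (intro continuous_intros)
 let ?I = "%z::complex. indicator {al..be} (norm z) :: ennreal"
 let ?P = "%tt. indicator {0..2 * pi} tt :: ennreal"
 have "ennreal (2 * pi) * (\<integral>\<^sup>+z. ennreal (f z) * ?I z \<partial>lborel) = (\<integral>\<^sup>+tt. (\<integral>\<^sup>+z. ennreal (f z) * ?I z \<partial>lborel) * ?P tt \<partial>lborel)"
  by (subst nn_integral_cmult_indicator) (auto simp: mult.commute)
 also have "... = (\<integral>\<^sup>+tt. (\<integral>\<^sup>+z. ennreal (f (cis tt * z)) * ?I z * ?P tt \<partial>lborel) \<partial>lborel)"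
 proof (rule nn_integral_cong)
  fix tt :: real
  have "(\<integral>\<^sup>+z. ennreal (f z) * ?I z \<partial>lborel) = (\<integral>\<^sup>+z. ennreal (f (cis tt * z)) * ?I (cis tt * z) \<partial>lborel)"
   by (rule nn_integral_rotate[symmetric]) measurable
  then show "(\<integral>\<^sup>+z. ennreal (f z) * ?I z \<partial>lborel) * ?P tt = (\<integral>\<^sup>+z. ennreal (f (cis tt * z)) * ?I z * ?P tt \<partial>lborel)"
   by (simp add: norm_mult nn_integral_multc)
 qed
 also have "... = (\<integral>\<^sup>+z. (\<integral>\<^sup>+tt. ennreal (f (cis tt * z)) * ?I z * ?P tt \<partial>lborel) \<partial>lborel)"
  by (rule lborel_pair.Fubini'[where f = "%z tt. ennreal (f (cis tt * z)) * ?I z * ?P tt"]) measurable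
 also have "... = (\<integral>\<^sup>+z. ennreal (2 * pi) * (ennreal (circ f (norm z)) * ?I z) \<partial>lborel)"
 proof (rule nn_integral_cong)
  fix z :: complex
  have "(\<integral>\<^sup>+tt. ennreal (f (cis tt * z)) * ?P tt \<partial>lborel) = ennreal (integral {0..2 * pi} (%tt. f (cis tt * z)))"
   by (rule nn_integral_has_integral_lebesgue'[OF f0])
    (intro integrable_integral icont continuous_on_compose2[OF c] continuous_intros, auto)
  also have "... = ennreal (2 * pi) * ennreal (circ f (norm z))"
   unfolding circ_rotate[OF c] by (simp add: ennreal_mult')
  finally have *: "(\<integral>\<^sup>+tt. ennreal (f (cis tt * z)) * ?P tt \<partial>lborel) = ennreal (2 * pi) * ennreal (circ f (norm z))" .
  have "(\<integral>\<^sup>+tt. ennreal (f (cis tt * z)) * ?I z * ?P tt \<partial>lborel) = (\<integral>\<^sup>+tt. (ennreal (f (cis tt * z)) * ?P tt) * ?I z \<partial>lborel)"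
   by (simp add: mult_ac)
  also have "... = ennreal (2 * pi) * ennreal (circ f (norm z)) * ?I z"
   by (subst nn_integral_multc) (auto simp: *)
  finally show "(\<integral>\<^sup>+tt. ennreal (f (cis tt * z)) * ?I z * ?P tt \<partial>lborel) =
    ennreal (2 * pi) * (ennreal (circ f (norm z)) * ?I z)" by (simp add: mult.assoc)
 qed
 also have "... = ennreal (2 * pi) * (\<integral>\<^sup>+z. ennreal (circ f (norm z)) * ?I z \<partial>lborel)"
  by (rule nn_integral_cmult) measurable
 finally have "(\<integral>\<^sup>+z. ennreal (f z) * ?I z \<partial>lborel) = (\<integral>\<^sup>+z. ennreal (circ f (norm z)) * ?I z \<partial>lborel)"
  by (subst (asm) ennreal_mult_cancel_left) auto
 also have "... = (\<integral>\<^sup>+r. ennreal (2 * pi * r) * indicator {0..} r * (ennreal (circ f r) * indicator {al..be} r) \<partial>lborel)"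
  by (rule nn_integral_radial) measurable
 also have "... = (\<integral>\<^sup>+r. ennreal (2 * pi * (r * circ f r)) * indicator {al..be} r \<partial>lborel)"
 proof (rule nn_integral_cong)
  fix r :: real
  show "ennreal (2 * pi * r) * indicator {0..} r * (ennreal (circ f r) * indicator {al..be} r) =
   ennreal (2 * pi * (r * circ f r)) * indicator {al..be} r"
  proof (cases "r : {al..be}")
   case True
   then have "ennreal (2 * pi * r) * ennreal (circ f r) = ennreal (2 * pi * r * circ f r)"
    using a by (intro ennreal_mult'[symmetric]) auto
   then show ?thesis using True a by (simp add: mult.assoc)
  qed simp
 qed
 also have "... = ennreal (2 * pi * integral {al..be} (%r. r * circ f r))"
 proof (rule nn_integral_has_integral_lebesgue')
  fix r assume "r : {al..be}"
  moreover have "circ f r >= 0" unfolding circ_def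
   by (intro divide_nonneg_nonneg integral_nonneg icont circ_integrand_cont c f0) auto
  ultimately show "0 <= 2 * pi * (r * circ f r)" using a by simp
 next
  show "((%r. 2 * pi * (r * circ f r)) has_integral 2 * pi * integral {al..be} (%r. r * circ f r)) {al..be}"
   by (intro has_integral_mult_right integrable_integral icont continuous_intros
     continuous_on_subset[OF continuous_circ[OF c]]) auto
 qed
 finally show ?thesis by (simp add: indicator_def)
qed

text \<open>The derivative of \<open>q h^2\<close>, added to \<open>W h^2\<close>, stays below
  \<open>p (h')^2\<close> by the square \<open>(p h' - q h)^2 / p\<close>. In applications
  \<open>q = p phi' / phi\<close>, where \<open>phi\<close> solves a comparison equation and has no
  zero on the interval.\<close>

lemma riccati_inequality:
 fixes h :: "real => real"
 assumes ab: "a <= b"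
  and h: "!!t. t : {a..b} ==> (h has_real_derivative h' t) (at t)" and ch: "continuous_on {a..b} h'"
  and q: "!!t. t : {a..b} ==> (q has_real_derivative q' t) (at t)"
  and p: "continuous_on {a..b} p" "!!t. t : {a..b} ==> p t > 0" and W: "continuous_on {a..b} W"
  and le: "!!t. t : {a..b} ==> q' t + (q t)^2 / p t + W t <= 0"
 shows "integral {a..b} (%t. W t * (h t)^2) + (q b * (h b)^2 - q a * (h a)^2) <= integral {a..b} (%t. p t * (h' t)^2)"
proof -
 have h_cont: "continuous_on {a..b} h"
  using h by (intro continuous_at_imp_continuous_on ballI DERIV_isCont) blast
 have i: "(%t. W t * (h t)^2) integrable_on {a..b}" "(%t. p t * (h' t)^2) integrable_on {a..b}"
  by (intro icont continuous_intros p W ch h_cont)+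
 have "((%t. q' t * (h t)^2 + q t * (2 * h t * h' t)) has_integral q b * (h b)^2 - q a * (h a)^2) {a..b}"
 proof (rule fundamental_theorem_of_calculus[OF ab])
  fix t assume t: "t : {a..b}"
  have "((%t. q t * (h t)^2) has_real_derivative q' t * (h t)^2 + q t * (2 * h t * h' t)) (at t)"
   by (auto intro!: derivative_eq_intros h q t)
  then show "((%t. q t * (h t)^2) has_vector_derivative q' t * (h t)^2 + q t * (2 * h t * h' t)) (at t within {a..b})"
   by (simp add: has_real_derivative_iff_has_vector_derivative has_vector_derivative_at_within)
 qed
 from has_integral_add[OF integrable_integral[OF i(1)] this]
 show ?thesis
 proof (rule has_integral_le[OF _ integrable_integral[OF i(2)]])
  fix t assume t: "t : {a..b}"
  define x where "x = (h t)^2"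
  have "0 <= (p t * h' t - q t * h t)^2 / p t" using p(2)[OF t] by simp
  also have "(p t * h' t - q t * h t)^2 / p t = p t * (h' t)^2 - 2 * q t * h t * h' t + (q t)^2 / p t * (h t)^2"
   using p(2)[OF t] by (simp add: field_simps sqr)
  finally have 1: "0 <= p t * (h' t)^2 - 2 * q t * h t * h' t + (q t)^2 / p t * x" unfolding x_def .
  have "(q' t + (q t)^2 / p t + W t) * x <= 0"
   using le[OF t] by (simp add: x_def mult_nonpos_nonneg)
  then have "q' t * x + (q t)^2 / p t * x + W t * x <= 0" by (simp only: distrib_right)
  with 1 show "W t * (h t)^2 + (q' t * (h t)^2 + q t * (2 * h t * h' t)) <= p t * (h' t)^2"
   unfolding x_def[symmetric] by (simp add: algebra_simps)
 qed
qed

lemma sqrt_5_2_pi_4: "sqrt (5 / 2) * (pi / 4) < pi / 2"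
proof -
 have "sqrt (5 / 2) < 2" by (rule real_less_lsqrt) auto
 then show ?thesis using pi_gt_zero by simp
qed

lemma tan_riccati:
 fixes x :: real
 assumes "cos x ~= 0"
 shows "- mu\<^sup>2 * inverse ((cos x)^2) + (mu * tan x)^2 = - mu\<^sup>2"
proof -
 have "inverse ((cos x)^2) = 1 + (tan x)^2" using tan_sec[OF assms] by (simp add: power_inverse)
 then show ?thesis by (simp add: power_mult_distrib algebra_simps)
qed

lemma frac_leI: "0 < b ==> 0 < d ==> a * d <= c * b ==> a / b <= c / d" for a b c d :: real
 by (simp add: divide_le_eq pos_le_divide_eq mult.commute)

lemma cos_pos_abs: "abs x < pi / 2 ==> cos x > 0" for x :: real
 by (rule cos_gt_zero_pi) auto

text \<open>The comparison function is \<open>cos (mu (t - m))\<close> about the midpoint, with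
  \<open>mu^2 = 5/2\<close>. At the sharp value 4 the cosine would vanish at both endpoints; the
  smaller \<open>mu\<close> keeps the Riccati function finite on the closed interval.\<close>

lemma interval_poincare:
 fixes u :: "real => real"
 assumes u: "!!t. (u has_real_derivative u' t) (at t)" and c: "cont u'"
  and 0: "u a = 0" "u (a + pi / 2) = 0"
 shows "5 / 2 * integral {a..a + pi / 2} (%t. (u t)^2) <= integral {a..a + pi / 2} (%t. (u' t)^2)"
proof -
 define mu :: real where "mu = sqrt (5 / 2)"
 have mu: "mu^2 = 5 / 2" by (simp add: mu_def)
 define m where "m = a + pi / 4"
 have cs: "cos (mu * (t - m)) > 0" if "t : {a..a + pi / 2}" for t
 proof -
  have "abs (mu * (t - m)) <= mu * (pi / 4)"
   unfolding abs_mult using that by (intro mult_mono abs_leI) (auto simp: mu_def m_def)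
  then show ?thesis using sqrt_5_2_pi_4 unfolding mu_def by (intro cos_pos_abs) linarith
 qed
 have "integral {a..a + pi / 2} (%t. 5 / 2 * (u t)^2) + ((- mu * tan (mu * (a + pi / 2 - m))) * (u (a + pi / 2))^2 - (- mu * tan (mu * (a - m))) * (u a)^2)
  <= integral {a..a + pi / 2} (%t. 1 * (u' t)^2)"
 proof (rule riccati_inequality[where q' = "%t. - mu\<^sup>2 * inverse ((cos (mu * (t - m)))^2)"])
  fix t assume t: "t : {a..a + pi / 2}"
  show "((%t. - mu * tan (mu * (t - m))) has_real_derivative - mu\<^sup>2 * inverse ((cos (mu * (t - m)))^2)) (at t)"
   using cs[OF t] by (auto intro!: derivative_eq_intros simp: sqr)
  show "- mu\<^sup>2 * inverse ((cos (mu * (t - m)))^2) + (- mu * tan (mu * (t - m)))^2 / 1 + 5 / 2 <= 0"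
   using tan_riccati[of "mu * (t - m)" mu] cs[OF t] unfolding mu by simp
 qed (use u c in \<open>auto intro: continuous_on_subset\<close>)
 then show ?thesis using 0 by simp
qed

text \<open>A pi-periodic function has no first harmonic, so the sharp constant is 4 instead of 1.
  Without Fourier series: after subtraction of a suitable constant the function vanishes at three
  points spaced by pi/2, and the interval inequality applies on both pieces of a period.\<close>

lemma wirtinger_pi:
 fixes g :: "real => real"
 assumes g: "!!t. (g has_real_derivative g' t) (at t)" and c: "cont g'"
  and per: "!!t. g (t + pi) = g t"
 shows "5 / 2 * (integral {0..2 * pi} (%t. (g t)^2) - (integral {0..2 * pi} g)\<^sup>2 / (2 * pi)) <= integral {0..2 * pi} (%t. (g' t)^2)"
proof -
 have cg: "continuous_on S g" for S
  using g by (intro continuous_at_imp_continuous_on ballI DERIV_isCont) blast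
 have cg': "continuous_on S g'" for S using c by (rule continuous_on_subset) simp
 have per': "g' (t + pi) = g' t" for t
 proof -
  have "((%t. g (t + pi)) has_real_derivative g' (t + pi) * 1) (at t)"
   by (rule DERIV_chain2[OF g]) (auto intro!: derivative_eq_intros)
  then have "(g has_real_derivative g' (t + pi)) (at t)" unfolding per by simp
  then show ?thesis using g by (rule DERIV_unique)
 qed
 have dbl: "integral {0..2 * pi} f = 2 * integral {0..pi} f"
  if f: "cont f" "!!t. f (t + pi) = f t" for f :: "real => real"
 proof -
  have i: "f integrable_on {x..y}" for x y
   by (rule icont[OF continuous_on_subset[OF f(1)]]) simp
  have "integral {0..2 * pi} f = integral {0..pi} f + integral {pi..pi + pi} f"
   using HK_combine[of 0 pi "2 * pi" f] i by simp
  also have "integral {pi..pi + pi} f = integral {0..pi} f"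
   by (rule integral_period_shift) (use f in auto)
  finally show ?thesis by simp
 qed
 \<comment> \<open>\<open>g t - g (t + pi/2)\<close> takes opposite values at 0 and pi/2 by
   periodicity, so it has a zero between.\<close>
 obtain a where a: "0 <= a" "a <= pi / 2" "g a = g (a + pi / 2)"
 proof -
  define k where "k t = g t - g (t + pi / 2)" for t
  have ck: "continuous_on {0..pi / 2} k" unfolding k_def[abs_def]
   by (intro continuous_intros cg continuous_on_compose2[OF cg[of UNIV]]) auto
  have "k (pi / 2) = - k 0" using per[of 0] by (simp add: k_def)
  then have "k 0 <= 0 & 0 <= k (pi / 2) | k (pi / 2) <= 0 & 0 <= k 0" by linarith
  then obtain t where "0 <= t" "t <= pi / 2" "k t = 0"
   using IVT'[OF _ _ _ ck] IVT2'[OF _ _ _ ck] by (metis pi_half_ge_zero)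
  then show ?thesis using that[of t] by (simp add: k_def)
 qed
 define v where "v = g a"
 define u where "u t = g t - v" for t
 have u: "(u has_real_derivative g' t) (at t)" for t
  unfolding u_def by (auto intro!: derivative_eq_intros g)
 have cu: "continuous_on S u" for S unfolding u_def by (intro continuous_intros cg)
 have u0: "u a = 0" "u (a + pi / 2) = 0" "u (a + pi / 2 + pi / 2) = 0"
  using a per[of a] by (simp_all add: u_def v_def add.commute)
 have split: "integral {0..pi} f = integral {a..a + pi / 2} f + integral {a + pi / 2..a + pi / 2 + pi / 2} f"
  if f: "cont f" "!!t. f (t + pi) = f t" for f :: "real => real"
 proof -
  have i: "f integrable_on {x..y}" for x y
   by (rule icont[OF continuous_on_subset[OF f(1)]]) simp
  have "integral {0..pi} f = integral {a..a + pi} f"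
   using integral_period_shift[OF f, of a] a by simp
  also have "a + pi = a + pi / 2 + pi / 2" by simp
  also have "integral {a..a + pi / 2 + pi / 2} f = integral {a..a + pi / 2} f + integral {a + pi / 2..a + pi / 2 + pi / 2} f"
   by (rule HK_combine[symmetric]) (use i in auto)
  finally show ?thesis .
 qed
 have su: "u (t + pi) = u t" for t by (simp add: u_def per)
 have "5 / 2 * integral {0..pi} (%t. (u t)^2) <= integral {0..pi} (%t. (g' t)^2)"
  using interval_poincare[OF u c u0(1,2)] interval_poincare[OF u c u0(2,3)]
  by (subst (1 2) split) (auto simp: su per' distrib_left intro!: continuous_intros cu cg')
 then have 1: "5 / 2 * integral {0..2 * pi} (%t. (u t)^2) <= integral {0..2 * pi} (%t. (g' t)^2)"
  by (subst (1 2) dbl) (auto simp: su per' intro!: continuous_intros cu cg')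
 have i: "g integrable_on {0..2 * pi}" "(%t. (g t)^2) integrable_on {0..2 * pi}"
  by (intro icont continuous_intros cg)+
 have "((%t. (g t)^2 - 2 * v * g t + v^2) has_integral
  integral {0..2 * pi} (%t. (g t)^2) - 2 * v * integral {0..2 * pi} g + (2 * pi) * v^2) {0..2 * pi}"
  using has_integral_const_real[of "v^2" 0 "2 * pi"]
  by (intro has_integral_add has_integral_diff has_integral_mult_right integrable_integral i) auto
 then have "integral {0..2 * pi} (%t. (u t)^2) = integral {0..2 * pi} (%t. (g t)^2) - 2 * v * integral {0..2 * pi} g + (2 * pi) * v^2"
  by (intro integral_unique) (simp add: u_def power2_diff algebra_simps)
 \<comment> \<open>The mean minimises the square deviation among all constants, so the variance is
   at most the integral of \<open>u^2\<close>.\<close>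
 moreover have "0 <= (integral {0..2 * pi} g - 2 * pi * v)^2 / (2 * pi)" by simp
 moreover have "(integral {0..2 * pi} g - 2 * pi * v)^2 / (2 * pi) = (integral {0..2 * pi} g)^2 / (2 * pi) - 2 * v * integral {0..2 * pi} g + (2 * pi) * v^2"
  by (simp add: field_simps sqr)
 ultimately have "integral {0..2 * pi} (%t. (g t)^2) - (integral {0..2 * pi} g)\<^sup>2 / (2 * pi) <= integral {0..2 * pi} (%t. (u t)^2)"
  by linarith
 from order_trans[OF mult_left_mono[OF this, of "5 / 2"] 1] show ?thesis by simp
qed

text \<open>The Riccati function is \<open>r phi' / phi\<close> with
  \<open>phi = (r^2 - m) / (r^2 + m)\<close>, the radial dilation mode of the bubble of scale
  \<open>m\<close>. It solves \<open>(r phi')' + 8 m r phi / (r^2 + m)^2 = 0\<close> and vanishes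
  only at \<open>r^2 = m\<close>.\<close>

lemma radial_riccati:
 fixes m r :: real
 assumes "r > 0" "m > 0" "r^2 ~= m"
 shows "((%r. 4 * m * r^2 / (r ^ 4 - m\<^sup>2)) has_real_derivative (- 8 * m * r ^ 5 - 8 * m ^ 3 * r) / (r ^ 4 - m\<^sup>2)^2) (at r)"
  "(- 8 * m * r ^ 5 - 8 * m ^ 3 * r) / (r ^ 4 - m\<^sup>2)^2 + (4 * m * r^2 / (r ^ 4 - m\<^sup>2))^2 / r = - 8 * m * r / (r^2 + m)^2"
proof -
 have f: "r ^ 4 - m\<^sup>2 = (r^2 - m) * (r^2 + m)" by (simp add: algebra_simps sqr power4_eq_xxxx)
 have pos: "r^2 + m > 0" using assms by (simp add: add_pos_pos)
 have ne: "r ^ 4 - m\<^sup>2 ~= 0" unfolding f using assms pos by simp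
 show "((%r. 4 * m * r^2 / (r ^ 4 - m\<^sup>2)) has_real_derivative (- 8 * m * r ^ 5 - 8 * m ^ 3 * r) / (r ^ 4 - m\<^sup>2)^2) (at r)"
  by (auto intro!: derivative_eq_intros ne) (simp add: sqr power3_eq_cube eval_nat_numeral algebra_simps)
 have "(4 * m * r^2 / (r ^ 4 - m\<^sup>2))^2 / r = 16 * m^2 * r ^ 3 / (r ^ 4 - m\<^sup>2)^2"
  using assms by (simp add: power_divide power_mult_distrib eval_nat_numeral)
 moreover have "- 8 * m * r ^ 5 - 8 * m ^ 3 * r + 16 * m^2 * r ^ 3 = - 8 * m * r * (r^2 - m)^2"
  by (simp add: eval_nat_numeral algebra_simps)
 ultimately have "(- 8 * m * r ^ 5 - 8 * m ^ 3 * r) / (r ^ 4 - m\<^sup>2)^2 + (4 * m * r^2 / (r ^ 4 - m\<^sup>2))^2 / r =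
  (- 8 * m * r * (r^2 - m)^2) / (r ^ 4 - m\<^sup>2)^2"
  by (simp only: add_divide_distrib[symmetric])
 also have "... = - 8 * m * r / (r^2 + m)^2"
  unfolding f power_mult_distrib using assms by simp
 finally show "(- 8 * m * r ^ 5 - 8 * m ^ 3 * r) / (r ^ 4 - m\<^sup>2)^2 + (4 * m * r^2 / (r ^ 4 - m\<^sup>2))^2 / r = - 8 * m * r / (r^2 + m)^2" .
qed

text \<open>The factor 10 is 5/4 of the bubble weight 8, a gain won by cutting at the two zeros of
  \<open>h\<close>. For \<open>r^2 <= s/3\<close> and \<open>r^2 >= 3 s\<close> the comparison
  functions are dilation modes of the shifted scales \<open>s/2\<close> and \<open>2 s\<close>,
  whose zeros lie outside these ranges; in between it is a cosine of \<open>ln r\<close>.\<close>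

lemma radial_gap:
 fixes h :: "real => real"
 assumes s: "s > 0" and al: "0 < al" "al <= sqrt (s / 3)" and be: "sqrt (3 * s) <= be"
  and h: "!!t. (h has_real_derivative h' t) (at t)" and c: "cont h'"
  and z1: "h (sqrt (s / 3)) = 0" and z2: "h (sqrt (3 * s)) = 0"
 shows "integral {al..be} (%r. 10 * s * r / (s + r^2)^2 * (h r)^2) <= integral {al..be} (%r. r * (h' r)^2)"
proof -
 let ?W = "%r. 10 * s * r / (s + r^2)^2"
 let ?a = "sqrt (s / 3)" and ?b = "sqrt (3 * s)"
 have ab: "?a < ?b" "0 < ?a" using s by auto
 have ne: "s + r^2 ~= 0" for r using s by (simp add: add_pos_nonneg less_imp_neq[symmetric])
 have ch: "continuous_on S h" for S
  using h by (intro continuous_at_imp_continuous_on ballI DERIV_isCont) blast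
 have ch': "continuous_on S h'" for S using c by (rule continuous_on_subset) simp
 have cW: "continuous_on S ?W" for S by (intro continuous_intros) (use ne in auto)
 note r = riccati_inequality[where p = "%r. r" and W = ?W and h = h and h' = h', OF _ h ch' _ continuous_on_id _ cW]
 have sq: "r^2 <= s / 3" if "0 < r" "r <= ?a" for r using that real_sqrt_le_iff[of "r^2" "s / 3"] by simp
 have sq2: "3 * s <= r^2" if "?b <= r" for r
  using that s power_mono[of ?b r 2] by simp
 have 1: "integral {al..?a} (%r. ?W r * (h r)^2) <= integral {al..?a} (%r. r * (h' r)^2)"
 proof -
  let ?q = "%r. 4 * (s / 2) * r^2 / (r ^ 4 - (s / 2)\<^sup>2)"
  have "integral {al..?a} (%r. ?W r * (h r)^2) + (?q ?a * (h ?a)^2 - ?q al * (h al)^2) <= integral {al..?a} (%r. r * (h' r)^2)"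
  proof (rule r[OF al(2)])
   fix r assume rr: "r : {al..?a}"
   then have r0: "r > 0" and r2: "r^2 <= s / 3" using al sq[of r] by auto
   have m: "s / 2 > 0" "r^2 ~= s / 2" using s r2 by auto
   show "r > 0" by fact
   show "(?q has_real_derivative (- 8 * (s / 2) * r ^ 5 - 8 * (s / 2) ^ 3 * r) / (r ^ 4 - (s / 2)\<^sup>2)^2) (at r)"
    by (rule radial_riccati(1)[OF r0 m])
   \<comment> \<open>\<open>8/5 (r^2 + s/2) <= s + r^2\<close> holds exactly up to
     \<open>r^2 = s/3\<close>, which fixes the inner cut; and \<open>(8/5)^2 = 2.56\<close> exceeds
     5/2.\<close>
   have "10 * (r^2 + s / 2)^2 <= 4 * (s + r^2)^2"
   proof -
    have "(5/2) * (r^2 + s / 2)^2 <= (8/5 * (r^2 + s/2))^2"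
     unfolding power_mult_distrib by (intro mult_right_mono) (auto simp: sqr)
    also have "... <= (s + r^2)^2" using r2 s by (intro power_mono) (auto)
    finally show ?thesis by simp
   qed
   then have "10 * s * r * (r^2 + s / 2)^2 <= 4 * s * r * (s + r^2)^2"
    using mult_left_mono[of _ _ "s * r"] s r0 by (simp add: mult_ac)
   then have "?W r <= 8 * (s / 2) * r / (r^2 + s / 2)^2"
    using s r0 by (intro frac_leI zero_less_power add_pos_pos) (auto simp: mult_ac)
   then show "(- 8 * (s / 2) * r ^ 5 - 8 * (s / 2) ^ 3 * r) / (r ^ 4 - (s / 2)\<^sup>2)^2 + (?q r)^2 / r + ?W r <= 0"
    unfolding radial_riccati(2)[OF r0 m] by simp
  qed
  \<comment> \<open>At the free end \<open>al\<close> nothing is known about \<open>h\<close>, but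
    \<open>q <= 0\<close> there gives the boundary term the favourable sign; at \<open>be\<close>
    below it is \<open>q >= 0\<close>.\<close>
  moreover have "?q al * (h al)^2 <= 0"
  proof -
   have "al^2 <= s / 2" using sq[OF al] s by simp
   then have "(al^2)^2 <= (s / 2)^2" by (intro power_mono) auto
   then have "al ^ 4 - (s / 2)\<^sup>2 <= 0" by simp
   then have "?q al <= 0" using s by (intro divide_nonneg_nonpos) auto
   then show ?thesis by (rule mult_nonpos_nonneg) simp
  qed
  ultimately show ?thesis using z1 by simp
 qed
 have 2: "integral {?b..be} (%r. ?W r * (h r)^2) <= integral {?b..be} (%r. r * (h' r)^2)"
 proof -
  let ?q = "%r. 4 * (2 * s) * r^2 / (r ^ 4 - (2 * s)\<^sup>2)"
  have "integral {?b..be} (%r. ?W r * (h r)^2) + (?q be * (h be)^2 - ?q ?b * (h ?b)^2) <= integral {?b..be} (%r. r * (h' r)^2)"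
  proof (rule r[OF be])
   fix r assume rr: "r : {?b..be}"
   then have r0: "r > 0" and r2: "3 * s <= r^2"
    using less_le_trans[OF less_trans[OF ab(2,1)], of r] sq2[of r] by auto
   have m: "2 * s > 0" "r^2 ~= 2 * s" using s r2 by auto
   show "r > 0" by fact
   show "(?q has_real_derivative (- 8 * (2 * s) * r ^ 5 - 8 * (2 * s) ^ 3 * r) / (r ^ 4 - (2 * s)\<^sup>2)^2) (at r)"
    by (rule radial_riccati(1)[OF r0 m])
   \<comment> \<open>\<open>r^2 + 2 s <= 5/4 (s + r^2)\<close> holds exactly from
     \<open>r^2 = 3 s\<close> on, which fixes the outer cut; and
     \<open>10 * 25/16 <= 16\<close>.\<close>
   have "10 * (r^2 + 2 * s)^2 <= 16 * (s + r^2)^2"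
   proof -
    have "(r^2 + 2 * s)^2 <= (5/4 * (s + r^2))^2" using r2 s by (intro power_mono) auto
    also have "... = 25 / 16 * (s + r^2)^2" unfolding power_mult_distrib by (simp add: sqr)
    finally have "(r^2 + 2 * s)^2 <= 25 / 16 * (s + r^2)^2" .
    moreover have "0 <= (s + r^2)^2" by simp
    ultimately show ?thesis by linarith
   qed
   then have "10 * s * r * (r^2 + 2 * s)^2 <= 16 * s * r * (s + r^2)^2"
    using mult_left_mono[of _ _ "s * r"] s r0 by (simp add: mult_ac)
   then have "?W r <= 8 * (2 * s) * r / (r^2 + 2 * s)^2"
    using s r0 by (intro frac_leI zero_less_power add_pos_pos) (auto simp: mult_ac)
   then show "(- 8 * (2 * s) * r ^ 5 - 8 * (2 * s) ^ 3 * r) / (r ^ 4 - (2 * s)\<^sup>2)^2 + (?q r)^2 / r + ?W r <= 0"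
    unfolding radial_riccati(2)[OF r0 m] by simp
  qed
  moreover have "0 <= ?q be * (h be)^2"
  proof -
   have "2 * s <= be^2" using sq2[OF be] s by simp
   then have "(2 * s)^2 <= (be^2)^2" using s by (intro power_mono) auto
   then have "0 <= be ^ 4 - (2 * s)\<^sup>2" by simp
   then show ?thesis using s by (intro mult_nonneg_nonneg divide_nonneg_nonneg) auto
  qed
  ultimately show ?thesis using z2 by simp
 qed
 \<comment> \<open>In the variable \<open>ln (r / sqrt s)\<close> the weight is at most 5/2, and the
   interval has half-length \<open>ln (sqrt 3) <= 3/4\<close>, which is below pi/4; so the cosine
   stays positive.\<close>
 have 3: "integral {?a..?b} (%r. ?W r * (h r)^2) <= integral {?a..?b} (%r. r * (h' r)^2)"
 proof -
  define mu :: real where "mu = sqrt (5 / 2)"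
  have mu: "mu^2 = 5 / 2" "mu > 0" by (simp_all add: mu_def)
  define x where "x r = mu * ln (r / sqrt s)" for r
  have cs: "cos (x r) > 0" if "r : {?a..?b}" for r
  proof -
   have 1: "r / sqrt s <= sqrt 3" "1 / sqrt 3 <= r / sqrt s" using that s by (auto simp: real_sqrt_mult real_sqrt_divide field_simps)
   have r0: "r / sqrt s > 0" using that s less_le_trans[OF ab(2), of r] by simp
   have l3: "ln (sqrt 3) <= (3::real) / 4"
   proof -
    have "(3::real) <= exp (3/2)"
    proof -
     have "(3::real) <= 1 + 3/2 + (3/2)^2 / 2" by (simp add: sqr)
     also have "... <= exp (3/2)" by (rule exp_lower_Taylor_quadratic) simp
     finally show ?thesis .
    qed
    then have "ln (3::real) <= ln (exp (3/2))" by (subst ln_le_cancel_iff) auto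
    then have "ln (3::real) <= 3/2" by simp
    then show ?thesis by (simp add: ln_sqrt)
   qed
   have "ln (r / sqrt s) <= ln (sqrt 3)" using 1 r0 by simp
   moreover have "- ln (sqrt 3) <= ln (r / sqrt s)"
   proof -
    have "ln (1 / sqrt 3) <= ln (r / sqrt s)" by (subst ln_le_cancel_iff) (use r0 1 in auto)
    then show ?thesis by (simp add: ln_div)
   qed
   ultimately have "abs (ln (r / sqrt s)) <= pi / 4" using l3 pi_gt3 by linarith
   then have "abs (x r) <= mu * (pi / 4)" unfolding x_def abs_mult using mu by (intro mult_mono) auto
   then show ?thesis using sqrt_5_2_pi_4 unfolding mu_def by (intro cos_pos_abs) linarith
  qed
  have "integral {?a..?b} (%r. ?W r * (h r)^2) + ((- mu * tan (x ?b)) * (h ?b)^2 - (- mu * tan (x ?a)) * (h ?a)^2) <= integral {?a..?b} (%r. r * (h' r)^2)"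
  proof (rule r[OF less_imp_le[OF ab(1)]])
   fix r assume rr: "r : {?a..?b}"
   show r0: "r > 0" using rr by (intro less_le_trans[OF ab(2)]) simp
   show "((%r. - mu * tan (x r)) has_real_derivative (- mu\<^sup>2 * inverse ((cos (x r))^2)) / r) (at r)"
    using cs[OF rr] r0 s unfolding x_def
    by (auto intro!: derivative_eq_intros simp: sqr field_simps)
   have "4 * s * r^2 <= (s + r^2)^2" using zero_le_power2[of "s - r\<^sup>2"] by (simp add: power2_sum power2_diff)
   moreover have "10 * s * r * r = 5 / 2 * (4 * s * r^2)" by (simp add: sqr)
   ultimately have "10 * s * r * r <= 5 / 2 * (s + r^2)^2" by linarith
   then have "?W r <= 5 / 2 / r" using r0 s by (intro frac_leI zero_less_power add_pos_pos) (auto simp: mult_ac)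
   moreover have "(- mu\<^sup>2 * inverse ((cos (x r))^2)) / r + (- mu * tan (x r))^2 / r = - (5 / 2) / r"
    unfolding add_divide_distrib[symmetric] using tan_riccati[of "x r" mu] cs[OF rr] unfolding mu(1) by simp
   ultimately show "(- mu\<^sup>2 * inverse ((cos (x r))^2)) / r + (- mu * tan (x r))^2 / r + ?W r <= 0" by simp
  qed
  then show ?thesis using z1 z2 by simp
 qed
 have comb: "integral {al..be} f = integral {al..?a} f + (integral {?a..?b} f + integral {?b..be} f)"
  if "cont f" for f :: "real => real"
 proof -
  have i: "f integrable_on {x..y}" for x y
   by (rule icont[OF continuous_on_subset[OF that]]) simp
  have "integral {?a..be} f = integral {?a..?b} f + integral {?b..be} f"
   using ab be i by (intro HK_combine[symmetric]) auto
  moreover have "integral {al..be} f = integral {al..?a} f + integral {?a..be} f"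
   using less_imp_le[OF less_le_trans[OF ab(1) be]] al i
   by (intro HK_combine[symmetric]) auto
  ultimately show ?thesis by simp
 qed
 have "integral {al..be} (%r. ?W r * (h r)^2) = integral {al..?a} (%r. ?W r * (h r)^2) +
  (integral {?a..?b} (%r. ?W r * (h r)^2) + integral {?b..be} (%r. ?W r * (h r)^2))"
  by (rule comb) (intro continuous_intros cW ch)
 moreover have "integral {al..be} (%r. r * (h' r)^2) = integral {al..?a} (%r. r * (h' r)^2) +
  (integral {?a..?b} (%r. r * (h' r)^2) + integral {?b..be} (%r. r * (h' r)^2))"
  by (rule comb) (intro continuous_intros ch')
 ultimately show ?thesis using 1 2 3 by linarith
qed

definition grad2 :: "(complex => real) => complex => real" where
 "grad2 y z = (dx y z)^2 + (dy y z)^2"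

definition circ_deriv :: "(complex => real) => real => real" where
 "circ_deriv y r = integral {0..2 * pi} (%tt. cos tt * dx y (of_real r * cis tt) + sin tt * dy y (of_real r * cis tt)) / (2 * pi)"

lemma continuous_grad2: "C1 y ==> cont (grad2 y)"
 unfolding grad2_def[abs_def] by (intro continuous_intros C1_cont_dx C1_cont_dy)

lemma grad2_nonneg: "grad2 y z >= 0"
 by (simp add: grad2_def)

lemma polar_derivs:
 assumes "C1 y"
 shows "((%r. y (of_real r * cis tt)) has_real_derivative
   cos tt * dx y (of_real r * cis tt) + sin tt * dy y (of_real r * cis tt)) (at r)"
  "((%tt. y (of_real r * cis tt)) has_real_derivative
   r * (cos tt * dy y (of_real r * cis tt) - sin tt * dx y (of_real r * cis tt))) (at tt)"
proof -
 note g = C1_has_grad[OF assms, unfolded has_grad_def]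
 have "((%r. of_real r * cis tt) has_derivative (%t. of_real t * cis tt)) (at r)"
  by (auto intro!: derivative_eq_intros)
 from has_derivative_compose[OF this g]
 show "((%r. y (of_real r * cis tt)) has_real_derivative
   cos tt * dx y (of_real r * cis tt) + sin tt * dy y (of_real r * cis tt)) (at r)"
  unfolding has_field_derivative_def
  by (rule has_derivative_eq_rhs) (auto simp: algebra_simps)
 have "((%tt. Complex (cos tt) (sin tt)) has_derivative (%t. of_real t * (\<i> * cis tt))) (at tt)"
  unfolding Complex_eq
  by (auto intro!: derivative_eq_intros simp: fun_eq_iff complex_eq_iff)
 then have "((%tt. of_real r * cis tt) has_derivative (%t. of_real r * (of_real t * (\<i> * cis tt)))) (at tt)"
  unfolding cis.code[symmetric] by (intro has_derivative_mult_right) (simp add: cis.code)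
 from has_derivative_compose[OF this g]
 show "((%tt. y (of_real r * cis tt)) has_real_derivative
   r * (cos tt * dy y (of_real r * cis tt) - sin tt * dx y (of_real r * cis tt))) (at tt)"
  unfolding has_field_derivative_def
  by (rule has_derivative_eq_rhs) (auto simp: algebra_simps)
qed

lemma circ_integrand_cont2:
 assumes "cont f"
 shows "continuous_on S (%p. f (of_real (fst p) * cis (snd p)))"
 by (intro continuous_on_compose2[OF assms] continuous_intros) auto

lemma circ_has_deriv:
 assumes "C1 y"
 shows "(circ y has_real_derivative circ_deriv y r) (at r)" "cont (circ_deriv y)"
proof -
 let ?d = "%r tt. cos tt * dx y (of_real r * cis tt) + sin tt * dy y (of_real r * cis tt)"
 have c: "continuous_on (UNIV \<times> cbox 0 (2 * pi)) (%(r, tt). ?d r tt)"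
  unfolding case_prod_unfold
  by (intro continuous_intros circ_integrand_cont2 C1_cont_dx C1_cont_dy assms)
 have "((%r. integral (cbox 0 (2 * pi)) (%tt. y (of_real r * cis tt))) has_field_derivative integral (cbox 0 (2 * pi)) (?d r)) (at r within UNIV)"
 proof (rule leibniz_rule_field_derivative[OF _ _ c])
  show "(%tt. y (of_real x * cis tt)) integrable_on cbox 0 (2 * pi)" for x
   by (intro integrable_continuous circ_integrand_cont C1_cont assms)
 qed (auto intro: polar_derivs(1)[OF assms])
 then show "(circ y has_real_derivative circ_deriv y r) (at r)"
  unfolding circ_def[abs_def] circ_deriv_def by (auto intro!: derivative_eq_intros)
 have "cont (%r. integral (cbox 0 (2 * pi)) (?d r))"
  by (rule integral_continuous_on_param[OF c])
 then show "cont (circ_deriv y)" unfolding circ_deriv_def[abs_def] by (simp add: continuous_on_divide)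
qed

text \<open>Evenness makes the restriction of \<open>y\<close> to a circle pi-periodic as a function
  of the angle. This excludes the first harmonics, that is, the translation modes, and the angular
  derivative controls the variance with factor 5/2. The radial derivative is handled by
  Jensen.\<close>

lemma circ_grad2_lower:
 assumes y: "C1 y" and even: "!!z. y (- z) = y z" and r: "r > 0"
 shows "(circ_deriv y r)^2 + 5 / 2 / r^2 * (circ (%z. (y z)^2) r - (circ y r)\<^sup>2) <= circ (grad2 y) r"
proof -
 define A where "A tt = cos tt * dx y (of_real r * cis tt) + sin tt * dy y (of_real r * cis tt)" for tt
 define B where "B tt = cos tt * dy y (of_real r * cis tt) - sin tt * dx y (of_real r * cis tt)" for tt
 have cA: "continuous_on S A" and cB: "continuous_on S B" for S
  unfolding A_def[abs_def] B_def[abs_def]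
  by (intro continuous_intros circ_integrand_cont C1_cont_dx C1_cont_dy y)+
 have G: "grad2 y (of_real r * cis tt) = (A tt)^2 + (B tt)^2" for tt
 proof -
  have rot: "(c * X + d * Y)^2 + (c * Y - d * X)^2 = (d^2 + c^2) * (X^2 + Y^2)" for c d X Y :: real
   by (simp add: sqr algebra_simps)
  have "(A tt)^2 + (B tt)^2 = ((sin tt)^2 + (cos tt)^2) * grad2 y (of_real r * cis tt)"
   unfolding A_def B_def grad2_def by (rule rot)
  then show ?thesis by simp
 qed
 have iA: "(%tt. (A tt)^2) integrable_on {0..2 * pi}" and iB: "(%tt. (B tt)^2) integrable_on {0..2 * pi}"
  by (intro icont continuous_intros cA cB)+
 have 1: "2 * pi * circ (grad2 y) r = integral {0..2 * pi} (%tt. (A tt)^2) + integral {0..2 * pi} (%tt. (B tt)^2)"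
  unfolding circ_def G using HK_add[OF iA iB] by simp
 have "(2 * pi * circ_deriv y r)^2 <= 2 * pi * integral {0..2 * pi} (%tt. (A tt)^2)"
 proof -
  have "circ_deriv y r = integral {0..2 * pi} A / (2 * pi)" by (simp add: circ_deriv_def A_def[abs_def])
  then show ?thesis using Jensen_square_integral[OF cA, of 0 "2 * pi"] by simp
 qed
 then have "2 * pi * (2 * pi * (circ_deriv y r)^2) <= 2 * pi * integral {0..2 * pi} (%tt. (A tt)^2)"
  by (simp add: sqr mult_ac)
 then have 2: "2 * pi * (circ_deriv y r)^2 <= integral {0..2 * pi} (%tt. (A tt)^2)"
  by (subst (asm) mult_le_cancel_left_pos) auto
 have "5 / 2 * (integral {0..2 * pi} (%tt. (y (of_real r * cis tt))^2) - (integral {0..2 * pi} (%tt. y (of_real r * cis tt)))\<^sup>2 / (2 * pi))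
  <= integral {0..2 * pi} (%tt. (r * B tt)^2)"
 proof (rule wirtinger_pi)
  show "((%tt. y (of_real r * cis tt)) has_real_derivative r * B tt) (at tt)" for tt
   unfolding B_def by (rule polar_derivs(2)[OF y])
  show "cont (%tt. r * B tt)" by (intro continuous_intros cB)
  show "y (of_real r * cis (tt + pi)) = y (of_real r * cis tt)" for tt
   using even[of "of_real r * cis tt"] by (simp add: cis_mult[symmetric])
 qed
 also have "(%tt. (r * B tt)^2) = (%tt. r^2 * (B tt)^2)" by (simp add: power_mult_distrib)
 also have "integral {0..2 * pi} (%tt. r^2 * (B tt)^2) = r^2 * integral {0..2 * pi} (%tt. (B tt)^2)" by simp
 also have "integral {0..2 * pi} (%tt. (y (of_real r * cis tt))^2) - (integral {0..2 * pi} (%tt. y (of_real r * cis tt)))\<^sup>2 / (2 * pi)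
  = 2 * pi * (circ (%z. (y z)^2) r - (circ y r)\<^sup>2)"
  unfolding circ_def by (simp add: field_simps sqr)
 finally have "2 * pi * (5 / 2 / r^2 * (circ (%z. (y z)^2) r - (circ y r)\<^sup>2)) <= integral {0..2 * pi} (%tt. (B tt)^2)"
  using r by (simp add: field_simps)
 with 1 2 have "2 * pi * ((circ_deriv y r)^2 + 5 / 2 / r^2 * (circ (%z. (y z)^2) r - (circ y r)\<^sup>2)) <= 2 * pi * circ (grad2 y) r"
  by (simp add: distrib_left)
 then show ?thesis by (subst (asm) mult_le_cancel_left_pos) auto
qed

lemma circ_Jensen:
 assumes "cont y"
 shows "(circ y r)^2 <= circ (%z. (y z)^2) r"
proof -
 have "(2 * pi * circ y r)^2 <= 2 * pi * (2 * pi * circ (%z. (y z)^2) r)"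
  using Jensen_square_integral[OF circ_integrand_cont[OF assms], of 0 "2 * pi" r] by (simp add: circ_def)
 then have "(2 * pi) * (2 * pi) * (circ y r)^2 <= (2 * pi) * (2 * pi) * circ (%z. (y z)^2) r"
  by (simp add: sqr mult_ac)
 then show ?thesis by (subst (asm) mult_le_cancel_left_pos) auto
qed

text \<open>The square is split into circle mean and variance. The means obey the radial gap; the
  variance is absorbed by the angular derivative, because \<open>4 s r^2 <= (s + r^2)^2\<close>
  bounds the weight by \<open>5/2 / r\<close>.\<close>

lemma annulus_gap:
 assumes y: "C1 y" and even: "!!z. y (- z) = y z"
  and s: "s > 0" and al: "0 < al" "al <= sqrt (s / 3)" and be: "sqrt (3 * s) <= be"
  and z: "circ y (sqrt (s / 3)) = 0" "circ y (sqrt (3 * s)) = 0"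
 shows "5 / 4 * integral {al..be} (%r. r * circ (%z. 8 * s / (s + (norm z)^2)^2 * (y z)^2) r) <= integral {al..be} (%r. r * circ (grad2 y) r)"
proof -
 note cy = C1_cont[OF y] and cd = circ_has_deriv[OF y]
 have cy2: "cont (%z. (y z)^2)" by (intro continuous_intros cy)
 have sub: "continuous_on S f" if "cont f" for S and f :: "real => real"
  using that by (rule continuous_on_subset) simp
 define V where "V r = circ (%z. (y z)^2) r - (circ y r)\<^sup>2" for r
 have ne: "s + r^2 > 0" for r using s by (simp add: add_pos_nonneg)
 let ?W = "%r. 10 * s * r / (s + r^2)^2"
 have cW: "continuous_on S ?W" for S by (intro continuous_intros) (use ne in \<open>auto simp: less_imp_neq[symmetric]\<close>)
 have cV: "continuous_on S V" for S unfolding V_def[abs_def]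
  by (intro continuous_intros sub[OF continuous_circ] cy cy2)
 have lhs: "5 / 4 * (r * circ (%z. 8 * s / (s + (norm z)^2)^2 * (y z)^2) r) = ?W r * (circ y r)^2 + ?W r * V r" if "r >= 0" for r
 proof -
  have "circ (%z. 8 * s / (s + (norm z)^2)^2 * (y z)^2) r = 8 * s / (s + r^2)^2 * circ (%z. (y z)^2) r"
   using that by (simp add: circ_def norm_mult)
  then show ?thesis by (simp add: V_def right_diff_distrib)
 qed
 have i1: "(%r. ?W r * (circ y r)^2) integrable_on {al..be}" "(%r. r * (circ_deriv y r)^2) integrable_on {al..be}"
  by (intro icont continuous_intros cW sub[OF continuous_circ[OF cy]] sub[OF cd(2)])+
 have i2: "(%r. ?W r * V r) integrable_on {al..be}"
  by (intro icont continuous_intros cW cV)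
 have i3: "(%r. r * circ (grad2 y) r) integrable_on {al..be}"
  by (intro icont continuous_intros sub[OF continuous_circ[OF continuous_grad2[OF y]]])
 have "5 / 4 * integral {al..be} (%r. r * circ (%z. 8 * s / (s + (norm z)^2)^2 * (y z)^2) r) =
  integral {al..be} (%r. 5 / 4 * (r * circ (%z. 8 * s / (s + (norm z)^2)^2 * (y z)^2) r))" by simp
 also have "... = integral {al..be} (%r. ?W r * (circ y r)^2 + ?W r * V r)"
  by (rule integral_cong) (use lhs al in auto)
 also have "... = integral {al..be} (%r. ?W r * (circ y r)^2) + integral {al..be} (%r. ?W r * V r)"
  by (rule HK_add[OF i1(1) i2])
 also have "... <= integral {al..be} (%r. r * (circ_deriv y r)^2) + integral {al..be} (%r. ?W r * V r)"
  using radial_gap[OF s al be cd z] by simp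
 also have "... = integral {al..be} (%r. r * (circ_deriv y r)^2 + ?W r * V r)"
  by (rule HK_add[OF i1(2) i2, symmetric])
 also have "... <= integral {al..be} (%r. r * circ (grad2 y) r)"
 proof (rule integral_le)
  fix r assume "r : {al..be}"
  then have r: "r > 0" using al by auto
  have "4 * s * r^2 <= (s + r^2)^2" using zero_le_power2[of "s - r\<^sup>2"] by (simp add: power2_sum power2_diff)
  moreover have "10 * s * r * r^2 = r * (5 / 2 * (4 * s * r^2))" by (simp add: sqr)
  ultimately have "10 * s * r * r^2 <= r * (5 / 2 * (s + r^2)^2)" using r by simp
  then have "?W r <= r * (5 / 2) / r^2" using r ne[of r] by (intro frac_leI zero_less_power) (auto simp: mult_ac)
  then have "?W r * V r <= r * (5 / 2) / r^2 * V r"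
   by (rule mult_right_mono) (use circ_Jensen[OF cy] in \<open>simp add: V_def\<close>)
  also have "... = r * (5 / 2 / r^2 * V r)" by simp
  finally have "r * (circ_deriv y r)^2 + ?W r * V r <= r * ((circ_deriv y r)^2 + 5 / 2 / r^2 * V r)" by (simp add: distrib_left)
  also have "... <= r * circ (grad2 y) r"
   using circ_grad2_lower[OF y even r] r by (intro mult_left_mono) (auto simp: V_def)
  finally show "r * (circ_deriv y r)^2 + ?W r * V r <= r * circ (grad2 y) r" .
 qed (use integrable_add[OF i1(2) i2] i3 in auto)
 finally show ?thesis .
qed

text \<open>The circle mean starts from 0 at radius \<open>a\<close>, and its square grows at most
  like \<open>ln (r/a)\<close> times the energy in between; the variance on the circle is bounded by
  the energy density there.\<close>

lemma circ_square_bound: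
 assumes y: "C1 y" and even: "!!z. y (- z) = y z"
  and a: "0 < a" "circ y a = 0" and r: "a <= r"
 shows "circ (%z. (y z)^2) r <= ln (r / a) * integral {a..r} (%r. r * circ (grad2 y) r) + 2 / 5 * r^2 * circ (grad2 y) r"
proof -
 note cy = C1_cont[OF y] and cd = circ_has_deriv[OF y]
 define H where "H = circ y r"
 define J where "J = integral {a..r} (%r. r * circ (grad2 y) r)"
 have r0: "r > 0" using a r by simp
 have sub: "continuous_on S f" if "cont f" for S and f :: "real => real"
  using that by (rule continuous_on_subset) simp
 have i: "(%r. r * circ (grad2 y) r) integrable_on {a..r}"
  by (intro icont continuous_intros sub[OF continuous_circ[OF continuous_grad2[OF y]]])
 \<comment> \<open>Cauchy-Schwarz against \<open>1/t\<close> in linearised form: the bound holds for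
   every \<open>k\<close> and is used at the optimal \<open>k = H / ln (r/a)\<close>.\<close>
 have k: "2 * k * H - k\<^sup>2 * ln (r / a) <= J" for k
 proof -
  have hi: "((%t. 2 * k * circ_deriv y t - k\<^sup>2 * inverse t) has_integral (2 * k * circ y r - k\<^sup>2 * ln r) - (2 * k * circ y a - k\<^sup>2 * ln a)) {a..r}"
  proof (rule fundamental_theorem_of_calculus[OF r])
   fix t assume "t : {a..r}"
   then have "t > 0" using a by simp
   then have "((%t. 2 * k * circ y t - k\<^sup>2 * ln t) has_real_derivative 2 * k * circ_deriv y t - k\<^sup>2 * inverse t) (at t)"
    by (auto intro!: derivative_eq_intros cd(1) simp: divide_inverse)
   then show "((%t. 2 * k * circ y t - k\<^sup>2 * ln t) has_vector_derivative 2 * k * circ_deriv y t - k\<^sup>2 * inverse t) (at t within {a..r})"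
    by (simp add: has_real_derivative_iff_has_vector_derivative has_vector_derivative_at_within)
  qed
  have "(2 * k * circ y r - k\<^sup>2 * ln r) - (2 * k * circ y a - k\<^sup>2 * ln a) <= J"
   unfolding J_def
  proof (rule has_integral_le[OF hi integrable_integral[OF i]])
   fix t assume "t : {a..r}"
   then have t: "t > 0" using a by simp
   have "0 <= (t * circ_deriv y t - k)^2 / t" using t by simp
   also have "... = t * (circ_deriv y t)^2 - (2 * k * circ_deriv y t - k\<^sup>2 * inverse t)"
    using t by (simp add: field_simps sqr)
   finally have "2 * k * circ_deriv y t - k\<^sup>2 * inverse t <= t * (circ_deriv y t)^2" by simp
   also have "... <= t * circ (grad2 y) t"
   proof -
    have "0 <= 5 / 2 / t^2 * (circ (%z. (y z)^2) t - (circ y t)\<^sup>2)"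
     using circ_Jensen[OF cy, of t] by simp
    then show ?thesis using circ_grad2_lower[OF y even t] t by (intro mult_left_mono) auto
   qed
   finally show "2 * k * circ_deriv y t - k\<^sup>2 * inverse t <= t * circ (grad2 y) t" .
  qed
  then show ?thesis using a r0 by (simp add: H_def ln_div algebra_simps)
 qed
 have l0: "ln (r / a) >= 0" using a r by simp
 have "H^2 <= ln (r / a) * J"
 proof (cases "ln (r / a) = 0")
  case True
  then have "r / a = 1" using a r0 by (simp add: ln_eq_zero_iff)
  then show ?thesis using a True by (simp add: H_def)
 next
  case False
  then have l: "ln (r / a) > 0" using l0 by simp
  have "ln (r / a) * (2 * (H / ln (r / a)) * H - (H / ln (r / a))\<^sup>2 * ln (r / a)) <= ln (r / a) * J"
   by (rule mult_left_mono[OF k l0])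
  also have "ln (r / a) * (2 * (H / ln (r / a)) * H - (H / ln (r / a))\<^sup>2 * ln (r / a)) = H^2"
   using l by (simp add: sqr algebra_simps)
  finally show ?thesis .
 qed
 moreover have "circ (%z. (y z)^2) r <= H^2 + 2 / 5 * r^2 * circ (grad2 y) r"
 proof -
  have "5 / 2 / r^2 * (circ (%z. (y z)^2) r - H\<^sup>2) <= circ (grad2 y) r"
   using circ_grad2_lower[OF y even r0] zero_le_power2[of "circ_deriv y r"] unfolding H_def by linarith
  then show ?thesis using r0 by (simp add: field_simps)
 qed
 ultimately show ?thesis unfolding J_def by linarith
qed

section \<open>The weight function\<close>

locale weight = torus +
 fixes P :: "complex => real" and kp :: real
 assumes P_per: "Per P" and P_even: "P (- z) = P z" and P_nonneg: "0 <= P z"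
  and P_eq_0: "P z = 0 \<longleftrightarrow> z : L" and P_C2: "C2 P" and S_C2: "C2 (lap P)"
  and P_grad: "(dx P z)^2 + (dy P z)^2 = P z * (lap P z + kp * P z)"
  and S_0: "lap P 0 = 4" and lapS_0: "lap (lap P) 0 = - 16 * kp" and kappa: "kp = 4 * pi / area"
  and P_near: "EX C>0. ALL z. norm z <= 1 --> abs (P z - (norm z)\<^sup>2) <= C * (norm z) ^ 4"
begin

abbreviation S :: "complex => real" where "S \<equiv> lap P"

lemma kappa_pos: "kp > 0" using kappa area_pos by simp
lemma kappa_area: "kp * area = 4 * pi" using kappa area_pos by simp
lemma P_cont: "cont P" by (rule C2_cont[OF P_C2])
lemma S_cont: "cont S" by (rule C2_cont[OF S_C2])
lemma S_per: "Per S" by (rule C2_periodic[OF P_C2 P_per])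
lemma S_even: "S (- z) = S z" by (rule C2_even[OF P_C2 P_even])

text \<open>The tolerance 1/40 is what later yields the factor 10/9 between the true and the flat
  bubble. Discs of radius \<open>R\<close> about lattice points are disjoint because
  \<open>P\<close> vanishes on the lattice while it stays close to \<open>|z|^2\<close> up to radius
  \<open>2 R\<close>.\<close>

lemma exists_radius:
 "EX R>0. R <= 1 / 2 & (ALL z. norm z <= R --> abs (P z - (norm z)\<^sup>2) <= (norm z)^2 / 40) &
  (ALL l:L. norm l <= 2 * R --> l = 0)"
proof -
 obtain C where C: "C > 0" "!!z. norm z <= 1 ==> abs (P z - (norm z)\<^sup>2) <= C * (norm z) ^ 4" using P_near by blast
 define R where "R = min (1 / 2) (1 / sqrt (40 * C))"
 have R: "R > 0" "R <= 1 / 2" using C by (auto simp: R_def)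
 have RC: "C * R^2 <= 1 / 40"
 proof -
  have "R^2 <= (1 / sqrt (40 * C))^2" using R by (intro power_mono) (auto simp: R_def)
  also have "... = 1 / (40 * C)" using C by (simp add: power_divide)
  finally show ?thesis using C by (simp add: field_simps)
 qed
 have 1: "abs (P z - (norm z)\<^sup>2) <= (C * r^2) * (norm z)^2" if "norm z <= r" "r <= 1" for z r
 proof -
  have "abs (P z - (norm z)\<^sup>2) <= C * (norm z) ^ 4" using C(2)[of z] that by simp
  also have "... = (C * (norm z)^2) * (norm z)^2" by (simp add: sqr power4_eq_xxxx)
  also have "... <= (C * r^2) * (norm z)^2"
   using C(1) that by (intro mult_right_mono mult_left_mono power_mono) auto
  finally show ?thesis .
 qed
 show ?thesis
 proof (intro exI[of _ R] conjI allI impI ballI)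
  fix z :: complex assume "norm z <= R"
  then have "abs (P z - (norm z)\<^sup>2) <= (C * R^2) * (norm z)^2" using 1[of z R] R by simp
  also have "... <= (1 / 40) * (norm z)^2" using RC by (intro mult_right_mono) auto
  finally show "abs (P z - (norm z)\<^sup>2) <= (norm z)^2 / 40" by simp
 next
  fix l assume l: "l : L" "norm l <= 2 * R"
  then have "(norm l)^2 <= (C * (2 * R)^2) * (norm l)^2" using 1[of l "2 * R"] R P_eq_0[of l] by simp
  also have "... <= (1 / 10) * (norm l)^2" using RC by (intro mult_right_mono) (auto simp: power_mult_distrib)
  finally have "(norm l)^2 <= 0" by simp
  then show "l = 0" by simp
 qed (use R in auto)
qed

definition R :: real where
 "R = (SOME R. R > 0 & R <= 1 / 2 & (ALL z. norm z <= R --> abs (P z - (norm z)\<^sup>2) <= (norm z)^2 / 40) &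
  (ALL l:L. norm l <= 2 * R --> l = 0))"

lemma R_props: "R > 0" "R <= 1 / 2" "!!z. norm z <= R ==> abs (P z - (norm z)\<^sup>2) <= (norm z)^2 / 40"
 "!!l. l : L ==> norm l <= 2 * R ==> l = 0"
 using someI_ex[OF exists_radius, folded R_def] by blast+

lemma P_lower_near: "norm z <= R ==> 39 / 40 * (norm z)^2 <= P z"
 using R_props(3)[of z] by linarith

text \<open>By periodicity the infimum runs over a compact set without lattice points, and
  \<open>P\<close> is positive there.\<close>

lemma P_away:
 obtains p0 where "p0 > 0" "p0 <= 1" "!!z. (!!l. l : L ==> R <= norm (z - l)) ==> p0 <= P z"
proof -
 define K where "K = cball 0 (norm o1 + norm o2) \<inter> (\<Inter>l\<in>L. {z. R <= norm (z - l)})"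
 have "closed {z. R <= norm (z - l)}" for l :: complex
  by (intro closed_Collect_le continuous_intros)
 then have K: "compact K" unfolding K_def by (intro compact_Int_closed closed_INT) auto
 have red: "EX w:K. P z = P w" if z: "!!l. l : L ==> R <= norm (z - l)" for z
 proof -
  obtain l where l: "l : L" "z - l : D" using ex_lattice_shift by blast
  have "R <= norm (z - l - m)" if "m : L" for m
   using z[OF L_add[OF l(1) that]] by (simp add: algebra_simps)
  then have "z - l : K" unfolding K_def using norm_D[OF l(2)] by auto
  then show ?thesis using Per_diff[OF P_per l(1)] by metis
 qed
 show ?thesis
 proof (cases "K = {}")
  case True
  then show ?thesis using that[of 1] red by fastforce
 next
  case False
  obtain w where w: "w : K" "!!z. z : K ==> P w <= P z"
   using continuous_attains_inf[OF K False continuous_on_subset[OF P_cont]] by blast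
  have "P w > 0"
  proof -
   have "w \<notin> L" using w(1) R_props(1) by (auto simp: K_def dest!: bspec[of _ _ w])
   then show ?thesis using P_eq_0[of w] P_nonneg[of w] by simp
  qed
  then show ?thesis using that[of "min 1 (P w)"] red w(2) by (metis min.coboundedI2 min.cobounded1 min_less_iff_conj zero_less_one)
 qed
qed

text \<open>Near the lattice \<open>P\<close> is comparable with the squared distance to it,
  elsewhere it is bounded below; so a quadratic bound at the origin spreads over the whole
  torus.\<close>

lemma P_dominates:
 fixes f :: "complex => real"
 assumes f: "cont f" "Per f" and near: "!!z. norm z <= R ==> abs (f z) <= e + C * (norm z)^2" and C: "C >= 0" and e: "e >= 0"
 obtains C' where "C' > 0" "!!z. abs (f z) <= e + C' * P z"
proof -
 obtain p0 where p0: "p0 > 0" "p0 <= 1" "!!z. (!!l. l : L ==> R <= norm (z - l)) ==> p0 <= P z"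
  using P_away by blast
 obtain B where B: "B > 0" "!!z. abs (f z) <= B" using Per_compact_bounded[OF f] by blast
 show ?thesis
 proof (rule that[of "2 * C + B / p0"])
  show "2 * C + B / p0 > 0" using C B p0 by (simp add: add_nonneg_pos)
  fix z
  have P0: "0 <= P z" by (rule P_nonneg)
  show "abs (f z) <= e + (2 * C + B / p0) * P z"
  proof (cases "EX l:L. norm (z - l) < R")
   case True
   then obtain l where l: "l : L" "norm (z - l) <= R" by force
   have "abs (f z) <= e + C * (norm (z - l))^2" using near[OF l(2)] Per_diff[OF f(2) l(1), of z] by simp
   also have "... <= e + C * (2 * P z)"
   proof -
    have "39 / 40 * (norm (z - l))^2 <= P z"
     using P_lower_near[OF l(2)] Per_diff[OF P_per l(1), of z] by simp
    moreover have "0 <= (norm (z - l))^2" by simp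
    ultimately have "(norm (z - l))^2 <= 2 * P z" by linarith
    then show ?thesis using C by (intro add_left_mono mult_left_mono) auto
   qed
   also have "... <= e + (2 * C + B / p0) * P z"
    using P0 B p0 by (simp add: algebra_simps)
   finally show ?thesis .
  next
   case False
   then have "p0 <= P z" by (intro p0(3)) force
   then have "B <= B / p0 * P z" using B p0 by (simp add: field_simps)
   moreover have "0 <= 2 * C * P z" using C P0 by simp
   ultimately have "B <= e + (2 * C + B / p0) * P z" using e by (simp add: distrib_right)
   then show ?thesis using B(2)[of z] by linarith
  qed
 qed
qed

lemma S_near: obtains C where "C > 0" "!!z. abs (4 - S z) <= C * P z"
proof -
 obtain C where C: "C > 0" "!!z. norm z <= 1 ==> abs (S z - S 0) <= C * (norm z)^2"
  using C2_even_taylor[OF S_C2 S_even] by blast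
 have n: "abs (4 - S z) <= 0 + C * (norm z)^2" if "norm z <= R" for z
  using C(2)[of z] that R_props(2) S_0 by (simp add: abs_minus_commute)
 have c: "cont (%z. 4 - S z)" "Per (%z. 4 - S z)"
  using S_per by (auto simp: Per_def intro!: continuous_intros S_cont)
 obtain C' where "C' > 0" "!!z. abs (4 - S z) <= 0 + C' * P z"
  by (rule P_dominates[OF c n]) (use C(1) in auto)
 then show ?thesis using that by simp
qed

text \<open>For \<open>lap S\<close> continuity is the only regularity at hand, so its value at the
  lattice is met up to a tolerance \<open>e\<close>, and the rest is absorbed by
  \<open>P\<close>.\<close>

lemma lapS_near:
 assumes "e > 0"
 obtains C where "C > 0" "!!z. abs (lap S z + 16 * kp) <= e + C * P z"
proof -
 define f where "f z = lap S z + 16 * kp" for z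
 have c: "cont f" unfolding f_def[abs_def] by (intro continuous_intros C2_cont_lap S_C2)
 have p: "Per f" unfolding f_def[abs_def] using C2_periodic[OF S_C2 S_per] by (auto simp: Per_def)
 obtain B where B: "B > 0" "!!z. abs (f z) <= B" using Per_compact_bounded[OF c p] by blast
 obtain d where d: "d > 0" "!!z. dist z 0 < d ==> dist (f z) (f 0) < e"
  using c[unfolded continuous_on_iff, rule_format, of 0 e] assms by auto
 have f0: "f 0 = 0" by (simp add: f_def lapS_0)
 have n: "abs (f z) <= e + B / d^2 * (norm z)^2" for z
 proof (cases "norm z < d")
  case True
  then have "abs (f z) <= e" using d(2)[of z] f0 by (simp add: dist_norm)
  moreover have "0 <= B / d^2 * (norm z)^2" using B by simp
  ultimately show ?thesis by linarith
 next
  case False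
  then have "d^2 <= (norm z)^2" using d(1) by (intro power_mono) auto
  then have "B <= B / d^2 * (norm z)^2" using B d by (simp add: field_simps)
  then show ?thesis using B(2)[of z] assms by linarith
 qed
 obtain C' where "C' > 0" "!!z. abs (f z) <= e + C' * P z"
  using P_dominates[of f e "B / d^2", OF c p n] B assms by auto
 then show ?thesis using that by (simp add: f_def)
qed

lemma spos: "s > 0 ==> s + P z > 0"
 using P_nonneg[of z] by simp

text \<open>The gradient of \<open>P\<close> enters only through its square, which the weight
  identity expresses by \<open>P\<close> and \<open>S\<close>.\<close>

lemma lap_comp_P:
 assumes "!!z. (ph has_real_derivative ph' (P z)) (at (P z))"
  and "!!z. (ph' has_real_derivative ph'' (P z)) (at (P z))" and "continuous_on {0..} ph''"
 shows "C2 (%z. ph (P z))" "lap (%z. ph (P z)) z = ph' (P z) * S z + ph'' (P z) * (P z * (S z + kp * P z))"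
proof -
 have "continuous_on (range P) ph''" using assms(3) by (rule continuous_on_subset) (auto simp: P_nonneg)
 note c = C2_compose[OF P_C2 assms(1,2) this]
 show "C2 (%z. ph (P z))" by (rule c)
 show "lap (%z. ph (P z)) z = ph' (P z) * S z + ph'' (P z) * (P z * (S z + kp * P z))"
  unfolding c(2) P_grad ..
qed

lemma ln_P:
 assumes s: "s > 0"
 shows "C2 (%z. ln (s + P z))" "lap (%z. ln (s + P z)) z = (s * S z - kp * (P z)^2) / (s + P z)^2"
proof -
 have 1: "((%p. ln (s + p)) has_real_derivative inverse (s + P z)) (at (P z))"
  "((%p. inverse (s + p)) has_real_derivative - inverse ((s + P z)^2)) (at (P z))" for z
  using spos[OF s, of z] by (auto intro!: derivative_eq_intros simp: divide_inverse sqr)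
 have 2: "continuous_on {0..} (%p. - inverse ((s + p)^2))"
  by (intro continuous_intros) (use s in \<open>auto simp: add_pos_nonneg less_imp_neq[symmetric]\<close>)
 note l = lap_comp_P[OF 1 2]
 show "C2 (%z. ln (s + P z))" by (rule l)
 define a where "a = inverse (s + P z)"
 have a: "(s + P z) * a = 1" using spos[OF s, of z] by (simp add: a_def)
 have "lap (%z. ln (s + P z)) z = a * S z - a\<^sup>2 * (P z * (S z + kp * P z))"
  unfolding l(2) a_def by (simp add: power_inverse)
 also have "a * S z = ((s + P z) * a) * a * S z" unfolding a by simp
 also have "((s + P z) * a) * a * S z - a\<^sup>2 * (P z * (S z + kp * P z)) = (s * S z - kp * (P z)^2) * a^2"
  by (simp add: sqr algebra_simps)
 also have "... = (s * S z - kp * (P z)^2) / (s + P z)^2"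
  by (simp add: a_def divide_inverse power_inverse)
 finally show "lap (%z. ln (s + P z)) z = (s * S z - kp * (P z)^2) / (s + P z)^2" .
qed

lemma inv_P:
 assumes s: "s > 0"
 shows "C2 (%z. inverse (s + P z))"
  "lap (%z. inverse (s + P z)) z = (S z * (P z - s) + 2 * kp * (P z)^2) / (s + P z) ^ 3"
proof -
 have 1: "((%p. inverse (s + p)) has_real_derivative - inverse ((s + P z)^2)) (at (P z))"
  "((%p. - inverse ((s + p)^2)) has_real_derivative 2 * inverse ((s + P z) ^ 3)) (at (P z))" for z
  using spos[OF s, of z] by (auto intro!: derivative_eq_intros simp: divide_inverse sqr power3_eq_cube)
 have 2: "continuous_on {0..} (%p. 2 * inverse ((s + p) ^ 3))"
  by (intro continuous_intros) (use s in \<open>auto simp: add_pos_nonneg less_imp_neq[symmetric]\<close>)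
 note l = lap_comp_P[OF 1 2]
 show "C2 (%z. inverse (s + P z))" by (rule l)
 define a where "a = inverse (s + P z)"
 have a: "(s + P z) * a = 1" using spos[OF s, of z] by (simp add: a_def)
 have "lap (%z. inverse (s + P z)) z = - a\<^sup>2 * S z + 2 * a ^ 3 * (P z * (S z + kp * P z))"
  unfolding l(2) a_def by (simp add: power_inverse)
 also have "- a\<^sup>2 * S z = - ((s + P z) * a) * a^2 * S z" unfolding a by simp
 also have "- ((s + P z) * a) * a^2 * S z + 2 * a ^ 3 * (P z * (S z + kp * P z)) = (S z * (P z - s) + 2 * kp * (P z)^2) * a ^ 3"
  by (simp add: sqr power3_eq_cube algebra_simps)
 also have "... = (S z * (P z - s) + 2 * kp * (P z)^2) / (s + P z) ^ 3"
  by (simp add: a_def divide_inverse power_inverse)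
 finally show "lap (%z. inverse (s + P z)) z = (S z * (P z - s) + 2 * kp * (P z)^2) / (s + P z) ^ 3" .
qed

lemma Per_comp_P: "Per (%z. ph (P z))"
 using P_per by (simp add: Per_def)

lemma cont_inv_pow:
 assumes "s > 0"
 shows "cont (%z. inverse ((s + P z) ^ n))" "cont (%z. inverse (s + P z))"
 using spos[OF assms] by (auto intro!: continuous_intros P_cont simp: less_imp_neq[symmetric])

lemma cont_div_pow:
 assumes "s > 0" "cont f"
 shows "cont (%z. f z / (s + P z) ^ n)" "cont (%z. f z / (s + P z))"
 using spos[OF assms(1)] by (auto intro!: continuous_intros P_cont assms(2) simp: less_imp_neq[symmetric])

lemma identity_ln:
 assumes "s > 0"
 shows "(\<integral>z. s * S z / (s + P z)^2) = kp * (\<integral>z. (P z)^2 / (s + P z)^2)"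
proof -
 have "(\<integral>z. lap (%z. ln (s + P z)) z) = 0"
  by (rule integral_lap_0[OF ln_P(1)[OF assms] Per_comp_P])
 then have "(\<integral>z. s * S z / (s + P z)^2 - kp * ((P z)^2 / (s + P z)^2)) = 0"
  unfolding ln_P(2)[OF assms] by (simp add: diff_divide_distrib)
 moreover have i: "integrable M (%z. s * S z / (s + P z)^2)" "integrable M (%z. (P z)^2 / (s + P z)^2)"
  by (intro int_cont cont_div_pow assms continuous_intros P_cont S_cont)+
 ultimately show ?thesis
  using Bochner_Integration.integral_diff[OF i(1) integrable_mult_right[OF i(2), of kp]]
  by (simp only: integral_mult_right_zero)
qed

lemma ratio_bounds:
 assumes "s > 0"
 shows "s / (s + P z) <= 1" "P z / (s + P z) <= 1" "0 <= s / (s + P z)" "0 <= P z / (s + P z)"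
  "s / (s + P z) + P z / (s + P z) = 1"
 using spos[OF assms, of z] P_nonneg[of z] assms by (auto simp: add_divide_distrib[symmetric])

text \<open>The Laplacian of \<open>ln (s + P)\<close> integrates to 0, which trades the
  concentrated integrand \<open>s S / (s + P)^2\<close> for the bounded
  \<open>kp P^2 / (s + P)^2\<close>. As \<open>4 - S = O(P)\<close>, \<open>S\<close> may be
  replaced by 4.\<close>

lemma I1_bound: obtains C where "C > 0" "!!s. s > 0 ==> (\<integral>z. s / (s + P z)^2) <= C"
proof -
 obtain C where C: "C > 0" "!!z. abs (4 - S z) <= C * P z" using S_near by blast
 show ?thesis
 proof (rule that[of "(kp + C) * area / 4"])
  show "(kp + C) * area / 4 > 0" using C kappa_pos area_pos by simp
  fix s :: real assume s: "s > 0"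
  have i: "integrable M (%z. s / (s + P z)^2)" "integrable M (%z. s * S z / (s + P z)^2)"
   "integrable M (%z. (P z)^2 / (s + P z)^2)"
   by (intro int_cont cont_div_pow s continuous_intros S_cont P_cont)+
  have "4 * (\<integral>z. s / (s + P z)^2) = (\<integral>z. 4 * (s / (s + P z)^2))"
   by (rule integral_mult_right_zero[symmetric])
  also have "... <= (\<integral>z. s * S z / (s + P z)^2 + C)"
  proof (rule integral_mono)
   fix z
   have sp: "s + P z > 0" by (rule spos[OF s])
   have "4 - S z <= C * P z" using C(2)[of z] by linarith
   then have "(4 - S z) * (s / (s + P z)^2) <= C * P z * (s / (s + P z)^2)"
    using s by (intro mult_right_mono) auto
   also have "... = C * ((P z / (s + P z)) * (s / (s + P z)))" by (simp add: sqr)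
   also have "... <= C * (1 * 1)"
    using C(1) ratio_bounds[OF s, of z] by (intro mult_left_mono mult_mono) auto
   finally show "4 * (s / (s + P z)^2) <= s * S z / (s + P z)^2 + C" by (simp add: algebra_simps diff_divide_distrib)
  qed (intro integrable_mult_right i Bochner_Integration.integrable_add M.integrable_const)+
  also have "... = kp * (\<integral>z. (P z)^2 / (s + P z)^2) + area * C"
   using i by (simp add: identity_ln[OF s] measure_space_M)
  also have "(\<integral>z. (P z)^2 / (s + P z)^2) <= (\<integral>z. 1)"
  proof (rule integral_mono)
   fix z
   show "(P z)^2 / (s + P z)^2 <= 1"
    using ratio_bounds(2,4)[OF s, of z] power_le_one[of "P z / (s + P z)" 2] by (simp add: power_divide)
  qed (use i in auto)
  finally show "(\<integral>z. s / (s + P z)^2) <= (kp + C) * area / 4"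
   using kappa_pos by (simp add: measure_space_M algebra_simps)
 qed
qed

lemma powr_P:
 assumes s: "s > 0"
 shows "C2 (%z. (s + P z) powr (1/8))"
  "lap (%z. (s + P z) powr (1/8)) z = (s + P z) powr (-15/8) * (1/8 * (S z * (s + P z / 8)) - 7/64 * (kp * (P z)^2))"
proof -
 have 1: "((%p. (s + p) powr (1/8)) has_real_derivative 1/8 * (s + P z) powr (-7/8)) (at (P z))"
  "((%p. 1/8 * (s + p) powr (-7/8)) has_real_derivative -7/64 * (s + P z) powr (-15/8)) (at (P z))" for z
  using spos[OF s, of z] by (auto intro!: derivative_eq_intros)
 have 2: "continuous_on {0..} (%p. -7/64 * (s + p) powr (-15/8))"
  by (intro continuous_intros) (use s in auto)
 note l = lap_comp_P[OF 1 2]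
 show "C2 (%z. (s + P z) powr (1/8))" by (rule l)
 have "(s + P z) powr (-7/8) = (s + P z) powr (-15/8 + 1)" by simp
 also have "... = (s + P z) powr (-15/8) * (s + P z)" using spos[OF s, of z] by (subst powr_add) simp
 finally show "lap (%z. (s + P z) powr (1/8)) z = (s + P z) powr (-15/8) * (1/8 * (S z * (s + P z / 8)) - 7/64 * (kp * (P z)^2))"
  unfolding l(2) by (simp add: algebra_simps sqr add_divide_distrib)
qed

text \<open>\<open>(s + P) powr (1/8)\<close> is a barrier: its Laplacian is at least
  \<open>1/16 (s + P) powr (-7/8)\<close> minus a constant, and it integrates to 0. In the limit the
  integrand is \<open>|z| powr (-7/4)\<close> near the lattice, still integrable.\<close>

lemma powr_bound: obtains C where "C > 0" "!!s. 0 < s ==> s <= 1 ==> (\<integral>z. (s + P z) powr (-7/8)) <= C"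
proof -
 obtain C where C: "C > 0" "!!z. abs (4 - S z) <= C * P z" using S_near by blast
 obtain B where B: "B > 0" "!!z. abs (P z) <= B" using Per_compact_bounded[OF P_cont P_per] by blast
 define K where "K = (7/64 * kp + C/8) * (1 + B) powr (1/8)"
 have K: "K > 0" using C kappa_pos by (simp add: K_def add_pos_pos B less_imp_neq[symmetric])
 show ?thesis
 proof (rule that[of "16 * (K * area)"])
  show "16 * (K * area) > 0" using K area_pos by simp
  fix s :: real assume s: "0 < s" "s <= 1"
  have c: "cont (%z. (s + P z) powr a)" for a
   by (intro continuous_intros P_cont) (use spos[OF s(1)] in \<open>auto simp: less_imp_neq[symmetric]\<close>)
  have i: "integrable M (%z. (s + P z) powr (-7/8))" "integrable M (lap (%z. (s + P z) powr (1/8)))"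
   by (intro int_cont c C2_cont_lap powr_P s)+
  have "(\<integral>z. 1/16 * (s + P z) powr (-7/8)) <= (\<integral>z. lap (%z. (s + P z) powr (1/8)) z + K)"
  proof (rule integral_mono)
   fix z
   define t where "t = s + P z"
   have t: "t > 0" "P z <= t" "s <= t" using spos[OF s(1), of z] P_nonneg[of z] s by (auto simp: t_def)
   have P0: "0 <= P z" by (rule P_nonneg)
   have "4 - C * P z <= S z" using C(2)[of z] by linarith
   then have "(4 - C * P z) * (s + P z / 8) <= S z * (s + P z / 8)"
    using s P0 by (intro mult_right_mono) auto
   moreover have "t / 2 <= 4 * (s + P z / 8)" using s by (simp add: t_def)
   moreover have "C * P z * (s + P z / 8) <= C * t * t"
    using C(1) P0 t s by (intro mult_mono) (auto simp: t_def)
   ultimately have 1: "t / 2 - C * t * t <= S z * (s + P z / 8)" by (simp add: left_diff_distrib)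
   have "(P z)^2 <= t^2" using t P0 by (intro power_mono) auto
   then have 2: "kp * (P z)^2 <= kp * t^2" using kappa_pos by simp
   have "1/16 * t - (C/8 + 7/64 * kp) * t^2 <= 1/8 * (S z * (s + P z / 8)) - 7/64 * (kp * (P z)^2)"
    using 1 2 by (simp add: sqr algebra_simps)
   then have "t powr (-15/8) * (1/16 * t - (C/8 + 7/64 * kp) * t^2) <= lap (%z. (s + P z) powr (1/8)) z"
    unfolding powr_P(2)[OF s(1)] t_def[symmetric] by (rule mult_left_mono) simp
   moreover have "t powr (-15/8) * t = t powr (-7/8)"
    using t powr_add[of t "-15/8" 1] by simp
   moreover have "t powr (-15/8) * t^2 = t powr (1/8)"
    using t powr_add[of t "-15/8" 2] by simp
   ultimately have "1/16 * t powr (-7/8) - (C/8 + 7/64 * kp) * t powr (1/8) <= lap (%z. (s + P z) powr (1/8)) z"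
   proof -
    assume a: "t powr (-15/8) * (1/16 * t - (C/8 + 7/64 * kp) * t^2) <= lap (%z. (s + P z) powr (1/8)) z"
     and b: "t powr (-15/8) * t = t powr (-7/8)" "t powr (-15/8) * t^2 = t powr (1/8)"
    have "X * (1/16 * t - Y * t^2) = 1/16 * (X * t) - Y * (X * t^2)" for X Y
     by (simp add: algebra_simps)
    then show ?thesis using a unfolding b[symmetric] by simp
   qed
   moreover have "(C/8 + 7/64 * kp) * t powr (1/8) <= K"
   proof -
    have "t <= 1 + B" using s B(2)[of z] by (simp add: t_def)
    then have "t powr (1/8) <= (1 + B) powr (1/8)" using t by (intro powr_mono2) auto
    then show ?thesis unfolding K_def using C kappa_pos by (simp add: add.commute)
   qed
   ultimately show "1/16 * (s + P z) powr (-7/8) <= lap (%z. (s + P z) powr (1/8)) z + K"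
    unfolding t_def by linarith
  qed (use i in auto)
  also have "... = area * K"
   using i integral_lap_0[OF powr_P(1)[OF s(1)] Per_comp_P] by (simp add: measure_space_M)
  finally show "(\<integral>z. (s + P z) powr (-7/8)) <= 16 * (K * area)" by (simp add: mult.commute)
 qed
qed

text \<open>The true size is \<open>s ln (1/s)\<close>; the exponent 7/8 swallows the
  logarithm.\<close>

lemma ratio_bound: obtains C where "C > 0" "!!s. 0 < s ==> s <= 1 ==> (\<integral>z. s / (s + P z)) <= C * s powr (7/8)"
proof -
 obtain C where C: "C > 0" "!!s. 0 < s ==> s <= 1 ==> (\<integral>z. (s + P z) powr (-7/8)) <= C"
  using powr_bound by blast
 show ?thesis
 proof (rule that[OF C(1)])
  fix s :: real assume s: "0 < s" "s <= 1"
  have c: "cont (%z. (s + P z) powr a)" for a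
   by (intro continuous_intros P_cont) (use spos[OF s(1)] in \<open>auto simp: less_imp_neq[symmetric]\<close>)
  have "(\<integral>z. s / (s + P z)) <= (\<integral>z. s powr (7/8) * (s + P z) powr (-7/8))"
  proof (rule integral_mono)
   fix z
   have r: "0 < s / (s + P z)" "s / (s + P z) <= 1" by (rule divide_pos_pos[OF s(1) spos[OF s(1)]], rule ratio_bounds(1)[OF s(1)])
   have "s / (s + P z) = (s / (s + P z)) powr 1" by (rule powr_one[OF less_imp_le[OF r(1)], symmetric])
   also have "... <= (s / (s + P z)) powr (7/8)" using r by (intro powr_mono') auto
   also have "... = s powr (7/8) * (s + P z) powr (-7/8)"
   proof -
    have "(s + P z) powr (-7/8) = inverse ((s + P z) powr (7/8))" using powr_minus[of "s + P z" "7/8"] by simp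
    then show ?thesis unfolding powr_divide by (simp only: divide_inverse)
   qed
   finally show "s / (s + P z) <= s powr (7/8) * (s + P z) powr (-7/8)" .
  qed (intro int_cont cont_div_pow continuous_intros c s)+
  also have "... = s powr (7/8) * (\<integral>z. (s + P z) powr (-7/8))" by simp
  also have "... <= s powr (7/8) * C" using C(2)[OF s] by (intro mult_left_mono) auto
  finally show "(\<integral>z. s / (s + P z)) <= C * s powr (7/8)" by (simp add: mult.commute)
 qed
qed

end

section \<open>The approximate solution\<close>

context weight
begin

definition eV :: "real => complex => real" where "eV s z = 8 * s / (s + P z)^2"
definition V :: "real => complex => real" where "V s z = ln (8 * s) - 2 * ln (s + P z)"
text \<open>The dilation mode: \<open>s\<close> times the derivative of \<open>V s\<close> with
  respect to \<open>s\<close>.\<close>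

definition Psi :: "real => complex => real" where "Psi s z = (P z - s) / (s + P z)"
text \<open>The residual \<open>lap V + eV - 2 kp\<close> of the approximate solution. Both summands
  are \<open>O(s / (s + P))\<close>, the first because \<open>4 - S = O(P)\<close>.\<close>

definition err :: "real => complex => real" where
 "err s z = 2 * s * (4 - S z) / (s + P z)^2 + 2 * kp * ((P z)^2 / (s + P z)^2 - 1)"
text \<open>The residual of the dilation mode in the linearised equation; it would be 0 for the flat
  bubble, \<open>P = |z|^2\<close> and \<open>kp = 0\<close>.\<close>

definition LPsi :: "real => complex => real" where "LPsi s z = lap (Psi s) z + eV s z * Psi s z"
definition mass :: "real => real" where "mass s = (\<integral>z. eV s z)"

lemma V_C2: assumes "s > 0" shows "C2 (V s)" "lap (V s) z = 2 * kp + err s z - eV s z"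
proof -
 note c = C2_sub[OF C2_const(1)[of "ln (8 * s)"] C2_cmult(1)[OF ln_P(1)[OF assms], of 2]]
 show "C2 (V s)" unfolding V_def[abs_def] by (rule c)
 have "lap (V s) z = - 2 * ((s * S z - kp * (P z)^2) / (s + P z)^2)"
  unfolding V_def[abs_def] c(2) C2_cmult(2)[OF ln_P(1)[OF assms]] C2_const ln_P(2)[OF assms]
 proof -
  have "0 - 2 * Y = - 2 * Y" for Y :: real by simp
  then show "0 - 2 * ((s * S z - kp * (P z)^2) / (s + P z)^2) = - 2 * ((s * S z - kp * (P z)^2) / (s + P z)^2)" .
 qed
 then show "lap (V s) z = 2 * kp + err s z - eV s z"
  unfolding err_def eV_def divide_inverse by (simp add: algebra_simps)
qed

lemma exp_V: "s > 0 ==> exp (V s z) = eV s z"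
 using spos[of s z] unfolding V_def eV_def exp_diff by (simp add: exp_double)

lemma eV_pos: "s > 0 ==> eV s z > 0"
 using spos[of s z] unfolding eV_def by simp

lemma eV_le: "s > 0 ==> eV s z <= 8 / s"
proof -
 assume s: "s > 0"
 have "s^2 <= (s + P z)^2" using s P_nonneg[of z] by (intro power_mono) auto
 then have "eV s z <= 8 * s / s^2" unfolding eV_def using s spos[OF s, of z] by (intro divide_left_mono mult_pos_pos) auto
 then show ?thesis using s by (simp add: sqr)
qed

lemma eV_cont: "s > 0 ==> cont (eV s)"
 unfolding eV_def[abs_def] by (intro cont_div_pow continuous_intros)

lemma eV_per: "Per (eV s)" and Psi_per: "Per (Psi s)" and V_per: "Per (V s)"
 unfolding eV_def[abs_def] Psi_def[abs_def] V_def[abs_def] by (rule Per_comp_P)+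

lemma err_per: "Per (err s)"
 using P_per S_per unfolding err_def[abs_def] by (simp add: Per_def)

lemma eV_even: "eV s (- z) = eV s z" and Psi_even: "Psi s (- z) = Psi s z" and V_even: "V s (- z) = V s z"
 and err_even: "err s (- z) = err s z"
 by (simp_all add: eV_def Psi_def V_def err_def P_even S_even)

lemma err_cont: "s > 0 ==> cont (err s)"
 unfolding err_def[abs_def] by (intro continuous_intros cont_div_pow P_cont S_cont)

lemma Psi_eq: "s > 0 ==> Psi s = (%z. 1 - 2 * s * inverse (s + P z))"
 using spos[of s] by (auto simp: Psi_def fun_eq_iff field_simps less_imp_neq[symmetric])

lemma Psi_C2: assumes "s > 0" shows "C2 (Psi s)" "lap (Psi s) z = - 2 * s * ((S z * (P z - s) + 2 * kp * (P z)^2) / (s + P z) ^ 3)"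
proof -
 note c = C2_sub[OF C2_const(1)[of 1] C2_cmult(1)[OF inv_P(1)[OF assms], of "2 * s"]]
 show "C2 (Psi s)" unfolding Psi_eq[OF assms] by (rule c)
 show "lap (Psi s) z = - 2 * s * ((S z * (P z - s) + 2 * kp * (P z)^2) / (s + P z) ^ 3)"
  unfolding Psi_eq[OF assms] c(2) C2_cmult(2)[OF inv_P(1)[OF assms]] C2_const inv_P(2)[OF assms] by simp
qed

lemma Psi_bound: "s > 0 ==> abs (Psi s z) <= 1"
 using spos[of s z] P_nonneg[of z] unfolding Psi_def by (simp add: abs_le_iff divide_le_eq le_divide_eq)

lemma LPsi_eq:
 assumes "s > 0"
 shows "LPsi s z = (2 * s * (4 - S z) * (P z - s) - 4 * kp * s * (P z)^2) / (s + P z) ^ 3"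
proof -
 have "eV s z * Psi s z = 8 * s * (P z - s) / (s + P z) ^ 3"
  unfolding eV_def Psi_def by (simp add: sqr power3_eq_cube)
 then show ?thesis
  unfolding LPsi_def Psi_C2(2)[OF assms] by (simp add: diff_divide_distrib add_divide_distrib algebra_simps)
qed

lemma LPsi_cont: "s > 0 ==> cont (LPsi s)"
 unfolding LPsi_def[abs_def] by (intro continuous_intros C2_cont_lap Psi_C2 eV_cont C2_cont)

text \<open>In terms of \<open>a = s / (s + P)\<close> and \<open>b = P / (s + P)\<close>, with
  \<open>a + b = 1\<close>, every term carries one factor \<open>a\<close> and otherwise bounded
  factors.\<close>

lemma err_LPsi_pointwise:
 obtains C where "C > 0" "!!s z. s > 0 ==> abs (err s z) <= C * (s / (s + P z))" "!!s z. s > 0 ==> abs (LPsi s z) <= C * (s / (s + P z))"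
proof -
 obtain C where C: "C > 0" "!!z. abs (4 - S z) <= C * P z" using S_near by blast
 show ?thesis
 proof (rule that[of "2 * C + 4 * kp"])
  show "2 * C + 4 * kp > 0" using C kappa_pos by simp
  fix s :: real and z assume s: "s > 0"
  define a where "a = s / (s + P z)"
  define b where "b = P z / (s + P z)"
  have ab: "0 <= a" "a <= 1" "0 <= b" "b <= 1" "a + b = 1" unfolding a_def b_def using ratio_bounds[OF s, of z] by simp_all
  have sp: "s + P z > 0" by (rule spos[OF s])
  define q where "q = (4 - S z) / (s + P z)"
  have q: "abs q <= C * b"
   unfolding q_def b_def abs_divide using C(2)[of z] sp by (simp add: divide_right_mono)
  have "C * b <= C * 1" using C(1) ab by (intro mult_left_mono) auto
  then have q': "abs q <= C" using q by simp
  have e: "err s z = 2 * (a * q) + 2 * kp * (b^2 - 1)"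
   unfolding err_def a_def q_def b_def by (simp add: sqr)
  have b2: "b^2 - 1 = - (a * (1 + b))" using ab(5) by (simp add: sqr algebra_simps)
   (metis ab(5) add.commute add_diff_cancel_left' diff_add_cancel mult.commute distrib_right mult_1)
  have aq: "abs (a * q) <= C * a" unfolding abs_mult using q' ab mult_left_mono[OF q', of a] by (simp add: mult.commute)
  have ab2: "a * (1 + b) <= 2 * a" "0 <= a * (1 + b)" using ab mult_left_mono[of "1 + b" 2 a] by auto
  have "abs (err s z) <= 2 * abs (a * q) + 2 * kp * abs (a * (1 + b))"
   unfolding e b2 by (rule order_trans[OF abs_triangle_ineq]) (use kappa_pos in \<open>simp add: abs_mult\<close>)
  also have "... <= 2 * (C * a) + 2 * kp * (2 * a)"
   using aq ab2 kappa_pos by (intro add_mono mult_left_mono) auto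
  finally show "abs (err s z) <= (2 * C + 4 * kp) * (s / (s + P z))" by (simp add: a_def[symmetric] algebra_simps)
  have l: "LPsi s z = 2 * (a * q) * Psi s z - 4 * kp * (a * b^2)"
  proof -
   define i where "i = inverse (s + P z)"
   have "LPsi s z = (2 * s * (4 - S z) * (P z - s) - 4 * kp * s * (P z)^2) * i ^ 3"
    unfolding LPsi_eq[OF s] i_def by (simp add: divide_inverse power_inverse)
   also have "... = 2 * ((s * i) * ((4 - S z) * i)) * ((P z - s) * i) - 4 * kp * ((s * i) * (P z * i)^2)"
    by (simp add: sqr power3_eq_cube algebra_simps)
   finally show ?thesis unfolding a_def q_def b_def Psi_def i_def by (simp only: divide_inverse)
  qed
  have "abs (LPsi s z) <= abs (2 * (a * q) * Psi s z) + abs (4 * kp * (a * b^2))"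
   unfolding l by (rule abs_triangle_ineq4)
  also have "abs (2 * (a * q) * Psi s z) <= 2 * (C * a) * 1"
   using aq Psi_bound[OF s, of z] C ab unfolding abs_mult[of "2 * (a * q)"] by (intro mult_mono) (auto simp: abs_mult)
  also have "abs (4 * kp * (a * b^2)) <= 4 * kp * (a * 1)"
   using ab kappa_pos power_le_one[of b 2] mult_left_mono[of "b^2" 1 a] by (simp add: abs_mult)
  finally show "abs (LPsi s z) <= (2 * C + 4 * kp) * (s / (s + P z))" by (simp add: a_def[symmetric] algebra_simps)
 qed
qed

lemma err_LPsi_norms:
 obtains C where "C > 0"
  "!!s. 0 < s ==> s <= 1 ==> (\<integral>z. abs (err s z)) <= C * s powr (7/8) & (\<integral>z. abs (LPsi s z)) <= C * s powr (7/8)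
   & (\<integral>z. (err s z)^2) <= C * s & (\<integral>z. (LPsi s z)^2) <= C * s"
proof -
 obtain C where C: "C > 0" "!!s z. s > 0 ==> abs (err s z) <= C * (s / (s + P z))" "!!s z. s > 0 ==> abs (LPsi s z) <= C * (s / (s + P z))"
  using err_LPsi_pointwise by blast
 obtain C1 where C1: "C1 > 0" "!!s. s > 0 ==> (\<integral>z. s / (s + P z)^2) <= C1" using I1_bound by blast
 obtain C2 where C2: "C2 > 0" "!!s. 0 < s ==> s <= 1 ==> (\<integral>z. s / (s + P z)) <= C2 * s powr (7/8)"
  using ratio_bound by blast
 have 1: "(\<integral>z. abs (f z)) <= C * (C2 * s powr (7/8))" "(\<integral>z. (f z)^2) <= C^2 * (s * C1)"
  if f: "cont f" "!!z. abs (f z) <= C * (s / (s + P z))" and s: "0 < s" "s <= 1" for f s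
 proof -
  have "(\<integral>z. abs (f z)) <= (\<integral>z. C * (s / (s + P z)))"
   by (intro integral_mono f int_cont continuous_intros cont_div_pow s)
  also have "... <= C * (C2 * s powr (7/8))"
   unfolding integral_mult_right_zero using C2(2)[OF s] C by (intro mult_left_mono) auto
  finally show "(\<integral>z. abs (f z)) <= C * (C2 * s powr (7/8))" .
  have "(\<integral>z. (f z)^2) <= (\<integral>z. C^2 * (s * (s / (s + P z)^2)))"
  proof (intro integral_mono int_cont continuous_on_mult continuous_on_power continuous_on_const cont_div_pow s f)
   fix z
   have "(f z)^2 <= (C * (s / (s + P z)))^2" using f(2)[of z] by (metis abs_ge_zero power2_abs power_mono)
   also have "... = C^2 * (s * (s / (s + P z)^2))" by (simp add: sqr)
   finally show "(f z)^2 <= C^2 * (s * (s / (s + P z)^2))" .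
  qed
  also have "... <= C^2 * (s * C1)"
   unfolding integral_mult_right_zero using C1(2)[OF s(1)] s by (intro mult_left_mono) auto
  finally show "(\<integral>z. (f z)^2) <= C^2 * (s * C1)" .
 qed
 show ?thesis
 proof (rule that[of "C * C2 + C^2 * C1"], goal_cases)
  case 1 then show ?case using C C1 C2 by (simp add: add_pos_pos)
 next
  case s: (2 s)
  have m: "C * (C2 * s powr (7/8)) <= (C * C2 + C^2 * C1) * s powr (7/8)" "C^2 * (s * C1) <= (C * C2 + C^2 * C1) * s"
   using C C1 C2 s by (auto simp: algebra_simps)
  show ?case
   using 1[OF err_cont[OF s(1)] C(2)[OF s(1)] s] 1[OF LPsi_cont[OF s(1)] C(3)[OF s(1)] s] m by linarith
 qed
qed

lemma mass_err: assumes "s > 0" shows "mass s = 8 * pi + (\<integral>z. err s z)"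
proof -
 have "(\<integral>z. lap (V s) z) = 0" by (rule integral_lap_0[OF V_C2(1)[OF assms] V_per])
 then have "(\<integral>z. 2 * kp + err s z - eV s z) = 0" unfolding V_C2(2)[OF assms] .
 moreover have "integrable M (err s)" "integrable M (eV s)" by (intro int_cont err_cont eV_cont assms)+
 ultimately have "area * (2 * kp) + (\<integral>z. err s z) - mass s = 0" by (simp add: measure_space_M mass_def)
 moreover have "area * (2 * kp) = 2 * (kp * area)" by simp
 ultimately show ?thesis using kappa_area by linarith
qed

end

lemma abs_integral_le: "abs (\<integral>x. f x \<partial>N) <= (\<integral>x. abs (f x) \<partial>N)" for f :: "'a => real"
 using integral_norm_bound[of N f] by simp

definition ring :: "real => real => (complex => real) => real" where
 "ring a b f = 2 * pi * integral {a..b} (%r. r * circ f r)"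

lemma ring_integrable: "cont f ==> (%r. r * circ f r) integrable_on {a..b}"
 by (intro icont continuous_intros continuous_on_subset[OF continuous_circ]) auto

lemma circ_mono:
 assumes f: "cont f" and g: "cont g" and le: "!!z. norm z = abs r ==> f z <= g z"
 shows "circ f r <= circ g r"
 unfolding circ_def
 by (intro divide_right_mono integral_le icont circ_integrand_cont f g) (auto intro!: le simp: norm_mult)

lemma circ_lincomb:
 assumes "cont f" "cont g"
 shows "circ (%z. p + a * f z + b * g z) r = p + a * circ f r + b * circ g r"
proof -
 have "((%tt. p + a * f (of_real r * cis tt) + b * g (of_real r * cis tt)) has_integral
   2 * pi * p + a * (2 * pi * circ f r) + b * (2 * pi * circ g r)) {0..2 * pi}"
  using has_integral_const_real[of p 0 "2 * pi"]
  by (intro has_integral_add has_integral_mult_right circ_has_integral assms) simp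
 from integral_unique[OF this] show ?thesis by (subst circ_def) (simp add: field_simps)
qed

lemma ring_mono:
 assumes f: "cont f" and g: "cont g" and a: "0 <= a"
  and le: "!!z. a <= norm z ==> norm z <= b ==> f z <= g z"
 shows "ring a b f <= ring a b g"
 unfolding ring_def
 by (intro mult_left_mono integral_le ring_integrable f g circ_mono le) (use a in auto)

lemma ring_nonneg: "cont f ==> (!!z. 0 <= f z) ==> 0 <= a ==> 0 <= ring a b f"
 using ring_mono[of "%_. 0" f a b] by (simp add: ring_def circ_def)

lemma ring_lin:
 assumes f: "cont f" and g: "cont g"
 shows "ring a b (%z. c * f z + d * g z) = c * ring a b f + d * ring a b g" "ring a b (%z. c * f z) = c * ring a b f"
proof -
 have i: "integral {a..b} (%r. c * (r * circ f r) + d * (r * circ g r)) = c * integral {a..b} (%r. r * circ f r) + d * integral {a..b} (%r. r * circ g r)" for d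
  by (rule integral_unique) (intro has_integral_add has_integral_mult_right integrable_integral ring_integrable f g)
 have e: "(%r. r * circ (%z. c * f z + d * g z) r) = (%r. c * (r * circ f r) + d * (r * circ g r))" for d
  using circ_lincomb[OF f g, of 0 c d] by (simp add: algebra_simps)
 have r: "ring a b (%z. c * f z + d * g z) = c * ring a b f + d * ring a b g" for d unfolding ring_def e i by (simp add: algebra_simps)
 show "ring a b (%z. c * f z + d * g z) = c * ring a b f + d * ring a b g" by (rule r)
 show "ring a b (%z. c * f z) = c * ring a b f" using r[of 0] by simp
qed

lemma nn_integral_ring:
 assumes "cont f" "!!z. 0 <= f z" "0 <= a"
 shows "(\<integral>\<^sup>+z. ennreal (f z) * indicator {z. norm z : {a..b}} z \<partial>lborel) = ennreal (ring a b f)"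
 unfolding ring_def by (rule nn_integral_annulus[OF assms])

context torus
begin

lemma integral_lin:
 fixes f g :: "complex => real"
 assumes "cont f" "cont g"
 shows "(\<integral>z. f z + c * g z) = (\<integral>z. f z) + c * (\<integral>z. g z)" "(\<integral>z. f z - c * g z) = (\<integral>z. f z) - c * (\<integral>z. g z)"
  "(\<integral>z. f z + g z) = (\<integral>z. f z) + (\<integral>z. g z)" "(\<integral>z. f z - g z) = (\<integral>z. f z) - (\<integral>z. g z)"
 using int_cont[OF assms(1)] int_cont[OF assms(2)] by simp_all

end

context weight
begin

lemma cball_measurable: "{z::complex. norm z : {a..b}} : sets borel"
proof -
 have "{z::complex. norm z : {a..b}} = {z : space borel. norm z : {a..b}}" by simp
 also have "... : sets borel" by measurable
 finally show ?thesis .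
qed

text \<open>Two points of the disc of radius \<open>R\<close> never differ by a nonzero period, so
  the annulus embeds in the torus.\<close>

lemma annulus_le_torus:
 assumes f: "cont f" "Per f" "!!z. 0 <= f z" and a: "0 <= a" "b <= R"
 shows "ring a b f <= (\<integral>z. f z)"
proof -
 let ?A = "{z::complex. norm z : {a..b}}"
 have [measurable]: "f : borel_measurable borel" by (rule borel_measurable_continuous_onI[OF f(1)])
 have "ennreal (ring a b f) = (\<integral>\<^sup>+z. ennreal (f z) * indicator ?A z \<partial>lborel)"
  by (rule nn_integral_ring[symmetric, OF f(1,3) a(1)])
 also have "... <= (\<integral>\<^sup>+z. ennreal (f z) \<partial>M)"
 proof (rule nn_integral_packing[OF _ cball_measurable])
  show "Per (%z. ennreal (f z))" using f(2) by (simp add: Per_def)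
  fix z l l' assume l: "l : L" "l' : L" "z + l : ?A" "z + l' : ?A"
  then have "norm (l - l') <= 2 * R"
   using norm_triangle_ineq4[of "z + l" "z + l'"] a by simp
  then show "l = l'" using R_props(4)[OF L_diff[OF l(1,2)]] by simp
 qed measurable
 also have "... = ennreal (\<integral>z. f z)"
  by (rule nn_integral_eq_integral[OF int_cont[OF f(1)]]) (simp add: f)
 finally show ?thesis
  by (subst (asm) ennreal_le_iff) (auto intro!: integral_ge_0 f)
qed

text \<open>On the annulus from \<open>sqrt s\<close> to \<open>R\<close> one has
  \<open>P <= 2 |z|^2\<close>, and the radial integral is a logarithm of \<open>1/s\<close>. This
  divergence decides the sign in the next lemma.\<close>

lemma integral_inv_P_lower: "\<forall>\<^sub>F s in at_right 0. B <= (\<integral>z. 1 / (s + P z))"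
proof -
 have J: "pi / 2 * (ln (s + 2 * R^2) - ln (3 * s)) <= (\<integral>z. 1 / (s + P z))" if s: "0 < s" "s < R^2" for s
 proof -
  define f where "f z = 1 / (s + 2 * (norm z)^2)" for z :: complex
  have pos: "s + 2 * x^2 > 0" for x :: real using s by (simp add: add_pos_nonneg)
  have cf: "cont f" unfolding f_def[abs_def]
   by (intro continuous_intros) (use pos in \<open>auto simp: less_imp_neq[symmetric]\<close>)
  have ci: "cont (%z. 1 / (s + P z))" by (intro cont_div_pow continuous_intros s)
  have a: "sqrt s <= R" "0 <= sqrt s" using s R_props(1) by (auto simp: real_le_lsqrt)
  have I: "integral {sqrt s..R} (%r. r * circ f r) = ln (s + 2 * R^2) / 4 - ln (s + 2 * (sqrt s)^2) / 4"
  proof (rule integral_unique, rule fundamental_theorem_of_calculus[OF a(1)])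
   fix r assume "r : {sqrt s..R}"
   then have "r >= 0" using order_trans[OF a(2)] by simp
   then have "r * circ f r = r / (s + 2 * r^2)" by (simp add: circ_def f_def norm_mult)
   moreover have "((%r. ln (s + 2 * r^2) / 4) has_real_derivative r / (s + 2 * r^2)) (at r)"
    using pos[of r] by (auto intro!: derivative_eq_intros simp: divide_simps)
   ultimately show "((%r. ln (s + 2 * r^2) / 4) has_vector_derivative r * circ f r) (at r within {sqrt s..R})"
    by (simp add: has_real_derivative_iff_has_vector_derivative has_vector_derivative_at_within)
  qed
  have "pi / 2 * (ln (s + 2 * R^2) - ln (3 * s)) = ring (sqrt s) R f" unfolding ring_def I using s by (simp add: algebra_simps)
  also have "... <= ring (sqrt s) R (%z. 1 / (s + P z))"
  proof (rule ring_mono[OF cf ci a(2)])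
   fix z :: complex assume "norm z <= R"
   then have "P z <= 2 * (norm z)^2" using R_props(3)[of z] zero_le_power2[of "norm z"] by linarith
   then show "f z <= 1 / (s + P z)" unfolding f_def using spos[OF s(1), of z] by (intro divide_left_mono) auto
  qed
  also have "... <= (\<integral>z. 1 / (s + P z))"
   by (rule annulus_le_torus[OF ci Per_comp_P]) (use spos[OF s(1)] a in \<open>auto simp: less_imp_le\<close>)
  finally show ?thesis .
 qed
 have r: "0 < R^2" using R_props(1) by simp
 have "filterlim (%s. pi / 2 * (ln (s + 2 * q) - ln (3 * s))) at_top (at_right 0)" if "0 < q" for q :: real using that by real_asymp
 from this[OF r] have "\<forall>\<^sub>F s in at_right 0. B <= pi / 2 * (ln (s + 2 * R^2) - ln (3 * s))" by (simp add: filterlim_at_top)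
 moreover have "\<forall>\<^sub>F s in at_right 0. 0 < s & s < R^2" unfolding eventually_at_right_field using r by blast
 ultimately show ?thesis by eventually_elim (use J order_trans in blast)
qed

text \<open>Up to a nonnegative remainder and a term of integral 0 the integrand is
  \<open>8 s F\<close>. Green's identity with \<open>S\<close> rewrites \<open>16 F\<close> so that
  its leading part is a multiple of \<open>I = 1 / (s + P)\<close>: \<open>16 kp\<close> from
  \<open>lap S\<close> at the lattice against \<open>- 8 kp\<close> from the gradient identity. This
  positive balance times the divergent integral of \<open>I\<close> beats every constant.\<close>

lemma Psi_err_lower: "\<forall>\<^sub>F s in at_right 0. s <= (\<integral>z. Psi s z * err s z)"
proof -
 obtain C where C: "C > 0" "!!z. abs (4 - S z) <= C * P z" using S_near by blast
 obtain C' where C': "C' > 0" "!!z. abs (lap S z + 16 * kp) <= kp + C' * P z" using lapS_near[OF kappa_pos] by blast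
 define K where "K = C^2 + 2 * kp * C + C'"
 have main: "s <= (\<integral>z. Psi s z * err s z)" if s: "0 < s" and low': "(2 + K * area) / kp <= (\<integral>z. 1 / (s + P z))" for s
 proof -
  define I where "I z = inverse (s + P z)" for z
  define F where "F z = (P z - s) * I z ^ 3" for z
  define G where "G z = (S z * (P z - s) + 2 * kp * (P z)^2) * I z ^ 3" for z
  have G: "G z = lap I z" for z
   unfolding I_def[abs_def] inv_P(2)[OF s] G_def by (simp add: I_def divide_inverse power_inverse)
  have cI: "cont I" unfolding I_def[abs_def] by (intro cont_inv_pow s)
  have IC: "C2 I" and Ip: "Per I" unfolding I_def[abs_def] by (rule inv_P(1)[OF s], rule Per_comp_P)
  have cF: "cont F" and cG: "cont G" and cl: "cont (lap S)"
   unfolding F_def[abs_def] G_def[abs_def] by (intro continuous_intros cI P_cont S_cont C2_cont_lap S_C2)+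
  have G0: "(\<integral>z. G z) = 0" unfolding G by (rule integral_lap_0[OF IC Ip])
  have SG: "(\<integral>z. S z * G z) = (\<integral>z. I z * lap S z)"
   unfolding G by (rule green_sym[OF S_C2 S_per IC Ip])
  have I: "0 < I z" "(s + P z) * I z = 1" "s * I z <= 1" "P z * I z <= 1" "0 <= P z * I z" "0 <= s * I z" for z
   using spos[OF s, of z] ratio_bounds[OF s, of z] by (auto simp: I_def divide_inverse)
  \<comment> \<open>\<open>G\<close> and \<open>S G - I lap S\<close> both integrate to 0. Adding
    them to \<open>16 F\<close> produces \<open>(4 - S)^2 F\<close>, in which the singularity of
    \<open>F\<close> is compensated by \<open>4 - S = O(P)\<close>.\<close>
  have low: "kp * I z - K <= 16 * F z - 8 * G z + (S z * G z - I z * lap S z)" for z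
  proof -
   define d where "d = 4 - S z"
   define p where "p = P z * I z"
   have d: "abs d <= C * P z" unfolding d_def by (rule C)
   have "16 * F z - 8 * G z + (S z * G z - I z * lap S z) = d^2 * F z - 2 * kp * (4 + d) * ((P z)^2 * I z ^ 3) - I z * lap S z"
    unfolding F_def G_def d_def by (simp add: sqr power3_eq_cube algebra_simps)
   moreover have "- (C^2) <= d^2 * F z"
   proof -
    have "abs ((P z - s) * I z) <= 1"
     using I[of z] unfolding left_diff_distrib by (auto simp: abs_le_iff)
    have "abs (d * I z) <= C * p" unfolding abs_mult p_def using d I(1)[of z] mult_right_mono[OF d, of "I z"] by (simp add: mult.assoc)
    also have "... <= C * 1" using C(1) I(4)[of z] unfolding p_def by (intro mult_left_mono) auto
    finally have "(d * I z)^2 <= C^2" using C(1) by (simp add: abs_le_square_iff[symmetric])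
    then have "(d * I z)^2 * abs ((P z - s) * I z) <= C^2 * 1"
     using \<open>abs ((P z - s) * I z) <= 1\<close> by (intro mult_mono) auto
    moreover have "d^2 * F z = (d * I z)^2 * ((P z - s) * I z)"
     unfolding F_def by (simp add: sqr power3_eq_cube)
    moreover have "- ((d * I z)^2 * abs ((P z - s) * I z)) <= (d * I z)^2 * ((P z - s) * I z)"
     using mult_left_mono[of "- abs ((P z - s) * I z)" "(P z - s) * I z" "(d * I z)^2"] by simp
    ultimately show ?thesis by linarith
   qed
   moreover have "2 * kp * (4 + d) * ((P z)^2 * I z ^ 3) <= 8 * kp * I z + 2 * kp * C"
   proof -
    have e: "(P z)^2 * I z ^ 3 = p^2 * I z" by (simp add: p_def sqr power3_eq_cube)
    have p: "0 <= p^2" "p^2 <= 1" using I[of z] by (auto simp: p_def intro: power_le_one)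
    have "(4 + d) * (p^2 * I z) <= (4 + C * P z) * (p^2 * I z)"
     using d p I(1)[of z] by (intro mult_right_mono) auto
    also have "... = 4 * (p^2 * I z) + C * (p * p^2)" by (simp add: p_def algebra_simps)
    also have "... <= 4 * (1 * I z) + C * (1 * 1)"
     using p I[of z] C(1) by (intro add_mono mult_left_mono mult_right_mono mult_mono) (auto simp: p_def)
    finally have "(4 + d) * (p^2 * I z) <= 4 * I z + C" by simp
    from mult_left_mono[OF this, of "2 * kp"] show ?thesis unfolding e using kappa_pos by (simp add: algebra_simps)
   qed
   \<comment> \<open>15 is 16 less 1: one \<open>kp\<close> is spent on the tolerance chosen in
     \<open>lapS_near\<close>.\<close>
   moreover have "15 * kp * I z - C' <= - (I z * lap S z)"
   proof -
    have "lap S z <= - 15 * kp + C' * P z" using C'(2)[of z] by linarith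
    then have "I z * lap S z <= I z * (- 15 * kp + C' * P z)" using I(1)[of z] by (intro mult_left_mono) auto
    also have "... = - (15 * kp * I z) + C' * p" by (simp add: p_def algebra_simps)
    also have "C' * p <= C' * 1" using C'(1) I[of z] unfolding p_def by (intro mult_left_mono) auto
    finally show ?thesis by simp
   qed
   moreover have "0 <= kp * I z" using kappa_pos I(1)[of z] by simp
   ultimately show ?thesis unfolding K_def by linarith
  qed
  have i: "integrable M I" "integrable M F" "integrable M G" "integrable M (%z. S z * G z)" "integrable M (%z. I z * lap S z)"
   by (intro int_cont continuous_intros cI cF cG S_cont cl)+
  have "(\<integral>z. kp * I z - K) <= (\<integral>z. 16 * F z - 8 * G z + (S z * G z - I z * lap S z))"
   by (intro integral_mono low) (use i in auto)
  also have "... = 16 * (\<integral>z. F z)" using i G0 SG by simp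
  finally have 1: "kp * (\<integral>z. I z) - K * area <= 16 * (\<integral>z. F z)"
   using i by (simp add: measure_space_M mult.commute)
  have "(2 + K * area) / kp <= (\<integral>z. I z)" using low' by (simp add: I_def divide_inverse)
  then have "2 + K * area <= kp * (\<integral>z. I z)" using kappa_pos by (simp add: pos_divide_le_eq mult.commute)
  with 1 have 2: "2 <= 16 * (\<integral>z. F z)" by linarith
  \<comment> \<open>The second part of \<open>err\<close>, together with the \<open>kp\<close> part
    of \<open>G\<close>, leaves exactly \<open>2 kp (s i)^2\<close>, which is nonnegative.\<close>
  have pt: "8 * s * F z - 2 * s * G z <= Psi s z * err s z" for z
  proof -
   have PI: "P z = (s + P z) - s" by simp
   define i where "i = I z"
   have si: "P z * i = 1 - s * i" using I(2)[of z] by (simp add: i_def algebra_simps)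
   have psi: "Psi s z = (P z - s) * i" by (simp add: Psi_def i_def I_def divide_inverse)
   have er: "err s z = 2 * s * (4 - S z) * i^2 + 2 * kp * ((P z * i)^2 - 1)"
    unfolding err_def i_def I_def by (simp add: divide_inverse power_inverse power_mult_distrib)
   have "Psi s z * err s z - (8 * s * F z - 2 * s * G z) = 2 * kp * (((P z - s) * i) * ((P z * i)^2 - 1) + 2 * (s * i) * (P z * i)^2)"
    unfolding psi er F_def G_def i_def[symmetric] by (simp add: sqr power3_eq_cube algebra_simps)
   also have "(P z - s) * i = 1 - 2 * (s * i)" using si by (simp add: left_diff_distrib)
   also have "(1 - 2 * (s * i)) * ((P z * i)^2 - 1) + 2 * (s * i) * (P z * i)^2 = (s * i)^2"
    unfolding si by (simp add: sqr algebra_simps)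
   finally show ?thesis using kappa_pos zero_le_power2[of "s * i"] mult_nonneg_nonneg[of "2 * kp" "(s * i)^2"] by linarith
  qed
  have "(\<integral>z. 8 * s * F z - 2 * s * G z) <= (\<integral>z. Psi s z * err s z)"
   by (intro integral_mono pt int_cont continuous_intros cF cG err_cont C2_cont Psi_C2 s)
  moreover have "(\<integral>z. 8 * s * F z - 2 * s * G z) = 8 * s * (\<integral>z. F z)" using i G0 by simp
  moreover have "s * 2 <= s * (16 * (\<integral>z. F z))" using 2 s by (intro mult_left_mono) auto
  ultimately show ?thesis by linarith
 qed
 show ?thesis
  using eventually_at_right_less[of 0] integral_inv_P_lower[of "(2 + K * area) / kp"] by eventually_elim (rule main)
qed

text \<open>A point within \<open>R\<close> of the lattice is counted by the unfolded disc;
  elsewhere \<open>P >= p0\<close> makes \<open>eV\<close> of order \<open>s\<close>.\<close>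

lemma near_far:
 obtains C where "C > 0" "!!s f. s > 0 ==> cont f ==> Per f ==> (!!z. 0 <= f z) ==>
  (\<integral>z. eV s z * f z) <= ring 0 R (%z. eV s z * f z) + C * s * (\<integral>z. f z)"
proof -
 obtain p0 where p0: "p0 > 0" "p0 <= 1" "!!z. (!!l. l : L ==> R <= norm (z - l)) ==> p0 <= P z"
  using P_away by blast
 show ?thesis
 proof (rule that[of "8 / p0^2"])
  show "8 / p0^2 > 0" using p0 by simp
  fix s :: real and f :: "complex => real"
  assume s: "s > 0" and f: "cont f" "Per f" "!!z. 0 <= f z"
  let ?A = "{z::complex. norm z : {0..R}}"
  let ?g = "%z. eV s z * f z"
  have cg: "cont ?g" by (intro continuous_intros eV_cont s f)
  have g0: "0 <= ?g z" for z using eV_pos[OF s, of z] f(3)[of z] by simp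
  have pg: "Per (%z. ennreal (?g z))" using eV_per[of s] f(2) by (simp add: Per_def)
  have [measurable]: "?g : borel_measurable borel" "f : borel_measurable borel"
   by (intro borel_measurable_continuous_onI cg f)+
  have [measurable]: "?A : sets borel" by (rule cball_measurable)
  have [measurable]: "lat_count ?A : borel_measurable borel" unfolding lat_count_def[abs_def] by measurable
  have pt: "ennreal (?g z) <= ennreal (?g z) * lat_count ?A z + ennreal (8 / p0^2 * s * f z)" for z
  proof (cases "EX l:L. norm (z - l) < R")
   case True
   then obtain l where l: "l : L" "norm (z - l) < R" by blast
   obtain n where n: "lat n = - l" using bij_lat L_minus[OF l(1)] unfolding bij_betw_def by (metis imageE)
   have "(1::ennreal) = indicator ?A (z + lat n)" using l(2) by (simp add: n)
   also have "... <= lat_count ?A z" unfolding lat_count_def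
    using sum_le_suminf[of "%n. indicator ?A (z + lat n) :: ennreal" "{n}"] by simp
   finally have "ennreal (?g z) * 1 <= ennreal (?g z) * lat_count ?A z" by (intro mult_left_mono) auto
   then show ?thesis by (simp add: add_increasing2)
  next
   case False
   then have "p0 <= P z" by (intro p0(3)) force
   then have "p0^2 <= (s + P z)^2" using p0 s by (intro power_mono) auto
   then have "eV s z <= 8 * s / p0^2" unfolding eV_def using s p0 spos[OF s, of z] by (intro divide_left_mono) auto
   then have "?g z <= 8 * s / p0^2 * f z" by (intro mult_right_mono f)
   then have "ennreal (?g z) <= ennreal (8 / p0^2 * s * f z)" by (intro ennreal_leI) simp
   then show ?thesis by (simp add: add_increasing)
  qed
  have "ennreal (\<integral>z. ?g z) = (\<integral>\<^sup>+z. ennreal (?g z) \<partial>M)"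
   by (rule nn_integral_eq_integral[symmetric, OF int_cont[OF cg]]) (simp add: g0)
  also have "... <= (\<integral>\<^sup>+z. ennreal (?g z) * lat_count ?A z + ennreal (8 / p0^2 * s * f z) \<partial>M)"
   by (intro nn_integral_mono pt)
  also have "... = (\<integral>\<^sup>+z. ennreal (?g z) * lat_count ?A z \<partial>M) + (\<integral>\<^sup>+z. ennreal (8 / p0^2 * s * f z) \<partial>M)"
   by (rule nn_integral_add; rule borel_M; measurable)
  also have "(\<integral>\<^sup>+z. ennreal (?g z) * lat_count ?A z \<partial>M) = (\<integral>\<^sup>+z. ennreal (?g z) * indicator ?A z \<partial>lborel)"
  proof -
   have "(\<integral>\<^sup>+z. ennreal (?g z) * indicator ?A z \<partial>lborel) = (\<integral>\<^sup>+z. ennreal (?g z) * indicator D z * lat_count ?A z \<partial>lborel)"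
    by (rule nn_integral_unfold[OF _ _ pg]) measurable
   then show ?thesis unfolding nn_integral_M by (simp only: mult_ac)
  qed
  also have "... = ennreal (ring 0 R ?g)" by (rule nn_integral_ring[OF cg g0]) simp
  also have "(\<integral>\<^sup>+z. ennreal (8 / p0^2 * s * f z) \<partial>M) = ennreal (\<integral>z. 8 / p0^2 * s * f z)"
   by (rule nn_integral_eq_integral) (use s p0 f in \<open>auto intro!: int_cont continuous_intros\<close>)
  finally have "ennreal (\<integral>z. ?g z) <= ennreal (ring 0 R ?g) + ennreal (8 / p0^2 * s * (\<integral>z. f z))" by simp
  moreover have "0 <= ring 0 R ?g" "0 <= 8 / p0^2 * s * (\<integral>z. f z)" using s f ring_nonneg[OF cg g0] by auto
  ultimately show "(\<integral>z. ?g z) <= ring 0 R ?g + 8 / p0^2 * s * (\<integral>z. f z)"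
   by (simp flip: ennreal_plus)
 qed
qed

end

section \<open>Uniform limits and convolution on the torus\<close>

lemma uniform_rate_limit:
 fixes F :: "nat => 'a => real"
 assumes F: "!!n m z. n <= m ==> abs (F n z - F m z) <= a n" and a: "a \<longlonglongrightarrow> 0"
 shows "(%n. F n z) \<longlonglongrightarrow> lim (%n. F n z)" "abs (F n z - lim (%n. F n z)) <= a n"
  "uniform_limit UNIV F (%z. lim (%n. F n z)) sequentially"
proof -
 have l: "(%n. F n z) \<longlonglongrightarrow> lim (%n. F n z)" for z
 proof -
  have "Cauchy (%n. F n z)"
  proof (rule metric_CauchyI)
   fix e :: real assume "e > 0"
   then have "\<forall>\<^sub>F n in sequentially. a n < e / 2" using a by (intro order_tendstoD) auto
   then obtain N where N: "a N < e / 2" by (auto simp: eventually_sequentially)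
   show "EX N. ALL m>=N. ALL n>=N. dist (F m z) (F n z) < e"
   proof (intro exI allI impI)
    fix m n assume "m >= N" "n >= N"
    then show "dist (F m z) (F n z) < e" using F[of N m z] F[of N n z] N unfolding dist_real_def by linarith
   qed
  qed
  then show ?thesis by (simp add: Cauchy_convergent_iff convergent_LIMSEQ_iff)
 qed
 show "(%n. F n z) \<longlonglongrightarrow> lim (%n. F n z)" by (rule l)
 have b: "abs (F n z - lim (%n. F n z)) <= a n" for n z
 proof (rule LIMSEQ_le_const2)
  show "(%m. abs (F n z - F m z)) \<longlonglongrightarrow> abs (F n z - lim (%n. F n z))" by (intro tendsto_intros l)
 qed (use F in blast)
 show "abs (F n z - lim (%n. F n z)) <= a n" by (rule b)
 show "uniform_limit UNIV F (%z. lim (%n. F n z)) sequentially"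
 proof (rule uniform_limitI)
  fix e :: real assume "e > 0"
  then have "\<forall>\<^sub>F n in sequentially. a n < e" using a by (intro order_tendstoD) auto
  then show "\<forall>\<^sub>F n in sequentially. ALL z:UNIV. dist (F n z) (lim (%n. F n z)) < e"
   by eventually_elim (auto simp: dist_real_def intro: le_less_trans[OF b])
 qed
qed

lemma C1_uniform_limit:
 assumes F: "!!n. C1 (F n)" and l: "!!z. (%n. F n z) \<longlonglongrightarrow> f z"
  and x: "uniform_limit UNIV (%n. dx (F n)) fx sequentially" and y: "uniform_limit UNIV (%n. dy (F n)) fy sequentially"
 shows "C1 f" "dx f = fx" "dy f = fy"
proof -
 have c: "cont fx" "cont fy"
  by (rule uniform_limit_theorem[OF _ x] uniform_limit_theorem[OF _ y]; simp add: C1_cont_dx C1_cont_dy F)+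
 have "EX g. ALL z:UNIV. (%n. F n z) \<longlonglongrightarrow> g z & (g has_derivative (%h. Re h * fx z + Im h * fy z)) (at z within UNIV)"
 proof (rule has_derivative_sequence[of UNIV F "%n z h. Re h * dx (F n) z + Im h * dy (F n) z" _ 0 "f 0"])
  fix e :: real assume e: "e > 0"
  have "\<forall>\<^sub>F n in sequentially. ALL z:UNIV. dist (dx (F n) z) (fx z) < e / 2" "\<forall>\<^sub>F n in sequentially. ALL z:UNIV. dist (dy (F n) z) (fy z) < e / 2"
   using uniform_limitD[OF x half_gt_zero[OF e]] uniform_limitD[OF y half_gt_zero[OF e]] .
  then show "\<forall>\<^sub>F n in sequentially. ALL z:UNIV. ALL h. norm (Re h * dx (F n) z + Im h * dy (F n) z - (Re h * fx z + Im h * fy z)) <= e * norm h"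
  proof eventually_elim
   case (elim n)
   show ?case
   proof (intro ballI allI)
    fix z h :: complex
    have "norm (Re h * dx (F n) z + Im h * dy (F n) z - (Re h * fx z + Im h * fy z)) = abs (Re h * (dx (F n) z - fx z) + Im h * (dy (F n) z - fy z))"
     by (simp add: algebra_simps)
    also have "... <= abs (Re h) * abs (dx (F n) z - fx z) + abs (Im h) * abs (dy (F n) z - fy z)"
     by (metis abs_mult abs_triangle_ineq)
    also have "... <= norm h * (e / 2) + norm h * (e / 2)"
     using elim[rule_format, of z] by (intro add_mono mult_mono abs_Re_le_cmod abs_Im_le_cmod) (auto simp: dist_real_def)
    finally show "norm (Re h * dx (F n) z + Im h * dy (F n) z - (Re h * fx z + Im h * fy z)) <= e * norm h" by simp
   qed
  qed
 qed (use C1_has_grad[OF F] l in \<open>auto simp: has_grad_def\<close>)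
 then obtain g where g: "!!z. (%n. F n z) \<longlonglongrightarrow> g z" "!!z. has_grad g (fx z) (fy z) z" by (auto simp: has_grad_def)
 then have "g = f" using LIMSEQ_unique[OF g(1) l] by blast
 from C1I[OF g(2) c, unfolded this] show "C1 f" "dx f = fx" "dy f = fy" .
qed

lemma C1_taylor:
 assumes f: "C1 f" and u: "!!w. norm (w - z) < d ==> abs (dx f w - dx f z) <= e & abs (dy f w - dy f z) <= e" and h: "norm h < d"
 shows "abs (f (z + h) - f z - (Re h * dx f z + Im h * dy f z)) <= 2 * e * norm h"
proof -
 define a b where "a = dx f z" and "b = dy f z"
 have g: "has_grad (%w. Re w * a + Im w * b) a b w" for w
  unfolding has_grad_def by (auto intro!: derivative_eq_intros)
 note g' = C1I[OF g continuous_on_const continuous_on_const]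
 note q = C1_sub[OF f g'(1), unfolded g']
 have "norm h >= 0" by simp
 with h have "d > 0" by linarith
 then have "abs ((f (z + h) - (Re (z + h) * a + Im (z + h) * b)) - (f z - (Re z * a + Im z * b))) <= 2 * e * norm (z + h - z)"
 proof (intro C1_bound_diff[OF q(1), of "ball z d"])
  fix w assume "w : ball z d"
  then show "abs (dx (%z. f z - (Re z * a + Im z * b)) w) + abs (dy (%z. f z - (Re z * a + Im z * b)) w) <= 2 * e"
   unfolding q(2,3) using u[of w] by (auto simp: a_def b_def dist_norm norm_minus_commute)
 qed (use h in \<open>auto simp: dist_norm\<close>)
 then show ?thesis by (simp add: a_def b_def algebra_simps)
qed

context torus
begin

lemma Per_uniform:
 fixes f :: "complex => real"
 assumes f: "cont f" "Per f" and e: "e > 0"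
 obtains d where "d > 0" "!!z w. norm (w - z) < d ==> abs (f w - f z) < e"
proof -
 \<comment> \<open>The radius exceeds that of the cell by 1, so that a point close to the cell stays
   in the compact set.\<close>
 let ?K = "cball 0 (norm o1 + norm o2 + 1) :: complex set"
 have "uniformly_continuous_on ?K f"
  by (rule compact_uniformly_continuous) (auto intro: continuous_on_subset[OF f(1)])
 then obtain d where d: "d > 0" "!!z w. z : ?K ==> w : ?K ==> dist w z < d ==> dist (f w) (f z) < e"
  unfolding uniformly_continuous_on_def using e by metis
 show ?thesis
 proof (rule that[of "min d 1"])
  fix z w :: complex assume zw: "norm (w - z) < min d 1"
  obtain l where l: "l : L" "z - l : D" using ex_lattice_shift by blast
  have "norm (w - l) <= norm (z - l) + norm (w - z)" using norm_triangle_ineq[of "z - l" "w - z"] by simp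
  then have "dist (f (w - l)) (f (z - l)) < e"
   using norm_D[OF l(2)] zw by (intro d(2)) (simp_all add: dist_norm[of "w - l" "z - l"])
  then show "abs (f w - f z) < e" using Per_diff[OF f(2) l(1)] by (simp add: dist_real_def)
 qed (use d in simp)
qed

definition conv :: "(complex => real) => (complex => real) => complex => real" where
 "conv f g z = (\<integral>w. f (z - w) * g w)"

lemma cont_flip: "cont f ==> cont (%w. f (z - w))" for f :: "complex => real"
 by (rule continuous_on_compose2[of UNIV f UNIV "%w. z - w"]) (auto intro!: continuous_intros)

lemma integrable_conv: "cont f ==> cont g ==> integrable M (%w. f (z - w) * g w)" for f g :: "complex => real"
 by (intro int_cont continuous_intros cont_flip)

lemma integral_flip:
 fixes f :: "complex => real"
 assumes "cont f" "Per f"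
 shows "(\<integral>w. f (z - w)) = (\<integral>w. f w)"
 by (rule integral_reflect) (use assms int_cont borel_measurable_continuous_onI in auto)

lemma conv_commute:
 assumes f: "cont f" "Per f" and g: "cont g" "Per g"
 shows "conv f g z = conv g f z"
proof -
 have p: "Per (%w. f (z - w) * g w)"
  unfolding Per_def
 proof (intro allI ballI)
  fix w l assume l: "l : L"
  have "f (z - (w + l)) = f (z - w)" using Per_diff[OF f(2) l, of "z - w"] by (simp add: diff_diff_eq)
  then show "f (z - (w + l)) * g (w + l) = f (z - w) * g w" using Per_add[OF g(2) l] by simp
 qed
 have "cont (%w. f (z - w) * g w)" by (intro continuous_intros cont_flip f g)
 from integral_flip[OF this p, of z] show ?thesis unfolding conv_def by (simp add: mult.commute)
qed

lemma conv_bound: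
 assumes f: "cont f" "Per f" and g: "cont g" "!!z. abs (g z) <= B"
 shows "abs (conv f g z) <= B * (\<integral>w. abs (f w))"
proof -
 have c: "cont (%w. abs (f w))" by (intro continuous_intros f)
 have "abs (conv f g z) <= (\<integral>w. abs (f (z - w) * g w))" unfolding conv_def by (rule abs_integral_le)
 also have "... <= (\<integral>w. B * abs (f (z - w)))"
 proof (rule integral_mono)
  fix w show "abs (f (z - w) * g w) <= B * abs (f (z - w))" using g(2)[of w] by (simp add: abs_mult mult.commute mult_right_mono)
 qed (intro int_cont continuous_intros cont_flip f g)+
 also have "... = B * (\<integral>w. abs (f w))" using integral_flip[OF c Per_compose[OF f(2)], of z] by simp
 finally show ?thesis .
qed

lemma conv_sub:
 assumes "cont f" "cont g" "cont h"
 shows "conv (%z. f z - g z) h z = conv f h z - conv g h z" "conv f (%z. g z + c * h z) z = conv f g z + c * conv f h z"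
 using integrable_conv[OF assms(1,3)] integrable_conv[OF assms(2,3)] integrable_conv[OF assms(1,2)] unfolding conv_def
 by (simp_all add: left_diff_distrib distrib_left mult.left_commute)

lemma Per_conv: "Per f ==> Per (conv f g)"
 unfolding Per_def conv_def
proof (intro allI ballI)
 fix z l assume f: "ALL z. ALL l:L. f (z + l) = f z" and l: "l : L"
 have "f (z + l - w) = f (z - w)" for w using f[rule_format, OF l, of "z - w"] by (simp add: algebra_simps)
 then show "(\<integral>w. f (z + l - w) * g w) = (\<integral>w. f (z - w) * g w)" by simp
qed

lemma conv_even:
 assumes f: "cont f" "Per f" "!!z. f (- z) = f z" and g: "cont g" "Per g" "!!z. g (- z) = g z"
 shows "conv f g (- z) = conv f g z"
proof -
 have "conv f g (- z) = (\<integral>w. f (z + w) * g w)"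
  unfolding conv_def using f(3)[of "z + _"] by simp
 also have "... = (\<integral>w. f (z + (0 - w)) * g (0 - w))"
 proof (rule integral_flip[symmetric])
  show "cont (%w. f (z + w) * g w)"
   by (intro continuous_intros continuous_on_compose2[OF f(1)] g) auto
  show "Per (%w. f (z + w) * g w)" using f(2) g(2) by (simp add: Per_def add.assoc[symmetric])
 qed
 finally show ?thesis unfolding conv_def using g(3) by simp
qed

lemma conv_continuous:
 assumes f: "cont f" "Per f" and g: "cont g"
 shows "cont (conv f g)"
 unfolding continuous_on_iff
proof (intro ballI allI impI)
 fix z :: complex and e :: real assume e: "e > 0"
 define G where "G = (\<integral>w. abs (g w)) + 1"
 have G: "G > 0" by (auto simp: G_def intro: add_nonneg_pos)
 obtain d where d: "d > 0" "!!z w. norm (w - z) < d ==> abs (f w - f z) < e / G" using Per_uniform[OF f, of "e / G"] e G by (metis divide_pos_pos)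
 show "EX d>0. ALL x':UNIV. dist x' z < d --> dist (conv f g x') (conv f g z) < e"
 proof (intro exI[of _ d] conjI ballI impI d(1))
  fix x assume x: "dist x z < d"
  have "dist (conv f g x) (conv f g z) = abs (\<integral>w. f (x - w) * g w - f (z - w) * g w)"
   unfolding conv_def dist_real_def using integrable_conv[OF f(1) g] by simp
  also have "... <= (\<integral>w. abs (f (x - w) * g w - f (z - w) * g w))" by (rule abs_integral_le)
  also have "... <= (\<integral>w. e / G * abs (g w))"
  proof (rule integral_mono)
   fix w
   have "abs (f (x - w) - f (z - w)) <= e / G" using d(2)[of "x - w" "z - w"] x by (simp add: dist_norm less_imp_le)
   from mult_right_mono[OF this, of "abs (g w)"] show "abs (f (x - w) * g w - f (z - w) * g w) <= e / G * abs (g w)"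
    by (simp add: abs_mult[symmetric] left_diff_distrib)
  qed (intro int_cont continuous_intros cont_flip f g)+
  also have "... = e / G * (G - 1)" by (simp add: G_def)
  also have "... < e" using e G by (simp add: field_simps)
  finally show "dist (conv f g x) (conv f g z) < e" .
 qed
qed

text \<open>Differentiation under the integral: the gradient is uniformly continuous on the torus,
  so the first-order Taylor error is uniform in the integration variable.\<close>

lemma conv_C1:
 assumes f: "C1 f" "Per f" and g: "cont g"
 shows "C1 (conv f g)" "dx (conv f g) = conv (dx f) g" "dy (conv f g) = conv (dy f) g"
proof -
 note cx = C1_cont_dx[OF f(1)] and cy = C1_cont_dy[OF f(1)] and pxy = C1_periodic[OF f]
 have "has_grad (conv f g) (conv (dx f) g z) (conv (dy f) g z) z" for z
  unfolding has_grad_def has_derivative_at_alt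
 proof (intro conjI allI impI)
  show "bounded_linear (%h. Re h * conv (dx f) g z + Im h * conv (dy f) g z)"
   by (intro bounded_linear_add bounded_linear_compose[OF bounded_linear_mult_left] bounded_linear_Re bounded_linear_Im)
  fix e :: real assume e: "e > 0"
  define G where "G = (\<integral>w. abs (g w)) + 1"
  have G: "G > 0" by (auto simp: G_def intro: add_nonneg_pos)
  define e' where "e' = e / (2 * G)"
  have e': "e' > 0" using e G by (simp add: e'_def)
  obtain d1 where d1: "d1 > 0" "!!z w. norm (w - z) < d1 ==> abs (dx f w - dx f z) < e'" using Per_uniform[OF cx pxy(1) e'] by blast
  obtain d2 where d2: "d2 > 0" "!!z w. norm (w - z) < d2 ==> abs (dy f w - dy f z) < e'" using Per_uniform[OF cy pxy(2) e'] by blast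
  show "EX d>0. ALL y. norm (y - z) < d --> norm (conv f g y - conv f g z - (Re (y - z) * conv (dx f) g z + Im (y - z) * conv (dy f) g z)) <= e * norm (y - z)"
  proof (intro exI[of _ "min d1 d2"] conjI allI impI)
   fix y assume y: "norm (y - z) < min d1 d2"
   have eq: "conv f g y - conv f g z - (Re (y - z) * conv (dx f) g z + Im (y - z) * conv (dy f) g z)
    = (\<integral>w. f (y - w) * g w - f (z - w) * g w - (Re (y - z) * (dx f (z - w) * g w) + Im (y - z) * (dy f (z - w) * g w)))"
    unfolding conv_def using integrable_conv[OF C1_cont[OF f(1)] g, of y] integrable_conv[OF C1_cont[OF f(1)] g, of z] integrable_conv[OF cx g, of z] integrable_conv[OF cy g, of z] by simp
   have "norm (conv f g y - conv f g z - (Re (y - z) * conv (dx f) g z + Im (y - z) * conv (dy f) g z)) <= (\<integral>w. abs (f (y - w) * g w - f (z - w) * g w - (Re (y - z) * (dx f (z - w) * g w) + Im (y - z) * (dy f (z - w) * g w))))"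
    unfolding eq real_norm_def by (rule abs_integral_le)
   also have "... <= (\<integral>w. 2 * e' * norm (y - z) * abs (g w))"
   proof (rule integral_mono)
    fix w
    have "abs (f (z - w + (y - z)) - f (z - w) - (Re (y - z) * dx f (z - w) + Im (y - z) * dy f (z - w))) <= 2 * e' * norm (y - z)"
     by (rule C1_taylor[OF f(1) _ y]) (use d1(2) d2(2) in \<open>auto simp: less_imp_le\<close>)
    from mult_right_mono[OF this, of "abs (g w)"]
    show "abs (f (y - w) * g w - f (z - w) * g w - (Re (y - z) * (dx f (z - w) * g w) + Im (y - z) * (dy f (z - w) * g w))) <= 2 * e' * norm (y - z) * abs (g w)"
     by (simp add: abs_mult[symmetric] left_diff_distrib distrib_right mult.assoc)
   qed (intro int_cont continuous_intros cont_flip C1_cont[OF f(1)] cx cy g)+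
   also have "... = 2 * e' * norm (y - z) * (G - 1)" by (simp add: G_def)
   also have "... <= 2 * e' * norm (y - z) * G" using e' by (intro mult_left_mono) auto
   also have "... = e * norm (y - z)" using G by (simp add: e'_def)
   finally show "norm (conv f g y - conv f g z - (Re (y - z) * conv (dx f) g z + Im (y - z) * conv (dy f) g z)) <= e * norm (y - z)" by simp
  qed (use d1 d2 in auto)
 qed
 from C1I[OF this conv_continuous[OF cx pxy(1) g] conv_continuous[OF cy pxy(2) g]]
 show "C1 (conv f g)" "dx (conv f g) = conv (dx f) g" "dy (conv f g) = conv (dy f) g" .
qed

text \<open>Convolution commutes, so the derivative may fall on either factor.\<close>

lemma conv_dx_swap:
 assumes f: "C1 f" "Per f" and g: "C1 g" "Per g"
 shows "conv (dx f) g = conv f (dx g)" "conv (dy f) g = conv f (dy g)"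
proof -
 have e: "conv f g = conv g f" by (rule ext) (rule conv_commute[OF C1_cont[OF f(1)] f(2) C1_cont[OF g(1)] g(2)])
 have "conv (dx f) g = conv (dx g) f" "conv (dy f) g = conv (dy g) f"
  using conv_C1(2,3)[OF f C1_cont[OF g(1)]] conv_C1(2,3)[OF g C1_cont[OF f(1)]] e by auto
 then show "conv (dx f) g = conv f (dx g)" "conv (dy f) g = conv f (dy g)"
  using conv_commute[OF C1_cont[OF f(1)] f(2) C1_cont_dx[OF g(1)] C1_periodic(1)[OF g]]
   conv_commute[OF C1_cont[OF f(1)] f(2) C1_cont_dy[OF g(1)] C1_periodic(2)[OF g]] by auto
qed

text \<open>After translation the point \<open>z\<close> sits at the corner 0 of the cell. If
  \<open>f z\<close> were positive, the translate would be positive near 0 on an open part of the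
  cell, which is not a null set.\<close>

lemma zero_if_square_integral_0:
 fixes f :: "complex => real"
 assumes f: "cont f" "Per f" "!!z. f z >= 0" and 0: "(\<integral>z. f z) = 0"
 shows "f z = 0"
proof (rule ccontr)
 assume "f z ~= 0"
 then have "(\<integral>w. f (z + w)) = 0" "f z > 0" using f 0
  by (auto simp: less_le integral_translate int_cont borel_measurable_continuous_onI)
 define g where "g w = f (z + w)" for w
 have g: "cont g" unfolding g_def[abs_def] by (rule continuous_on_compose2[OF f(1)]) (auto intro!: continuous_intros)
 have "AE w in M. g w = 0"
  using integral_nonneg_eq_0_iff_AE[of M g] int_cont[OF g] f(3) \<open>(\<integral>w. f (z + w)) = 0\<close> by (auto simp: g_def[abs_def])
 then have ae: "AE w in lborel. w : D --> g w = 0"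
  unfolding torus_measure_def by (subst (asm) AE_restrict_space_iff) auto
 have "isCont g 0" using g by (simp add: continuous_on_eq_continuous_at)
 then have "\<forall>\<^sub>F w in at 0. g w > 0" using \<open>f z > 0\<close> by (intro order_tendstoD[of g "g 0"]) (auto simp: isCont_def g_def)
 then obtain d where d: "d > 0" "!!w. w ~= 0 ==> norm w < d ==> g w > 0" by (auto simp: eventually_at)
 \<comment> \<open>0 is a boundary point of the cell, hence the intersection of the ball with the
   open cell.\<close>
 define U where "U = {w. 0 < cx w & cx w < 1 & 0 < cy w & cy w < 1} \<inter> ball 0 d"
 have "open U" unfolding U_def
  by (intro open_Int open_ball open_Collect_conj open_Collect_less continuous_intros continuous_cxy)
 have "\<not> (AE w in lborel. w \<notin> U)"
 proof
  assume "AE w in lborel. w \<notin> U"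
  then have "emeasure lborel U = 0" using \<open>open U\<close> by (auto simp: AE_iff_measurable[OF _ refl])
  moreover have "U ~= {}"
  proof -
   define t where "t = min (1/2) (d / (2 * (norm o1 + norm o2 + 1)))"
   have n: "norm o1 + norm o2 + 1 > 0" by (simp add: add_nonneg_pos)
   have t: "0 < t" "t < 1" using d n by (auto simp: t_def)
   have "norm (of_real t * o1 + of_real t * o2) <= t * (norm o1 + norm o2 + 1)"
    using norm_triangle_ineq[of "of_real t * o1" "of_real t * o2"] t by (simp add: norm_mult distrib_left)
   also have "... <= d / (2 * (norm o1 + norm o2 + 1)) * (norm o1 + norm o2 + 1)" using n by (intro mult_right_mono) (auto simp: t_def)
   also have "... = d / 2" using n by (simp add: field_simps)
   finally have "of_real t * o1 + of_real t * o2 : U" using d t by (simp add: U_def cxy_lincomb)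
   then show ?thesis by blast
  qed
  ultimately show False using open_not_negligible[OF \<open>open U\<close>] negligible_iff_emeasure0[of U] \<open>open U\<close> by (auto simp: lmeasurable_iff_integrable)
 qed
 moreover have "AE w in lborel. w \<notin> U"
  using ae
 proof eventually_elim
  case (elim w)
  have "w \<notin> U | w = 0 | False" if "w : U"
   using elim d(2)[of w] that by (auto simp: U_def D_iff)
  moreover have "0 \<notin> U" by (simp add: U_def cx_def)
  ultimately show ?case by auto
 qed
 ultimately show False by simp
qed

end

section \<open>The Green operator\<close>

context weight
begin

text \<open>The regularised Green function: in the limit \<open>- 1/(4 pi) ln P\<close> has
  Laplacian \<open>1/area\<close> minus a unit mass at the lattice.\<close>

definition E :: "real => complex => real" where "E s z = - 1 / (4 * pi) * ln (s + P z)"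

lemma E_C2:
 assumes s: "s > 0"
 shows "C2 (E s)" "lap (E s) z = - 1 / (4 * pi) * ((s * S z - kp * (P z)^2) / (s + P z)^2)"
  "dx (E s) z = - 1 / (4 * pi) * (dx P z / (s + P z))" "dy (E s) z = - 1 / (4 * pi) * (dy P z / (s + P z))"
proof -
 show "C2 (E s)" "lap (E s) z = - 1 / (4 * pi) * ((s * S z - kp * (P z)^2) / (s + P z)^2)"
  unfolding E_def[abs_def] C2_cmult(2)[OF ln_P(1)[OF s]] by (intro C2_cmult ln_P(1) s) (simp add: ln_P(2)[OF s])
 have g: "has_grad (E s) (- 1 / (4 * pi) * (1 / (s + P z)) * dx P z) (- 1 / (4 * pi) * (1 / (s + P z)) * dy P z) z"
  unfolding E_def[abs_def]
  by (rule has_grad_compose[OF C1_has_grad[OF C2_C1[OF P_C2]], of "%p. - 1 / (4 * pi) * ln (s + p)"])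
   (use spos[OF s, of z] in \<open>auto intro!: derivative_eq_intros simp: divide_simps\<close>)
 show "dx (E s) z = - 1 / (4 * pi) * (dx P z / (s + P z))" "dy (E s) z = - 1 / (4 * pi) * (dy P z / (s + P z))"
  using has_grad_dx[OF g] has_grad_dy[OF g] by simp_all
qed

lemma E_per: "Per (E s)" unfolding E_def[abs_def] by (rule Per_compose[OF P_per])
lemma E_even: "E s (- z) = E s z" by (simp add: E_def P_even)

lemma P_upper: obtains B where "B >= 1" "!!z. P z <= B" "!!z. abs (S z) <= B"
proof -
 obtain B1 where B1: "!!z. abs (P z) <= B1" using Per_compact_bounded[OF P_cont P_per] by metis
 obtain B2 where B2: "!!z. abs (S z) <= B2" using Per_compact_bounded[OF S_cont S_per] by metis
 have "P z <= max 1 (max B1 B2)" "abs (S z) <= max 1 (max B1 B2)" for z using B1[of z] B2[of z] by linarith+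
 then show ?thesis by (intro that[of "max 1 (max B1 B2)"]) auto
qed

lemma powr_cont: "s > 0 ==> cont (%z. (s + P z) powr a)"
 using spos by (intro continuous_intros P_cont) (auto simp: less_imp_neq[symmetric])

text \<open>The gradient of \<open>E\<close> is of size \<open>P powr (-1/2)\<close>; gaining the
  factor \<open>s powr (3/8)\<close> costs a further \<open>-3/8\<close>, and the sum
  \<open>-7/8\<close> is the exponent with a uniformly bounded integral. For \<open>E\<close> itself
  the same power dominates the logarithm.\<close>

lemma kernel_pointwise:
 obtains C where "C > 0" "!!s t z. 0 < t ==> t <= s ==> s <= 1 ==>
  abs (E s z - E t z) <= C * s powr (3/8) * (t + P z) powr (-7/8) & abs (dx (E s) z - dx (E t) z) <= C * s powr (3/8) * (t + P z) powr (-7/8)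
  & abs (dy (E s) z - dy (E t) z) <= C * s powr (3/8) * (t + P z) powr (-7/8)"
proof -
 obtain B where B: "B >= 1" "!!z. P z <= B" "!!z. abs (S z) <= B" using P_upper by blast
 define G where "G = sqrt (B + kp * B)"
 have G0: "G >= 0" using B kappa_pos by (simp add: G_def)
 have G: "abs (dx P z) <= G * sqrt (P z)" "abs (dy P z) <= G * sqrt (P z)" for z
 proof -
  have "kp * P z <= kp * B" using B(2)[of z] kappa_pos by (intro mult_left_mono) auto
  then have "P z * (S z + kp * P z) <= P z * (B + kp * B)" using B(3)[of z] P_nonneg[of z] by (intro mult_left_mono) auto
  then have "(dx P z)^2 <= P z * (B + kp * B)" "(dy P z)^2 <= P z * (B + kp * B)"
   using P_grad[of z] zero_le_power2[of "dx P z"] zero_le_power2[of "dy P z"] by linarith+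
  then show "abs (dx P z) <= G * sqrt (P z)" "abs (dy P z) <= G * sqrt (P z)"
   unfolding G_def by (subst real_sqrt_mult[symmetric], intro real_le_rsqrt, simp add: mult.commute)+
 qed
 define C where "C = 6 * (1 + B) + G"
 have C0: "C > 0" using B G0 by (simp add: C_def add_pos_nonneg)
 show ?thesis
 proof (rule that[OF C0])
  fix s t z assume t: "0 < t" "t <= s" "s <= (1::real)"
  define p where "p = t + P z"
  have p: "p > 0" "p <= s + P z" "p <= 1 + B" "P z <= p" "s <= s + P z" using t P_nonneg[of z] B(2)[of z] by (auto simp: p_def add_pos_nonneg)
  have q: "s + P z > 0" using p by linarith
  have Q: "s powr (3/8) * p powr (-7/8) >= 0" by simp
  have fp: "1 <= 4 * pi" using pi_gt3 by simp
  have red: "abs (- 1 / (4 * pi) * a - - 1 / (4 * pi) * b) <= abs (a - b)" for a b :: real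
  proof -
   have "- 1 / (4 * pi) * a - - 1 / (4 * pi) * b = (b - a) / (4 * pi)" by (simp add: field_simps)
   then have "abs (- 1 / (4 * pi) * a - - 1 / (4 * pi) * b) = abs (a - b) / (4 * pi)" by (simp add: abs_divide)
   also have "... <= abs (a - b)" using fp by (simp add: divide_le_eq mult_le_cancel_left1)
   finally show ?thesis .
  qed
  have ra: "s / (s + P z) <= s powr (3/8) * p powr (- 3/8)"
  proof -
   have "s / (s + P z) <= (s / (s + P z)) powr (3/8)"
    using powr_mono'[of "3/8" 1 "s / (s + P z)"] t q p by simp
   also have "... = s powr (3/8) / (s + P z) powr (3/8)" using t q by (simp add: powr_divide)
   also have "... <= s powr (3/8) / p powr (3/8)" using p by (intro divide_left_mono powr_mono2) auto
   finally show ?thesis by (simp add: powr_minus_divide)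
  qed
  have 1: "abs (E s z - E t z) <= 6 * (s powr (3/8) * p powr (- 3/8))"
  proof -
   define x where "x = (s - t) / p"
   have x0: "x >= 0" using t p by (simp add: x_def)
   have "abs (ln (s + P z) - ln p) = ln (1 + x)"
   proof -
    have "ln (s + P z) - ln p = ln ((s + P z) / p)" using p q by (simp add: ln_div)
    also have "(s + P z) / p = 1 + x" using p by (simp add: x_def p_def field_simps)
    finally show ?thesis using x0 by simp
   qed
   also have "... <= 6 * x powr (3/8)"
   proof (cases "x <= 1")
    case True
    have "ln (1 + x) <= x" using x0 by (rule ln_add_one_self_le_self)
    also have "... <= x powr (3/8)" using powr_mono'[of "3/8" 1 x] True x0 by simp
    also have "... <= 6 * x powr (3/8)" by simp
    finally show ?thesis .
   next
    case False
    have "ln (1 + x) <= (1 + x) powr (3/8) / (3/8)" using False by (intro ln_powr_bound) auto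
    also have "(1 + x) powr (3/8) <= (2 * x) powr (3/8)" using False by (intro powr_mono2) auto
    also have "... = 2 powr (3/8) * x powr (3/8)" using x0 by (simp add: powr_mult)
    also have "... <= 2 * x powr (3/8)" using powr_mono[of "3/8" 1 "2::real"] by (intro mult_right_mono) auto
    finally have "ln (1 + x) <= 16 / 3 * x powr (3/8)" using False by simp
    also have "... <= 6 * x powr (3/8)" by (intro mult_right_mono) auto
    finally show ?thesis .
   qed
   also have "... <= 6 * (s / p) powr (3/8)" using t p by (intro mult_left_mono powr_mono2) (auto simp: x_def divide_right_mono)
   also have "... = 6 * (s powr (3/8) * p powr (- 3/8))" using t p by (simp add: powr_divide powr_minus_divide)
   finally show ?thesis using red[of "ln (s + P z)" "ln p"] by (simp add: E_def p_def)
  qed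
  have "p powr (- 3/8) = p powr (1/2) * p powr (-7/8)" by (simp add: powr_add[symmetric])
  also have "... <= (1 + B) * p powr (-7/8)"
  proof (rule mult_right_mono)
   have "p powr (1/2) <= (1 + B) powr (1/2)" using p by (intro powr_mono2) auto
   also have "... <= (1 + B) powr 1" using B by (intro powr_mono) auto
   finally show "p powr (1/2) <= 1 + B" using B by simp
  qed simp
  finally have pp: "p powr (- 3/8) <= (1 + B) * p powr (-7/8)" .
  have "abs (E s z - E t z) <= 6 * (s powr (3/8) * ((1 + B) * p powr (-7/8)))"
   by (rule order_trans[OF 1]) (intro mult_left_mono pp; simp)
  also have "... = 6 * (1 + B) * (s powr (3/8) * p powr (-7/8))" by (simp add: algebra_simps)
  also have "... <= C * (s powr (3/8) * p powr (-7/8))" using G0 by (intro mult_right_mono Q) (simp add: C_def)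
  finally have r1: "abs (E s z - E t z) <= C * (s powr (3/8) * p powr (-7/8))" .
  have r2: "abs (D / (s + P z) - D / p) <= C * (s powr (3/8) * p powr (-7/8))" if D: "abs D <= G * sqrt (P z)" for D
  proof -
   have "D / (s + P z) - D / p = D * (p - (s + P z)) / ((s + P z) * p)" using p q by (subst diff_frac_eq) (auto simp: algebra_simps)
   also have "... = D * (t - s) / ((s + P z) * p)" by (simp add: p_def)
   finally have "D / (s + P z) - D / p = - (D * (s - t) / ((s + P z) * p))" by (simp add: minus_divide_left algebra_simps)
   then have "abs (D / (s + P z) - D / p) = abs D * (s - t) / ((s + P z) * p)" using t p q by (simp add: abs_mult)
   also have "... <= (G * sqrt p) * s / ((s + P z) * p)"
    using t p q D mult_left_mono[OF real_sqrt_le_mono[OF p(4)] G0] G0 by (intro divide_right_mono mult_mono) auto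
   also have "... = G * (s / (s + P z)) * (sqrt p / p)" by simp
   also have "... <= G * (s powr (3/8) * p powr (- 3/8)) * (sqrt p / p)" using ra G0 p by (intro mult_right_mono mult_left_mono) auto
   also have "sqrt p / p = p powr (- 1/2)" using p powr_diff[of p "1/2" 1] by (simp add: powr_half_sqrt)
   also have "G * (s powr (3/8) * p powr (- 3/8)) * p powr (- 1/2) = G * (s powr (3/8) * (p powr (- 3/8) * p powr (- 1/2)))" by simp
   also have "p powr (- 3/8) * p powr (- 1/2) = p powr (-7/8)" by (simp add: powr_add[symmetric])
   also have "G * (s powr (3/8) * p powr (-7/8)) <= C * (s powr (3/8) * p powr (-7/8))" using B by (intro mult_right_mono Q) (simp add: C_def)
   finally show ?thesis .
  qed
  have "t > 0" "s > 0" using t by auto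
  then have "abs (dx (E s) z - dx (E t) z) <= C * (s powr (3/8) * p powr (-7/8))" "abs (dy (E s) z - dy (E t) z) <= C * (s powr (3/8) * p powr (-7/8))"
   unfolding E_C2(3,4)[OF \<open>s > 0\<close>] E_C2(3,4)[OF \<open>t > 0\<close>] using order_trans[OF red r2[OF G(1)[of z]]] order_trans[OF red r2[OF G(2)[of z]]] by (simp_all add: p_def)
  with r1 show "abs (E s z - E t z) <= C * s powr (3/8) * (t + P z) powr (-7/8) & abs (dx (E s) z - dx (E t) z) <= C * s powr (3/8) * (t + P z) powr (-7/8)
   & abs (dy (E s) z - dy (E t) z) <= C * s powr (3/8) * (t + P z) powr (-7/8)" by (simp add: p_def mult.assoc)
 qed
qed

text \<open>The 1-norm of the difference of kernels times the sup of \<open>g\<close>.\<close>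

lemma kernel_cauchy:
 obtains C where "C > 0" "!!s t g B z. 0 < t ==> t <= s ==> s <= 1 ==> cont g ==> (!!z. abs (g z) <= B) ==>
  abs (conv (E s) g z - conv (E t) g z) <= B * (C * s powr (3/8)) & abs (conv (dx (E s)) g z - conv (dx (E t)) g z) <= B * (C * s powr (3/8))
  & abs (conv (dy (E s)) g z - conv (dy (E t)) g z) <= B * (C * s powr (3/8))"
proof -
 obtain A where A: "A > 0" "!!s t z. 0 < t ==> t <= s ==> s <= 1 ==>
  abs (E s z - E t z) <= A * s powr (3/8) * (t + P z) powr (-7/8) & abs (dx (E s) z - dx (E t) z) <= A * s powr (3/8) * (t + P z) powr (-7/8)
  & abs (dy (E s) z - dy (E t) z) <= A * s powr (3/8) * (t + P z) powr (-7/8)" using kernel_pointwise by blast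
 obtain K where K: "K > 0" "!!s. 0 < s ==> s <= 1 ==> (\<integral>z. (s + P z) powr (-7/8)) <= K" using powr_bound by blast
 show ?thesis
 proof (rule that[of "A * K"])
  fix s t B :: real and g :: "complex => real" and z assume t: "0 < t" "t <= s" "s <= (1::real)" and g: "cont g" "!!z. abs (g z) <= (B::real)"
  have B: "B >= 0" using g(2)[of 0] by linarith
  have *: "abs (conv f g z - conv h g z) <= B * (A * K * s powr (3/8))"
   if f: "cont f" "Per f" and h: "cont h" "Per h" and le: "!!z. abs (f z - h z) <= A * s powr (3/8) * (t + P z) powr (-7/8)" for f h
  proof -
   have c: "cont (%z. f z - h z)" by (intro continuous_intros f h)
   have "abs (conv f g z - conv h g z) = abs (conv (%z. f z - h z) g z)" using conv_sub(1)[OF f(1) h(1) g(1)] by simp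
   also have "... <= B * (\<integral>w. abs (f w - h w))" by (rule conv_bound[OF c Per_sub[OF f(2) h(2)] g])
   also have "... <= B * (\<integral>w. A * s powr (3/8) * (t + P w) powr (-7/8))"
    by (intro mult_left_mono integral_mono int_cont le continuous_intros f h powr_cont t B)
   also have "... <= B * (A * s powr (3/8) * K)" using K(2)[OF t(1)] t A(1) B by (auto intro!: mult_left_mono)
   finally show ?thesis by (simp add: mult_ac)
  qed
  have st: "s > 0" "t > 0" using t by auto
  note e = C2_C1[OF E_C2(1)[OF st(1)]] C2_C1[OF E_C2(1)[OF st(2)]]
  note le = A(2)[OF t]
  show "abs (conv (E s) g z - conv (E t) g z) <= B * (A * K * s powr (3/8)) & abs (conv (dx (E s)) g z - conv (dx (E t)) g z) <= B * (A * K * s powr (3/8))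
   & abs (conv (dy (E s)) g z - conv (dy (E t)) g z) <= B * (A * K * s powr (3/8))"
   using *[OF C1_cont[OF e(1)] E_per C1_cont[OF e(2)] E_per] *[OF C1_cont_dx[OF e(1)] C1_periodic(1)[OF e(1) E_per] C1_cont_dx[OF e(2)] C1_periodic(1)[OF e(2) E_per]]
    *[OF C1_cont_dy[OF e(1)] C1_periodic(2)[OF e(1) E_per] C1_cont_dy[OF e(2)] C1_periodic(2)[OF e(2) E_per]] le by blast
 qed (use A K in simp)
qed

definition tn :: "nat => real" where "tn n = 1 / (real n + 1)"

lemma tn: "tn n > 0" "tn n <= 1" "n <= m ==> tn m <= tn n"
 by (auto simp: tn_def frac_le)

lemma tn_powr: "(%n. B * (C * tn n powr (3/8))) \<longlonglongrightarrow> 0"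
proof -
 have "(%n. tn n powr (3/8)) \<longlonglongrightarrow> 0" unfolding tn_def by real_asymp
 then have "(%n. B * (C * tn n powr (3/8))) \<longlonglongrightarrow> B * (C * 0)" by (intro tendsto_intros)
 then show ?thesis by simp
qed

text \<open>By \<open>kernel_cauchy\<close> the limit exists uniformly in \<open>z\<close> for
  bounded continuous \<open>g\<close>; it is the Green potential up to an additive constant.\<close>

definition U :: "(complex => real) => complex => real" where "U g z = lim (%n. conv (E (tn n)) g z)"

lemma E_tn: "C2 (E (tn n))" "C1 (E (tn n))" "cont (E (tn n))"
 using E_C2(1)[OF tn(1)] C2_C1 C2_cont by blast+

lemma U_limit:
 assumes g: "cont g" "Per g"
 shows "(%n. conv (E (tn n)) g z) \<longlonglongrightarrow> U g z" "C1 (U g)"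
  "(%n. conv (dx (E (tn n))) g z) \<longlonglongrightarrow> dx (U g) z" "(%n. conv (dy (E (tn n))) g z) \<longlonglongrightarrow> dy (U g) z"
proof -
 obtain B where B: "!!z. abs (g z) <= B" using Per_compact_bounded[OF g] by metis
 obtain C where C: "!!s t g B z. 0 < t ==> t <= s ==> s <= 1 ==> cont g ==> (!!z. abs (g z) <= B) ==>
  abs (conv (E s) g z - conv (E t) g z) <= B * (C * s powr (3/8)) & abs (conv (dx (E s)) g z - conv (dx (E t)) g z) <= B * (C * s powr (3/8))
  & abs (conv (dy (E s)) g z - conv (dy (E t)) g z) <= B * (C * s powr (3/8))" using kernel_cauchy by metis
 note c = C[OF tn(1) tn(3) tn(2) g(1) B]
 note l = uniform_rate_limit[of "%n. conv (E (tn n)) g", OF c[THEN conjunct1] tn_powr, simplified]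
 note lx = uniform_rate_limit[of "%n. conv (dx (E (tn n))) g", OF c[THEN conjunct2, THEN conjunct1] tn_powr, simplified]
 note ly = uniform_rate_limit[of "%n. conv (dy (E (tn n))) g", OF c[THEN conjunct2, THEN conjunct2] tn_powr, simplified]
 show 1: "(%n. conv (E (tn n)) g z) \<longlonglongrightarrow> U g z" for z unfolding U_def by (rule l(1))
 note d = conv_C1[OF E_tn(2) E_per g(1)]
 have ux: "uniform_limit UNIV (%n. dx (conv (E (tn n)) g)) (%z. lim (%n. conv (dx (E (tn n))) g z)) sequentially"
  "uniform_limit UNIV (%n. dy (conv (E (tn n)) g)) (%z. lim (%n. conv (dy (E (tn n))) g z)) sequentially"
  unfolding d(2,3) by (rule lx(3) ly(3))+
 note u = C1_uniform_limit[OF d(1) 1 ux]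
 show "C1 (U g)" by (rule u(1))
 show "(%n. conv (dx (E (tn n))) g z) \<longlonglongrightarrow> dx (U g) z" "(%n. conv (dy (E (tn n))) g z) \<longlonglongrightarrow> dy (U g) z"
  unfolding u by (rule lx(1) ly(1))+
qed

text \<open>The second derivatives of the kernels have no uniform integral bound. One derivative is
  therefore moved onto \<open>g\<close>, which is where \<open>g\<close> is used as a
  \<open>C1\<close> function.\<close>

lemma U_C2:
 assumes g: "C1 g" "Per g"
 shows "C2 (U g)" "(%n. conv (lap (E (tn n))) g z) \<longlonglongrightarrow> lap (U g) z"
proof -
 note gx = C1_cont_dx[OF g(1)] C1_periodic(1)[OF g] and gy = C1_cont_dy[OF g(1)] C1_periodic(2)[OF g] and gc = C1_cont[OF g(1)]
 have e: "dx (U g) = U (dx g)" "dy (U g) = U (dy g)"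
  using LIMSEQ_unique[OF U_limit(3)[OF gc g(2)] U_limit(1)[OF gx, folded conv_dx_swap(1)[OF E_tn(2) E_per g]]]
   LIMSEQ_unique[OF U_limit(4)[OF gc g(2)] U_limit(1)[OF gy, folded conv_dx_swap(2)[OF E_tn(2) E_per g]]] by auto
 show "C2 (U g)" unfolding C2_def e using U_limit(2) gx gy gc g(2) by auto
 have "conv (lap (E (tn n))) g z = conv (dx (E (tn n))) (dx g) z + conv (dy (E (tn n))) (dy g) z" for n
 proof -
  note ex = C2_dx[OF E_tn(1), of n] C1_periodic(1)[OF E_tn(2) E_per, of n] and ey = C2_dy[OF E_tn(1), of n] C1_periodic(2)[OF E_tn(2) E_per, of n]
  show ?thesis
   unfolding conv_dx_swap(1)[OF ex g, symmetric] conv_dx_swap(2)[OF ey g, symmetric]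
   using integrable_conv[OF C1_cont_dx[OF ex(1)] gc] integrable_conv[OF C1_cont_dy[OF ey(1)] gc]
   by (simp add: conv_def lap_def distrib_right)
 qed
 then show "(%n. conv (lap (E (tn n))) g z) \<longlonglongrightarrow> lap (U g) z"
  unfolding lap_def e using tendsto_add[OF U_limit(3)[OF gx] U_limit(4)[OF gy]] by simp
qed

lemma P_dist: obtains C where "C > 0" "!!z. EX l:L. norm (z - l) <= C * sqrt (P z)"
proof -
 obtain p0 where p0: "p0 > 0" "!!z. (!!l. l : L ==> R <= norm (z - l)) ==> p0 <= P z" using P_away by metis
 define N where "N = norm o1 + norm o2"
 have N: "N >= 0" by (simp add: N_def)
 show ?thesis
 proof (rule that[of "2 + N / sqrt p0"])
  fix z
  show "EX l:L. norm (z - l) <= (2 + N / sqrt p0) * sqrt (P z)"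
  proof (cases "EX l:L. norm (z - l) < R")
   case True
   then obtain l where l: "l : L" "norm (z - l) <= R" by (auto intro: less_imp_le)
   have "(norm (z - l))^2 <= 4 * P z" using P_lower_near[OF l(2)] zero_le_power2[of "norm (z - l)"] Per_diff[OF P_per l(1), of z] by linarith
   then have "norm (z - l) <= sqrt (4 * P z)" by (rule real_le_rsqrt)
   also have "... = 2 * sqrt (P z)" by (simp add: real_sqrt_mult)
   also have "... <= (2 + N / sqrt p0) * sqrt (P z)" using N p0 P_nonneg[of z] by (intro mult_right_mono) auto
   finally show ?thesis using l by blast
  next
   case False
   then have "p0 <= P z" by (intro p0(2)) auto
   then have "N / sqrt p0 * sqrt p0 <= N / sqrt p0 * sqrt (P z)" using N p0 by (intro mult_left_mono real_sqrt_le_mono) auto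
   moreover have "N / sqrt p0 * sqrt p0 = N" "0 <= sqrt (P z)" using p0 P_nonneg[of z] by auto
   ultimately have "N <= (2 + N / sqrt p0) * sqrt (P z)" unfolding distrib_right by linarith
   then show ?thesis using ex_lattice_shift[of z] norm_D[of "z - _"] unfolding N_def by (meson order_trans)
  qed
 qed (use N p0 in \<open>auto intro: add_pos_nonneg\<close>)
qed

text \<open>\<open>rh = 1/area - lap (E s)\<close> has integral 1 and is
  \<open>O(s / (s + P)^2)\<close>, an approximate identity at the lattice. The Lipschitz bound on
  \<open>g\<close> contributes a factor \<open>sqrt P\<close>, and the error becomes
  \<open>s powr (3/8)\<close> times the bounded integral of exponent \<open>-7/8\<close>.\<close>

lemma lap_E_delta:
 assumes g: "C1 g" "Per g"
 shows "(%n. conv (lap (E (tn n))) g z) \<longlonglongrightarrow> (\<integral>w. g w) / area - g z"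
proof -
 obtain B where B: "B > 0" "!!z w. abs (g z - g w) <= B * norm (z - w)" using C1_global_lipschitz[OF g] by blast
 obtain C where C: "C > 0" "!!z. EX l:L. norm (z - l) <= C * sqrt (P z)" using P_dist by blast
 obtain A where A: "A >= 1" "!!z. P z <= A" "!!z. abs (S z) <= A" using P_upper by blast
 obtain K where K: "K > 0" "!!s. 0 < s ==> s <= 1 ==> (\<integral>z. (s + P z) powr (-7/8)) <= K" using powr_bound by blast
 define Q where "Q = A + 2 * kp * (1 + A)"
 have Q: "Q > 0" using A kappa_pos by (simp add: Q_def add_pos_nonneg)
 have gc: "cont g" by (rule C1_cont[OF g(1)])
 have "abs (conv (lap (E s)) g z - ((\<integral>w. g w) / area - g z)) <= B * C * Q * K * s powr (3/8)" if s: "0 < s" "s <= 1" for s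
 proof -
  define rh where "rh w = kp / (4 * pi) - lap (E s) w" for w
  have cl [continuous_intros]: "cont (lap (E s))" "cont g" by (rule C2_cont_lap[OF E_C2(1)[OF s(1)]] gc)+
  have cr [continuous_intros]: "cont rh" unfolding rh_def[abs_def] by (intro continuous_intros)
  have pl: "Per (lap (E s))" by (rule C2_periodic[OF E_C2(1)[OF s(1)] E_per])
  have pr: "Per rh" unfolding rh_def[abs_def] by (rule Per_compose[OF pl])
  have ka: "kp / (4 * pi) = 1 / area" using kappa by simp
  have "(\<integral>w. rh w) = 1"
   unfolding rh_def ka using integral_lin(4)[OF continuous_on_const cl(1)] integral_lap_0[OF E_C2(1)[OF s(1)] E_per] area_pos by (simp add: measure_space_M)
  moreover have "conv (lap (E s)) g z = conv (%_. 1 / area) g z - conv rh g z"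
   using conv_sub(1)[OF continuous_on_const cr gc, of "1 / area" z] by (simp add: rh_def ka)
  moreover have "conv rh g z = conv g rh z" by (rule conv_commute[OF cr pr gc g(2)])
  ultimately have e: "(\<integral>w. g w) / area - g z - conv (lap (E s)) g z = conv g rh z - (\<integral>w. g z * rh w)"
   by (simp add: conv_def)
  also have "... = (\<integral>w. (g (z - w) - g z) * rh w)"
   unfolding conv_def left_diff_distrib by (rule integral_lin(4)[symmetric]; intro continuous_intros cont_flip)
  also have "abs (...) <= (\<integral>w. abs ((g (z - w) - g z) * rh w))" by (rule abs_integral_le)
  also have "... <= (\<integral>w. B * C * Q * s powr (3/8) * (s + P w) powr (-7/8))"
  proof (rule integral_mono)
   fix w
   define p where "p = s + P w"
   have p: "p > 0" "P w <= p" "s <= p" "p <= 1 + A" using s P_nonneg[of w] A(2)[of w] spos[OF s(1), of w] by (auto simp: p_def)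
   obtain l where l: "l : L" "norm (w - l) <= C * sqrt (P w)" using C(2) by blast
   have "abs (g (z - w) - g z) = abs (g (z - w + l) - g z)" using Per_add[OF g(2) l(1)] by simp
   also have "... <= B * norm (z - w + l - z)" by (rule B)
   also have "norm (z - w + l - z) = norm (w - l)" by (metis add_diff_cancel_left' add_diff_eq diff_add_eq diff_diff_eq2 norm_minus_commute)
   also have "B * norm (w - l) <= B * (C * sqrt p)"
    using order_trans[OF l(2) mult_left_mono[OF real_sqrt_le_mono[OF p(2)], of C]] B C by (intro mult_left_mono) auto
   finally have 1: "abs (g (z - w) - g z) <= B * (C * sqrt p)" .
   have "rh w = s * (S w + kp * (2 * P w + s)) / (4 * pi * p^2)"
    unfolding rh_def E_C2(2)[OF s(1)] using p spos[OF s(1), of w] by (simp add: p_def divide_simps) (simp add: sqr algebra_simps)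
   then have "abs (rh w) = s * abs (S w + kp * (2 * P w + s)) / (4 * pi * p^2)" using s by (simp add: abs_mult)
   also have "... <= s * Q / (1 * p^2)"
   proof (intro frac_le mult_left_mono mult_right_mono mult_nonneg_nonneg)
    have "kp * (2 * P w + s) <= kp * (2 * (1 + A))" using p kappa_pos A(2)[of w] s by (intro mult_left_mono) auto
    moreover have "0 <= kp * (2 * P w + s)" using kappa_pos P_nonneg[of w] s by simp
    ultimately show "abs (S w + kp * (2 * P w + s)) <= Q" using A(3)[of w] by (simp add: Q_def algebra_simps)
    show "1 <= 4 * pi" using pi_gt3 by simp
   qed (use s Q p in auto)
   finally have 2: "abs (rh w) <= s * Q / p^2" by simp
   have "abs ((g (z - w) - g z) * rh w) <= B * (C * sqrt p) * (s * Q / p^2)" unfolding abs_mult using 1 2 B(1) C(1) p(1) by (intro mult_mono) auto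
   also have "... = B * C * Q * (s * (sqrt p / p^2))" by simp
   also have "... <= B * C * Q * (s powr (3/8) * p powr (-7/8))"
   proof (rule mult_left_mono)
    show "0 <= B * C * Q" using B(1) C(1) Q by simp
    have "sqrt p / p^2 = p powr (- 3/2)" using p powr_diff[of p "1/2" 2] by (simp add: powr_half_sqrt)
    moreover have "s = s powr (3/8) * s powr (5/8)" using s by (simp add: powr_add[symmetric])
    ultimately have "s * (sqrt p / p^2) = s powr (3/8) * (s powr (5/8) * p powr (- 3/2))" by simp
    also have "... <= s powr (3/8) * (p powr (5/8) * p powr (- 3/2))" using s p by (intro mult_left_mono mult_right_mono powr_mono2) auto
    finally show "s * (sqrt p / p^2) <= s powr (3/8) * p powr (-7/8)" by (simp add: powr_add[symmetric])
   qed
   finally show "abs ((g (z - w) - g z) * rh w) <= B * C * Q * s powr (3/8) * (s + P w) powr (-7/8)"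
    by (simp add: p_def mult.assoc)
  qed (intro int_cont continuous_intros cont_flip[OF gc] powr_cont[OF s(1)])+
  also have "... <= B * C * Q * s powr (3/8) * K" using K(2)[OF s] B(1) C(1) Q by (auto intro!: mult_left_mono)
  finally show ?thesis by (simp add: mult_ac abs_minus_commute)
 qed
 then have *: "abs (conv (lap (E (tn n))) g z - ((\<integral>w. g w) / area - g z)) <= B * C * Q * K * tn n powr (3/8)" for n
  using tn by blast
 have "(%n. conv (lap (E (tn n))) g z - ((\<integral>w. g w) / area - g z)) \<longlonglongrightarrow> 0"
 proof (rule Lim_null_comparison)
  show "\<forall>\<^sub>F n in sequentially. norm (conv (lap (E (tn n))) g z - ((\<integral>w. g w) / area - g z)) <= B * C * Q * K * tn n powr (3/8)"
   using * by (intro always_eventually) simp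
  show "(%n. B * C * Q * K * tn n powr (3/8)) \<longlonglongrightarrow> 0" using tn_powr[of "B * C * Q" K] by (simp add: mult_ac)
 qed
 then show ?thesis by (simp add: LIM_zero_iff)
qed

end

text \<open>The exponent 7/32 in the proof is a quarter of 7/8, so the fourth power of the logarithm
  meets the integrable weight.\<close>

lemma abs_ln_bound:
 fixes A :: real
 assumes "A >= 1"
 obtains C where "C > 0" "!!x. 0 < x ==> x <= A ==> (ln x) ^ 4 <= C * x powr (-7/8)"
proof (rule that[of "(32/7 + A) ^ 4 * A powr (7/8)"])
 fix x assume x: "0 < x" "x <= A"
 have "abs (ln x) <= (32/7 + A) * (A / x) powr (7/32)"
 proof (cases "x <= 1")
  case True
  have "abs (ln x) = ln (1 / x)" using x True by (simp add: ln_div)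
  also have "... <= (1 / x) powr (7/32) / (7/32)" using x True by (intro ln_powr_bound) auto
  also have "... <= (A / x) powr (7/32) / (7/32)" using x assms by (intro divide_right_mono powr_mono2) (auto simp: divide_right_mono)
  also have "... = 32/7 * (A / x) powr (7/32)" by simp
  also have "... <= (32/7 + A) * (A / x) powr (7/32)" using assms by (intro mult_right_mono) auto
  finally show ?thesis .
 next
  case False
  then have "abs (ln x) = ln x" by simp
  also have "... <= x - 1" using x by (intro ln_le_minus_one) auto
  also have "... <= (32/7 + A) * 1" using x by simp
  also have "... <= (32/7 + A) * (A / x) powr (7/32)" using x assms by (intro mult_left_mono ge_one_powr_ge_zero) auto
  finally show ?thesis .
 qed
 from power_mono[OF this, of 4] have "abs (ln x) ^ 4 <= (32/7 + A) ^ 4 * ((A / x) powr (7/32)) ^ 4" by (simp add: power_mult_distrib)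
 also have "((A / x) powr (7/32)) ^ 4 = (A / x) powr (7/8)" using x assms by (subst powr_realpow[symmetric]) (auto simp: powr_powr)
 also have "... = A powr (7/8) * x powr (-7/8)" using x assms by (simp add: powr_divide powr_minus_divide)
 finally show "(ln x) ^ 4 <= (32/7 + A) ^ 4 * A powr (7/8) * x powr (-7/8)" by (simp add: mult.assoc)
qed (use assms in simp)

context weight
begin

lemma integrable_M [intro]: "cont f ==> integrable M f" for f :: "complex => real"
 by (rule int_cont)

lemma E_fourth: obtains C where "C > 0" "!!s. 0 < s ==> s <= 1 ==> (\<integral>z. (E s z) ^ 4) <= C"
proof -
 obtain B where B: "B >= 1" "!!z. P z <= B" "!!z. abs (S z) <= B" using P_upper by blast
 obtain C where C: "C > 0" "!!x. 0 < x ==> x <= 1 + B ==> (ln x) ^ 4 <= C * x powr (-7/8)" using abs_ln_bound[of "1 + B"] B by auto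
 obtain K where K: "K > 0" "!!s. 0 < s ==> s <= 1 ==> (\<integral>z. (s + P z) powr (-7/8)) <= K" using powr_bound by blast
 show ?thesis
 proof (rule that[of "C * K"])
  fix s :: real assume s: "0 < s" "s <= 1"
  have "(\<integral>z. (E s z) ^ 4) <= (\<integral>z. C * (s + P z) powr (-7/8))"
  proof (rule integral_mono)
   fix z
   have "abs (E s z) <= abs (ln (s + P z))"
    using pi_gt3 by (simp add: E_def abs_mult divide_le_eq mult_le_cancel_left1)
   from power_mono[OF this, of 4] have "(E s z) ^ 4 <= (ln (s + P z)) ^ 4" by simp
   also have "... <= C * (s + P z) powr (-7/8)" using spos[OF s(1), of z] B(2)[of z] s by (intro C(2)) auto
   finally show "(E s z) ^ 4 <= C * (s + P z) powr (-7/8)" .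
  qed (intro integrable_M continuous_intros powr_cont[OF s(1)] C2_cont[OF E_C2(1)[OF s(1)]])+
  also have "... <= C * K" using K(2)[OF s] C(1) by (simp add: mult_left_mono)
  finally show "(\<integral>z. (E s z) ^ 4) <= C * K" .
 qed (use C(1) K(1) in simp)
qed

text \<open>Hoelder with exponents 4 and 4/3, the 4/3-norm of \<open>g\<close> being interpolated
  between the 2-norm and the 1-norm; in effect Cauchy-Schwarz twice.\<close>

lemma conv_E_bound:
 obtains C where "C > 0" "!!s g z. 0 < s ==> s <= 1 ==> cont g ==>
  (conv (E s) g z)^2 <= C * sqrt (\<integral>w. (g w)^2) * (\<integral>w. abs (g w))"
proof -
 obtain C where C: "C > 0" "!!s. 0 < s ==> s <= 1 ==> (\<integral>z. (E s z) ^ 4) <= C" using E_fourth by blast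
 show ?thesis
 proof (rule that[of "sqrt C"])
  fix s :: real and g :: "complex => real" and z
  assume s: "0 < s" "s <= 1" and g [continuous_intros]: "cont g"
  have ce: "cont (E s)" by (rule C2_cont[OF E_C2(1)[OF s(1)]])
  have c [continuous_intros]: "cont (%w. E s (z - w))" by (rule cont_flip[OF ce])
  have "abs (conv (E s) g z) <= (\<integral>w. abs (E s (z - w) * g w))" unfolding conv_def by (rule abs_integral_le)
  also have "... = (\<integral>w. abs ((E s (z - w) * sqrt (abs (g w))) * sqrt (abs (g w))))" by (simp add: abs_mult mult.assoc)
  finally have "(conv (E s) g z)^2 <= (\<integral>w. abs ((E s (z - w) * sqrt (abs (g w))) * sqrt (abs (g w))))^2" by (rule abs_le_square_iff[THEN iffD1, OF order_trans]) simp
  also have "... <= (\<integral>w. (E s (z - w) * sqrt (abs (g w)))^2) * (\<integral>w. (sqrt (abs (g w)))^2)"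
   by (intro Cauchy_Schwarz_integral(2) cont_M integrable_M continuous_intros)
  also have "... = (\<integral>w. (E s (z - w))^2 * abs (g w)) * (\<integral>w. abs (g w))" by (simp add: power_mult_distrib)
  also have "... <= sqrt C * sqrt (\<integral>w. (g w)^2) * (\<integral>w. abs (g w))"
  proof (intro mult_right_mono)
   have "(\<integral>w. (E s (z - w))^2 * abs (g w))^2 <= (\<integral>w. ((E s (z - w))^2)^2) * (\<integral>w. abs (g w)^2)"
    by (intro Cauchy_Schwarz_integral(3) cont_M integrable_M continuous_intros)
   also have "(\<integral>w. ((E s (z - w))^2)^2) = (\<integral>w. (E s w) ^ 4)"
    using integral_flip[of "%w. (E s w) ^ 4" z] ce Per_compose[OF E_per, of "%x. x ^ 4" s] by (simp add: continuous_intros)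
   also have "(\<integral>w. (E s w) ^ 4) * (\<integral>w. abs (g w)^2) <= C * (\<integral>w. (g w)^2)" using C(2)[OF s] by (simp add: mult_right_mono)
   finally show "(\<integral>w. (E s (z - w))^2 * abs (g w)) <= sqrt C * sqrt (\<integral>w. (g w)^2)"
    unfolding real_sqrt_mult[symmetric] by (rule real_le_rsqrt)
  qed simp
  finally show "(conv (E s) g z)^2 <= sqrt C * sqrt (\<integral>w. (g w)^2) * (\<integral>w. abs (g w))" .
 qed (use C in simp)
qed

text \<open>The inverse of \<open>- lap\<close> on data of mean zero, normalised to mean zero; for
  other data it inverts up to the mean.\<close>

definition K :: "(complex => real) => complex => real" where "K g z = U g z - (\<integral>w. U g w) / area"

lemma U_per: assumes "cont g" "Per g" shows "Per (U g)"
proof -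
 have "U g (z + l) = U g z" if l: "l : L" for z l
  unfolding U_def using Per_add[OF Per_conv[OF E_per] l, of _ g z] by simp
 then show ?thesis by (simp add: Per_def)
qed

lemma K_props:
 assumes g: "cont g" "Per g"
 shows "C1 (K g)" "cont (K g)" "Per (K g)" "(\<integral>z. K g z) = 0" "(!!z. g (- z) = g z) ==> K g (- z) = K g z"
proof -
 note u = U_limit(2)[OF g]
 show c: "C1 (K g)" unfolding K_def[abs_def] by (intro C1_sub(1) C1_const(1) u)
 then show "cont (K g)" by (rule C1_cont)
 show "Per (K g)" unfolding K_def[abs_def] by (rule Per_compose[OF U_per[OF g]])
 show "(\<integral>z. K g z) = 0" unfolding K_def using integrable_M[OF C1_cont[OF u]] area_pos by (simp add: measure_space_M)
 assume e: "!!z. g (- z) = g z"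
 show "K g (- z) = K g z" unfolding K_def U_def using conv_even[OF E_tn(3) E_per E_even g e] by simp
qed

lemma K_lin:
 assumes f: "cont f" "Per f" and g: "cont g" "Per g"
 shows "K (%z. f z + c * g z) z = K f z + c * K g z"
proof -
 have fg: "cont (%z. f z + c * g z)" "Per (%z. f z + c * g z)"
  using f g by (auto intro!: continuous_intros simp: Per_def)
 have "(%n. conv (E (tn n)) f z + c * conv (E (tn n)) g z) \<longlonglongrightarrow> U f z + c * U g z" for z
  by (intro tendsto_intros U_limit(1) f g)
 then have u: "U (%z. f z + c * g z) = (%z. U f z + c * U g z)"
  unfolding conv_sub(2)[OF E_tn(3) f(1) g(1), symmetric] by (intro ext LIMSEQ_unique[OF U_limit(1)[OF fg]]) auto
 show ?thesis unfolding K_def u using integral_lin(1)[OF C1_cont[OF U_limit(2)[OF f]] C1_cont[OF U_limit(2)[OF g]], of c]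
  by (simp add: add_divide_distrib algebra_simps)
qed

lemma K_C2:
 assumes g: "C1 g" "Per g"
 shows "C2 (K g)" "lap (K g) z = (\<integral>w. g w) / area - g z"
proof -
 have l: "lap (U g) z = (\<integral>w. g w) / area - g z" using LIMSEQ_unique[OF U_C2(2)[OF g] lap_E_delta[OF g]] .
 show "C2 (K g)" "lap (K g) z = (\<integral>w. g w) / area - g z"
  unfolding K_def[abs_def] using C2_sub[OF U_C2(1)[OF g] C2_const(1)] l by (simp_all add: C2_const)
qed

lemma K_bound:
 obtains C where "C > 0" "!!g z. cont g ==> Per g ==> abs (K g z) <= C * sqrt (sqrt (\<integral>w. (g w)^2) * (\<integral>w. abs (g w)))"
proof -
 obtain C where C: "C > 0" "!!s g z. 0 < s ==> s <= 1 ==> cont g ==>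
  (conv (E s) g z)^2 <= C * sqrt (\<integral>w. (g w)^2) * (\<integral>w. abs (g w))" using conv_E_bound by blast
 show ?thesis
 proof (rule that[of "2 * sqrt C"])
  fix g :: "complex => real" and z assume g: "cont g" "Per g"
  define B where "B = sqrt C * sqrt (sqrt (\<integral>w. (g w)^2) * (\<integral>w. abs (g w)))"
  have b: "abs (U g z) <= B" for z
  proof (rule LIMSEQ_le_const2)
   show "(%n. abs (conv (E (tn n)) g z)) \<longlonglongrightarrow> abs (U g z)" by (intro tendsto_intros U_limit(1) g)
   have "abs (conv (E (tn n)) g z) <= B" for n
    unfolding B_def real_sqrt_mult[symmetric, of C] using C(2)[OF tn(1,2) g(1), of n z] by (intro real_le_rsqrt) (simp add: mult.assoc)
   then show "EX N. ALL n>=N. abs (conv (E (tn n)) g z) <= B" by blast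
  qed
  have "abs (\<integral>w. U g w) <= (\<integral>w. abs (U g w))" by (rule abs_integral_le)
  also have "... <= (\<integral>w. B)" by (intro integral_mono b integrable_M continuous_intros C1_cont[OF U_limit(2)[OF g]])
  finally have "abs ((\<integral>w. U g w) / area) <= B" using area_pos by (simp add: measure_space_M abs_divide pos_divide_le_eq mult.commute)
  then have "abs (K g z) <= 2 * B" using b[of z] unfolding K_def by linarith
  then show "abs (K g z) <= 2 * sqrt C * sqrt (sqrt (\<integral>w. (g w)^2) * (\<integral>w. abs (g w)))" by (simp add: B_def)
 qed (use C in simp)
qed

text \<open>The difference has constant Laplacian and mean zero, so Green's identity gives it zero
  Dirichlet energy.\<close>

lemma K_unique:
 assumes h: "C2 h" "Per h" "(\<integral>z. h z) = 0" and g: "C1 g" "Per g" and l: "!!z. lap h z = c - g z"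
 shows "h = K g"
proof -
 define q where "q z = h z - K g z" for z
 note k = K_props(3,4)[OF C1_cont[OF g(1)] g(2)]
 have q: "C2 q" "lap q = (%z. c - (\<integral>w. g w) / area)"
  unfolding q_def[abs_def] using C2_sub[OF h(1) K_C2(1)[OF g]] l K_C2(2)[OF g] by (simp_all add: fun_eq_iff)
 have qp: "Per q" unfolding q_def[abs_def] using h k by (intro Per_sub) auto
 have q0: "(\<integral>z. q z) = 0"
  unfolding q_def using integral_lin(4)[OF C2_cont[OF h(1)] C2_cont[OF K_C2(1)[OF g]]] h k by simp
 have "(\<integral>z. q z * lap q z) = 0" unfolding q(2) using q0 by simp
 then have 0: "dir q q = 0" using green[OF C2_C1[OF q(1)] qp q(1) qp] by simp
 note q1 = C2_C1[OF q(1)]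
 have "(dx q z)^2 + (dy q z)^2 = 0" for z
  by (rule zero_if_square_integral_0[of "%z. (dx q z)^2 + (dy q z)^2"])
   (use 0 C1_cont_dx[OF q1] C1_cont_dy[OF q1] C1_periodic[OF q1 qp] in \<open>auto simp: dir_def sqr Per_def intro!: continuous_intros\<close>)
 then have "dx q z = 0" "dy q z = 0" for z by (auto simp: sum_power2_eq_zero_iff)
 then have "(q has_derivative (%h. 0)) (at z)" for z
  using C1_has_grad[OF q1, unfolded has_grad_def] by simp
 then obtain e where e: "q z = e" for z using has_derivative_zero_constant[of UNIV q] by auto
 then have "e = 0" using q0 area_pos by (simp add: measure_space_M)
 then show ?thesis using e by (auto simp: q_def)
qed

lemma dir_Cauchy_Schwarz:
 assumes f: "C1 f" and g: "C1 g"
 shows "(dir f g)^2 <= dir f f * dir g g"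
proof -
 define n where "n f z = sqrt (grad2 f z)" for f z
 have c [continuous_intros]: "cont (n f)" if "C1 f" for f
  unfolding n_def[abs_def] by (intro continuous_intros continuous_grad2 that)
 have d: "dir f f = (\<integral>z. (n f z)^2)" for f using grad2_nonneg[of f] by (simp add: dir_def n_def grad2_def sqr)
 have "abs (dir f g) <= (\<integral>z. abs (dx f z * dx g z + dy f z * dy g z))" unfolding dir_def by (rule abs_integral_le)
 also have "... <= (\<integral>z. n f z * n g z)"
 proof (intro integral_mono integrable_M continuous_intros C1_cont_dx C1_cont_dy f g)
  fix z show "abs (dx f z * dx g z + dy f z * dy g z) <= n f z * n g z"
   using Cauchy_Schwarz_ineq2[of "Complex (dx f z) (dy f z)" "Complex (dx g z) (dy g z)"] by (simp add: inner_complex_def cmod_def n_def grad2_def)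
 qed
 finally have "(dir f g)^2 <= (\<integral>z. n f z * n g z)^2" by (rule abs_le_square_iff[THEN iffD1, OF order_trans]) simp
 also have "... <= dir f f * dir g g"
  unfolding d by (intro Cauchy_Schwarz_integral(3) cont_M integrable_M continuous_intros f g)
 finally show ?thesis .
qed

lemma dir_K:
 assumes g: "C1 g" "Per g" and f: "C1 f" "Per f" "(\<integral>z. f z) = 0"
 shows "dir f (K g) = (\<integral>z. f z * g z)"
proof -
 have "(\<integral>z. f z * lap (K g) z) = (\<integral>z. (\<integral>w. g w) / area * f z - 1 * (f z * g z))"
  unfolding K_C2(2)[OF g] by (simp add: algebra_simps)
 also have "... = (\<integral>w. g w) / area * (\<integral>z. f z) - (\<integral>z. f z * g z)"
  by (subst integral_lin(2); (intro continuous_intros C1_cont f g)?) simp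
 finally show ?thesis using green[OF f(1,2) K_C2(1)[OF g] K_props(3)[OF C1_cont[OF g(1)] g(2)]] f(3) by simp
qed

text \<open>By duality: the square norm of \<open>f\<close> equals \<open>dir f (K f)\<close>, and
  the sup bound on \<open>K f\<close> controls the energy of \<open>K f\<close> by the same square
  norm.\<close>

lemma poincare:
 obtains C where "C > 0" "!!f. C1 f ==> Per f ==> (\<integral>z. f z) = 0 ==> (\<integral>z. (f z)^2) <= C * dir f f"
proof -
 obtain C where C: "C > 0" "!!g z. cont g ==> Per g ==> abs (K g z) <= C * sqrt (sqrt (\<integral>w. (g w)^2) * (\<integral>w. abs (g w)))"
  using K_bound by blast
 define A where "A = sqrt area"
 have A: "A > 0" using area_pos by (simp add: A_def)
 show ?thesis
 proof (rule that[of "C * sqrt A * A"])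
  fix f assume f: "C1 f" "Per f" "(\<integral>z. f z) = 0"
  note c [continuous_intros] = C1_cont[OF f(1)]
  note k = K_props[OF c f(2)]
  define Y where "Y = sqrt (\<integral>z. (f z)^2)"
  have Y: "Y >= 0" "(\<integral>z. (f z)^2) = Y^2" by (simp_all add: Y_def)
  have "(\<integral>z. abs (f z))^2 <= (\<integral>z. abs (f z)^2) * (\<integral>z. 1^2)"
   using Cauchy_Schwarz_integral(3)[of "%z. abs (f z)" M "%_. 1"] cont_M[of "%z. abs (f z)"] integrable_M[of "%z. abs (f z)^2"] by (simp add: continuous_intros)
  also have "... = (Y * A)^2" using area_pos by (simp add: Y power_mult_distrib A_def measure_space_M)
  finally have a: "(\<integral>z. abs (f z)) <= Y * A" by (rule power2_le_imp_le) (use Y A in simp)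
  have b: "abs (K f z) <= C * sqrt A * Y" for z
  proof -
   have "abs (K f z) <= C * sqrt (Y * (\<integral>w. abs (f w)))" using C(2)[OF c f(2), of z] by (simp add: Y_def)
   also have "... <= C * sqrt (Y * (Y * A))" using a Y C by (intro mult_left_mono real_sqrt_le_mono) auto
   also have "... = C * sqrt A * Y" using Y by (simp add: real_sqrt_mult)
   finally show ?thesis .
  qed
  have "dir (K f) (K f) = (\<integral>z. K f z * f z)" by (rule dir_K[OF f(1,2) k(1,3,4)])
  also have "... <= (\<integral>z. C * sqrt A * Y * abs (f z))"
  proof (intro integral_mono integrable_M continuous_intros k(2))
   fix z show "K f z * f z <= C * sqrt A * Y * abs (f z)"
    using mult_right_mono[OF b[of z], of "abs (f z)"] abs_ge_self[of "K f z * f z"] by (simp add: abs_mult)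
  qed
  also have "... <= C * sqrt A * Y * (Y * A)" using a Y A C by (simp add: mult_left_mono)
  finally have d: "dir (K f) (K f) <= C * sqrt A * A * Y^2" by (simp add: sqr mult_ac)
  have "dir f (K f) = Y^2" using dir_K[OF f(1,2) f] Y by (simp add: sqr)
  then have "(Y^2)^2 <= dir f f * (C * sqrt A * A * Y^2)"
   using dir_Cauchy_Schwarz[OF f(1) k(1)] mult_left_mono[OF d dir_nonneg[of f]] by simp
  then have "Y^2 * Y^2 <= Y^2 * (C * sqrt A * A * dir f f)" by (simp add: sqr[of "Y^2"] mult_ac)
  then have "Y^2 <= C * sqrt A * A * dir f f | Y^2 = 0" by (metis mult_le_cancel_left_pos zero_less_power2 zero_power2)
  then show "(\<integral>z. (f z)^2) <= C * sqrt A * A * dir f f" unfolding Y(2) using C A dir_nonneg[of f] by auto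
 qed (use C A in simp)
qed

lemma K_sym:
 assumes f: "C1 f" "Per f" and g: "C1 g" "Per g"
 shows "(\<integral>z. K f z * g z) = (\<integral>z. f z * K g z)"
proof -
 note k = K_props[OF C1_cont[OF f(1)] f(2)] K_props[OF C1_cont[OF g(1)] g(2)]
 have "dir (K f) (K g) = dir (K g) (K f)" by (simp add: dir_def mult.commute)
 then show ?thesis using dir_K[OF g k(1,3,4)] dir_K[OF f k(6,8,9)] by (simp add: mult.commute)
qed

end

section \<open>Coercivity\<close>

lemma ln_ge_1: "0 < s ==> s <= exp (-1) ==> 1 <= ln (1 / s)" for s :: real
 using ln_le_cancel_iff[of s "exp (-1)"] by (simp add: ln_div)

text \<open>The annulus inequalities have a positive inner radius; continuity of the integral in its
  lower end carries them over to the disc.\<close>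

lemma integral_from_0_le:
 fixes f g :: "real => real"
 assumes c: "continuous_on {0..b} f" "continuous_on {0..b} g" and b: "0 < b" and d: "0 < d"
  and le: "!!a. 0 < a ==> a <= d ==> integral {a..b} f <= integral {a..b} g"
 shows "integral {0..b} f <= integral {0..b} g"
proof -
 have t: "((%a. integral {a..b} f) \<longlongrightarrow> integral {0..b} f) (at_right 0)" if c: "continuous_on {0..b} f" for f :: "real => real"
 proof -
  have i: "f integrable_on {0..b}" by (rule icont[OF c])
  have "continuous_on {0..b} (%x. integral {0..x} f)" by (rule indefinite_integral_continuous_1[OF i])
  from this[unfolded continuous_on_def, rule_format, of 0] b
  have "((%x. integral {0..x} f) \<longlongrightarrow> integral {0..0} f) (at 0 within {0..b})" by simp
  then have "((%x. integral {0..x} f) \<longlongrightarrow> 0) (at_right 0)"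
   using b by (simp add: at_within_Icc_at_right)
  then have "((%x. integral {0..b} f - integral {0..x} f) \<longlongrightarrow> integral {0..b} f - 0) (at_right 0)"
   by (intro tendsto_intros)
  moreover have "\<forall>\<^sub>F x in at_right 0. integral {0..b} f - integral {0..x} f = integral {x..b} f"
   unfolding eventually_at_right_field
  proof (intro exI[of _ b] conjI allI impI)
   fix x assume "x > 0" "x < b"
   then show "integral {0..b} f - integral {0..x} f = integral {x..b} f"
    using HK_combine[of 0 x b f] i by simp
  qed (rule b)
  ultimately show ?thesis using Lim_transform_eventually[of "%x. integral {0..b} f - integral {0..x} f" _ "at_right 0" "%x. integral {x..b} f"] by simp
 qed
 show ?thesis
 proof (rule tendsto_le[OF _ t[OF c(2)] t[OF c(1)]])
  show "\<forall>\<^sub>F a in at_right 0. integral {a..b} f <= integral {a..b} g"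
   unfolding eventually_at_right_field using d le by (intro exI[of _ d]) auto
 qed simp
qed

context weight
begin

text \<open>The tolerance 1/40 between \<open>P\<close> and \<open>|z|^2\<close> costs the factor
  \<open>(40/39)^2\<close>, which is below 10/9.\<close>

lemma eV_near:
 assumes s: "s > 0" and z: "norm z <= R"
 shows "eV s z <= 10 / 9 * (8 * s / (s + (norm z)^2)^2)"
proof -
 define t where "t = s + (norm z)^2"
 have t: "t > 0" using s by (simp add: t_def add_pos_nonneg)
 have "39 / 40 * t <= s + P z" using P_lower_near[OF z] s by (simp add: t_def distrib_left)
 then have "(39 / 40 * t)^2 <= (s + P z)^2" using t by (intro power_mono) auto
 moreover have "9 / 10 * t^2 <= (39 / 40 * t)^2" unfolding power_mult_distrib by (rule mult_right_mono) (simp_all add: sqr)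
 ultimately have "9 / 10 * t^2 <= (s + P z)^2" by linarith
 then have "eV s z <= 8 * s / (9 / 10 * t^2)"
  unfolding eV_def using s t spos[OF s, of z] by (intro divide_left_mono) auto
 then show ?thesis by (simp add: t_def)
qed

text \<open>The two zero averages exclude the constants and the dilation mode, which are the only even
 functions on which the Dirichlet form does not dominate the mass term.\<close>

lemma gap_y:
 obtains C where "C > 0" "!!s y. 0 < s ==> sqrt (3 * s) <= R / 2 ==> s <= exp (-1) ==> C2 y ==> Per y ==> (!!z. y (- z) = y z) ==>
  circ y (sqrt (s / 3)) = 0 ==> circ y (sqrt (3 * s)) = 0 ==>
  (\<integral>z. eV s z * (y z)^2) <= (8 / 9 + C * s * ln (1 / s)) * dir y y & (\<integral>z. (y z)^2) <= C * ln (1 / s) * dir y y"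
proof -
 obtain Cf where Cf: "Cf > 0" "!!s f. s > 0 ==> cont f ==> Per f ==> (!!z. 0 <= f z) ==>
  (\<integral>z. eV s z * f z) <= ring 0 R (%z. eV s z * f z) + Cf * s * (\<integral>z. f z)"
  using near_far by blast
 obtain p where p: "p > 0" "!!f. C1 f ==> Per f ==> (\<integral>z. f z) = 0 ==> (\<integral>z. (f z)^2) <= p * dir f f" using poincare by blast
 define B where "B = area * (2 + 2 * p) / (3 / 4 * pi * R^2)"
 have B: "B > 0" unfolding B_def using area_pos p(1) R_props(1) by (intro divide_pos_pos mult_pos_pos) auto
 define K where "K = p + B"
 have K: "K > 0" using p B by (simp add: K_def)
 show ?thesis
 proof (rule that[of "K + Cf * K"], goal_cases)
  case 1 show ?case using Cf K by (simp add: add_pos_pos)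
 next
  case (2 s y)
  note s = 2(1) and sR = 2(2) and y = C2_C1[OF 2(4)] and yp = 2(5) and even = 2(6) and z1 = 2(7) and z2 = 2(8)
  note c [continuous_intros] = C1_cont[OF y] continuous_grad2[OF y] eV_cont[OF s]
  have l1: "1 <= ln (1 / s)" by (rule ln_ge_1[OF s 2(3)])
  have a0: "0 < sqrt (3 * s)" "sqrt (s / 3) <= R" "0 < sqrt (s / 3)"
  proof -
   have "sqrt (s / 3) <= sqrt (3 * s)" by (rule real_sqrt_le_mono) (use s in simp)
   then show "sqrt (s / 3) <= R" using sR R_props(1) by linarith
  qed (use s in auto)
  define d where "d = dir y y"
  have d0: "0 <= d" unfolding d_def by (rule dir_nonneg)
  have gp: "Per (grad2 y)" unfolding grad2_def[abs_def] using C1_periodic[OF y yp] by (simp add: Per_def)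
  have ann: "ring a b (grad2 y) <= d" if "0 <= a" "b <= R" for a b
   using annulus_le_torus[OF c(2) gp grad2_nonneg that] unfolding d_def dir_def grad2_def[abs_def] sqr .
  define u where "u z = 8 * s / (s + (norm z)^2)^2 * (y z)^2" for z
  have cu: "cont u"
  proof -
   have "s + (norm z)^2 > 0" for z :: complex using s by (simp add: add_pos_nonneg)
   then show ?thesis unfolding u_def[abs_def] by (intro continuous_intros) (auto simp: less_imp_neq[symmetric])
  qed
  have "integral {0..R} (%r. 5 / 4 * (r * circ u r)) <= integral {0..R} (%r. r * circ (grad2 y) r)"
  proof (rule integral_from_0_le[OF _ _ R_props(1) a0(3)])
   fix a :: real assume a: "0 < a" "a <= sqrt (s / 3)"
   show "integral {a..R} (%r. 5 / 4 * (r * circ u r)) <= integral {a..R} (%r. r * circ (grad2 y) r)"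
    using annulus_gap[OF y even s a _ z1 z2, of R] sR R_props(1) unfolding u_def[abs_def] by simp
  qed (intro continuous_intros continuous_on_subset[OF continuous_circ[OF cu]] continuous_on_subset[OF continuous_circ[OF c(2)]] subset_UNIV)+
  then have "5 / 4 * ring 0 R u <= ring 0 R (grad2 y)" by (simp add: ring_def)
  also have "... <= d" by (rule ann) simp_all
  finally have 1: "5 / 4 * ring 0 R u <= d" .
  have "ring 0 R (%z. eV s z * (y z)^2) <= ring 0 R (%z. 10 / 9 * u z)"
  proof (intro ring_mono continuous_intros cu)
   fix z :: complex assume "norm z <= R"
   from mult_right_mono[OF eV_near[OF s this], of "(y z)^2"]
   show "eV s z * (y z)^2 <= 10 / 9 * u z" unfolding u_def by (simp only: mult.assoc) simp
  qed simp
  \<comment> \<open>\<open>8/9 = 10/9 * 4/5\<close>: the loss from replacing \<open>P\<close> by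
    \<open>|z|^2\<close> times the inverse of the annulus gain 5/4. The product stays below
    1.\<close>
  then have near: "ring 0 R (%z. eV s z * (y z)^2) <= 8 / 9 * d" using 1 ring_lin(2)[OF cu cu, of 0 R "10 / 9"] by simp
  define Y where "Y = (\<integral>z. (y z)^2)"
  define m where "m = (\<integral>z. y z) / area"
  define X where "X = ring (R / 2) R (%z. (y z)^2)"
  have cy2: "cont (%z. (y z)^2)" by (intro continuous_intros)
  \<comment> \<open>The zero average at radius \<open>sqrt (3 s)\<close> turns energy into a square
    bound on the outer annulus, at the cost of the logarithm of the ratio of the radii.\<close>
  have X: "X <= ln (1 / s) * d"
  proof -
   define e where "e = ln (1 / s) / 2 * (d / (2 * pi))"
   have e: "e >= 0" using l1 d0 by (simp add: e_def)
   have "integral {R / 2..R} (%r. r * circ (%z. (y z)^2) r) <= integral {R / 2..R} (%r. e + 2 / 5 * (r * circ (grad2 y) r))"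
   proof (rule integral_le)
    fix r assume r: "r : {R / 2..R}"
    define J where "J = integral {sqrt (3 * s)..r} (%r. r * circ (grad2 y) r)"
    have r0: "r > 0" "r <= 1" using r R_props(1,2) by auto
    have "0 <= ring (sqrt (3 * s)) r (grad2 y) / (2 * pi)" using a0 by (intro divide_nonneg_nonneg ring_nonneg c(2) grad2_nonneg) auto
    then have J0: "0 <= J" unfolding ring_def J_def by simp
    have G0: "0 <= circ (grad2 y) r" using circ_mono[of "%_. 0" "grad2 y" r] c(2) grad2_nonneg[of y] by (simp add: circ_def)
    have "circ (%z. (y z)^2) r <= ln (r / sqrt (3 * s)) * J + 2 / 5 * r^2 * circ (grad2 y) r"
     unfolding J_def by (rule circ_square_bound[OF y even a0(1) z2]) (use r sR in auto)
    also have "ln (r / sqrt (3 * s)) * J <= e" unfolding e_def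
    proof (rule mult_mono)
     have "ln (r / sqrt (3 * s)) <= ln (1 / sqrt s)"
     proof (subst ln_le_cancel_iff)
      show "r / sqrt (3 * s) <= 1 / sqrt s" using r0 s by (intro frac_le) auto
     qed (use r0 s in auto)
     also have "... = ln (1 / s) / 2" using s by (simp add: ln_div ln_sqrt)
     finally show "ln (r / sqrt (3 * s)) <= ln (1 / s) / 2" .
     show "J <= d / (2 * pi)" using ann[of "sqrt (3 * s)" r] a0 r by (simp add: J_def ring_def pos_le_divide_eq mult.commute)
    qed (use J0 l1 in auto)
    finally have "r * circ (%z. (y z)^2) r <= r * (e + 2 / 5 * r^2 * circ (grad2 y) r)"
     using r0 by (intro mult_left_mono) auto
    also have "... = r * e + 2 / 5 * r^2 * (r * circ (grad2 y) r)" by (simp add: algebra_simps)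
    also have "... <= 1 * e + 2 / 5 * 1 * (r * circ (grad2 y) r)"
     using r0 e G0 power_le_one[of r 2] by (intro add_mono mult_right_mono mult_left_mono mult_nonneg_nonneg) auto
    finally show "r * circ (%z. (y z)^2) r <= e + 2 / 5 * (r * circ (grad2 y) r)" by simp
   qed (intro integrable_add integrable_on_mult_right integrable_const_ivl ring_integrable c(2) cy2)+
   also have "... = R / 2 * e + 2 / 5 * integral {R / 2..R} (%r. r * circ (grad2 y) r)"
    by (subst HK_add[OF integrable_const_ivl integrable_on_mult_right[OF ring_integrable[OF c(2)]]]) (use R_props(1) in simp)
   finally have "2 * pi * integral {R / 2..R} (%r. r * circ (%z. (y z)^2) r) <= 2 * pi * (R / 2 * e + 2 / 5 * integral {R / 2..R} (%r. r * circ (grad2 y) r))"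
    by (rule mult_left_mono) simp
   then have "X <= R / 4 * (ln (1 / s) * d) + 2 / 5 * ring (R / 2) R (grad2 y)" by (simp add: X_def ring_def e_def algebra_simps)
   also have "... <= 1 / 4 * (ln (1 / s) * d) + 2 / 5 * d"
    using R_props(1,2) l1 d0 ann[of "R / 2" R] by (intro add_mono mult_right_mono mult_left_mono mult_nonneg_nonneg) auto
   also have "... <= ln (1 / s) * d" using mult_right_mono[OF l1 d0] d0 by linarith
   finally show ?thesis .
  qed
  \<comment> \<open>Poincare controls the deviation \<open>q\<close> from the mean; the mean
    \<open>m\<close> itself is recovered on the outer annulus, where both \<open>y\<close> and
    \<open>q\<close> are bounded.\<close>
  define q where "q z = y z - m" for z
  have q: "C1 q" "dx q = dx y" "dy q = dy y" unfolding q_def[abs_def] using C1_sub[OF y C1_const(1)[of m]] by (simp_all add: C1_const)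
  note cq [continuous_intros] = C1_cont[OF q(1)]
  have qp: "Per q" unfolding q_def[abs_def] using yp by (simp add: Per_def)
  have q0: "(\<integral>z. q z) = 0" unfolding q_def using integrable_M[OF c(1)] area_pos by (simp add: measure_space_M m_def)
  have "dir q q = d" unfolding dir_def q d_def ..
  then have Q: "(\<integral>z. (q z)^2) <= p * d" using p(2)[OF q(1) qp q0] by simp
  have cq2: "cont (%z. (q z)^2)" by (intro continuous_intros)
  have ld: "d <= ln (1 / s) * d" using mult_right_mono[OF l1 d0] by simp
  have "((%r. r * m^2) has_integral R\<^sup>2 * m^2 / 2 - (R / 2)\<^sup>2 * m^2 / 2) {R / 2..R}"
   by (rule fundamental_theorem_of_calculus)
    (use R_props(1) in \<open>auto simp: has_real_derivative_iff_has_vector_derivative[symmetric] intro!: derivative_eq_intros\<close>)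
  from integral_unique[OF this] have "3 / 4 * pi * R^2 * m^2 = ring (R / 2) R (%z. m^2)"
   by (auto simp: ring_def circ_def power_divide)
  also have "... <= ring (R / 2) R (%z. 2 * (y z)^2 + 2 * (q z)^2)"
  proof (intro ring_mono continuous_intros)
   fix z show "m^2 <= 2 * (y z)^2 + 2 * (q z)^2"
    using zero_le_power2[of "2 * y z - m"] unfolding q_def by (simp add: sqr algebra_simps)
  qed (use R_props(1) in simp)
  also have "... <= 2 * X + 2 * (p * d)"
   using annulus_le_torus[OF cq2 Per_compose[OF qp] zero_le_power2, of "R / 2" R] Q R_props(1) ring_lin(1)[OF cy2 cq2] by (simp add: X_def)
  also have "... <= (2 + 2 * p) * (ln (1 / s) * d)"
   using X mult_left_mono[OF ld, of p] p(1) by (simp add: algebra_simps)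
  finally have "m^2 <= (2 + 2 * p) * (ln (1 / s) * d) / (3 / 4 * pi * R^2)"
   using R_props(1) by (subst pos_le_divide_eq) (auto simp: mult_ac)
  from mult_left_mono[OF this less_imp_le[OF area_pos]] have m2: "area * m^2 <= B * (ln (1 / s) * d)"
   by (simp only: B_def times_divide_eq_right times_divide_eq_left mult.assoc)
  have "Y = (\<integral>z. (q z)^2 + 2 * m * q z + m^2)"
   unfolding Y_def q_def by (rule integral_eqI) (auto simp: sqr algebra_simps)
  also have "... = (\<integral>z. (q z)^2) + area * m^2"
   using q0 integrable_M[OF cq2] integrable_M[OF cq] by (simp add: measure_space_M)
  also have "... <= K * (ln (1 / s) * d)"
   using Q m2 mult_left_mono[OF ld, of p] p(1) unfolding K_def distrib_right by linarith
  finally have Y: "Y <= K * (ln (1 / s) * d)" .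
  have "(\<integral>z. eV s z * (y z)^2) <= 8 / 9 * d + Cf * s * Y"
   using Cf(2)[OF s cy2 Per_compose[OF yp] zero_le_power2] near unfolding Y_def by linarith
  also have "... <= 8 / 9 * d + Cf * s * (K * (ln (1 / s) * d))" using Cf s Y by (intro add_left_mono mult_left_mono) auto
  finally have 3: "(\<integral>z. eV s z * (y z)^2) <= 8 / 9 * d + Cf * s * (K * (ln (1 / s) * d))" .
  have "0 <= K * s * (ln (1 / s) * d)" "0 <= Cf * K * (ln (1 / s) * d)" using K Cf(1) s order_trans[OF d0 ld] by simp_all
  with 3 Y show ?case unfolding Y_def[symmetric] d_def[symmetric] by (simp add: algebra_simps)
 qed
qed

end

lemma ev_small:
 fixes f :: "real => real"
 assumes "(f \<longlongrightarrow> 0) F" "0 < e"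
 shows "\<forall>\<^sub>F s in F. C * f s <= e"
proof -
 have "((%s. C * f s) \<longlongrightarrow> C * 0) F" by (intro tendsto_intros assms)
 then have "\<forall>\<^sub>F s in F. C * f s < e" using order_tendstoD(2)[of _ "C * 0" F e] assms(2) by simp
 then show ?thesis by eventually_elim simp
qed

context weight
begin

text \<open>For \<open>P = |z|^2\<close> the two averages would be 1/2 and -1/2; the tolerance on
  \<open>P\<close> leaves 1/3. The opposite signs make \<open>Psi\<close> and the constants
  independent on the two circles.\<close>

lemma circ_Psi:
 assumes s: "s > 0" "sqrt (3 * s) <= R"
 shows "1 / 3 <= circ (Psi s) (sqrt (3 * s))" "circ (Psi s) (sqrt (s / 3)) <= - 1 / 3"
proof -
 have "sqrt (s / 3) <= sqrt (3 * s)" by (rule real_sqrt_le_mono) (use s in simp)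
 then have r: "sqrt (s / 3) <= R" using s by linarith
 have c: "cont (Psi s)" by (rule C2_cont[OF Psi_C2(1)[OF s(1)]])
 have "circ (%_. 1 / 3) (sqrt (3 * s)) <= circ (Psi s) (sqrt (3 * s))"
 proof (intro circ_mono c continuous_on_const)
  fix z :: complex assume "norm z = abs (sqrt (3 * s))"
  then have n: "(norm z)^2 = 3 * s" "norm z <= R" using s by simp_all
  show "1 / 3 <= Psi s z"
   using P_lower_near[OF n(2)] s spos[OF s(1), of z] unfolding n(1) Psi_def by (simp add: field_simps)
 qed
 then show "1 / 3 <= circ (Psi s) (sqrt (3 * s))" by (simp add: circ_def)
 have "circ (Psi s) (sqrt (s / 3)) <= circ (%_. - 1 / 3) (sqrt (s / 3))"
 proof (intro circ_mono c continuous_on_const)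
  fix z :: complex assume "norm z = abs (sqrt (s / 3))"
  then have n: "(norm z)^2 = s / 3" "norm z <= R" using s r by simp_all
  have "P z <= s / 2" using R_props(3)[OF n(2)] s unfolding n(1) abs_le_iff by linarith
  then show "Psi s z <= - 1 / 3"
   using s spos[OF s(1), of z] unfolding Psi_def by (simp add: field_simps)
 qed
 then show "circ (Psi s) (sqrt (s / 3)) <= - 1 / 3" by (simp add: circ_def)
qed

definition nrm :: "real => (complex => real) => real" where
 "nrm s f = sqrt (\<integral>z. eV s z * (f z)^2)"

text \<open>Orthogonality to \<open>eV\<close> allows \<open>2 a\<close> times the vanishing
  integral to be subtracted. As \<open>w^2 - 2 a w = (w - a)^2 - a^2\<close>, the constant then
  contributes \<open>a^2 mass\<close> with a positive sign, although constants are negative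
  directions of the form. The mode \<open>Psi\<close> enters only through its residual.\<close>

lemma quadratic_form_split:
 assumes s: "s > 0" and y: "C2 y" "Per y" and w: "w = (%z. y z + a + b * Psi s z)"
  and 0: "(\<integral>z. eV s z * w z) = 0"
 shows "dir w w - (\<integral>z. eV s z * (w z)^2) = dir y y - (\<integral>z. eV s z * (y z)^2) + a^2 * mass s
  - 2 * b * (\<integral>z. y z * LPsi s z) - b\<^sup>2 * (\<integral>z. Psi s z * LPsi s z)"
proof -
 note p = Psi_C2(1)[OF s]
 have c [continuous_intros]: "cont y" "cont (Psi s)" "cont (eV s)" "cont (lap (Psi s))" "cont (LPsi s)"
  using y p s by (auto intro: C2_cont C2_cont_lap eV_cont LPsi_cont)
 have wd: "dx w = (%z. dx y z + b * dx (Psi s) z)" "dy w = (%z. dy y z + b * dy (Psi s) z)"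
  unfolding w using C1_add(2,3)[OF C1_add(1)[OF C2_C1[OF y(1)] C1_const(1)] C1_cmult(1)[OF C2_C1[OF p]]]
   C1_add(2,3)[OF C2_C1[OF y(1)] C1_const(1)] C1_cmult(2,3)[OF C2_C1[OF p]] by (simp_all add: C1_const)
 have g [continuous_intros]: "cont (dx y)" "cont (dy y)" "cont (dx (Psi s))" "cont (dy (Psi s))"
  using C1_cont_dx C1_cont_dy C2_C1 y p by blast+
 have i: "integrable M f" if "cont f" for f :: "complex => real" using that by (rule int_cont)
 have "dir w w = (\<integral>z. (dx y z * dx y z + dy y z * dy y z) + 2 * b * (dx y z * dx (Psi s) z + dy y z * dy (Psi s) z)
   + b^2 * (dx (Psi s) z * dx (Psi s) z + dy (Psi s) z * dy (Psi s) z))"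
  unfolding dir_def wd by (rule integral_eqI) (auto simp: algebra_simps sqr)
 also have "... = dir y y + 2 * b * dir y (Psi s) + b^2 * dir (Psi s) (Psi s)"
  unfolding dir_def by (subst integral_lin(1); (intro continuous_intros)?)+ simp
 finally have d: "dir w w = dir y y - 2 * b * (\<integral>z. y z * lap (Psi s) z) - b\<^sup>2 * (\<integral>z. Psi s z * lap (Psi s) z)"
  using green[OF C2_C1[OF y(1)] y(2) p Psi_per] green[OF C2_C1[OF p] Psi_per p Psi_per] by simp
 have "(\<integral>z. eV s z * (w z)^2) - 2 * a * (\<integral>z. eV s z * w z)
  = (\<integral>z. eV s z * (w z)^2 - 2 * a * (eV s z * w z))"
  unfolding w by (rule integral_lin(2)[symmetric]; intro continuous_intros)
 also have "... = (\<integral>z. eV s z * (y z)^2 + 2 * b * (y z * (LPsi s z - lap (Psi s) z)) + b^2 * (Psi s z * (LPsi s z - lap (Psi s) z)) - a\<^sup>2 * eV s z)"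
  unfolding w LPsi_def by (rule integral_eqI) (auto simp: algebra_simps sqr)
 also have "... = (\<integral>z. eV s z * (y z)^2) + 2 * b * (\<integral>z. y z * (LPsi s z - lap (Psi s) z))
   + b^2 * (\<integral>z. Psi s z * (LPsi s z - lap (Psi s) z)) - a\<^sup>2 * mass s"
  unfolding mass_def by (subst integral_lin(1) integral_lin(2); (intro continuous_intros)?)+ simp
 also have "(\<integral>z. y z * (LPsi s z - lap (Psi s) z)) = (\<integral>z. y z * LPsi s z) - (\<integral>z. y z * lap (Psi s) z)"
  unfolding right_diff_distrib by (rule integral_lin(4); intro continuous_intros)
 also have "(\<integral>z. Psi s z * (LPsi s z - lap (Psi s) z)) = (\<integral>z. Psi s z * LPsi s z) - (\<integral>z. Psi s z * lap (Psi s) z)"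
  unfolding right_diff_distrib by (rule integral_lin(4); intro continuous_intros)
 finally show ?thesis using 0 d by (simp add: algebra_simps)
qed

text \<open>The limits are \<open>8 pi\<close> for the mass and \<open>area\<close> for the integral
  of \<open>Psi\<close>; the bounds are halves and doubles of these.\<close>

lemma mass_bounds: "\<forall>\<^sub>F s in at_right 0. 4 * pi <= mass s & mass s <= 16 * pi & area / 2 <= (\<integral>z. Psi s z)"
proof -
 obtain C where C: "C > 0" "!!s. 0 < s ==> s <= 1 ==> (\<integral>z. abs (err s z)) <= C * s powr (7/8)"
  using err_LPsi_norms by metis
 obtain B where B: "B > 0" "!!s. 0 < s ==> s <= 1 ==> (\<integral>z. s / (s + P z)) <= B * s powr (7/8)" using ratio_bound by metis
 have t: "((%s::real. s powr (7/8)) \<longlongrightarrow> 0) (at_right 0)" by real_asymp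
 have 1: "\<forall>\<^sub>F s::real in at_right 0. 0 < s & s <= 1" unfolding eventually_at_right_field by (intro exI[of _ 1]) auto
 have pp: "0 < 4 * pi" "0 < area / 4" using area_pos by auto
 show ?thesis using 1 ev_small[OF t pp(1), of C] ev_small[OF t pp(2), of B]
 proof eventually_elim
  case (elim s)
  then have s: "s > 0" "s <= 1" by auto
  have "abs (\<integral>z. err s z) <= 4 * pi" using abs_integral_le[of M "err s"] C(2)[OF s] elim by linarith
  moreover have "(\<integral>z. Psi s z) = area - 2 * (\<integral>z. s / (s + P z))"
  proof -
   have "(\<integral>z. Psi s z) = (\<integral>z. 1 - 2 * (s / (s + P z)))"
    using spos[OF s(1)] by (intro integral_eqI) (auto simp: Psi_def field_simps less_imp_neq[symmetric])
   moreover have "integrable M (%z. s / (s + P z))"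
    by (intro int_cont cont_div_pow(2)[OF s(1)] continuous_intros)
   then have "(\<integral>z. 1 - 2 * (s / (s + P z))) = area - 2 * (\<integral>z. s / (s + P z))"
    by (subst Bochner_Integration.integral_diff) (auto simp: measure_space_M simp del: times_divide_eq_right)
   ultimately show ?thesis by (rule trans)
  qed
  ultimately show ?case using mass_err[OF s(1)] B(2)[OF s] elim by (auto simp: abs_le_iff)
 qed
qed

lemma eventually_s: "\<forall>\<^sub>F s::real in at_right 0. 0 < s & s <= exp (-1) & sqrt (3 * s) <= R / 2"
proof -
 have "((%s. sqrt (3 * s)) \<longlongrightarrow> 0) (at_right 0)" by real_asymp
 then have "\<forall>\<^sub>F s in at_right 0. sqrt (3 * s) < R / 2" using R_props(1) by (intro order_tendstoD) auto
 moreover have "\<forall>\<^sub>F s::real in at_right 0. 0 < s & s < exp (-1)" unfolding eventually_at_right_field by (intro exI[of _ "exp (-1)"]) auto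
 ultimately show ?thesis by eventually_elim auto
qed

text \<open>Orthogonality to \<open>eV\<close> makes the form coercive against the constants;
  maintaining it along the iteration is what the multiplier \<open>b\<close> pays for. The zero mean
  is what tames the dilation mode.\<close>

definition admissible :: "real => (complex => real) => bool" where
 "admissible s w \<longleftrightarrow> C2 w & Per w & (ALL z. w (- z) = w z) & (\<integral>z. w z) = 0 & (\<integral>z. eV s z * w z) = 0"

text \<open>\<open>w\<close> is split as \<open>y + a + b Psi\<close> with \<open>y\<close> of zero
  average on both circles. The gap holds for \<open>y\<close>, orthogonality gives
  \<open>a^2\<close> a positive weight, and \<open>b\<close>, in which the form nearly degenerates,
  is bounded through the zero mean of \<open>w\<close> at the cost of a logarithm.\<close>

lemma coercive:
 obtains c where "c > 0" "\<forall>\<^sub>F s in at_right 0. ALL w. admissible s w --> (1 + c / ln (1 / s)) * (\<integral>z. eV s z * (w z)^2) <= dir w w"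
proof -
 obtain C where C: "C > 0" "!!s y. 0 < s ==> sqrt (3 * s) <= R / 2 ==> s <= exp (-1) ==> C2 y ==> Per y ==> (!!z. y (- z) = y z) ==>
  circ y (sqrt (s / 3)) = 0 ==> circ y (sqrt (3 * s)) = 0 ==>
  (\<integral>z. eV s z * (y z)^2) <= (8 / 9 + C * s * ln (1 / s)) * dir y y & (\<integral>z. (y z)^2) <= C * ln (1 / s) * dir y y"
  using gap_y by blast
 obtain B where B: "B > 0" "!!s. 0 < s ==> s <= 1 ==> (\<integral>z. abs (LPsi s z)) <= B * s powr (7/8) & (\<integral>z. (LPsi s z)^2) <= B * s"
  using err_LPsi_norms by metis
 define A where "A = 8 * C / area + 8"
 have A: "A >= 8" "8 * C / area <= A" using C area_pos by (auto simp: A_def)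
 define K where "K = A * (1 + B) + C * B"
 define m where "m = 3 + 48 * pi + 48 * pi * A"
 have m: "m > 0" using A by (simp add: m_def add_pos_pos)
 have t1: "((%s::real. s * ln (1 / s)) \<longlongrightarrow> 0) (at_right 0)" by real_asymp
 have t2: "((%s::real. ln (1 / s) * sqrt s) \<longlongrightarrow> 0) (at_right 0)" by real_asymp
 have *: "\<forall>\<^sub>F s in at_right 0. ALL w. admissible s w --> (1 + (1 / (20 * m)) / ln (1 / s)) * (\<integral>z. eV s z * (w z)^2) <= dir w w"
  using eventually_s mass_bounds ev_small[OF t1, of "1 / 18" C, simplified] ev_small[OF t2, of "1 / 180" K, simplified]
 proof eventually_elim
  case (elim s)
  define l where "l = ln (1 / s)"
  have s: "s > 0" "s <= exp (-1)" "sqrt (3 * s) <= R / 2" using elim by auto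
  then have s1: "s <= 1" by (simp add: order_trans[OF s(2)])
  have l1: "1 <= l" unfolding l_def by (rule ln_ge_1[OF s(1,2)])
  have sR: "sqrt (3 * s) <= R" using s R_props(1) by linarith
  note ps = circ_Psi[OF s(1) sR] and p = Psi_C2(1)[OF s(1)]
  show ?case
  proof (intro allI impI)
   fix w assume "admissible s w"
   then have w: "C2 w" "Per w" "!!z. w (- z) = w z" "(\<integral>z. w z) = 0" "(\<integral>z. eV s z * w z) = 0" by (auto simp: admissible_def)
   \<comment> \<open>Two linear equations for the averages on the two circles; by
     \<open>circ_Psi\<close> their determinant is at least 2/3.\<close>
   define b where "b = (circ w (sqrt (3 * s)) - circ w (sqrt (s / 3))) / (circ (Psi s) (sqrt (3 * s)) - circ (Psi s) (sqrt (s / 3)))"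
   define a where "a = circ w (sqrt (3 * s)) - b * circ (Psi s) (sqrt (3 * s))"
   define y where "y z = w z - a - b * Psi s z" for z
   have y: "C2 y" "Per y" "!!z. y (- z) = y z"
    unfolding y_def[abs_def] using w by (auto intro!: C2_sub C2_const C2_cmult p Per_sub Per_const Per_compose[OF Psi_per] simp: Psi_even)
   have y_alt: "y = (%z. - a + 1 * w z + - b * Psi s z)" by (auto simp: y_def)
   have bb: "b * (circ (Psi s) (sqrt (3 * s)) - circ (Psi s) (sqrt (s / 3))) = circ w (sqrt (3 * s)) - circ w (sqrt (s / 3))"
    using ps by (simp add: b_def)
   have z: "circ y (sqrt (s / 3)) = 0" "circ y (sqrt (3 * s)) = 0"
    unfolding y_alt circ_lincomb[OF C2_cont[OF w(1)] C2_cont[OF p]] using bb by (auto simp: a_def algebra_simps)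
   have wy: "w = (%z. y z + a + b * Psi s z)" by (auto simp: y_def)
   define d where "d = dir y y"
   have d0: "d >= 0" unfolding d_def by (rule dir_nonneg)
   define E where "E = (\<integral>z. eV s z * (y z)^2)"
   define Y where "Y = (\<integral>z. (y z)^2)"
   define J where "J = (\<integral>z. y z * LPsi s z)"
   note g = C(2)[OF s(1,3,2) y z, folded d_def l_def E_def Y_def]
   note c [continuous_intros] = C2_cont[OF y(1)] C2_cont[OF p] eV_cont[OF s(1)] LPsi_cont[OF s(1)]
   have i: "integrable M f" if "cont f" for f :: "complex => real" using that by (rule int_cont)
   have E: "E <= 17 / 18 * d"
   proof -
    have "C * s * l * d <= 1 / 18 * d" using elim d0 by (intro mult_right_mono) (auto simp: l_def mult.assoc)
    with g show ?thesis by (simp add: algebra_simps)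
   qed
   have ld: "d <= l * d" using mult_right_mono[OF l1 d0] by simp
   \<comment> \<open>\<open>Psi\<close> is close to 1 off the bubble and its integral is at least
     \<open>area / 2\<close>; so the zero mean of \<open>w\<close> expresses \<open>b\<close>
     through the mean of \<open>y\<close> and through \<open>a\<close>.\<close>
   have b2: "b^2 <= A * (l * (d + a^2))"
   proof -
    have "0 = (\<integral>z. y z + a + b * Psi s z)" using w(4) by (simp add: wy[symmetric])
    also have "... = (\<integral>z. y z) + area * a + b * (\<integral>z. Psi s z)"
     by (subst integral_lin(1) integral_lin(3); (intro continuous_intros)?)+ (simp add: measure_space_M)
    finally have e: "b * (\<integral>z. Psi s z) = - ((\<integral>z. y z) + area * a)" by simp
    have "(area / 2)^2 * b^2 <= (\<integral>z. Psi s z)^2 * b^2" using elim area_pos by (intro mult_right_mono power_mono) auto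
    also have "... = ((\<integral>z. y z) + area * a)^2" using arg_cong[OF e, of "%x. x^2", unfolded power2_minus power_mult_distrib] by (simp only: mult.commute)
    also have "... <= 2 * (\<integral>z. y z)^2 + 2 * (area * a)^2"
     using zero_le_power2[of "(\<integral>z. y z) - area * a"] by (simp add: sqr algebra_simps)
    also have "(\<integral>z. y z)^2 <= area * Y"
     using Cauchy_Schwarz_integral(3)[of y M "%_. 1"] cont_M[OF c(1)] i[of "%z. (y z)^2"]
     by (simp add: continuous_intros measure_space_M Y_def mult.commute)
    also have "area * Y <= area * (C * l * d)" using g area_pos by (intro mult_left_mono) auto
    finally have "(area / 2)^2 * b^2 <= 2 * (area * (C * l * d)) + 2 * (area * a)^2" by simp
    then have "b^2 <= (2 * (area * (C * l * d)) + 2 * (area * a)^2) / (area / 2)^2"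
     using area_pos by (subst pos_le_divide_eq) (auto simp: mult.commute)
    also have "... = 8 * C / area * (l * d) + 8 * a^2" using area_pos by (simp add: field_simps sqr)
    also have "... <= A * (l * d) + A * (l * a^2)"
    proof (intro add_mono mult_mono A)
     show "a^2 <= l * a^2" using mult_right_mono[OF l1, of "a^2"] by simp
    qed (use l1 d0 A in auto)
    finally show ?thesis by (simp add: algebra_simps)
   qed
   have ss: "sqrt s > 0" "sqrt s * sqrt s = s" "0 <= b^2" using s by auto
   \<comment> \<open>Young's inequality with weight \<open>sqrt s\<close>: it beats the logarithm
     carried by \<open>b^2\<close>, and \<open>J^2 / sqrt s\<close> is still of order
     \<open>sqrt s\<close> times the square norm of \<open>y\<close>.\<close>
   have "2 * b * J <= b^2 * sqrt s + J^2 / sqrt s"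
    using zero_le_power2[of "b * sqrt s - J"] ss by (simp add: field_simps sqr)
   also have "J^2 <= Y * (B * s)"
   proof -
    have "J^2 <= Y * (\<integral>z. (LPsi s z)^2)" unfolding J_def Y_def
     by (intro Cauchy_Schwarz_integral(3) cont_M i continuous_intros)
    also have "... <= Y * (B * s)" using B(2)[OF s(1) s1] by (intro mult_left_mono) (auto simp: Y_def)
    finally show ?thesis .
   qed
   also have "Y * (B * s) / sqrt s = B * (Y * sqrt s)" using ss by (simp add: field_simps)
   also have "B * (Y * sqrt s) <= B * ((C * l * d) * sqrt s)" using g B ss by (intro mult_left_mono mult_right_mono) auto
   finally have J: "2 * b * J <= b^2 * sqrt s + C * B * (l * d * sqrt s)" using ss by (simp add: divide_right_mono mult_ac)
   have "(\<integral>z. Psi s z * LPsi s z) <= (\<integral>z. abs (LPsi s z))"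
   proof (rule integral_mono)
    fix z show "Psi s z * LPsi s z <= abs (LPsi s z)"
     using mult_right_mono[OF Psi_bound[OF s(1), of z], of "abs (LPsi s z)"] abs_ge_self[of "Psi s z * LPsi s z"] by (simp add: abs_mult)
   qed (intro i continuous_intros)+
   also have "... <= B * s powr (7/8)" using B(2)[OF s(1) s1] by simp
   also have "... <= B * sqrt s" using B s s1 by (intro mult_left_mono) (auto simp: powr_half_sqrt[symmetric] intro: powr_mono')
   finally have I: "b^2 * (\<integral>z. Psi s z * LPsi s z) <= b^2 * (B * sqrt s)" by (intro mult_left_mono) auto
   have "b^2 * sqrt s + C * B * (l * d * sqrt s) + b^2 * (B * sqrt s) = (1 + B) * sqrt s * b^2 + C * B * (l * sqrt s) * d" by (simp add: algebra_simps)
   also have "... <= (1 + B) * sqrt s * (A * (l * (d + a^2))) + C * B * (l * sqrt s) * (d + a^2)"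
    using b2 B C ss l1 by (intro add_mono mult_left_mono mult_nonneg_nonneg) auto
   also have "... = K * (l * sqrt s) * (d + a^2)" by (simp add: K_def algebra_simps)
   also have "... <= 1 / 180 * (d + a^2)" using elim d0 by (intro mult_right_mono) (auto simp: l_def)
   finally have small: "2 * b * J + b^2 * (\<integral>z. Psi s z * LPsi s z) <= 1 / 180 * (d + a^2)" using I J by linarith
   have am: "a^2 <= a^2 * mass s"
    using mult_left_mono[of 1 "mass s" "a^2"] elim pi_gt3 by auto
   define W where "W = (\<integral>z. eV s z * (w z)^2)"
   \<comment> \<open>\<open>1/18 - 1/180 = 1/20\<close>: the gap of \<open>y\<close> less the cross
     terms.\<close>
   have Q: "1 / 20 * (d + a^2) <= dir w w - W"
    using quadratic_form_split[OF s(1) y(1,2) wy w(5), folded d_def E_def J_def W_def] E small[unfolded distrib_left] am zero_le_power2[of a]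
    unfolding distrib_left by linarith
   \<comment> \<open>The weighted norm of \<open>w\<close> is at most a logarithm times
     \<open>d + a^2\<close>, which converts the surplus \<open>1/20 (d + a^2)\<close> into the gain
     \<open>c / ln (1/s)\<close>.\<close>
   have "W <= (\<integral>z. 3 * (eV s z * (y z)^2) + 3 * (a^2 + b^2) * eV s z)"
    unfolding W_def
   proof (rule integral_mono)
    fix z
    have "(Psi s z)^2 <= 1" using Psi_bound[OF s(1), of z] by (simp add: abs_square_le_1)
    from mult_left_mono[OF this, of "b^2"] have "(b * Psi s z)^2 <= b^2" by (simp add: power_mult_distrib)
    moreover have "(w z)^2 <= 3 * (y z)^2 + 3 * a^2 + 3 * (b * Psi s z)^2"
     using zero_le_power2[of "y z - a"] zero_le_power2[of "y z - b * Psi s z"] zero_le_power2[of "a - b * Psi s z"]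
     unfolding wy by (simp add: sqr algebra_simps)
    ultimately have "(w z)^2 <= 3 * (y z)^2 + 3 * (a^2 + b^2)" by (simp add: distrib_left)
    from mult_left_mono[OF this less_imp_le[OF eV_pos[OF s(1), of z]]]
    show "eV s z * (w z)^2 <= 3 * (eV s z * (y z)^2) + 3 * (a^2 + b^2) * eV s z" by (simp add: algebra_simps)
   qed (intro i continuous_intros C2_cont w)+
   also have "... = 3 * E + 3 * (a^2 + b^2) * mass s"
    unfolding E_def mass_def by (subst integral_lin(1); (intro continuous_intros)?)+ simp
   also have "... <= 3 * (l * (d + a^2)) + 3 * (l * (d + a^2) + A * (l * (d + a^2))) * (16 * pi)"
   proof -
    have la: "a^2 <= l * a^2" using mult_right_mono[OF l1, of "a^2"] by simp
    have 1: "E <= l * (d + a^2)" unfolding distrib_left using E ld la d0 zero_le_power2[of a] by linarith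
    have 2: "a^2 + b^2 <= l * (d + a^2) + A * (l * (d + a^2))" using b2 ld la d0 by (simp add: distrib_left)
    have "3 * (a^2 + b^2) * mass s <= 3 * (a^2 + b^2) * (16 * pi)" using elim by (intro mult_left_mono) auto
    also have "... <= 3 * (l * (d + a^2) + A * (l * (d + a^2))) * (16 * pi)" using 2 by (intro mult_left_mono mult_right_mono) auto
    finally show ?thesis using 1 by linarith
   qed
   also have "... = m * l * (d + a^2)" by (simp add: m_def algebra_simps)
   finally have "W / (20 * m * l) <= 1 / 20 * (d + a^2)" using m l1 by (subst pos_divide_le_eq) (auto simp: field_simps)
   with Q have "W + W / (20 * m * l) <= dir w w" by linarith
   then show "(1 + 1 / (20 * m) / ln (1 / s)) * (\<integral>z. eV s z * (w z)^2) <= dir w w"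
    unfolding W_def[symmetric] l_def[symmetric] by (simp add: distrib_right)
  qed
 qed
 show ?thesis by (rule that[OF _ *]) (use m in simp)
qed

end

section \<open>Uniform estimates for the linearised operator\<close>

context weight
begin

lemma C1_eV: assumes s: "s > 0" shows "C1 (eV s)"
proof -
 have "C1 (%z. exp (V s z))"
  by (rule C1_compose(1)[OF C2_C1[OF V_C2(1)[OF s]], of exp exp]) (auto intro: DERIV_exp continuous_intros)
 then show ?thesis using exp_V[OF s] by simp
qed

lemma C1_err: assumes s: "s > 0" shows "C1 (err s)"
proof -
 define i where "i z = inverse (s + P z)" for z
 have i: "C1 i" unfolding i_def[abs_def] by (rule C2_C1[OF inv_P(1)[OF s]])
 have "err s = (%z. (2 * s) * ((4 - S z) * (i z * i z)) + 2 * kp * ((P z * i z) * (P z * i z) - 1))"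
  by (rule ext) (simp add: err_def i_def divide_inverse sqr)
 then show ?thesis using i C2_C1[OF P_C2] C2_C1[OF S_C2] by (auto intro!: C1_add(1) C1_cmult(1) C1_mult(1) C1_sub(1) C1_const(1))
qed

text \<open>\<open>V s\<close> already solves the Poisson equation with datum
  \<open>eV - err\<close>, so the potential of \<open>eV\<close> is explicit up to that of
  \<open>err\<close>.\<close>

lemma K_err: "s > 0 ==> K (eV s) z = V s z - (\<integral>w. V s w) / area + K (err s) z"
proof -
 assume s: "s > 0"
 note e = C1_eV[OF s] eV_per C1_err[OF s] err_per
 have g: "C1 (%z. eV s z + (-1) * err s z)" "Per (%z. eV s z + (-1) * err s z)"
  by (intro C1_add(1) C1_cmult(1) e) (use e in \<open>simp add: Per_def\<close>)
 have v: "C2 (%z. V s z - (\<integral>w. V s w) / area)" by (intro C2_sub(1) C2_const(1) V_C2(1) s)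
 have "(%z. V s z - (\<integral>w. V s w) / area) = K (%z. eV s z + (-1) * err s z)"
 proof (rule K_unique[OF v _ _ g])
  show "(\<integral>z. V s z - (\<integral>w. V s w) / area) = 0"
   using integrable_M[OF C2_cont[OF V_C2(1)[OF s]]] area_pos by (simp add: measure_space_M)
  show "lap (%z. V s z - (\<integral>w. V s w) / area) z = 2 * kp - (eV s z + (-1) * err s z)" for z
   using C2_sub(2)[OF V_C2(1)[OF s] C2_const(1)] V_C2(2)[OF s, of z] by (simp add: C2_const)
 qed (rule Per_compose[OF V_per])
 from fun_cong[OF this, of z] show ?thesis
  using K_lin[OF C1_cont[OF e(1)] e(2) C1_cont[OF e(3)] e(4), of "-1" z] by simp
qed

text \<open>The exponent 11/16 is half of \<open>1/2 + 7/8\<close>: \<open>K_bound\<close> takes the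
  geometric mean of the 2-norm \<open>O(s powr (1/2))\<close> and the 1-norm
  \<open>O(s powr (7/8))\<close>.\<close>

lemma err_both: obtains C where "C >= 1" "!!s. 0 < s ==> s <= 1 ==> (\<integral>z. abs (err s z)) <= C * s powr (7/8)
  & (\<integral>z. (err s z)^2) <= C * s & (\<integral>z. abs (LPsi s z)) <= C * s powr (7/8)
  & (ALL z. abs (K (err s) z) <= C * s powr (11/16))"
proof -
 obtain C where C: "C > 0" "!!s. 0 < s ==> s <= 1 ==> (\<integral>z. abs (err s z)) <= C * s powr (7/8) & (\<integral>z. abs (LPsi s z)) <= C * s powr (7/8)
   & (\<integral>z. (err s z)^2) <= C * s & (\<integral>z. (LPsi s z)^2) <= C * s" using err_LPsi_norms by blast
 obtain B where B: "B > 0" "!!g z. cont g ==> Per g ==> abs (K g z) <= B * sqrt (sqrt (\<integral>w. (g w)^2) * (\<integral>w. abs (g w)))" using K_bound by blast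
 define A where "A = max 1 (max C (B * sqrt (sqrt C * C)))"
 show ?thesis
 proof (rule that[of A])
  show "A >= 1" by (simp add: A_def)
  fix s :: real assume s: "0 < s" "s <= 1"
  have m: "C * x <= A * x" if "x >= 0" for x using that by (intro mult_right_mono) (auto simp: A_def)
  have "abs (K (err s) z) <= A * s powr (11/16)" for z
  proof -
   have "abs (K (err s) z) <= B * sqrt (sqrt (\<integral>w. (err s w)^2) * (\<integral>w. abs (err s w)))"
    by (rule B(2)[OF err_cont[OF s(1)] err_per])
   also have "... <= B * sqrt (sqrt (C * s) * (C * s powr (7/8)))"
    using C(2)[OF s] C(1) B(1) s by (intro mult_left_mono real_sqrt_le_mono mult_mono) auto
   also have "sqrt (C * s) * (C * s powr (7/8)) = (sqrt C * C) * (s powr (11/8))"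
    using s by (simp add: real_sqrt_mult powr_half_sqrt[symmetric] powr_add[symmetric])
   also have "B * sqrt ((sqrt C * C) * (s powr (11/8))) = (B * sqrt (sqrt C * C)) * s powr (11/16)"
    using s by (simp add: real_sqrt_mult powr_half_sqrt[symmetric] powr_powr)
   also have "... <= A * s powr (11/16)" by (intro mult_right_mono) (auto simp: A_def)
   finally show ?thesis .
  qed
  then show "(\<integral>z. abs (err s z)) <= A * s powr (7/8) & (\<integral>z. (err s z)^2) <= A * s & (\<integral>z. abs (LPsi s z)) <= A * s powr (7/8)
   & (ALL z. abs (K (err s) z) <= A * s powr (11/16))"
   using C(2)[OF s] order_trans[OF _ m[of "s powr (7/8)"]] order_trans[OF _ m[of s]] s by simp
 qed
qed

text \<open>\<open>V\<close> oscillates by at most \<open>2 ln (1/s)\<close> plus a constant, and so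
  does its deviation from the mean; the potential of \<open>err\<close> is bounded.\<close>

lemma KeV_upper: obtains C where "C >= 1" "!!s z. 0 < s ==> s <= exp (-1) ==> abs (K (eV s) z) <= C * ln (1 / s)"
proof -
 obtain A where A: "A >= 1" "!!s. 0 < s ==> s <= 1 ==> (\<integral>z. abs (err s z)) <= A * s powr (7/8)
  & (\<integral>z. (err s z)^2) <= A * s & (\<integral>z. abs (LPsi s z)) <= A * s powr (7/8)
  & (ALL z. abs (K (err s) z) <= A * s powr (11/16))" using err_both by blast
 obtain B where B: "B >= 1" "!!z. P z <= B" "!!z. abs (S z) <= B" using P_upper by blast
 have lB: "0 <= ln (1 + B)" using B by simp
 show ?thesis
 proof (rule that[of "A + 2 + 2 * ln (1 + B)"])
  fix s :: real and z assume s: "0 < s" "s <= exp (-1)"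
  then have s1: "s <= 1" by (simp add: order_trans[OF s(2)])
  define l where "l = ln (1 / s)"
  have l1: "1 <= l" unfolding l_def by (rule ln_ge_1[OF s])
  define a b where "a = ln (8 * s) - 2 * ln (1 + B)" and "b = ln (8 * s) + 2 * l"
  have v: "a <= V s z & V s z <= b" for z
  proof -
   have p: "s + P z > 0" "s <= s + P z" "s + P z <= 1 + B" using spos[OF s(1), of z] P_nonneg[of z] B(2)[of z] s1 by auto
   have "ln (s + P z) <= ln (1 + B)" "ln s <= ln (s + P z)" using p s by (auto simp: ln_le_cancel_iff)
   then show ?thesis using s by (simp add: V_def a_def b_def l_def ln_div)
  qed
  have i: "integrable M (V s)" by (rule integrable_M[OF C2_cont[OF V_C2(1)[OF s(1)]]])
  have "(\<integral>w. a) <= (\<integral>w. V s w)" "(\<integral>w. V s w) <= (\<integral>w. b)" using v by (intro integral_mono i integrable_M continuous_intros; blast)+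
  then have "a <= (\<integral>w. V s w) / area" "(\<integral>w. V s w) / area <= b"
   using area_pos by (auto simp: measure_space_M field_simps)
  then have 1: "abs (V s z - (\<integral>w. V s w) / area) <= b - a" using v[of z] by linarith
  have "s powr (11/16) <= 1" using s s1 by (intro powr_le1) auto
  then have "A * s powr (11/16) <= A" using A by (simp add: mult_left_le)
  moreover have "abs (K (err s) z) <= A * s powr (11/16)" using A(2)[OF s(1) s1] by blast
  ultimately have "abs (K (err s) z) <= A" by linarith
  then have "abs (K (eV s) z) <= A + (2 * l + 2 * ln (1 + B))" using 1 unfolding K_err[OF s(1)] a_def b_def by linarith
  also have "... <= A * l + (2 * l + 2 * ln (1 + B) * l)" using A lB l1 by (intro add_mono) (auto simp: mult_le_cancel_left1)
  also have "... = (A + 2 + 2 * ln (1 + B)) * l" by (simp add: algebra_simps)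
  finally show "abs (K (eV s) z) <= (A + 2 + 2 * ln (1 + B)) * ln (1 / s)" by (simp add: l_def)
 qed (use A lB in auto)
qed

text \<open>The integral is the Dirichlet energy of \<open>k = K (eV s)\<close>. Testing with
  \<open>P\<close> bounds it below: \<open>lap k = mass / area - eV\<close> pairs with
  \<open>P\<close> to a definite positive amount, since \<open>eV\<close> concentrates where
  \<open>P\<close> vanishes, and Cauchy-Schwarz compares with the fixed energy of
  \<open>P\<close>.\<close>

lemma KeV_lower: obtains C where "C >= 1" "\<forall>\<^sub>F s in at_right 0. 1 <= C * (\<integral>z. K (eV s) z * eV s z)"
proof -
 have "(\<integral>z. P z) ~= 0"
 proof
  assume "(\<integral>z. P z) = 0"
  from zero_if_square_integral_0[OF P_cont P_per P_nonneg this] have "P = (%z. 0)" by auto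
  then have "lap P = lap (%z. 0)" by simp
  then have "lap P 0 = 0" by (simp add: C2_const(2))
  then show False using S_0 by simp
 qed
 then have Ppos: "(\<integral>z. P z) > 0" using P_nonneg by (simp add: less_le integral_ge_0)
 define q where "q = 2 * pi * (\<integral>z. P z) / area"
 have q: "q > 0" using Ppos area_pos by (simp add: q_def)
 define Q where "Q = dir P P"
 have Q: "Q >= 0" unfolding Q_def by (rule dir_nonneg)
 obtain B where B: "B > 0" "!!s. 0 < s ==> s <= 1 ==> (\<integral>z. s / (s + P z)) <= B * s powr (7/8)" using ratio_bound by metis
 have t: "((%s::real. s powr (7/8)) \<longlongrightarrow> 0) (at_right 0)" by real_asymp
 have *: "\<forall>\<^sub>F s in at_right 0. q^2 <= Q * (\<integral>z. K (eV s) z * eV s z)"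
  using eventually_s mass_bounds ev_small[OF t q, of "8 * B"]
 proof eventually_elim
  case (elim s)
  then have s: "0 < s" "s <= exp (-1)" by auto
  then have s1: "s <= 1" by (simp add: order_trans[OF s(2)])
  define k where "k = K (eV s)"
  note e = C1_eV[OF s(1)] eV_per[of s]
  note k = K_props[OF C1_cont[OF e(1)] e(2), folded k_def] and k2 = K_C2[OF e, folded k_def]
  note c [continuous_intros] = C1_cont[OF e(1)] k(2) P_cont S_cont
  have d: "dir k k = (\<integral>z. k z * eV s z)" using dir_K[OF e k(1,3,4)] by (simp add: k_def)
  have "(\<integral>z. P z * eV s z) <= (\<integral>z. 8 * (s / (s + P z)))"
  proof (rule integral_mono)
   fix z
   have "P z * eV s z = 8 * (s / (s + P z)) * (P z / (s + P z))" by (simp add: eV_def sqr)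
   also have "... <= 8 * (s / (s + P z)) * 1" using ratio_bounds[OF s(1), of z] by (intro mult_left_mono) auto
   finally show "P z * eV s z <= 8 * (s / (s + P z))" by simp
  qed (intro integrable_M continuous_intros cont_div_pow(2)[OF s(1)])+
  also have "... <= 8 * (B * s powr (7/8))" using B(2)[OF s(1) s1] by (simp del: times_divide_eq_right)
  finally have pe: "(\<integral>z. P z * eV s z) <= q" using elim by simp
  have "(\<integral>z. k z * S z) = (\<integral>z. P z * lap k z)" by (rule green_sym[OF k2(1) k(3) P_C2 P_per])
  also have "... = (\<integral>z. mass s / area * P z - 1 * (P z * eV s z))"
   unfolding k2(2) mass_def by (simp add: algebra_simps)
  also have "... = mass s / area * (\<integral>z. P z) - (\<integral>z. P z * eV s z)"
   by (subst integral_lin(2); (intro continuous_intros)?) simp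
  finally have "q <= (\<integral>z. k z * S z)"
  proof -
   assume a: "(\<integral>z. k z * S z) = mass s / area * (\<integral>z. P z) - (\<integral>z. P z * eV s z)"
   have "2 * q = 4 * pi / area * (\<integral>z. P z)" by (simp add: q_def)
   also have "... <= mass s / area * (\<integral>z. P z)" using elim area_pos Ppos by (intro mult_right_mono divide_right_mono) auto
   finally show ?thesis using a pe by linarith
  qed
  then have "q <= - dir k P" using green[OF k(1,3) P_C2 P_per] by simp
  then have "q^2 <= (dir k P)^2" using power_mono[of q "- dir k P" 2] q by simp
  also have "... <= Q * dir k k" using dir_Cauchy_Schwarz[OF k(1) C2_C1[OF P_C2]] by (simp add: Q_def mult.commute)
  finally show ?case unfolding d unfolding k_def by (simp add: mult_ac)
 qed
 have "Q / q^2 >= 0" using Q by simp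
 show ?thesis
 proof (rule that[of "1 + Q / q^2"])
  show "\<forall>\<^sub>F s in at_right 0. 1 <= (1 + Q / q^2) * (\<integral>z. K (eV s) z * eV s z)"
   using *
  proof eventually_elim
   case (elim s)
   have q2: "q^2 > 0" using q by simp
   then have "Q * (\<integral>z. K (eV s) z * eV s z) > 0" using elim by linarith
   then have "(\<integral>z. K (eV s) z * eV s z) > 0"
    using Q by (meson less_imp_le mult_nonneg_nonneg mult_nonneg_nonpos not_less)
   moreover have "1 <= Q / q^2 * (\<integral>z. K (eV s) z * eV s z)" using elim q2 by (simp add: pos_le_divide_eq)
   ultimately show ?case by (simp add: distrib_right)
  qed
 qed (use \<open>Q / q^2 >= 0\<close> in simp)
qed

end

text \<open>One constant \<open>C\<close>, one coercivity constant \<open>c\<close> and one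
  threshold \<open>s1\<close> serve all asymptotic estimates, so that the nonlinear argument can
  work at a fixed scale.\<close>

locale est = weight +
 fixes c C s1 :: real
 assumes c: "0 < c" "c <= 1" and C: "1 <= C" and s1: "0 < s1" "s1 <= exp (-1)"
  and coer: "!!s w. 0 < s ==> s < s1 ==> admissible s w ==> (1 + c / ln (1 / s)) * (\<integral>z. eV s z * (w z)^2) <= dir w w"
  and mass_le: "!!s. 0 < s ==> s < s1 ==> mass s <= 16 * pi"
  and Kb: "!!g z. cont g ==> Per g ==> abs (K g z) <= C * sqrt (sqrt (\<integral>w. (g w)^2) * (\<integral>w. abs (g w)))"
  and err1: "!!s. 0 < s ==> s < s1 ==> (\<integral>z. abs (err s z)) <= C * s powr (7/8)"
  and LPsi1: "!!s. 0 < s ==> s < s1 ==> (\<integral>z. abs (LPsi s z)) <= C * s powr (7/8)"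
  and Kerr: "!!s z. 0 < s ==> s < s1 ==> abs (K (err s) z) <= C * s powr (11/16)"
  and keV: "!!s z. 0 < s ==> s < s1 ==> abs (K (eV s) z) <= C * ln (1 / s)"
  and keV0: "!!s. 0 < s ==> s < s1 ==> 1 <= C * (\<integral>z. K (eV s) z * eV s z)"
  and Psi0: "!!s. 0 < s ==> s < s1 ==> area / 2 <= (\<integral>z. Psi s z)"
  and Psi_err: "!!s. 0 < s ==> s < s1 ==> s <= (\<integral>z. Psi s z * err s z)"

lemma (in weight) est_exists: obtains c C s1 where "est o1 o2 P kp c C s1"
proof -
 obtain c where c: "c > 0" "\<forall>\<^sub>F s in at_right 0. ALL w. admissible s w --> (1 + c / ln (1 / s)) * (\<integral>z. eV s z * (w z)^2) <= dir w w"
  using coercive by blast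
 obtain C1 where C1: "C1 > 0" "!!g z. cont g ==> Per g ==> abs (K g z) <= C1 * sqrt (sqrt (\<integral>w. (g w)^2) * (\<integral>w. abs (g w)))" using K_bound by blast
 obtain C2 where C2: "C2 >= 1" "!!s. 0 < s ==> s <= 1 ==> (\<integral>z. abs (err s z)) <= C2 * s powr (7/8)
  & (\<integral>z. (err s z)^2) <= C2 * s & (\<integral>z. abs (LPsi s z)) <= C2 * s powr (7/8)
  & (ALL z. abs (K (err s) z) <= C2 * s powr (11/16))" using err_both by blast
 obtain C3 where C3: "C3 >= 1" "!!s z. 0 < s ==> s <= exp (-1) ==> abs (K (eV s) z) <= C3 * ln (1 / s)" using KeV_upper by blast
 obtain C4 where C4: "C4 >= 1" "\<forall>\<^sub>F s in at_right 0. 1 <= C4 * (\<integral>z. K (eV s) z * eV s z)" using KeV_lower by blast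
 have "\<forall>\<^sub>F s in at_right 0. (ALL w. admissible s w --> (1 + c / ln (1 / s)) * (\<integral>z. eV s z * (w z)^2) <= dir w w)
  & 1 <= C4 * (\<integral>z. K (eV s) z * eV s z) & mass s <= 16 * pi & area / 2 <= (\<integral>z. Psi s z) & s <= (\<integral>z. Psi s z * err s z)"
  using c(2) C4(2) mass_bounds Psi_err_lower by eventually_elim auto
 then obtain s0 where s0: "s0 > 0" "!!s. 0 < s ==> s < s0 ==> (ALL w. admissible s w --> (1 + c / ln (1 / s)) * (\<integral>z. eV s z * (w z)^2) <= dir w w)
  & 1 <= C4 * (\<integral>z. K (eV s) z * eV s z) & mass s <= 16 * pi & area / 2 <= (\<integral>z. Psi s z) & s <= (\<integral>z. Psi s z * err s z)"
  unfolding eventually_at_right_field by auto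
 define C where "C = C1 + C2 + C3 + C4"
 have CC: "C1 <= C" "C2 <= C" "C3 <= C" "C4 <= C" "1 <= C" using C1(1) C2(1) C3(1) C4(1) by (auto simp: C_def)
 define s1 where "s1 = min s0 (exp (-1))"
 have sl: "s <= 1" "s <= exp (-1)" "1 <= ln (1 / s)" "s < s0" if "0 < s" "s < s1" for s
 proof -
  show "s < s0" "s <= exp (-1)" using that by (auto simp: s1_def)
  then show "1 <= ln (1 / s)" using that by (intro ln_ge_1)
  show "s <= 1" using \<open>s <= exp (-1)\<close> by (rule order_trans) simp
 qed
 define c' where "c' = min c 1"
 have "est o1 o2 P kp c' C s1"
 proof (unfold_locales, goal_cases)
  case (6 s w)
  have "c' / ln (1 / s) <= c / ln (1 / s)" using sl(3)[OF 6(1,2)] by (intro divide_right_mono) (auto simp: c'_def)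
  then have "(1 + c' / ln (1 / s)) * (\<integral>z. eV s z * (w z)^2) <= (1 + c / ln (1 / s)) * (\<integral>z. eV s z * (w z)^2)"
   using 6(1) by (intro mult_right_mono integral_ge_0) (simp_all add: less_imp_le[OF eV_pos])
  also have "... <= dir w w" using s0(2)[OF 6(1) sl(4)[OF 6(1,2)]] 6(3) by blast
  finally show ?case .
 next
  case (8 g z) then show ?case using order_trans[OF C1(2) mult_right_mono[OF CC(1)]] by simp
 next
  case (9 s) then show ?case using C2(2)[OF 9(1) sl(1)] order_trans[OF _ mult_right_mono[OF CC(2)]] by simp
 next
  case (10 s) then show ?case using C2(2)[OF 10(1) sl(1)] order_trans[OF _ mult_right_mono[OF CC(2)]] by simp
 next
  case (11 s z) then show ?case using C2(2)[OF 11(1) sl(1)] order_trans[OF _ mult_right_mono[OF CC(2)]] by simp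
 next
  case (12 s z) then show ?case using order_trans[OF C3(2)[OF 12(1)] mult_right_mono[OF CC(3)]] sl[OF 12] by simp
 next
  case (13 s)
  define x where "x = (\<integral>z. K (eV s) z * eV s z)"
  have x: "1 <= C4 * x" using s0(2)[OF 13(1) sl(4)[OF 13]] by (simp add: x_def)
  then have "0 < C4 * x" by linarith
  then have "x > 0" using C4(1) by (simp add: zero_less_mult_iff)
  then show ?case using order_trans[OF x mult_right_mono[OF CC(4)]] unfolding x_def[symmetric] by simp
 next
  case (7 s) then show ?case using s0(2)[OF 7(1) sl(4)] by blast
 next
  case (14 s) then show ?case using s0(2)[OF 14(1) sl(4)] by blast
 next
  case (15 s) then show ?case using s0(2)[OF 15(1) sl(4)] by blast
 qed (use c(1) CC(5) s0(1) in \<open>simp_all add: c'_def s1_def\<close>)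
 then show ?thesis by (rule that)
qed

section \<open>The nonlinear problem\<close>

definition N :: "real => real" where "N x = exp x - 1 - x"

lemma N_lipschitz:
 assumes "abs x <= r" "abs y <= r" "r <= 1"
 shows "abs (N x - N y) <= 2 * r * abs (x - y)"
proof -
 have "norm (N x - N y) <= 2 * r * norm (x - y)"
 proof (rule field_differentiable_bound[of "cball 0 r" N "%x. exp x - 1"])
  fix t :: real assume "t : cball 0 r"
  then have t: "abs t <= r" by simp
  show "(N has_field_derivative exp t - 1) (at t within cball 0 r)"
   unfolding N_def[abs_def] by (auto intro!: derivative_eq_intros)
  have "abs (exp t - 1) <= 2 * abs t"
  proof (cases "t >= 0")
   case True
   have "exp t <= 1 + t + t^2" using True t assms(3) by (intro exp_bound) auto
   moreover have "t^2 <= t" using True t assms(3) by (simp add: sqr mult_left_le)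
   ultimately show ?thesis using True by simp
  next
   case False
   then have "exp t <= 1" by simp
   then show ?thesis using False exp_ge_add_one_self[of t] by linarith
  qed
  then show "norm (exp t - 1) <= 2 * r" using t by simp
 qed (use assms in auto)
 then show ?thesis by simp
qed

lemma N_0: "N 0 = 0" by (simp add: N_def)

lemma N_bound: "abs x <= r ==> r <= 1 ==> abs (N x) <= 2 * r * abs x"
 using N_lipschitz[of x r 0] by (simp add: N_0)

lemma N_square: "abs x <= 1 ==> abs (N x) <= 2 * x^2"
 using N_bound[of x "abs x"] by (simp add: sqr)

lemma N_cont [continuous_intros]: "continuous_on S f ==> continuous_on S (%z. N (f z))"
 unfolding N_def by (intro continuous_intros)

lemma C1_N: assumes "C1 f" shows "C1 (%z. N (f z))"
 by (rule C1_compose(1)[OF assms, of N "%x. exp x - 1"])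
  (auto simp: N_def[abs_def] intro!: derivative_eq_intros continuous_intros)

context weight
begin

lemma nrm_sq: "s > 0 ==> (nrm s f)^2 = (\<integral>z. eV s z * (f z)^2)"
 unfolding nrm_def by (subst real_sqrt_pow2) (auto intro!: integral_ge_0 mult_nonneg_nonneg less_imp_le[OF eV_pos])

lemma nrm_nonneg: "s > 0 ==> 0 <= nrm s f"
 unfolding nrm_def by (auto intro!: integral_ge_0 mult_nonneg_nonneg less_imp_le[OF eV_pos])

lemma nrm_CS:
 assumes s: "s > 0" and f: "cont f" and g: "cont g"
 shows "abs (\<integral>z. eV s z * (f z * g z)) <= nrm s f * nrm s g"
proof -
 note e = eV_cont[OF s]
 have p: "0 <= eV s z" for z using eV_pos[OF s, of z] by simp
 have "(\<integral>z. (sqrt (eV s z) * f z) * (sqrt (eV s z) * g z))^2 <= (\<integral>z. (sqrt (eV s z) * f z)^2) * (\<integral>z. (sqrt (eV s z) * g z)^2)"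
  by (intro Cauchy_Schwarz_integral(3) cont_M integrable_M continuous_intros e f g)
 also have "(\<integral>z. (sqrt (eV s z) * f z) * (sqrt (eV s z) * g z)) = (\<integral>z. eV s z * (f z * g z))"
  using p by (simp add: mult.assoc mult.left_commute[of "f _"] real_sqrt_mult_self flip: mult.assoc[of "sqrt _" "sqrt _"])
 also have "(\<integral>z. (sqrt (eV s z) * f z)^2) * (\<integral>z. (sqrt (eV s z) * g z)^2) = (nrm s f * nrm s g)^2"
  using p by (simp add: power_mult_distrib nrm_sq[OF s])
 finally show ?thesis
  using abs_le_square_iff[of "\<integral>z. eV s z * (f z * g z)" "nrm s f * nrm s g"] nrm_nonneg[OF s] by simp
qed

lemma nrm_triangle:
 assumes s: "s > 0" and f: "cont f" and g: "cont g"
 shows "nrm s (%z. f z + g z) <= nrm s f + nrm s g"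
proof (rule power2_le_imp_le)
 note e = eV_cont[OF s]
 have "(nrm s (%z. f z + g z))^2 = (\<integral>z. eV s z * (f z)^2 + 2 * (eV s z * (f z * g z)) + eV s z * (g z)^2)"
  unfolding nrm_sq[OF s] by (simp add: algebra_simps sqr)
 also have "... = (nrm s f)^2 + 2 * (\<integral>z. eV s z * (f z * g z)) + (nrm s g)^2"
  unfolding nrm_sq[OF s] by (subst integral_lin(1) integral_lin(3); (intro continuous_intros e f g)?)+ simp
 also have "... <= (nrm s f)^2 + 2 * (nrm s f * nrm s g) + (nrm s g)^2" using nrm_CS[OF s f g] by linarith
 also have "... = (nrm s f + nrm s g)^2" by (simp add: sqr algebra_simps)
 finally show "(nrm s (%z. f z + g z))^2 <= (nrm s f + nrm s g)^2" .
qed (use nrm_nonneg[OF s] in auto)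

lemma nrm_mono:
 assumes s: "s > 0" and f: "cont f" and g: "cont g" and le: "!!z. abs (f z) <= abs (g z)"
 shows "nrm s f <= nrm s g"
 unfolding nrm_def
proof (intro real_sqrt_le_mono integral_mono mult_left_mono)
 show "(f z)^2 <= (g z)^2" for z using le[of z] by (simp add: abs_le_square_iff)
qed (use less_imp_le[OF eV_pos[OF s]] in \<open>auto intro!: integrable_M continuous_intros f g eV_cont s\<close>)

lemma nrm_cmult: "s > 0 ==> nrm s (%z. a * f z) = abs a * nrm s f"
 unfolding nrm_def by (simp add: power_mult_distrib mult.left_commute[of _ "a^2"] real_sqrt_mult)

lemma integral_eV_sq:
 assumes s: "s > 0" and f: "cont f"
 shows "(\<integral>z. (eV s z * f z)^2) <= 8 / s * (nrm s f)^2"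
proof -
 have "(\<integral>z. (eV s z * f z)^2) <= (\<integral>z. 8 / s * (eV s z * (f z)^2))"
 proof (rule integral_mono)
  fix z
  have "eV s z * (eV s z * (f z)^2) <= 8 / s * (eV s z * (f z)^2)"
   using eV_le[OF s, of z] less_imp_le[OF eV_pos[OF s, of z]] by (intro mult_right_mono) auto
  then show "(eV s z * f z)^2 <= 8 / s * (eV s z * (f z)^2)" by (simp add: sqr mult_ac)
 qed (intro integrable_M continuous_intros f eV_cont s)+
 then show ?thesis by (simp add: nrm_sq[OF s])
qed

end

context est
begin

abbreviation (input) ok :: "real => bool" where "ok s \<equiv> 0 < s & s < s1"

definition l :: "real => real" where "l s = ln (1 / s)"
text \<open>Chosen so that the bound \<open>8 C^2 (l s)\<close> for the multiplier costs
  \<open>c / (4 l)\<close>, half of the \<open>c / (2 l)\<close> gained by coercivity.\<close>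

definition eta :: "real => real" where "eta s = c / (32 * C^2 * (l s)^2)"
definition X :: "real => (complex => real) => real => real" where "X s w b = nrm s w + eta s * abs b"

lemma l_ge_1: "ok s ==> 1 <= l s"
 unfolding l_def using s1 by (intro ln_ge_1) auto

lemma eta: "ok s ==> 0 < eta s" "ok s ==> eta s <= 1"
proof -
 assume s: "ok s"
 have "1 <= C^2" "1 <= (l s)^2" using C l_ge_1[OF s] by auto
 then have "1 * 1 <= C^2 * (l s)^2" by (intro mult_mono) auto
 then have "1 <= 32 * C^2 * (l s)^2" by simp
 then show "0 < eta s" "eta s <= 1" unfolding eta_def using c by (auto simp: divide_le_eq)
qed

lemma nrm_const: "ok s ==> nrm s (%z. b) <= 8 * abs b"
proof -
 assume s: "ok s"
 have "nrm s (%z. b) = sqrt (mass s) * abs b" unfolding nrm_def mass_def by (simp add: real_sqrt_mult)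
 \<comment> \<open>The mass is at most \<open>16 pi\<close>, which is below 64; this is the origin
   of the factor 8.\<close>
 also have "sqrt (mass s) <= sqrt 64" using mass_le[of s] s pi_less_4 by (intro real_sqrt_le_mono) auto
 also have "sqrt 64 = (8::real)" by (rule real_sqrt_unique) auto
 finally show ?thesis by (simp add: mult_right_mono)
qed

lemma nrm_bound: "ok s ==> cont f ==> (!!z. abs (f z) <= B) ==> nrm s f <= 8 * B"
proof -
 assume s: "ok s" and f: "cont f" "!!z. abs (f z) <= B"
 have "B >= 0" using f(2)[of 0] by linarith
 then show ?thesis using nrm_mono[of s f "%_. B"] nrm_const[OF s, of B] f s by force
qed

lemma nrm_shift: "ok s ==> cont w ==> nrm s (%z. w z + b) <= nrm s w + 8 * abs b"
 using nrm_triangle[of s w "%_. b"] nrm_const[of s b] by (auto simp: continuous_on_const)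

lemma X_bounds:
 assumes s: "ok s"
 shows "nrm s w <= X s w b" "abs b <= X s w b / eta s" "0 <= X s w b"
  "cont w ==> nrm s (%z. w z + b) <= 9 / eta s * X s w b"
proof -
 note e = eta[OF s] and n = nrm_nonneg[of s w]
 show 1: "nrm s w <= X s w b" using e by (simp add: X_def)
 show 2: "abs b <= X s w b / eta s" using e n s by (simp add: X_def pos_le_divide_eq mult.commute)
 show 0: "0 <= X s w b" using 1 n s by simp
 assume w: "cont w"
 have "X s w b <= X s w b / eta s" using e 0 by (simp add: pos_le_divide_eq mult_left_le)
 then show "nrm s (%z. w z + b) <= 9 / eta s * X s w b" using nrm_shift[OF s w, of b] 1 2 by simp
qed

lemma integral_eV_abs: "ok s ==> cont f ==> (\<integral>z. abs (eV s z * f z)) <= 8 * nrm s f"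
proof -
 assume s: "ok s" and f: "cont f"
 have a: "cont (%z. abs (f z))" by (intro continuous_intros f)
 have "abs (eV s z * f z) = eV s z * (abs (f z) * 1)" for z using eV_pos[of s z] s by (simp add: abs_mult)
 then have "(\<integral>z. abs (eV s z * f z)) = (\<integral>z. eV s z * (abs (f z) * 1))" by simp
 also have "... <= nrm s (%z. abs (f z)) * nrm s (%z. 1)"
  using nrm_CS[OF _ a continuous_on_const, of s 1] s by linarith
 also have "nrm s (%z. abs (f z)) = nrm s f" by (simp add: nrm_def)
 also have "nrm s f * nrm s (%z. 1) <= nrm s f * 8" using nrm_const[OF s, of 1] nrm_nonneg[of s f] s by (intro mult_left_mono) auto
 finally show ?thesis by simp
qed

text \<open>In terms of \<open>nrm s f\<close>, the bound \<open>eV <= 8/s\<close> makes the 2-norm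
  of \<open>eV f\<close> of order \<open>s powr (-1/2)\<close>, while its 1-norm is of order 1;
  \<open>Kb\<close> takes the geometric mean.\<close>

lemma K_eV_bound:
 assumes s: "ok s" and f: "cont f" "Per f"
 shows "abs (K (%z. eV s z * f z) z) <= 5 * C * s powr (-1/4) * nrm s f"
proof -
 define n where "n = nrm s f"
 have n: "n >= 0" unfolding n_def using nrm_nonneg s by simp
 have c: "cont (%z. eV s z * f z)" using s by (intro continuous_intros eV_cont f) simp
 have p: "Per (%z. eV s z * f z)" using f(2) eV_per by (simp add: Per_def)
 have "sqrt (\<integral>z. (eV s z * f z)^2) <= sqrt (8 / s * n^2)"
  using integral_eV_sq[of s f] s f by (intro real_sqrt_le_mono) (simp add: n_def)
 also have "... = sqrt (8 / s) * n" unfolding real_sqrt_mult using n by simp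
 finally have 1: "sqrt (\<integral>z. (eV s z * f z)^2) <= sqrt (8 / s) * n" .
 have "sqrt (\<integral>z. (eV s z * f z)^2) * (\<integral>z. abs (eV s z * f z)) <= (sqrt (8 / s) * n) * (8 * n)"
  using integral_eV_abs[OF s f(1)] s n by (intro mult_mono 1) (auto simp: n_def)
 also have "... <= (5 * s powr (-1/4) * n)^2"
 proof -
  have "sqrt (8 / s) * 8 <= 25 * s powr (-1/2)"
  proof -
   have "sqrt 8 <= (3::real)" by (rule real_le_lsqrt) auto
   then have "sqrt 8 / sqrt s * 8 <= 25 / sqrt s" using s by (simp add: divide_right_mono)
   then show ?thesis using s by (simp add: real_sqrt_divide powr_minus_divide powr_half_sqrt)
  qed
  moreover have "(s powr (-1/4))^2 = s powr (-1/2)" using s by (simp add: sqr powr_add[symmetric])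
  ultimately have "(sqrt (8 / s) * 8) * n^2 <= 25 * (s powr (-1/4))^2 * n^2" by (intro mult_right_mono) auto
  then show ?thesis by (simp only: power_mult_distrib sqr[of n]) (simp add: mult_ac)
 qed
 finally have "sqrt (sqrt (\<integral>z. (eV s z * f z)^2) * (\<integral>z. abs (eV s z * f z))) <= 5 * s powr (-1/4) * n"
  using n by (intro real_le_lsqrt) auto
 then have "C * sqrt (sqrt (\<integral>z. (eV s z * f z)^2) * (\<integral>z. abs (eV s z * f z))) <= C * (5 * s powr (-1/4) * n)"
  using C by (intro mult_left_mono) auto
 then show ?thesis using Kb[OF c p, of z] by (simp add: n_def)
qed

lemma k_props:
 assumes s: "ok s"
 shows "C2 (K (eV s))" "Per (K (eV s))" "(\<integral>z. K (eV s) z) = 0" "K (eV s) (- z) = K (eV s) z" "lap (K (eV s)) z = mass s / area - eV s z"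
  "cont (K (eV s))"
 using K_props[OF C1_cont[OF C1_eV] eV_per] K_C2[OF C1_eV eV_per] s eV_even by (auto simp: mass_def)

text \<open>Tested with \<open>h\<close>, the constants \<open>c0\<close> and \<open>be\<close> drop
  out by the two orthogonality conditions, and coercivity applies. Tested with
  \<open>K (eV s)\<close>, the left side vanishes by the same conditions and \<open>be\<close> is
  read off.\<close>

lemma linear_estimate:
 assumes s: "ok s" and h: "admissible s h" and f: "cont f" and eq: "!!z. lap h z = c0 - eV s z * (f z + be)"
 shows "(1 + c / l s) * nrm s h <= nrm s f" "abs be <= 8 * C^2 * l s * nrm s f" "X s h be <= (1 - c / (4 * l s)) * nrm s f"
proof -
 have s0: "s > 0" using s by simp
 note h' = h[unfolded admissible_def]
 note l1 = l_ge_1[OF s]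
 have cl [continuous_intros]: "cont h" "cont (eV s)" "cont f" "cont (K (eV s))"
  using h' C2_cont eV_cont s f k_props(6)[OF s] by auto
 have test: "(\<integral>z. g z * lap h z) = c0 * (\<integral>z. g z) - (\<integral>z. eV s z * (f z * g z)) - be * (\<integral>z. eV s z * g z)"
  if [continuous_intros]: "cont g" for g
 proof -
  have "(\<integral>z. g z * lap h z) = (\<integral>z. c0 * g z - 1 * (eV s z * (f z * g z)) - be * (eV s z * g z))"
   unfolding eq by (simp add: algebra_simps)
  then show ?thesis by (simp only: integral_lin(2) continuous_intros) simp
 qed
 define n where "n = nrm s h"
 have n: "n >= 0" unfolding n_def by (rule nrm_nonneg[OF s0])
 have "dir h h = (\<integral>z. eV s z * (f z * h z))"
  using green[of h h] test[OF cl(1)] h' C2_C1 by auto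
 also have "... <= nrm s f * n" unfolding n_def using nrm_CS[OF s0 f cl(1)] by linarith
 finally have "(1 + c / l s) * n^2 <= nrm s f * n"
  using coer[of s h] s h unfolding n_def nrm_sq[OF s0] l_def by auto
 then show 1: "(1 + c / l s) * nrm s h <= nrm s f"
  using n nrm_nonneg[OF s0, of f] unfolding n_def[symmetric] by (cases "n = 0") (auto simp: sqr)
 define q where "q = (\<integral>z. K (eV s) z * eV s z)"
 have q: "1 <= C * q" using keV0[of s] s by (simp add: q_def)
 have q0: "q > 0"
 proof -
  have "0 < C * q" using q by linarith
  then show ?thesis using C by (simp add: zero_less_mult_iff)
 qed
 have "(\<integral>z. K (eV s) z * lap h z) = (\<integral>z. h z * lap (K (eV s)) z)"
  by (rule green_sym) (use h' k_props[OF s] in auto)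
 also have "... = (\<integral>z. mass s / area * h z - 1 * (eV s z * h z))" unfolding k_props(5)[OF s] by (simp add: algebra_simps)
 also have "... = 0" by (subst integral_lin(2)) (intro continuous_intros | use h' in simp)+
 finally have "be * q = - (\<integral>z. eV s z * (f z * K (eV s) z))"
  using test[OF cl(4)] k_props(3)[OF s] by (simp add: q_def mult.commute)
 then have "abs be * q = abs (\<integral>z. eV s z * (f z * K (eV s) z))" using q0 by (metis abs_minus_cancel abs_mult abs_of_pos)
 also have "... <= (\<integral>z. abs (eV s z * (f z * K (eV s) z)))" by (rule abs_integral_le)
 also have "... <= (\<integral>z. C * l s * abs (eV s z * f z))"
 proof (rule integral_mono)
  fix z
  have "abs (eV s z * f z) * abs (K (eV s) z) <= abs (eV s z * f z) * (C * l s)" using keV[of s z] s by (intro mult_left_mono) (auto simp: l_def)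
  then show "abs (eV s z * (f z * K (eV s) z)) <= C * l s * abs (eV s z * f z)" by (simp add: abs_mult mult_ac)
 qed (intro integrable_M continuous_intros)+
 also have "... <= C * l s * (8 * nrm s f)" using integral_eV_abs[OF s f] C l1 by (auto intro!: mult_left_mono)
 finally have b: "abs be * q <= C * l s * (8 * nrm s f)" .
 have "abs be <= abs be * (C * q)" using q mult_left_mono[OF q, of "abs be"] by simp
 also have "... = C * (abs be * q)" by simp
 also have "... <= C * (C * l s * (8 * nrm s f))" using b C by (intro mult_left_mono) auto
 finally show 2: "abs be <= 8 * C^2 * l s * nrm s f" by (simp add: sqr mult_ac)
 define x where "x = c / l s"
 have x: "0 < x" "x <= 1" using c l1 by (auto simp: x_def divide_le_eq)
 have nf: "0 <= nrm s f" by (rule nrm_nonneg[OF s0])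
 \<comment> \<open>This is \<open>1 / (1 + x) <= 1 - x/2\<close> on the unit interval, in product
   form.\<close>
 have "(1 - x / 2) * nrm s f - n = (1 - x / 2) * (nrm s f - (1 + x) * n) + (x / 2 * (1 - x)) * n" by (simp add: field_simps sqr)
 moreover have "0 <= (1 - x / 2) * (nrm s f - (1 + x) * n)" using 1 x by (intro mult_nonneg_nonneg) (auto simp: n_def x_def)
 moreover have "0 <= (x / 2 * (1 - x)) * n" using x n by (intro mult_nonneg_nonneg) auto
 ultimately have a: "n <= (1 - x / 2) * nrm s f" by linarith
 have "eta s * abs be <= eta s * (8 * C^2 * l s * nrm s f)" using 2 eta[OF s] by (intro mult_left_mono) auto
 also have "... = x / 4 * nrm s f" using C l1 by (simp add: eta_def x_def field_simps sqr)
 finally have "X s h be <= (1 - x / 4) * nrm s f" using a unfolding X_def n_def by (simp add: left_diff_distrib)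
 then show "X s h be <= (1 - c / (4 * l s)) * nrm s f" by (simp add: x_def mult.commute)
qed

text \<open>The weighted norm gives no pointwise control; that comes from writing \<open>h\<close>
  as the potential of its own source.\<close>

lemma sup_estimate:
 assumes s: "ok s" and h: "C2 h" "Per h" "(\<integral>z. h z) = 0" and f: "C1 f" "Per f" and eq: "!!z. lap h z = c0 - eV s z * (f z + be)"
 shows "abs (h z) <= 5 * C * s powr (-1/4) * nrm s f + C * l s * abs be"
proof -
 have s0: "s > 0" using s by simp
 note e = C1_eV[OF s0] eV_per[of s]
 have g: "C1 (%z. eV s z * f z)" "Per (%z. eV s z * f z)" using f e by (auto intro: C1_mult(1) Per_mult)
 have gg: "C1 (%z. eV s z * f z + be * eV s z)" "Per (%z. eV s z * f z + be * eV s z)"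
  by (intro C1_add(1) C1_cmult(1) g e) (use g e in \<open>simp add: Per_def\<close>)
 have "h = K (%z. eV s z * f z + be * eV s z)" by (rule K_unique[OF h gg]) (simp add: eq algebra_simps)
 then have "h z = K (%z. eV s z * f z) z + be * K (eV s) z"
  using K_lin[OF C1_cont[OF g(1)] g(2) C1_cont[OF e(1)] e(2)] by simp
 then have "abs (h z) <= abs (K (%z. eV s z * f z) z) + abs be * abs (K (eV s) z)" by (metis abs_mult abs_triangle_ineq)
 also have "... <= 5 * C * s powr (-1/4) * nrm s f + abs be * (C * l s)"
  using keV[of s z] s by (intro add_mono mult_left_mono K_eV_bound[OF s C1_cont[OF f(1)] f(2)]) (auto simp: l_def)
 finally show ?thesis by (simp add: mult_ac)
qed

end

lemma geometric_rate:
 fixes F :: "nat => 'a => real"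
 assumes F: "!!n. abs (F (Suc n) z - F n z) <= B * tt ^ n" and tt: "0 <= tt" "tt < 1" and nm: "n <= m"
 shows "abs (F n z - F m z) <= B / (1 - tt) * tt ^ n"
proof -
 have B: "0 <= B" using F[of 0] by simp
 have "abs (F n z - F m z) <= B / (1 - tt) * (tt ^ n - tt ^ m)"
  using nm
 proof (induction m rule: dec_induct)
  case (step m)
  have "B / (1 - tt) * (tt ^ n - tt ^ Suc m) = B / (1 - tt) * (tt ^ n - tt ^ m) + B * tt ^ m"
   using tt by (simp add: field_simps)
  then show ?case using step.IH F[of m] by linarith
 qed simp
 also have "... <= B / (1 - tt) * tt ^ n" using B tt by (intro mult_left_mono) auto
 finally show ?thesis .
qed

context est
begin

text \<open>The sup radius. Up to logarithms \<open>Z\<close> is of order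
  \<open>s powr (11/16)\<close> and \<open>Dc A\<close> of order
  \<open>s powr (11/16 - 1/4)\<close>, that is \<open>s powr (7/16)\<close>. The exponent 3/8 lies
  below both, and is large enough that \<open>r s * s powr (7/8)\<close> is
  \<open>o(s)\<close>.\<close>

definition r :: "real => real" where "r s = s powr (3/8)"
definition Z :: "real => real" where "Z s = C * s powr (11/16) + (1 + C * l s) * C ^ 3 * l s * s powr (7/8)"
text \<open>The solution of \<open>A = th A + 8 Z\<close>: the ball of this radius is invariant
  under a map that contracts by \<open>th\<close> and moves 0 by at most \<open>8 Z\<close>.\<close>

definition A :: "real => real" where "A s = 64 * l s / c * Z s"
definition Dc :: "real => real" where "Dc s = 2 * (5 * C * s powr (-1/4) + 8 * C ^ 3 * (l s)^2)"
text \<open>The first inequality makes the step contract in the weighted norm, the second keeps the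
  iterates in the sup ball.\<close>

definition small :: "real => bool" where
 "small s \<longleftrightarrow> 0 < s & s < s1 & 18 * r s / eta s <= c / (8 * l s) & Z s + (Dc s + 16 * C^2 * l s) * A s <= r s"
definition th :: "real => real" where "th s = 1 - c / (8 * l s)"

lemma small_ok: "small s ==> ok s" by (simp add: small_def)

lemma eventually_small: "\<forall>\<^sub>F s in at_right 0. small s"
proof -
 have cC: "0 < c" "0 < C" using c C by auto
 \<comment> \<open>Each inequality of \<open>small\<close> divided by its right-hand side, written
   out as an elementary function of \<open>s\<close>.\<close>
 have 1: "((%s. 18 * s powr (3/8) / (c / (32 * C^2 * (ln (1 / s))^2)) / (c / (8 * ln (1 / s)))) \<longlongrightarrow> 0) (at_right 0)"
  using cC by real_asymp
 have 2: "((%s. ((C * s powr (11/16) + (1 + C * ln (1 / s)) * C ^ 3 * ln (1 / s) * s powr (7/8))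
   + (2 * (5 * C * s powr (-1/4) + 8 * C ^ 3 * (ln (1 / s))^2) + 16 * C^2 * ln (1 / s))
    * (64 * ln (1 / s) / c * (C * s powr (11/16) + (1 + C * ln (1 / s)) * C ^ 3 * ln (1 / s) * s powr (7/8)))) / s powr (3/8)) \<longlongrightarrow> 0) (at_right 0)"
  using cC by real_asymp
 have "\<forall>\<^sub>F s in at_right 0. ok s" unfolding eventually_at_right_field using s1 by (intro exI[of _ s1]) auto
 then show ?thesis
  using order_tendstoD(2)[OF 1 zero_less_one] order_tendstoD(2)[OF 2 zero_less_one]
 proof eventually_elim
  case (elim s)
  then have p: "c / (8 * l s) > 0" "r s > 0" using l_ge_1[of s] c by (auto simp: r_def)
  have "18 * r s / eta s / (c / (8 * l s)) < 1" "(Z s + (Dc s + 16 * C^2 * l s) * A s) / r s < 1"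
   unfolding r_def eta_def l_def Z_def A_def Dc_def using elim by simp_all
  then have "18 * r s / eta s < 1 * (c / (8 * l s))" "Z s + (Dc s + 16 * C^2 * l s) * A s < 1 * r s"
   using p by (simp_all only: pos_divide_less_eq)
  then show ?case using elim(1) by (simp add: small_def)
 qed
qed

lemma small_bounds:
 assumes "small s"
 shows "0 < r s" "r s <= 1" "0 <= Z s" "0 <= A s" "0 <= Dc s" "0 < th s" "th s < 1" "1 + 18 * r s / eta s <= 2"
  "(1 - c / (4 * l s)) * (1 + 18 * r s / eta s) <= th s"
proof -
 note s = small_ok[OF assms] and l1 = l_ge_1[OF small_ok[OF assms]]
 have se: "s <= 1" using s s1 by (meson less_imp_le order_trans exp_le_one_iff[THEN iffD2] neg_le_0_iff_le[THEN iffD2] zero_le_one)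
 show "0 < r s" "r s <= 1" using s se by (auto simp: r_def powr_le1)
 show Z: "0 <= Z s" using C l1 by (auto simp: Z_def intro!: add_nonneg_nonneg mult_nonneg_nonneg)
 then show "0 <= A s" using c l1 by (auto simp: A_def)
 show "0 <= Dc s" using C by (auto simp: Dc_def intro!: add_nonneg_nonneg mult_nonneg_nonneg)
 define x where "x = c / (8 * l s)"
 have x: "0 < x" "x <= 1 / 8" using c l1 by (auto simp: x_def divide_le_eq)
 then show "0 < th s" "th s < 1" by (auto simp: th_def x_def[symmetric])
 have e: "18 * r s / eta s <= x" using assms by (simp add: small_def x_def)
 then show "1 + 18 * r s / eta s <= 2" using x by simp
 have "(1 - 2 * x) * (1 + 18 * r s / eta s) <= (1 - 2 * x) * (1 + x)" using e x by (intro mult_left_mono) auto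
 also have "... <= 1 - x" using x by (simp add: algebra_simps)
 finally show "(1 - c / (4 * l s)) * (1 + 18 * r s / eta s) <= th s" by (simp add: th_def x_def)
qed

text \<open>A fixed point solves the nonlinear equation, because \<open>x + N x = exp x - 1\<close>.
  The linear term \<open>eV w\<close> belongs to the old iterate: coercivity with a factor above 1
  makes this map contract. The constant \<open>c0\<close> is free since the Laplacian determines its
  source up to the mean.\<close>

definition step :: "real => (complex => real) => real => (complex => real) => real => bool" where
 "step s w b w' b' \<longleftrightarrow> admissible s w' &
  (EX c0. ALL z. lap w' z = c0 - eV s z * (w z + N (w z + b)) - err s z - b' * eV s z)"

lemma admissible_0: "admissible s (%_. 0)"
 by (simp add: admissible_def C2_const Per_def)

lemma source_C1:
 assumes "s > 0" "C1 w" "Per w"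
 shows "C1 (%z. eV s z * (w z + N (w z + b)) + err s z + b' * eV s z)" "Per (%z. eV s z * (w z + N (w z + b)) + err s z + b' * eV s z)"
 by (intro C1_add(1) C1_mult(1) C1_cmult(1) C1_N C1_const(1) C1_eV C1_err assms)
  (use assms(3) eV_per err_per in \<open>simp add: Per_def\<close>)

text \<open>The mean-zero potential of the source satisfies everything except orthogonality to
  \<open>eV\<close>. Symmetry of \<open>K\<close> turns this last condition into one linear equation
  for \<open>b'\<close> with the nonzero coefficient \<open>q\<close>.\<close>

lemma step_ex:
 assumes s: "ok s" and w: "admissible s w"
 shows "EX w' b'. step s w b w' b'"
proof -
 have s0: "s > 0" using s by simp
 have w: "C1 w" "Per w" "!!z. w (- z) = w z" using w C2_C1 by (auto simp: admissible_def)
 define q where "q = (\<integral>z. K (eV s) z * eV s z)"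
 have q: "q ~= 0" using keV0[of s] s by (auto simp: q_def)
 define G where "G b' = (%z. eV s z * (w z + N (w z + b)) + err s z + b' * eV s z)" for b'
 note G = source_C1[OF s0 w(1,2), of b, folded G_def]
 have Ge: "G b' (- z) = G b' z" for b' z by (simp add: G_def w(3) eV_even err_even)
 define b' where "b' = - (\<integral>z. G 0 z * K (eV s) z) / q"
 have "(\<integral>z. K (G b') z * eV s z) = (\<integral>z. G b' z * K (eV s) z)"
  by (rule K_sym[OF G C1_eV[OF s0] eV_per])
 also have "... = (\<integral>z. G 0 z * K (eV s) z + b' * (K (eV s) z * eV s z))" by (simp add: G_def algebra_simps)
 also have "... = (\<integral>z. G 0 z * K (eV s) z) + b' * q"
  unfolding q_def by (intro integral_lin(1) continuous_intros C1_cont[OF G(1)] k_props(6)[OF s] eV_cont s0)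
 also have "... = 0" using q by (simp add: b'_def)
 finally have "admissible s (K (G b'))"
  using K_props(3,4)[OF C1_cont[OF G(1)] G(2), of b'] K_props(5)[OF C1_cont[OF G(1)] G(2) Ge] K_C2(1)[OF G] by (simp add: admissible_def mult.commute)
 moreover have "lap (K (G b')) z = (\<integral>w. G b' w) / area - eV s z * (w z + N (w z + b)) - err s z - b' * eV s z" for z
  unfolding K_C2(2)[OF G] by (simp add: G_def)
 ultimately show ?thesis unfolding step_def by blast
qed

lemma admissible_diff:
 assumes fg: "admissible s f" "admissible s g" and s: "s > 0"
 shows "admissible s (%z. f z - g z)"
proof -
 have c: "cont f" "cont g" using fg by (auto simp: admissible_def C2_cont)
 show ?thesis
  using integral_lin(4)[OF c] integral_lin(4)[OF continuous_on_mult[OF eV_cont[OF s] c(1)] continuous_on_mult[OF eV_cont[OF s] c(2)]] fg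
  by (auto simp: admissible_def right_diff_distrib intro!: C2_sub(1) Per_sub)
qed

text \<open>\<open>N\<close> is Lipschitz with constant \<open>2 rh\<close> on the sup ball, and
  \<open>nrm s (w + b)\<close> costs \<open>9 / eta\<close> in terms of \<open>X\<close>; hence the
  perturbation \<open>18 rh / eta\<close> of the contraction.\<close>

lemma source_diff:
 assumes s: "ok s" and w: "C1 w1" "Per w1" "C1 w2" "Per w2" and b: "!!z. abs (w1 z + b1) <= rh" "!!z. abs (w2 z + b2) <= rh" and rh: "rh <= 1"
  and f_def: "f = (%z. w1 z - w2 z + (N (w1 z + b1) - N (w2 z + b2)))" and x_def: "x = X s (%z. w1 z - w2 z) (b1 - b2)"
 shows "C1 f" "Per f" "nrm s f <= (1 + 18 * rh / eta s) * x" "0 <= x"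
proof -
 have s0: "s > 0" using s by simp
 have rh0: "0 <= rh" by (rule order_trans[OF abs_ge_zero b(1)])
 show "C1 f" "Per f" unfolding f_def
  by (intro C1_add(1) C1_sub(1) C1_N C1_const(1) w) (use w in \<open>simp add: Per_def\<close>)
 have cd [continuous_intros]: "cont w1" "cont w2" using w C1_cont by auto
 have xn: "nrm s (%z. w1 z - w2 z + (b1 - b2)) <= 9 / eta s * x" "nrm s (%z. w1 z - w2 z) <= x" "0 <= x"
  unfolding x_def using X_bounds(1,3)[OF s, of "%z. w1 z - w2 z" "b1 - b2"] X_bounds(4)[OF s continuous_on_diff[OF cd], of "b1 - b2"] by simp_all
 have "nrm s (%z. N (w1 z + b1) - N (w2 z + b2)) <= nrm s (%z. (2 * rh) * (w1 z - w2 z + (b1 - b2)))"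
 proof (rule nrm_mono[OF s0])
  fix z
  have "abs (N (w1 z + b1) - N (w2 z + b2)) <= 2 * rh * abs (w1 z + b1 - (w2 z + b2))" by (rule N_lipschitz[OF b rh])
  also have "... = abs (2 * rh * (w1 z - w2 z + (b1 - b2)))" using rh0 by (simp add: abs_mult add_diff_add)
  finally show "abs (N (w1 z + b1) - N (w2 z + b2)) <= abs (2 * rh * (w1 z - w2 z + (b1 - b2)))" .
 qed (intro continuous_intros)+
 also have "... = 2 * rh * nrm s (%z. w1 z - w2 z + (b1 - b2))" using rh0 nrm_cmult[OF s0, of "2 * rh"] by simp
 also have "... <= 2 * rh * (9 / eta s * x)" using xn rh0 by (intro mult_left_mono) auto
 finally have "nrm s (%z. N (w1 z + b1) - N (w2 z + b2)) <= 18 * rh / eta s * x" by simp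
 moreover have "nrm s f <= nrm s (%z. w1 z - w2 z) + nrm s (%z. N (w1 z + b1) - N (w2 z + b2))"
  unfolding f_def by (intro nrm_triangle[OF s0] continuous_intros)
 ultimately show "nrm s f <= (1 + 18 * rh / eta s) * x" using xn by (simp add: distrib_right)
 show "0 <= x" by (rule xn(3))
qed

text \<open>\<open>err\<close> cancels in the difference of two steps, which thus solves the linear
  equation with source \<open>f\<close>; the linear estimate gives the weighted bounds and the sup
  estimate the pointwise one.\<close>

lemma step_diff:
 assumes sm: "small s" and 1: "step s w1 b1 w1' b1'" and 2: "step s w2 b2 w2' b2'"
  and w: "C1 w1" "Per w1" "C1 w2" "Per w2" and b: "!!z. abs (w1 z + b1) <= r s" "!!z. abs (w2 z + b2) <= r s"
 defines "x \<equiv> X s (%z. w1 z - w2 z) (b1 - b2)"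
 shows "X s (%z. w1' z - w2' z) (b1' - b2') <= th s * x" "abs (w1' z - w2' z) <= Dc s * x" "abs (b1' - b2') <= 16 * C^2 * l s * x"
proof -
 note s = small_ok[OF sm] and sb = small_bounds[OF sm]
 then have s0: "s > 0" by simp
 note l1 = l_ge_1[OF s]
 define f where "f = (%z. w1 z - w2 z + (N (w1 z + b1) - N (w2 z + b2)))"
 note sd = source_diff[OF s w b sb(2) f_def x_def[THEN meta_eq_to_obj_eq]]
 note f = sd(1,2) and nf = sd(3) and xn = sd(4)
 have nf2: "nrm s f <= 2 * x" by (rule order_trans[OF nf]) (use sb(8) xn in \<open>intro mult_right_mono; simp\<close>)
 obtain c1 c2 where cc: "!!z. lap w1' z = c1 - eV s z * (w1 z + N (w1 z + b1)) - err s z - b1' * eV s z"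
  "!!z. lap w2' z = c2 - eV s z * (w2 z + N (w2 z + b2)) - err s z - b2' * eV s z" using 1 2 unfolding step_def by auto
 have ad: "admissible s w1'" "admissible s w2'" using 1 2 by (auto simp: step_def)
 note h = admissible_diff[OF ad s0]
 have eq: "lap (%z. w1' z - w2' z) z = (c1 - c2) - eV s z * (f z + (b1' - b2'))" for z
  using C2_sub(2)[of w1' w2'] ad cc by (simp add: admissible_def f_def algebra_simps)
 note le = linear_estimate[OF s h C1_cont[OF f(1)] eq]
 have x0: "0 <= 1 - c / (4 * l s)" using c l1 by (simp add: divide_le_eq)
 have "X s (%z. w1' z - w2' z) (b1' - b2') <= (1 - c / (4 * l s)) * ((1 + 18 * r s / eta s) * x)"
  by (rule order_trans[OF le(3) mult_left_mono[OF nf x0]])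
 also have "... <= th s * x" using mult_right_mono[OF sb(9) xn] by (simp add: mult.assoc)
 finally show "X s (%z. w1' z - w2' z) (b1' - b2') <= th s * x" .
 have "8 * C^2 * l s * nrm s f <= 8 * C^2 * l s * (2 * x)" using nf2 l1 by (intro mult_left_mono) auto
 also have "... = 16 * C^2 * l s * x" by simp
 finally show b': "abs (b1' - b2') <= 16 * C^2 * l s * x" by (rule order_trans[OF le(2)])
 have "abs (w1' z - w2' z) <= 5 * C * s powr (-1/4) * nrm s f + C * l s * abs (b1' - b2')"
  by (rule sup_estimate[OF s _ _ _ f eq]) (use h in \<open>auto simp: admissible_def\<close>)
 also have "... <= 5 * C * s powr (-1/4) * (2 * x) + C * l s * (16 * C^2 * l s * x)"
  using nf2 b' C l1 by (intro add_mono mult_left_mono) auto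
 also have "... = Dc s * x" by (simp add: Dc_def sqr power3_eq_cube algebra_simps)
 finally show "abs (w1' z - w2' z) <= Dc s * x" .
qed

text \<open>From the origin the step is \<open>K (err) + b K (eV)\<close>; \<open>b\<close> is found
  by testing with \<open>K (eV)\<close>, whose pairing with \<open>err\<close> is of order
  \<open>ln (1/s) s powr (7/8)\<close>.\<close>

lemma step_0:
 assumes s: "ok s" and st: "step s (%_. 0) 0 w b"
 shows "abs (w z) + abs b <= Z s" "X s w b <= 8 * Z s"
proof -
 have s0: "s > 0" using s by simp
 note l1 = l_ge_1[OF s]
 obtain c0 where eq: "!!z. lap w z = c0 - err s z - b * eV s z" using st by (auto simp: step_def N_0)
 have w: "C2 w" "Per w" "(\<integral>z. w z) = 0" "(\<integral>z. eV s z * w z) = 0" using st by (auto simp: step_def admissible_def)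
 note e = C1_err[OF s0] err_per[of s] C1_eV[OF s0] eV_per[of s]
 note cc [continuous_intros] = C1_cont[OF e(1)] C1_cont[OF e(3)] k_props(6)[OF s] C2_cont[OF w(1)]
 define q where "q = (\<integral>z. K (eV s) z * eV s z)"
 have q: "1 <= C * q" using keV0[of s] s by (simp add: q_def)
 have "(\<integral>z. K (eV s) z * lap w z) = (\<integral>z. w z * lap (K (eV s)) z)"
  by (rule green_sym) (use w k_props[OF s] in auto)
 also have "... = (\<integral>z. mass s / area * w z - 1 * (eV s z * w z))" unfolding k_props(5)[OF s] by (simp add: algebra_simps)
 also have "... = 0" by (subst integral_lin(2)) (intro continuous_intros | use w in simp)+
 also have "(\<integral>z. K (eV s) z * lap w z) = (\<integral>z. c0 * K (eV s) z - 1 * (K (eV s) z * err s z) - b * (K (eV s) z * eV s z))"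
  unfolding eq by (simp add: algebra_simps)
 also have "... = c0 * (\<integral>z. K (eV s) z) - (\<integral>z. K (eV s) z * err s z) - b * q"
  unfolding q_def by (simp only: integral_lin(2) continuous_intros) simp
 finally have "b * q = - (\<integral>z. K (eV s) z * err s z)" using k_props(3)[OF s] by simp
 then have "abs b * abs q = abs (\<integral>z. K (eV s) z * err s z)" by (metis abs_minus_cancel abs_mult)
 also have "... <= (\<integral>z. abs (K (eV s) z * err s z))" by (rule abs_integral_le)
 also have "... <= (\<integral>z. C * l s * abs (err s z))"
 proof (rule integral_mono)
  show "abs (K (eV s) z * err s z) <= C * l s * abs (err s z)" for z
   using keV[of s z] s unfolding abs_mult l_def by (intro mult_right_mono) auto
 qed (intro integrable_M continuous_intros)+
 also have "... <= C * l s * (C * s powr (7/8))" using err1[of s] s C l1 by (auto intro!: mult_left_mono)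
 finally have bq: "abs b * abs q <= C * l s * (C * s powr (7/8))" .
 have "1 <= C * abs q" using q mult_left_mono[OF abs_ge_self[of q], of C] C by linarith
 then have "abs b <= abs b * (C * abs q)" using mult_left_mono[of 1 "C * abs q" "abs b"] by simp
 also have "... = C * (abs b * abs q)" by simp
 also have "... <= C * (C * l s * (C * s powr (7/8)))" using bq C by (intro mult_left_mono) auto
 finally have b: "abs b <= C ^ 3 * l s * s powr (7/8)" by (simp add: power3_eq_cube mult_ac)
 have "w = K (%z. err s z + b * eV s z)"
  by (rule K_unique[OF w(1-3)]) (use e eq in \<open>auto intro!: C1_add(1) C1_cmult(1) simp: Per_def\<close>)
 then have "w z = K (err s) z + b * K (eV s) z" for z using K_lin[OF cc(1) e(2) cc(2) e(4)] by simp
 then have wz: "abs (w z) <= C * s powr (11/16) + abs b * (C * l s)" for z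
 proof -
  assume "!!z. w z = K (err s) z + b * K (eV s) z"
  then have "abs (w z) <= abs (K (err s) z) + abs b * abs (K (eV s) z)" by (metis abs_mult abs_triangle_ineq)
  also have "... <= C * s powr (11/16) + abs b * (C * l s)"
   using Kerr[of s z] keV[of s z] s by (intro add_mono mult_left_mono) (auto simp: l_def)
  finally show ?thesis .
 qed
 have "C * s powr (11/16) + abs b * (C * l s) + abs b = C * s powr (11/16) + (1 + C * l s) * abs b" by (simp add: algebra_simps)
 also have "... <= C * s powr (11/16) + (1 + C * l s) * (C ^ 3 * l s * s powr (7/8))" using b C l1 by (intro add_mono mult_left_mono) auto
 also have "... = Z s" by (simp add: Z_def mult.assoc)
 finally have ZZ: "C * s powr (11/16) + abs b * (C * l s) + abs b <= Z s" .
 then show "abs (w z) + abs b <= Z s" using wz[of z] by linarith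
 define p where "p = C * s powr (11/16) + abs b * (C * l s)"
 have "X s w b <= 8 * p + 1 * abs b"
  unfolding X_def p_def using eta[OF s] by (intro add_mono mult_right_mono nrm_bound[OF s cc(4) wz]) auto
 then show "X s w b <= 8 * Z s" using ZZ[folded p_def] abs_ge_zero[of b] by linarith
qed

text \<open>Two balls at once: the step contracts in \<open>X\<close>, while \<open>N\<close> is
  Lipschitz in the sup ball of \<open>w + b\<close>.\<close>

definition bset :: "real => (complex => real) => real => bool" where
 "bset s w b \<longleftrightarrow> admissible s w & X s w b <= A s & (ALL z. abs (w z + b) <= r s)"

lemma bset_C1: "bset s w b ==> C1 w" "bset s w b ==> Per w"
 using C2_C1 by (auto simp: bset_def admissible_def)

lemma bset_0: "small s ==> bset s (%_. 0) 0"
 using small_bounds[of s] admissible_0 by (simp add: bset_def X_def nrm_def)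

lemma A_eq: "small s ==> th s * A s + 8 * Z s = A s"
 using l_ge_1[OF small_ok, of s] c by (simp add: th_def A_def field_simps)

text \<open>Both bounds follow by comparison with the step from \<open>(0, 0)\<close>: contraction
  for \<open>X\<close>, and \<open>Z + (Dc + 16 C^2 l) A <= r\<close> for the sup norm.\<close>

lemma step_bset:
 assumes sm: "small s" and p: "bset s w b" and st: "step s w b w' b'"
 shows "bset s w' b'"
proof -
 note s = small_ok[OF sm] and sb = small_bounds[OF sm]
 then have s0: "s > 0" by simp
 obtain w1 b1 where st1: "step s (%_. 0) 0 w1 b1" using step_ex[OF s admissible_0] by blast
 note d = step_diff[OF sm st st1 bset_C1[OF p] bset_C1[OF bset_0[OF sm]]]
 have b: "abs (w z + b) <= r s" "X s w b <= A s" for z using p by (auto simp: bset_def)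
 have d: "X s (%z. w' z - w1 z) (b' - b1) <= th s * A s" "abs (w' z - w1 z) <= Dc s * A s" "abs (b' - b1) <= 16 * C^2 * l s * A s" for z
  using d[OF b(1)] sb b(2) l_ge_1[OF s] by (auto intro: order_trans[OF _ mult_left_mono[OF b(2)]])
 have ad: "admissible s w'" "admissible s w1" using st st1 by (auto simp: step_def)
 then have cw: "cont w'" "cont w1" by (auto simp: admissible_def C2_cont)
 have "nrm s w' <= nrm s (%z. w' z - w1 z) + nrm s w1"
  using nrm_triangle[OF s0 continuous_on_diff[OF cw] cw(2)] by simp
 moreover have "eta s * abs (b') <= eta s * (abs (b' - b1) + abs b1)" using eta[OF s] by (intro mult_left_mono) auto
 ultimately have "X s w' b' <= th s * A s + 8 * Z s"
  using d(1) step_0(2)[OF s st1] unfolding X_def by (simp add: distrib_left)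
 moreover have "abs (w' z + b') <= r s" for z
 proof -
  have "abs (w' z + b') <= Z s + (Dc s + 16 * C^2 * l s) * A s"
   using d(2)[of z] d(3) step_0(1)[OF s st1, of z] unfolding distrib_right by linarith
  then show ?thesis using sm by (simp add: small_def)
 qed
 ultimately show ?thesis using ad A_eq[OF sm] by (simp add: bset_def)
qed

text \<open>\<open>ga\<close> is the free constant by which the parameter of the equation moves from
  \<open>2 kp\<close> to \<open>2 kp + ga\<close>.\<close>

definition sol :: "real => (complex => real) => real => real => bool" where
 "sol s w b ga \<longleftrightarrow> admissible s w & (ALL z. abs (w z + b) <= r s) &
  (ALL z. lap w z = ga - eV s z * (exp (w z + b) - 1) - err s z)"

lemma sol_step: "sol s w b ga ==> step s w b w b"
 unfolding sol_def step_def by (auto simp: N_def algebra_simps intro!: exI[of _ ga])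

text \<open>A solution is a fixed point of the step, so contraction relative to the first step from
  0 yields the \<open>A\<close>-bound a posteriori, for every solution in the sup ball and not just
  for the constructed one.\<close>

lemma sol_X:
 assumes sm: "small s" and p: "sol s w b ga"
 shows "X s w b <= A s"
proof -
 note s = small_ok[OF sm] and sb = small_bounds[OF sm]
 then have s0: "s > 0" by simp
 obtain w1 b1 where st1: "step s (%_. 0) 0 w1 b1" using step_ex[OF s admissible_0] by blast
 have w: "C1 w" "Per w" "!!z. abs (w z + b) <= r s" using p C2_C1 by (auto simp: sol_def admissible_def)
 have d: "X s (%z. w z - w1 z) (b - b1) <= th s * X s w b"
  using step_diff(1)[OF sm sol_step[OF p] st1 w(1,2) bset_C1[OF bset_0[OF sm]] w(3)] sb(1) by simp
 have cw: "cont w" "cont w1" using st1 C1_cont[OF w(1)] by (auto simp: step_def admissible_def C2_cont)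
 have "nrm s w <= nrm s (%z. w z - w1 z) + nrm s w1"
  using nrm_triangle[OF s0 continuous_on_diff[OF cw] cw(2)] by simp
 moreover have "eta s * abs b <= eta s * (abs (b - b1) + abs b1)" using eta[OF s] by (intro mult_left_mono) auto
 ultimately have "X s w b <= th s * X s w b + 8 * Z s"
  using d step_0(2)[OF s st1] unfolding X_def by (simp add: distrib_left)
 then have "(1 - th s) * X s w b <= (1 - th s) * A s" using A_eq[OF sm] by (simp add: algebra_simps)
 then show ?thesis using sb(7) by simp
qed

text \<open>The iterates converge geometrically in the sup norm, without control of Laplacians. The
  limit is therefore identified as \<open>K g\<close> with \<open>g\<close> continuous, hence it is
  \<open>C1\<close>; then \<open>g\<close> is \<open>C1\<close> too, and \<open>K g\<close> is
  \<open>C2\<close>.\<close>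

lemma sol_exists:
 assumes sm: "small s"
 shows "EX w b ga. sol s w b ga"
proof -
 note s = small_ok[OF sm] and sb = small_bounds[OF sm]
 then have s0: "s > 0" by simp
 have "EX f. ALL n. bset s (fst (f n)) (snd (f n)) & step s (fst (f n)) (snd (f n)) (fst (f (Suc n))) (snd (f (Suc n)))"
 proof (rule dependent_nat_choice)
  show "EX p. bset s (fst p) (snd p)" using bset_0[OF sm] by (intro exI[of _ "(%_. 0, 0)"]) simp
  fix p :: "(complex => real) \<times> real" and n :: nat assume p: "bset s (fst p) (snd p)"
  then obtain w' b' where st: "step s (fst p) (snd p) w' b'" using step_ex[OF s, of "fst p" "snd p"] by (auto simp: bset_def)
  show "EX q. bset s (fst q) (snd q) & step s (fst p) (snd p) (fst q) (snd q)"
   using step_bset[OF sm p st] st by (intro exI[of _ "(w', b')"]) simp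
 qed
 then obtain f where f: "!!n. bset s (fst (f n)) (snd (f n))" "!!n. step s (fst (f n)) (snd (f n)) (fst (f (Suc n))) (snd (f (Suc n)))" by blast
 define w where "w n = fst (f n)" for n
 define b where "b n = snd (f n)" for n
 have p: "bset s (w n) (b n)" and st: "step s (w n) (b n) (w (Suc n)) (b (Suc n))" for n using f by (auto simp: w_def b_def)
 have wb: "C1 (w n)" "Per (w n)" "abs (w n z + b n) <= r s" for n z using bset_C1[OF p] p by (auto simp: bset_def)
 note cw [continuous_intros] = C1_cont[OF wb(1)]
 note sd = step_diff[OF sm st st wb(1,2) wb(1,2) wb(3) wb(3)]
 define X0 where "X0 = X s (%z. w 1 z - w 0 z) (b 1 - b 0)"
 have X: "X s (%z. w (Suc n) z - w n z) (b (Suc n) - b n) <= X0 * th s ^ n" for n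
 proof (induction n)
  case (Suc n)
  have "X s (%z. w (Suc (Suc n)) z - w (Suc n) z) (b (Suc (Suc n)) - b (Suc n)) <= th s * (X0 * th s ^ n)"
   by (rule order_trans[OF sd(1) mult_left_mono[OF Suc]]) (use sb in auto)
  then show ?case by (simp add: mult_ac)
 qed (simp add: X0_def)
 define B where "B = Dc s * X0 + X0 / eta s"
 have X0: "X0 >= 0" unfolding X0_def by (rule X_bounds(3)[OF s])
 have B: "Dc s * X0 <= B" "X0 / eta s <= B" "0 <= B" using X0 sb(5) eta[OF s] by (auto simp: B_def)
 have t: "0 <= th s" "th s < 1" using sb by auto
 \<comment> \<open>The sup estimate of a difference rests on the \<open>X\<close> estimate one step
   earlier; hence the shift of the index, and the sequences used below start at
   \<open>w 1\<close>.\<close>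
 have 1: "abs (w (Suc (Suc n)) z - w (Suc n) z) <= B * th s ^ n" for n z
 proof -
  have "abs (w (Suc (Suc n)) z - w (Suc n) z) <= Dc s * (X0 * th s ^ n)" by (rule order_trans[OF sd(2) mult_left_mono[OF X sb(5)]])
  also have "... <= B * th s ^ n" using mult_right_mono[OF B(1), of "th s ^ n"] t by (simp add: mult.assoc)
  finally show ?thesis .
 qed
 have 2: "abs (b (Suc (Suc n)) - b (Suc n)) <= B * th s ^ n" for n
 proof -
  have "abs (b (Suc (Suc n)) - b (Suc n)) <= X0 * th s ^ Suc n / eta s"
   by (rule order_trans[OF X_bounds(2)[OF s] divide_right_mono[OF X]]) (use eta[OF s] in simp)
  also have "... = X0 / eta s * th s ^ Suc n" by simp
  also have "... <= B * th s ^ n" using B X0 eta[OF s] t power_decreasing[of n "Suc n" "th s"] by (intro mult_mono) auto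
  finally show ?thesis .
 qed
 define a where "a n = B / (1 - th s) * th s ^ n" for n
 have a0: "a \<longlonglongrightarrow> 0"
 proof -
  have "a \<longlonglongrightarrow> B / (1 - th s) * 0" unfolding a_def[abs_def] by (intro tendsto_intros LIMSEQ_realpow_zero t)
  then show ?thesis by simp
 qed
 have gw: "n <= m ==> abs (w (Suc n) z - w (Suc m) z) <= a n" "n <= m ==> abs (b (Suc n) - b (Suc m)) <= a n" for n m z
  unfolding a_def using geometric_rate[of "%n. w (Suc n)", OF 1 t, of n m] geometric_rate[of "%n _. b (Suc n)", OF 2 t, of n m] by auto
 note wl = uniform_rate_limit[of "%n. w (Suc n)" a, OF gw(1) a0, simplified] and bl = uniform_rate_limit[of "%n (_ :: unit). b (Suc n)" a, OF gw(2) a0, simplified]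
 define w' where "w' z = lim (%n. w (Suc n) z)" for z
 define b' where "b' = lim (%n. b (Suc n))"
 note wl = wl[folded w'_def] and bl = bl[folded b'_def]
 have c' [continuous_intros]: "cont w'"
  by (rule uniform_limit_theorem[OF _ wl(3)]) (auto intro!: always_eventually cw)
 have per: "Per w'" unfolding w'_def[abs_def] using wb(2) by (simp add: Per_def)
 have r': "abs (w' z + b') <= r s" for z
 proof (rule LIMSEQ_le_const2)
  show "(%n. abs (w (Suc n) z + b (Suc n))) \<longlonglongrightarrow> abs (w' z + b')" by (intro tendsto_intros wl bl)
 qed (use wb(3) in blast)
 have even: "w' (- z) = w' z" for z unfolding w'_def using p by (simp add: bset_def admissible_def)
 define G where "G w b b' = (%z. eV s z * (w z + N (w z + b)) + err s z + b' * eV s z)" for w b b'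
 note G = source_C1[OF s0, folded G_def]
 have gcont [continuous_intros]: "cont (G w b b')" if "cont w" for w b b'
  unfolding G_def using that s0 by (intro continuous_intros eV_cont err_cont)
 have KG: "w (Suc n) = K (G (w n) (b n) (b (Suc n)))" for n
 proof -
  obtain c0 where "!!z. lap (w (Suc n)) z = c0 - G (w n) (b n) (b (Suc n)) z" using st[of n] by (auto simp: step_def G_def algebra_simps)
  then show ?thesis using st[of n] G[OF wb(1,2)] by (intro K_unique) (auto simp: step_def admissible_def)
 qed
 define g where "g = G w' b' b'"
 have gp: "Per g" unfolding g_def G_def using per eV_per err_per by (simp add: Per_def)
 have gc: "cont g" unfolding g_def by (intro gcont c')
 \<comment> \<open>\<open>56 = 8 * 7\<close>: the bound \<open>8/s\<close> for \<open>eV\<close>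
   times the sup distance \<open>1 + 4 + 1\<close> of the sources, rounded up.\<close>
 have close: "abs (g z - G (w (Suc n)) (b (Suc n)) (b (Suc (Suc n))) z) <= 56 / s * a n" for z n
 proof -
  have an: "a (Suc n) <= a n" using t B X0 eta[OF s] power_decreasing[of n "Suc n" "th s"] unfolding a_def
   by (intro mult_left_mono divide_nonneg_nonneg) (auto intro: order_trans[OF divide_nonneg_nonneg B(2)])
  have N: "abs (N (w' z + b') - N (w (Suc n) z + b (Suc n))) <= 2 * abs ((w' z + b') - (w (Suc n) z + b (Suc n)))"
   using N_lipschitz[of "w' z + b'" 1 "w (Suc n) z + b (Suc n)"] order_trans[OF r' sb(2)] order_trans[OF wb(3) sb(2)] by simp
  define d where "d = w' z - w (Suc n) z + (N (w' z + b') - N (w (Suc n) z + b (Suc n))) + (b' - b (Suc (Suc n)))"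
  have "abs ((w' z + b') - (w (Suc n) z + b (Suc n))) <= 2 * a n" using wl(2)[of n z] bl(2)[of n] by linarith
  then have N': "abs (N (w' z + b') - N (w (Suc n) z + b (Suc n))) <= 4 * a n" by (intro order_trans[OF N]) simp
  have bb: "abs (b' - b (Suc (Suc n))) <= a n" using bl(2)[of "Suc n"] an by linarith
  have "abs (w' z - w (Suc n) z) <= a n" using wl(2)[of n z] by linarith
  then have "abs d <= a n + 4 * a n + a n"
   unfolding d_def by (intro order_trans[OF abs_triangle_ineq] add_mono N' bb)
  also have "... <= 7 * a n" using order_trans[OF abs_ge_zero bb] by simp
  finally have "abs d <= 7 * a n" .
  then have "abs (eV s z) * abs d <= 8 / s * (7 * a n)"
   using eV_le[OF s0, of z] eV_pos[OF s0, of z] s0 by (intro mult_mono) auto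
  moreover have "g z - G (w (Suc n)) (b (Suc n)) (b (Suc (Suc n))) z = eV s z * d" by (simp add: g_def G_def d_def algebra_simps)
  ultimately show ?thesis by (simp add: abs_mult)
 qed
 have wK: "w' = K g"
 proof
  fix z
  have "(%n. w (Suc (Suc n)) z) \<longlonglongrightarrow> K g z"
  proof (rule Lim_null_comparison[THEN LIM_zero_cancel])
   show "(%n. C * (sqrt (sqrt area * area) * (56 / s * a n))) \<longlonglongrightarrow> 0"
    using tendsto_mult[OF tendsto_const[of "C * sqrt (sqrt area * area) * (56 / s)"] a0] by (simp add: mult.assoc)
   have "abs (K (G (w (Suc n)) (b (Suc n)) (b (Suc (Suc n)))) z - K g z) <= C * (sqrt (sqrt area * area) * (56 / s * a n))" for n
   proof -
    define e where "e = 56 / s * a n"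
    have e: "e >= 0" using close[of 0 n] by (simp add: e_def)
    define h where "h z = G (w (Suc n)) (b (Suc n)) (b (Suc (Suc n))) z + (-1) * g z" for z
    note Gn = C1_cont[OF G(1)[OF wb(1,2)]] G(2)[OF wb(1,2)]
    have h: "cont h" "Per h" "abs (h z) <= e" for z
     unfolding h_def[abs_def] e_def using close[of z n] gp Gn by (auto intro!: continuous_intros gc simp: Per_def)
    have "(\<integral>z. abs (h z)) <= (\<integral>z. e)" "(\<integral>z. (h z)^2) <= (\<integral>z. e^2)"
     using h(3) abs_le_square_iff[of "h _" e] e by (intro integral_mono integrable_M continuous_intros h(1); simp)+
    then have i: "(\<integral>z. abs (h z)) <= area * e" "(\<integral>z. (h z)^2) <= area * e^2" by (auto simp: measure_space_M)
    have "abs (K h z) <= C * sqrt (sqrt (area * e^2) * (area * e))"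
     using C i area_pos e by (intro order_trans[OF Kb[OF h(1,2)]] mult_left_mono real_sqrt_le_mono mult_mono) auto
    also have "sqrt (area * e^2) * (area * e) = sqrt area * area * e^2" using e by (simp add: real_sqrt_mult sqr)
    also have "sqrt (sqrt area * area * e^2) = sqrt (sqrt area * area) * e" using e by (simp add: real_sqrt_mult)
    finally show ?thesis using K_lin[OF Gn gc gp, of _ _ _ "-1" z] by (simp add: h_def[abs_def] e_def)
   qed
   then show "\<forall>\<^sub>F n in sequentially. norm (w (Suc (Suc n)) z - K g z) <= C * (sqrt (sqrt area * area) * (56 / s * a n))"
    using KG by (intro always_eventually) simp
  qed
  then show "w' z = K g z" using LIMSEQ_unique[OF LIMSEQ_Suc[OF wl(1)]] by blast
 qed
 have w1: "C1 w'" unfolding wK by (rule K_props(1)[OF gc gp])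
 note g1 = G[OF w1 per, of b' b', folded g_def]
 have ad0: "(\<integral>z. eV s z * w' z) = 0"
 proof -
  have "(%n. 0 - (\<integral>z. eV s z * w' z)) \<longlonglongrightarrow> 0"
  proof (rule Lim_null_comparison[OF always_eventually])
   show "(%n. 64 * a n) \<longlonglongrightarrow> 0" using tendsto_mult[OF tendsto_const[of 64] a0] by simp
   show "ALL n. norm (0 - (\<integral>z. eV s z * w' z)) <= 64 * a n"
   proof
    fix n
    have "0 - (\<integral>z. eV s z * w' z) = (\<integral>z. eV s z * w (Suc n) z) - (\<integral>z. eV s z * w' z)" using p[of "Suc n"] by (simp add: bset_def admissible_def)
    also have "... = (\<integral>z. eV s z * (w (Suc n) z - w' z))"
     unfolding right_diff_distrib by (rule integral_lin(4)[symmetric]; intro continuous_intros eV_cont s0)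
    finally have "norm (0 - (\<integral>z. eV s z * w' z)) <= (\<integral>z. abs (eV s z * (w (Suc n) z - w' z)))" by (simp add: abs_integral_le)
    also have "... <= 8 * nrm s (%z. w (Suc n) z - w' z)" by (intro integral_eV_abs[OF s] continuous_intros)
    also have "... <= 8 * (8 * a n)" by (intro mult_left_mono nrm_bound[OF s] continuous_intros wl(2)) simp_all
    finally show "norm (0 - (\<integral>z. eV s z * w' z)) <= 64 * a n" by simp
   qed
  qed
  from LIMSEQ_unique[OF tendsto_const this] show ?thesis by simp
 qed
 have "C2 w'" unfolding wK by (rule K_C2(1)[OF g1])
 then have "admissible s w'" using per even ad0 K_props(4)[OF gc gp] wK unfolding admissible_def by simp
 moreover have "lap w' z = (\<integral>z. g z) / area - eV s z * (exp (w' z + b') - 1) - err s z" for z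
 proof -
  have "lap w' z = (\<integral>z. g z) / area - g z" unfolding wK by (rule K_C2(2)[OF g1])
  then show ?thesis by (simp add: g_def G_def N_def algebra_simps)
 qed
 ultimately have "sol s w' b' ((\<integral>z. g z) / area)" using r' by (simp add: sol_def)
 then show ?thesis by blast
qed

end

section \<open>The excess mass as a function of the scale\<close>

context est
begin

text \<open>Bounds the terms of the test with \<open>Psi\<close> other than the pairing with
  \<open>err\<close>. Up to logarithms their exponents are \<open>3/8 + 7/8\<close> and
  \<open>2 * 11/16\<close>, both above 1, so \<open>Gm s\<close> is \<open>o(s)\<close>.\<close>

definition Gm :: "real => real" where "Gm s = C * r s * s powr (7/8) + 2 * (9 / eta s * A s)^2"

lemma sol_facts:
 assumes sm: "small s" and p: "sol s w b ga"
 shows "C2 w" "Per w" "!!z. w (- z) = w z" "(\<integral>z. w z) = 0" "(\<integral>z. eV s z * w z) = 0" "!!z. abs (w z + b) <= r s"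
  "!!z. lap w z = ga - eV s z * (w z + b + N (w z + b)) - err s z" "abs b <= 1"
proof -
 show w: "C2 w" "Per w" "!!z. w (- z) = w z" "(\<integral>z. w z) = 0" "(\<integral>z. eV s z * w z) = 0" "!!z. abs (w z + b) <= r s"
  using p by (auto simp: sol_def admissible_def)
 show "lap w z = ga - eV s z * (w z + b + N (w z + b)) - err s z" for z using p by (simp add: sol_def N_def)
 have i: "integrable M w" by (rule integrable_M[OF C2_cont[OF w(1)]])
 have "abs (\<integral>z. w z + b) <= (\<integral>z. abs (w z + b))" by (rule abs_integral_le)
 also have "... <= (\<integral>z. 1)"
  using order_trans[OF w(6) small_bounds(2)[OF sm]] by (intro integral_mono integrable_M continuous_intros C2_cont w)
 finally show "abs b <= 1" using i w(4) area_pos by (simp add: measure_space_M abs_mult)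
qed

text \<open>Green's identity moves the linearised operator from \<open>w\<close> onto
  \<open>Psi\<close>, where it leaves the small residual \<open>LPsi\<close>; \<open>b\<close> may
  join \<open>w\<close> because the Laplacian of \<open>Psi\<close> integrates to 0. The leading
  part of \<open>ga\<close> times the integral of \<open>Psi\<close> is the pairing of
  \<open>Psi\<close> with \<open>err\<close>.\<close>

lemma gamma_bounds:
 assumes sm: "small s" and p: "sol s w b ga"
 shows "s - Gm s <= ga * (\<integral>z. Psi s z)" "abs ga * (area / 2) <= C * s powr (7/8) + Gm s"
proof -
 note s = small_ok[OF sm] and sb = small_bounds[OF sm] and sf = sol_facts[OF sm p]
 then have s0: "s > 0" by simp
 note c [continuous_intros] = C2_cont[OF sf(1)] eV_cont[OF s0] err_cont[OF s0] LPsi_cont[OF s0] C2_cont[OF Psi_C2(1)[OF s0]] C2_cont_lap[OF Psi_C2(1)[OF s0]]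
 have a: "abs (\<integral>z. f z * g z) <= B * (\<integral>z. abs (g z))" if [continuous_intros]: "cont f" "cont g" and B: "!!z. abs (f z) <= B" for f g :: "complex => real" and B
 proof -
  have "abs (\<integral>z. f z * g z) <= (\<integral>z. abs (f z * g z))" by (rule abs_integral_le)
  also have "... <= (\<integral>z. B * abs (g z))"
   unfolding abs_mult by (intro integral_mono integrable_M continuous_intros mult_right_mono B) auto
  finally show ?thesis by simp
 qed
 have "abs (\<integral>z. (w z + b) * LPsi s z) <= r s * (\<integral>z. abs (LPsi s z))" by (intro a continuous_intros sf)
 also have "... <= r s * (C * s powr (7/8))" using LPsi1[of s] s sb by (intro mult_left_mono) auto
 finally have 1: "abs (\<integral>z. (w z + b) * LPsi s z) <= C * r s * s powr (7/8)" by (simp add: mult_ac)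
 have "abs (\<integral>z. Psi s z * (eV s z * N (w z + b))) <= 1 * (\<integral>z. abs (eV s z * N (w z + b)))" by (intro a continuous_intros Psi_bound s0)
 also have "... <= 1 * (\<integral>z. 2 * (eV s z * (w z + b)^2))"
 proof (intro mult_left_mono integral_mono)
  fix z
  have "eV s z * abs (N (w z + b)) <= eV s z * (2 * (w z + b)^2)"
   by (intro mult_left_mono N_square order_trans[OF sf(6) sb(2)] less_imp_le[OF eV_pos[OF s0]])
  then show "abs (eV s z * N (w z + b)) <= 2 * (eV s z * (w z + b)^2)" using eV_pos[OF s0, of z] by (simp add: abs_mult)
 qed (auto intro!: integrable_M continuous_intros)
 also have "... = 2 * (nrm s (%z. w z + b))^2" by (simp add: nrm_sq[OF s0])
 also have "... <= 2 * (9 / eta s * A s)^2"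
 proof (intro mult_left_mono power_mono)
  have "nrm s (%z. w z + b) <= 9 / eta s * X s w b" by (intro X_bounds(4)[OF s] c)
  also have "... <= 9 / eta s * A s" using sol_X[OF sm p] eta[OF s] by (intro mult_left_mono) auto
  finally show "nrm s (%z. w z + b) <= 9 / eta s * A s" .
 qed (use nrm_nonneg[OF s0] in auto)
 finally have 2: "abs (\<integral>z. Psi s z * (eV s z * N (w z + b))) <= 2 * (9 / eta s * A s)^2" .
 have "abs (\<integral>z. Psi s z * err s z) <= 1 * (\<integral>z. abs (err s z))" by (intro a continuous_intros Psi_bound s0)
 also have "... <= C * s powr (7/8)" using err1[of s] s by simp
 finally have 3: "abs (\<integral>z. Psi s z * err s z) <= C * s powr (7/8)" .
 have "(\<integral>z. w z * lap (Psi s) z) = (\<integral>z. Psi s z * lap w z)" by (rule green_sym[OF sf(1,2) Psi_C2(1)[OF s0] Psi_per])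
 also have "... = (\<integral>z. ga * Psi s z - 1 * (eV s z * Psi s z * (w z + b)) - 1 * (Psi s z * (eV s z * N (w z + b))) - 1 * (Psi s z * err s z))"
  unfolding sf(7) by (simp add: algebra_simps)
 also have "... = ga * (\<integral>z. Psi s z) - (\<integral>z. eV s z * Psi s z * (w z + b)) - (\<integral>z. Psi s z * (eV s z * N (w z + b))) - (\<integral>z. Psi s z * err s z)"
  by (subst integral_lin(2); (intro continuous_intros)?)+ simp
 finally have 4: "(\<integral>z. w z * lap (Psi s) z) = ..." .
 have "(\<integral>z. (w z + b) * LPsi s z) = (\<integral>z. w z * lap (Psi s) z + b * lap (Psi s) z + eV s z * Psi s z * (w z + b))"
  unfolding LPsi_def by (simp add: algebra_simps)
 also have "... = (\<integral>z. w z * lap (Psi s) z) + b * (\<integral>z. lap (Psi s) z) + (\<integral>z. eV s z * Psi s z * (w z + b))"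
  by (subst integral_lin(3) integral_lin(1); (intro continuous_intros)?)+ simp
 finally have 5: "ga * (\<integral>z. Psi s z) = (\<integral>z. (w z + b) * LPsi s z) + (\<integral>z. Psi s z * (eV s z * N (w z + b))) + (\<integral>z. Psi s z * err s z)"
  using 4 integral_lap_0[OF Psi_C2(1)[OF s0] Psi_per] by simp
 have e: "s <= (\<integral>z. Psi s z * err s z)" "area / 2 <= (\<integral>z. Psi s z)" using Psi_err[of s] Psi0[of s] s by auto
 show "s - Gm s <= ga * (\<integral>z. Psi s z)" unfolding 5 Gm_def using 1 2 e(1) by linarith
 have "abs ga * (area / 2) <= abs ga * (\<integral>z. Psi s z)" using e by (intro mult_left_mono) auto
 also have "... = abs (ga * (\<integral>z. Psi s z))" using e area_pos by (simp add: abs_mult)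
 also have "... <= C * s powr (7/8) + Gm s" unfolding 5 Gm_def using 1 2 3 by linarith
 finally show "abs ga * (area / 2) <= C * s powr (7/8) + Gm s" .
qed

lemma Gm_small: "\<forall>\<^sub>F s in at_right 0. Gm s < s" "((%s. C * s powr (7/8) + Gm s) \<longlongrightarrow> 0) (at_right 0)"
proof -
 have cC: "0 < c" "0 < C" using c C by auto
 define h :: "real => real" where "h s = 9 / (c / (32 * C^2 * (ln (1 / s))^2)) * (64 * ln (1 / s) / c * (C * s powr (11/16) + (1 + C * ln (1 / s)) * C ^ 3 * ln (1 / s) * s powr (7/8)))" for s
 have G: "Gm s = C * s powr (3/8) * s powr (7/8) + 2 * (h s)^2" for s
  by (simp add: Gm_def r_def eta_def A_def Z_def l_def h_def)
 have "((%s. (C * s powr (3/8) * s powr (7/8) + 2 * (h s)^2) / s) \<longlongrightarrow> 0) (at_right 0)"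
  unfolding h_def using cC by real_asymp
 from order_tendstoD(2)[OF this zero_less_one]
 have "\<forall>\<^sub>F s in at_right 0. (C * s powr (3/8) * s powr (7/8) + 2 * (h s)^2) / s < 1" .
 moreover have "\<forall>\<^sub>F s::real in at_right 0. 0 < s" by (simp add: eventually_at_right_less)
 ultimately show "\<forall>\<^sub>F s in at_right 0. Gm s < s" unfolding G by eventually_elim (simp add: pos_divide_less_eq)
 show "((%s. C * s powr (7/8) + Gm s) \<longlongrightarrow> 0) (at_right 0)" unfolding G h_def using cC by real_asymp
qed

text \<open>The contraction argument, applied to two arbitrary solutions at nearby scales. With
  equal scales and \<open>de = 0\<close> it shows that \<open>ga\<close> is determined by the scale,
  so picking it by \<open>SOME\<close> is harmless.\<close>

lemma stability:
 assumes sm0: "small s0"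
 obtains B where "B > 0" "!!s de w b ga w0 b0 ga0. small s ==> s <= 2 * s0 ==> sol s0 w0 b0 ga0 ==> sol s w b ga ==>
  (!!z. abs (eV s z - eV s0 z) <= de) ==> (!!z. abs (err s z - err s0 z) <= de) ==> abs (ga - ga0) <= B * de"
proof -
 note s = small_ok[OF sm0] and sb = small_bounds[OF sm0]
 then have s0: "s0 > 0" by simp
 note l1 = l_ge_1[OF s] and et = eta[OF s] and k = k_props[OF s]
 obtain B0 where B0: "B0 >= 1" "!!z. P z <= B0" "!!z. abs (S z) <= B0" using P_upper by blast
 \<comment> \<open>At fixed \<open>s0\<close> the weight \<open>eV s0\<close> is bounded below, so a
   uniform error may be divided by it; the resulting \<open>B\<close> depends on
   \<open>s0\<close>.\<close>
 define e0 where "e0 = 8 * s0 / (s0 + B0)^2"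
 have e0: "e0 > 0" using s0 B0(1) by (simp add: e0_def)
 have eV0: "e0 <= eV s0 z" for z
  unfolding e0_def eV_def using s0 B0(2)[of z] spos[OF s0, of z] by (intro divide_left_mono power_mono mult_pos_pos) auto
 define q where "q = (\<integral>z. K (eV s0) z * eV s0 z)"
 have q: "q > 0"
 proof -
  have "0 < C * q" using keV0[of s0] s by (simp add: q_def)
  then show ?thesis using C by (simp add: zero_less_mult_iff)
 qed
 define y where "y = c / (4 * l s0)"
 have y: "0 < y" "y <= 1" using c l1 by (auto simp: y_def divide_le_eq)
 define k1 where "k1 = X s0 (K (eV s0)) 1"
 have k1: "0 <= k1" unfolding k1_def by (rule X_bounds(3)[OF s])
 define a1 where "a1 = 2 * area / q"
 have a1: "0 <= a1" using q area_pos by (simp add: a1_def)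
 define c1 where "c1 = 2 * (a1 * k1) + 32 / e0"
 define x1 where "x1 = c1 / y^2"
 have c1: "0 <= c1" "0 <= x1" using a1 k1 e0 by (auto simp: c1_def x1_def)
 define Bf where "Bf = a1 * mass s0 + 8 * (2 * x1 + c1) + 16 * pi * (x1 / eta s0)"
 have m0: "0 <= mass s0" unfolding mass_def using eV_pos[OF s0] by (intro integral_ge_0) (simp add: less_imp_le)
 show ?thesis
 proof (rule that[of "Bf / area + 1"])
  show "Bf / area + 1 > 0" using a1 m0 c1 et area_pos by (auto simp: Bf_def intro!: add_nonneg_pos divide_nonneg_nonneg add_nonneg_nonneg mult_nonneg_nonneg)
  fix s1' de w b ga w0 b0 ga0
  assume sm: "small s1'" "s1' <= 2 * s0" and p0: "sol s0 w0 b0 ga0" and p: "sol s1' w b ga"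
   and d: "!!z. abs (eV s1' z - eV s0 z) <= de" "!!z. abs (err s1' z - err s0 z) <= de"
  have s': "s1' > 0" using sm by (simp add: small_def)
  have de: "0 <= de" by (rule order_trans[OF abs_ge_zero d(1)])
  note f0 = sol_facts[OF sm0 p0] and f1 = sol_facts[OF sm(1) p]
  have W1: "abs (w z + b) <= 1" for z by (rule order_trans[OF f1(6) small_bounds(2)[OF sm(1)]])
  have "r s1' <= (2 * s0) powr (3/8)" unfolding r_def using sm s' by (intro powr_mono2) auto
  also have "... = 2 powr (3/8) * r s0" using s0 by (simp add: r_def powr_mult)
  also have "... <= 2 * r s0" using sb(1) powr_mono[of "3/8" 1 "2::real"] by (intro mult_right_mono) auto
  finally have rr: "r s1' <= 2 * r s0" .
  \<comment> \<open>\<open>s <= 2 s0\<close> gives \<open>r s <= 2 r s0\<close>, and the smallness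
    at \<open>s0\<close> has enough slack for the doubled radius.\<close>
  define rh where "rh = min 1 (2 * r s0)"
  have W: "abs (w z + b) <= rh" "abs (w0 z + b0) <= rh" for z
   using W1[of z] order_trans[OF f1(6) rr, of z] f0(6)[of z] sb(1,2) by (auto simp: rh_def)
  note cc [continuous_intros] = C2_cont[OF f0(1)] C2_cont[OF f1(1)] eV_cont[OF s0] eV_cont[OF s'] err_cont[OF s0] err_cont[OF s'] k(6)
  define h where "h z = w z - w0 z" for z
  define f2 where "f2 = (%z. w z - w0 z + (N (w z + b) - N (w0 z + b0)))"
  define x where "x = X s0 (%z. w z - w0 z) (b - b0)"
  note sd = source_diff[OF s C2_C1[OF f1(1)] f1(2) C2_C1[OF f0(1)] f0(2) W _ f2_def x_def]
  have rh: "rh <= 1" by (simp add: rh_def)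
  have sm0': "18 * r s0 / eta s0 <= y / 2" using sm0 by (simp add: small_def y_def)
  have "18 * rh / eta s0 <= 18 * (2 * r s0) / eta s0" using et by (intro divide_right_mono mult_left_mono) (auto simp: rh_def)
  also have "... = 2 * (18 * r s0 / eta s0)" by simp
  also have "... <= y" using sm0' by linarith
  finally have "nrm s0 f2 <= (1 + y) * x"
   using sd(3)[OF rh] sd(4)[OF rh] by (intro order_trans[OF sd(3)[OF rh]] mult_right_mono) auto
  note nf2 = this
  \<comment> \<open>The change of the source when the coefficients of the other scale are replaced
    by those of \<open>s0\<close>.\<close>
  define F where "F z = (eV s1' z - eV s0 z) * (w z + b + N (w z + b)) + (err s1' z - err s0 z)" for z
  have F: "abs (F z) <= 4 * de" for z
  proof -
   have "abs (w z + b + N (w z + b)) <= 3"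
   proof -
    have "abs (N (w z + b)) <= 2" using N_bound[OF W1[of z]] W1[of z] by simp
    then show ?thesis using W1[of z] by linarith
   qed
   then have "abs ((eV s1' z - eV s0 z) * (w z + b + N (w z + b))) <= de * 3" unfolding abs_mult using d(1)[of z] de by (intro mult_mono) auto
   then show ?thesis unfolding F_def using d(2)[of z] by linarith
  qed
  \<comment> \<open>\<open>w\<close> is orthogonal to the weight of its own scale, so
    \<open>h\<close> is not orthogonal to \<open>eV s0\<close>; subtracting
    \<open>al K (eV s0)\<close> repairs this at a cost \<open>O(de)\<close>.\<close>
  define al where "al = (\<integral>z. eV s0 z * h z) / q"
  have hc [continuous_intros]: "cont h" unfolding h_def[abs_def] by (intro continuous_intros)
  have Fc [continuous_intros]: "cont F" unfolding F_def[abs_def] by (intro continuous_intros)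
  have al: "abs al <= a1 * de"
  proof -
   have "(\<integral>z. eV s0 z * h z) = (\<integral>z. eV s0 z * w z) - (\<integral>z. eV s0 z * w0 z)"
    unfolding h_def right_diff_distrib by (rule integral_lin(4); intro continuous_intros)
   also have "... = (\<integral>z. eV s0 z * w z) - (\<integral>z. eV s1' z * w z)" using f0(5) f1(5) by simp
   also have "... = (\<integral>z. (eV s0 z - eV s1' z) * w z)"
    unfolding left_diff_distrib by (rule integral_lin(4)[symmetric]; intro continuous_intros)
   finally have "abs (\<integral>z. eV s0 z * h z) <= (\<integral>z. abs ((eV s0 z - eV s1' z) * w z))" by (simp add: abs_integral_le)
   also have "... <= (\<integral>z. de * 2)"
   proof (rule integral_mono)
    fix z
    have "abs (w z) <= 2" using W1[of z] f1(8) by linarith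
    moreover have "abs (eV s0 z - eV s1' z) <= de" using d(1)[of z] by (simp add: abs_minus_commute)
    ultimately show "abs ((eV s0 z - eV s1' z) * w z) <= de * 2" unfolding abs_mult by (intro mult_mono) (auto simp: de)
   qed (intro integrable_M continuous_intros)+
   finally have "abs (\<integral>z. eV s0 z * h z) <= 2 * area * de" by (simp add: measure_space_M mult_ac)
   then show ?thesis using q by (simp add: al_def a1_def abs_divide divide_right_mono)
  qed
  define h' where "h' z = h z - al * K (eV s0) z" for z
  have h2: "C2 h" "lap h = (%z. lap w z - lap w0 z)" unfolding h_def[abs_def] using C2_sub[OF f1(1) f0(1)] by auto
  have h'2: "C2 h'" "lap h' = (%z. lap h z - al * lap (K (eV s0)) z)"
   unfolding h'_def[abs_def] using C2_sub[OF h2(1) C2_cmult(1)[OF k(1)]] C2_cmult(2)[OF k(1)] by auto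
  have "admissible s0 h'"
   unfolding admissible_def
  proof (intro conjI allI)
   show "Per h'" unfolding h'_def[abs_def] h_def using f0(2) f1(2) k(2) by (simp add: Per_def)
   show "h' (- z) = h' z" for z using f0(3) f1(3) k(4) by (simp add: h'_def h_def)
   show "(\<integral>z. h' z) = 0"
    using integral_lin(2)[OF hc cc(7)] integral_lin(4)[OF cc(2,1)] f0(4) f1(4) k(3) by (simp add: h'_def h_def)
   have "(\<integral>z. eV s0 z * h' z) = (\<integral>z. eV s0 z * h z - al * (K (eV s0) z * eV s0 z))" by (simp add: h'_def algebra_simps)
   also have "... = (\<integral>z. eV s0 z * h z) - al * q" unfolding q_def by (rule integral_lin(2); intro continuous_intros)
   finally show "(\<integral>z. eV s0 z * h' z) = 0" using q by (simp add: al_def)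
  qed (rule h'2)
  note ad = this
  define f where "f z = f2 z + F z / eV s0 z" for z
  have ne: "eV s0 z ~= 0" for z using eV_pos[OF s0, of z] by simp
  have f2c [continuous_intros]: "cont f2" using sd(1)[OF rh] by (rule C1_cont)
  have fc [continuous_intros]: "cont f" unfolding f_def[abs_def] by (intro continuous_intros) (use ne in auto)
  define cst where "cst = ga - ga0 - al * (mass s0 / area)"
  have eq: "lap h' z = cst - eV s0 z * (f z + (b - b0 - al))" for z
  proof -
   have "eV s0 z * f z = eV s0 z * f2 z + F z" using ne[of z] by (simp add: f_def distrib_left)
   then show ?thesis unfolding h'2 h2 f0(7) f1(7) k(5) by (simp add: F_def f2_def cst_def algebra_simps)
  qed
  note le = linear_estimate[OF s ad fc eq]
  define x' where "x' = X s0 h' (b - b0 - al)"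
  have x'0: "0 <= x'" unfolding x'_def by (rule X_bounds(3)[OF s])
  have xx: "x <= x' + a1 * k1 * de"
  proof -
   have "nrm s0 h <= nrm s0 h' + nrm s0 (%z. al * K (eV s0) z)"
    using nrm_triangle[OF s0 C2_cont[OF h'2(1)] continuous_on_mult_left[OF cc(7)], of al] by (simp add: h'_def)
   moreover have "eta s0 * abs (b - b0) <= eta s0 * (abs (b - b0 - al) + abs al)" using et by (intro mult_left_mono) auto
   ultimately have "x <= x' + abs al * k1"
    unfolding x_def x'_def k1_def X_def h_def[abs_def, symmetric] nrm_cmult[OF s0] by (simp add: algebra_simps)
   also have "abs al * k1 <= a1 * de * k1" using al k1 by (rule mult_right_mono)
   finally show ?thesis by (simp add: mult_ac)
  qed
  have nf: "nrm s0 f <= (1 + y) * x' + c1 * de"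
  proof -
   have "abs (F z / eV s0 z) <= 4 * de / e0" for z
    unfolding abs_divide using F[of z] eV0[of z] e0 by (intro frac_le) auto
   then have "nrm s0 (%z. F z / eV s0 z) <= 8 * (4 * de / e0)" by (intro nrm_bound[OF s] continuous_intros) (use ne in auto)
   moreover have "nrm s0 f <= nrm s0 f2 + nrm s0 (%z. F z / eV s0 z)"
    unfolding f_def[abs_def] by (intro nrm_triangle[OF s0] continuous_intros) (use ne in auto)
   moreover have "(1 + y) * x <= (1 + y) * (x' + a1 * k1 * de)" using xx y by (intro mult_left_mono) auto
   moreover have "(1 + y) * (a1 * k1 * de) <= 2 * (a1 * k1 * de)" using y a1 k1 de by (intro mult_right_mono) auto
   ultimately have "nrm s0 f <= (1 + y) * x' + 2 * (a1 * k1 * de) + 8 * (4 * de / e0)"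
    using nf2 unfolding distrib_left by linarith
   then show ?thesis by (simp add: c1_def algebra_simps)
  qed
  \<comment> \<open>\<open>(1 - y) (1 + y) = 1 - y^2\<close> still contracts, with gain
    \<open>y^2\<close>.\<close>
  have "x' <= (1 - y) * ((1 + y) * x' + c1 * de)"
   using le(3) nf y unfolding x'_def[symmetric] y_def[symmetric] by (intro order_trans[OF le(3)[folded x'_def y_def]] mult_left_mono) auto
  also have "... = x' - y\<^sup>2 * x' + (1 - y) * (c1 * de)" by (simp add: algebra_simps sqr)
  also have "(1 - y) * (c1 * de) <= 1 * (c1 * de)" using y c1 de by (intro mult_right_mono) auto
  finally have "y^2 * x' <= c1 * de" by simp
  then have x': "x' <= x1 * de" using y by (simp add: x1_def pos_le_divide_eq mult.commute)
  have "(1 + y) * x' <= 2 * (x1 * de)" using y x' x'0 by (intro mult_mono) auto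
  then have nfd: "nrm s0 f <= (2 * x1 + c1) * de" using nf by (simp add: algebra_simps)
  have bd: "abs (b - b0 - al) <= x1 / eta s0 * de"
   using order_trans[OF X_bounds(2)[OF s, of "b - b0 - al" h'] divide_right_mono[OF x'[unfolded x'_def], of "eta s0"]] et by simp
  \<comment> \<open>Integration of the equation isolates \<open>cst\<close>, the term that contains
    \<open>ga - ga0\<close>.\<close>
  have "0 = (\<integral>z. lap h' z)" using integral_lap_0[OF h'2(1)] ad by (simp add: admissible_def)
  also have "... = (\<integral>z. cst - 1 * (eV s0 z * f z) - (b - b0 - al) * eV s0 z)" unfolding eq by (simp add: algebra_simps)
  also have "... = area * cst - (\<integral>z. eV s0 z * f z) - (b - b0 - al) * mass s0"
   unfolding mass_def by (subst integral_lin(2); (intro continuous_intros)?)+ (simp add: measure_space_M)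
  finally have "area * (ga - ga0) = al * mass s0 + (\<integral>z. eV s0 z * f z) + (b - b0 - al) * mass s0"
   using area_pos by (simp add: cst_def algebra_simps)
  also have "abs (...) <= abs al * mass s0 + abs (\<integral>z. eV s0 z * f z) + abs (b - b0 - al) * mass s0"
   using m0 by (intro order_trans[OF abs_triangle_ineq] add_mono order_trans[OF abs_triangle_ineq]) (auto simp: abs_mult)
  also have "... <= a1 * de * mass s0 + 8 * ((2 * x1 + c1) * de) + x1 / eta s0 * de * (16 * pi)"
   using m0 al bd mass_le[of s0] s nfd order_trans[OF abs_integral_le integral_eV_abs[OF s fc]]
   by (intro add_mono mult_mono mult_right_mono) auto
  also have "... = Bf * de" by (simp add: Bf_def algebra_simps)
  finally have "area * abs (ga - ga0) <= Bf * de" using area_pos by (simp add: abs_mult)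
  then have "abs (ga - ga0) <= Bf / area * de" using area_pos by (simp add: pos_le_divide_eq mult.commute)
  then show "abs (ga - ga0) <= (Bf / area + 1) * de" using de by (simp add: distrib_right)
 qed
qed

end

context torus
begin

text \<open>Uniform continuity on a compact product; the interval from \<open>s0 / 2\<close> keeps
  the parameter away from 0.\<close>

lemma uniform_parameter:
 fixes F :: "real => complex => real"
 assumes s0: "s0 > 0" and c: "continuous_on ({s0 / 2..2 * s0} \<times> UNIV) (%p. F (fst p) (snd p))" and per: "!!s. Per (F s)" and e: "e > 0"
 obtains d where "d > 0" "!!s z. abs (s - s0) < d ==> abs (F s z - F s0 z) <= e"
proof -
 let ?K = "{s0 / 2..2 * s0} \<times> cball 0 (norm o1 + norm o2) :: (real \<times> complex) set"
 have "uniformly_continuous_on ?K (%p. F (fst p) (snd p))"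
  by (rule compact_uniformly_continuous) (auto intro!: continuous_on_subset[OF c] compact_Times)
 then obtain d where d: "d > 0" "!!p q. p : ?K ==> q : ?K ==> dist q p < d ==> dist (F (fst q) (snd q)) (F (fst p) (snd p)) < e"
  unfolding uniformly_continuous_on_def using e by metis
 show ?thesis
 proof (rule that[of "min d (s0 / 2)"])
  fix s z assume s: "abs (s - s0) < min d (s0 / 2)"
  obtain l where l: "l : L" "z - l : D" using ex_lattice_shift by blast
  have "s0 / 2 <= s" "s <= 2 * s0" "abs (s - s0) < d" using s by linarith+
  then have "dist (F s (z - l)) (F s0 (z - l)) < e"
   using d(2)[of "(s0, z - l)" "(s, z - l)"] norm_D[OF l(2)] s0 by (simp add: dist_Pair_Pair dist_real_def)
  then show "abs (F s z - F s0 z) <= e" using Per_diff[OF per l(1)] by (simp add: dist_real_def)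
 qed (use d s0 in simp)
qed

end

context est
begin

lemma coefficients_uniform:
 assumes s0: "s0 > 0" and e: "e > 0"
 obtains d where "d > 0" "!!s z. abs (s - s0) < d ==> abs (eV s z - eV s0 z) <= e & abs (err s z - err s0 z) <= e"
proof -
 let ?A = "{s0 / 2..2 * s0} \<times> (UNIV :: complex set)"
 have ne: "fst p + P (snd p) ~= 0" if "p : ?A" for p
  using that s0 spos[of "fst p" "snd p"] by auto
 note c = continuous_on_compose2[OF P_cont continuous_on_snd[OF continuous_on_id]] continuous_on_compose2[OF S_cont continuous_on_snd[OF continuous_on_id]]
 have "continuous_on ?A (%p. eV (fst p) (snd p))" "continuous_on ?A (%p. err (fst p) (snd p))"
  unfolding eV_def err_def by (intro continuous_intros c; use ne in auto)+
 from uniform_parameter[OF s0 this(1) eV_per e] uniform_parameter[OF s0 this(2) err_per e]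
 obtain d1 d2 where "d1 > 0" "!!s z. abs (s - s0) < d1 ==> abs (eV s z - eV s0 z) <= e"
  "d2 > 0" "!!s z. abs (s - s0) < d2 ==> abs (err s z - err s0 z) <= e" by metis
 then show ?thesis by (intro that[of "min d1 d2"]) auto
qed

definition g :: "real => real" where "g s = (SOME ga. EX w b. sol s w b ga)"

lemma g_sol: "small s ==> EX w b. sol s w b (g s)"
 unfolding g_def by (rule someI_ex[of "%ga. EX w b. sol s w b ga"]) (use sol_exists[of s] in blast)

lemma g_cont:
 assumes sm: "!!s. 0 < s ==> s <= s3 ==> small s"
 shows "continuous_on {0<..s3} g"
 unfolding continuous_on_iff
proof (intro ballI allI impI)
 fix s0 e :: real assume s0: "s0 : {0<..s3}" and e: "0 < e"
 then have sm0: "small s0" "s0 > 0" using sm by auto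
 obtain B where B: "B > 0" "!!s de w b ga w0 b0 ga0. small s ==> s <= 2 * s0 ==> sol s0 w0 b0 ga0 ==> sol s w b ga ==>
  (!!z. abs (eV s z - eV s0 z) <= de) ==> (!!z. abs (err s z - err s0 z) <= de) ==> abs (ga - ga0) <= B * de" using stability[OF sm0(1)] by blast
 have "e / (2 * B) > 0" using e B(1) by simp
 then obtain d where d: "d > 0" "!!s z. abs (s - s0) < d ==> abs (eV s z - eV s0 z) <= e / (2 * B) & abs (err s z - err s0 z) <= e / (2 * B)"
  using coefficients_uniform[OF sm0(2)] by blast
 show "EX d>0. ALL s:{0<..s3}. dist s s0 < d --> dist (g s) (g s0) < e"
 proof (intro exI[of _ "min d s0"] conjI ballI impI)
  fix s assume s: "s : {0<..s3}" "dist s s0 < min d s0"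
  then have sms: "small s" using sm by auto
  obtain w b w0 b0 where w: "sol s w b (g s)" "sol s0 w0 b0 (g s0)" using g_sol[OF sms] g_sol[OF sm0(1)] by blast
  have "abs (g s - g s0) <= B * (e / (2 * B))"
   by (rule B(2)[OF sms _ w(2,1)]) (use s d(2)[of s] in \<open>auto simp: dist_real_def\<close>)
  also have "... < e" using B(1) e by simp
  finally show "dist (g s) (g s0) < e" by (simp add: dist_real_def)
 qed (use d sm0 in simp)
qed

text \<open>\<open>gamma_bounds\<close> makes \<open>g\<close> positive and, near 0, as small as
  desired; continuity yields the values between. The chosen scale tends to 0 because
  \<open>g\<close> has a positive minimum on each \<open>[h, s3]\<close>, so a smaller
  \<open>ep\<close> can be attained only below \<open>h\<close>.\<close>

lemma bubble_scale:
 obtains ep0 sf where "ep0 > 0" "!!ep. 0 < ep ==> ep < ep0 ==> small (sf ep) & g (sf ep) = ep" "(sf \<longlongrightarrow> 0) (at_right 0)"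
proof -
 have "\<forall>\<^sub>F s in at_right 0. small s & Gm s < s" using eventually_small Gm_small(1) by eventually_elim auto
 then obtain s2 where s2: "s2 > 0" "!!s. 0 < s ==> s < s2 ==> small s & Gm s < s" unfolding eventually_at_right_field by auto
 define s3 where "s3 = s2 / 2"
 have s3: "s3 > 0" "!!s. 0 < s ==> s <= s3 ==> small s" "!!s. 0 < s ==> s <= s3 ==> Gm s < s" using s2 by (auto simp: s3_def)
 note gc = g_cont[OF s3(2)]
 have gp: "g s > 0" if s: "0 < s" "s <= s3" for s
 proof -
  obtain w b where w: "sol s w b (g s)" using g_sol[OF s3(2)[OF s]] by blast
  have "0 < g s * (\<integral>z. Psi s z)" using gamma_bounds(1)[OF s3(2)[OF s] w] s3(3)[OF s] by linarith
  moreover have "(\<integral>z. Psi s z) > 0" using Psi0[of s] small_ok[OF s3(2)[OF s]] area_pos by simp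
  ultimately show ?thesis by (simp add: zero_less_mult_iff)
 qed
 have ex: "EX s. 0 < s & s <= s3 & g s = ep" if e: "0 < ep" "ep < g s3" for ep
 proof -
  have "ep * (area / 2) > 0" using e area_pos by simp
  from order_tendstoD(2)[OF Gm_small(2) this]
  have "\<forall>\<^sub>F s in at_right 0. C * s powr (7/8) + Gm s < ep * (area / 2)" .
  moreover have "\<forall>\<^sub>F s in at_right 0. 0 < s & s < s3" unfolding eventually_at_right_field using s3(1) by blast
  ultimately have "\<forall>\<^sub>F s in at_right 0. 0 < s & s < s3 & C * s powr (7/8) + Gm s < ep * (area / 2)" by eventually_elim auto
  then obtain t where t: "0 < t" "t < s3" "C * t powr (7/8) + Gm t < ep * (area / 2)" using eventually_happens'[OF trivial_limit_at_right_real] by blast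
  obtain w b where w: "sol t w b (g t)" using g_sol[OF s3(2)[of t]] t by auto
  have "abs (g t) * (area / 2) < ep * (area / 2)" using gamma_bounds(2)[OF s3(2)[of t] w] t by linarith
  then have "g t < ep" using area_pos by (simp add: mult_less_cancel_right)
  moreover have "continuous_on {t..s3} g" by (rule continuous_on_subset[OF gc]) (use t in auto)
  ultimately obtain s where "t <= s" "s <= s3" "g s = ep" using IVT'[of g t ep s3] e t by auto
  then show ?thesis using t by (intro exI[of _ s]) auto
 qed
 define sf where "sf ep = (SOME s. 0 < s & s <= s3 & g s = ep)" for ep
 have sf: "0 < sf ep & sf ep <= s3 & g (sf ep) = ep" if "0 < ep" "ep < g s3" for ep
  unfolding sf_def by (rule someI_ex[OF ex[OF that]])
 have g3: "g s3 > 0" using gp[of s3] s3(1) by simp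
 have "(sf \<longlongrightarrow> 0) (at_right 0)"
 proof (rule tendstoI)
  fix e :: real assume e: "e > 0"
  define h where "h = min e s3"
  have h: "0 < h" "h <= s3" using e s3(1) by (auto simp: h_def)
  have ch: "continuous_on {h..s3} g" by (rule continuous_on_subset[OF gc]) (use h in auto)
  obtain m where m: "m : {h..s3}" "!!t. t : {h..s3} ==> g m <= g t"
   using continuous_attains_inf[OF compact_Icc _ ch] h by auto
  have gm: "g m > 0" using m(1) h gp[of m] by auto
  show "\<forall>\<^sub>F ep in at_right 0. dist (sf ep) 0 < e"
   unfolding eventually_at_right_field
  proof (intro exI[of _ "min (g m) (g s3)"] conjI allI impI)
   fix ep assume a: "0 < ep" "ep < min (g m) (g s3)"
   then have f: "0 < sf ep" "sf ep <= s3" "g (sf ep) = ep" using sf[of ep] by auto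
   have "sf ep < h" by (rule ccontr) (use m(2)[of "sf ep"] f a in auto)
   then show "dist (sf ep) 0 < e" using f by (simp add: h_def dist_real_def)
  qed (use gm g3 in simp)
 qed
 then show ?thesis using that[of "g s3" sf] g3 sf s3(2) by blast
qed

end

context weight
begin

text \<open>In \<open>v = V + w + b\<close> the residual \<open>err\<close> cancels, and
  \<open>eV exp (w + b)\<close> is \<open>exp v\<close>.\<close>

lemma bubble_solutions:
 obtains ep0 sf v where "ep0 > 0" "!!ep. 0 < ep ==> ep < ep0 ==> 0 < sf ep & C2 (v ep) & Per (v ep) & (ALL z. v ep (- z) = v ep z)
   & (ALL z. abs (v ep z - V (sf ep) z) <= 1) & (ALL z. lap (v ep) z + exp (v ep z) = 2 * kp + ep)"
  "(sf \<longlongrightarrow> 0) (at_right 0)"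
proof -
 obtain c C s1 where "est o1 o2 P kp c C s1" using est_exists .
 then interpret est o1 o2 P kp c C s1 .
 obtain ep0 sf where e: "ep0 > 0" "!!ep. 0 < ep ==> ep < ep0 ==> small (sf ep) & g (sf ep) = ep" "(sf \<longlongrightarrow> 0) (at_right 0)"
  using bubble_scale by metis
 have "EX v. C2 v & Per v & (ALL z. v (- z) = v z) & (ALL z. abs (v z - V (sf ep) z) <= 1) & (ALL z. lap v z + exp (v z) = 2 * kp + ep)"
  if "0 < ep" "ep < ep0" for ep
 proof -
  define s where "s = sf ep"
  have sm: "small s" "g s = ep" using e(2)[OF that] by (auto simp: s_def)
  then have s0: "s > 0" by (simp add: small_def)
  obtain w b where w: "sol s w b ep" using g_sol[OF sm(1)] sm(2) by auto
  note f = sol_facts[OF sm(1) w]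
  define v where "v z = V s z + (w z + b)" for z
  have v: "C2 v" "lap v = (%z. lap (V s) z + lap w z)"
   unfolding v_def[abs_def] using C2_add[OF V_C2(1)[OF s0] C2_add(1)[OF f(1) C2_const(1)]] C2_add(2)[OF f(1) C2_const(1)[of b]]
   by (simp_all add: C2_const)
  have "Per v" unfolding v_def[abs_def] using V_per[of s] f(2) by (simp add: Per_def)
  moreover have "v (- z) = v z" for z using f(3) V_even by (simp add: v_def)
  moreover have "abs (v z - V s z) <= 1" for z using order_trans[OF f(6) small_bounds(2)[OF sm(1)]] by (simp add: v_def)
  moreover have "lap v z + exp (v z) = 2 * kp + ep" for z
   unfolding v V_C2(2)[OF s0] f(7) by (simp add: v_def exp_add exp_V[OF s0] N_def algebra_simps)
  ultimately show ?thesis using v(1) unfolding s_def by blast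
 qed
 then obtain v where v: "!!ep. 0 < ep ==> ep < ep0 ==> C2 (v ep) & Per (v ep) & (ALL z. v ep (- z) = v ep z) & (ALL z. abs (v ep z - V (sf ep) z) <= 1) & (ALL z. lap (v ep) z + exp (v ep z) = 2 * kp + ep)"
  by metis
 show ?thesis
 proof (rule that[OF e(1) _ e(3)])
  fix ep assume a: "0 < ep" "ep < ep0"
  have "0 < sf ep" using e(2)[OF a] by (simp add: small_def)
  with v[OF a] show "0 < sf ep & C2 (v ep) & Per (v ep) & (ALL z. v ep (- z) = v ep z)
   & (ALL z. abs (v ep z - V (sf ep) z) <= 1) & (ALL z. lap (v ep) z + exp (v ep z) = 2 * kp + ep)" by blast
 qed
qed

end

section \<open>Blow-up and the passage to the given torus\<close>

context weight
begin

text \<open>Integrating the equation fixes the mass. Away from the lattice \<open>exp v\<close> is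
  \<open>O(s)\<close> by the sup bound on \<open>v - V\<close>, so the mass \<open>8 pi\<close>
  gathers at the lattice; the pointwise limits are those of \<open>V\<close>.\<close>

lemma bubble_measure:
 assumes e: "ep0 > 0" "ALL ep. 0 < ep --> ep < ep0 --> 0 < sf ep & C2 (v ep) & Per (v ep) & (ALL z. abs (v ep z - V (sf ep) z) <= 1) & (ALL z. lap (v ep) z + exp (v ep z) = 2 * kp + ep)"
  and sf: "(sf \<longlongrightarrow> 0) (at_right 0)" and f: "cont f" "Per f"
 shows "((%ep. \<integral>z. f z * exp (v ep z)) \<longlongrightarrow> 8 * pi * f 0) (at_right 0)"
  "0 < ep ==> ep < ep0 ==> (\<integral>z. exp (v ep z)) = area * (2 * kp + ep)"
  "filterlim (%ep. v ep 0) at_top (at_right 0)" "x \<notin> L ==> filterlim (%ep. v ep x) at_bot (at_right 0)"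
proof -
 note e2 = e(2)[THEN spec, THEN mp, THEN mp]
 have ev: "\<forall>\<^sub>F ep in at_right 0. 0 < ep & ep < ep0" unfolding eventually_at_right_field using e(1) by blast
 have ev': "\<forall>\<^sub>F ep in at_right 0. 0 < sf ep" using ev by eventually_elim (use e2 in blast)
 have s: "filterlim sf (at_right 0) (at_right 0)" unfolding filterlim_at using sf ev' by (auto elim: eventually_mono)
 show m: "(\<integral>z. exp (v ep z)) = area * (2 * kp + ep)" if "0 < ep" "ep < ep0" for ep
 proof -
  note v = e2[OF that]
  have "exp (v ep z) = 2 * kp + ep - lap (v ep) z" for z using v by (metis add_diff_cancel_left')
  then have "(\<integral>z. exp (v ep z)) = (\<integral>z. 2 * kp + ep - lap (v ep) z)" by simp
  then show ?thesis
   using integral_lin(4)[OF continuous_on_const C2_cont_lap[of "v ep"]] integral_lap_0[of "v ep"] v by (simp add: measure_space_M)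
 qed
 obtain B where B: "B > 0" "!!z. abs (f z) <= B" using Per_compact_bounded[OF f] by blast
 obtain C where C: "C > 0" "!!z. EX l:L. norm (z - l) <= C * sqrt (P z)" using P_dist by blast
 show "((%ep. \<integral>z. f z * exp (v ep z)) \<longlongrightarrow> 8 * pi * f 0) (at_right 0)"
 proof -
  have "((%ep. \<integral>z. (f z - f 0) * exp (v ep z)) \<longlongrightarrow> 0) (at_right 0)"
  proof (rule tendstoI)
   fix e' :: real assume e': "e' > 0"
   define q where "q = e' / (4 * (8 * pi + area))"
   have pa: "8 * pi + area > 0" using area_pos by (simp add: add_pos_pos)
   have q: "q > 0" using e' pa by (simp add: q_def)
   obtain d where d: "d > 0" "!!z w. norm (w - z) < d ==> abs (f w - f z) < q" using Per_uniform[OF f q] by blast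
   \<comment> \<open>By the choice of \<open>C\<close>, \<open>P z < p\<close> puts \<open>z\<close>
     within \<open>d / 2\<close> of the lattice.\<close>
   define p where "p = (d / (2 * C))^2"
   have p: "p > 0" using d(1) C(1) by (simp add: p_def)
   define k where "k = 2 * B * (24 / p^2) * area"
   have k: "k >= 0" using B(1) p area_pos by (simp add: k_def)
   have "((%ep. k * sf ep) \<longlongrightarrow> k * 0) (at_right 0)" by (intro tendsto_intros sf)
   then have "\<forall>\<^sub>F ep in at_right 0. k * sf ep < e' / 2" using e' by (intro order_tendstoD) auto
   moreover have "\<forall>\<^sub>F ep::real in at_right 0. 0 < ep & ep < 1" unfolding eventually_at_right_field by (intro exI[of _ 1]) auto
   ultimately show "\<forall>\<^sub>F ep in at_right 0. dist (\<integral>z. (f z - f 0) * exp (v ep z)) 0 < e'"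
    using ev
   proof eventually_elim
    case (elim ep)
    define s where "s = sf ep"
    note v = e2[OF elim(3)[THEN conjunct1] elim(3)[THEN conjunct2], folded s_def]
    then have s0: "s > 0" by blast
    have vc: "cont (v ep)" using v C2_cont by blast
    have "abs ((f z - f 0) * exp (v ep z)) <= 2 * B * (24 / p^2 * s) + q * exp (v ep z)" for z
    proof (cases "P z < p")
     case True
     obtain l where l: "l : L" "norm (z - l) <= C * sqrt (P z)" using C(2) by blast
     have "sqrt (P z) < d / (2 * C)" using True d(1) C(1) by (intro real_less_lsqrt) (auto simp: p_def P_nonneg)
     then have "norm (z - l) < d" using l(2) C(1) d(1) by (simp add: field_simps)
     then have "abs (f (z - l) - f 0) <= q" using d(2)[of "z - l" 0] by simp
     then have "abs (f z - f 0) <= q" using Per_diff[OF f(2) l(1)] by simp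
     then have "abs ((f z - f 0) * exp (v ep z)) <= q * exp (v ep z)" unfolding abs_mult by (simp add: mult_right_mono)
     also have "... <= 2 * B * (24 / p^2 * s) + q * exp (v ep z)" using B(1) p s0 by simp
     finally show ?thesis .
    next
     case False
     \<comment> \<open>The constant 24 below is \<open>8 * 3\<close>, with \<open>exp 1 <= 3\<close>
       for the deviation of \<open>v\<close> from \<open>V\<close>.\<close>
     have "v ep z <= V s z + 1" using v by (smt (verit))
     then have "exp (v ep z) <= exp (V s z + 1)" by simp
     also have "... = eV s z * exp 1" using exp_V[OF s0] by (simp add: exp_add)
     also have "... <= (8 * s / p^2) * 3"
      unfolding eV_def using False s0 p P_nonneg[of z] exp_le by (intro mult_mono divide_left_mono power_mono mult_pos_pos zero_less_power) (auto intro!: add_pos_nonneg)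
     finally have "exp (v ep z) <= 24 / p^2 * s" by simp
     moreover have "abs (f z - f 0) <= 2 * B" using B(2)[of z] B(2)[of 0] by linarith
     ultimately have "abs ((f z - f 0) * exp (v ep z)) <= 2 * B * (24 / p^2 * s)" unfolding abs_mult using B(1) by (intro mult_mono) auto
     also have "... <= 2 * B * (24 / p^2 * s) + q * exp (v ep z)" using q by simp
     finally show ?thesis .
    qed
    then have "(\<integral>z. abs ((f z - f 0) * exp (v ep z))) <= (\<integral>z. 2 * B * (24 / p^2 * s) + q * exp (v ep z))"
     by (intro integral_mono integrable_M continuous_intros f vc)
    also have "... = k * s + q * (area * (2 * kp + ep))"
     using elim integral_lin(1)[of "%_. 2 * B * (24 / p^2 * s)" "%z. exp (v ep z)" q] vc m[of ep] by (simp add: continuous_intros k_def measure_space_M)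
    also have "q * (area * (2 * kp + ep)) <= q * (8 * pi + area)"
    proof (rule mult_left_mono)
     have "area * (2 * kp + ep) = 2 * (kp * area) + ep * area" by (simp add: algebra_simps)
     also have "... <= 2 * (4 * pi) + 1 * area" unfolding kappa_area using elim area_pos by (intro add_left_mono mult_right_mono) auto
     finally show "area * (2 * kp + ep) <= 8 * pi + area" by simp
    qed (use q in simp)
    also have "q * (8 * pi + area) = e' / 4"
    proof -
     have "q * T = e' / 4" if "T > 0" "q = e' / (4 * T)" for T using that by simp
     then show ?thesis using pa q_def by blast
    qed
    finally have "abs (\<integral>z. (f z - f 0) * exp (v ep z)) <= k * s + e' / 4" using order_trans[OF abs_integral_le] by fastforce
    then show ?case using elim e' by (simp add: s_def)
   qed
  qed
  moreover have "((%ep. f 0 * (area * (2 * kp + ep))) \<longlongrightarrow> f 0 * (area * (2 * kp + 0))) (at_right 0)" by (intro tendsto_intros)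
  ultimately have lim: "((%ep. (\<integral>z. (f z - f 0) * exp (v ep z)) + f 0 * (area * (2 * kp + ep))) \<longlongrightarrow> 0 + f 0 * (area * (2 * kp + 0))) (at_right 0)"
   by (rule tendsto_add)
  have eq: "\<forall>\<^sub>F ep in at_right 0. (\<integral>z. (f z - f 0) * exp (v ep z)) + f 0 * (area * (2 * kp + ep)) = (\<integral>z. f z * exp (v ep z))"
   using ev
  proof eventually_elim
   case (elim ep)
   have vc: "cont (v ep)" using e2 elim C2_cont by blast
   have "(\<integral>z. (f z - f 0) * exp (v ep z)) = (\<integral>z. f z * exp (v ep z) - f 0 * exp (v ep z))" by (simp add: left_diff_distrib)
   also have "... = (\<integral>z. f z * exp (v ep z)) - f 0 * (\<integral>z. exp (v ep z))" by (intro integral_lin(2) continuous_intros f vc)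
   finally show ?case using m elim by simp
  qed
  have "0 + f 0 * (area * (2 * kp + 0)) = 2 * (kp * area) * f 0" by simp
  also have "... = 8 * pi * f 0" unfolding kappa_area by simp
  finally have "0 + f 0 * (area * (2 * kp + 0)) = 8 * pi * f 0" .
  from Lim_transform_eventually[OF lim eq, unfolded this] show ?thesis .
 qed
 have near: "\<forall>\<^sub>F ep in at_right 0. abs (v ep x - V (sf ep) x) <= 1" for x using ev by eventually_elim (use e2 in blast)
 have P0: "P 0 = 0" using P_eq_0 L_0 by simp
 have "filterlim (%s. ln (8 * s) - 2 * ln (s + 0) - 1) at_top (at_right (0::real))" by real_asymp
 from filterlim_compose[OF this s] have "filterlim (%ep. V (sf ep) 0 - 1) at_top (at_right 0)" by (simp add: V_def P0)
 then show "filterlim (%ep. v ep 0) at_top (at_right 0)"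
  by (rule filterlim_at_top_mono) (use near[of 0] in \<open>eventually_elim, linarith\<close>)
 assume "x \<notin> L"
 then have Px: "P x > 0" using P_eq_0[of x] P_nonneg[of x] by auto
 have "filterlim (%s. ln (8 * s) - 2 * ln (s + P x) + 1) at_bot (at_right (0::real))" using Px by real_asymp
 from filterlim_compose[OF this s] have "filterlim (%ep. V (sf ep) x + 1) at_bot (at_right 0)" by (simp add: V_def)
 then show "filterlim (%ep. v ep x) at_bot (at_right 0)"
  by (rule filterlim_at_bot_mono) (use near[of x] in \<open>eventually_elim, linarith\<close>)
qed

end

text \<open>\<open>w1\<close>, \<open>w2\<close> span the lattice generated by the given one and
  \<open>p\<close>, in which the given one has index 2; a function periodic for it repeats the
  bubble at 0 at the point \<open>p\<close>.\<close>

locale half_lattice = big: torus o1 o2 + sub: torus w1 w2 for o1 o2 w1 w2 :: complex +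
 fixes p :: complex
 assumes sub_L: "!!z. z : lattice w1 w2 \<longleftrightarrow> z : lattice o1 o2 | z - p : lattice o1 o2"
  and p: "p \<notin> lattice o1 o2" "2 * p : lattice o1 o2"
begin

lemma Per_sub: "sub.Per f ==> big.Per f"
 using sub_L by (simp add: Per_def)

text \<open>The small cell and its translate by \<open>p\<close> together meet every class of the
  large torus once.\<close>

lemma fundamental: "\<exists>!l. l : big.L & z + l : sub.D \<union> {z. z - p : sub.D}"
proof -
 obtain l where l: "l : sub.L" "z - l : sub.D" using sub.ex_lattice_shift by blast
 have ex: "EX l. l : big.L & z + l : sub.D \<union> {z. z - p : sub.D}"
 proof (cases "- l : big.L")
  case True then show ?thesis using l by (intro exI[of _ "- l"]) simp
 next
  case False
  then have "- l - p : big.L" using l(1) sub.L_minus sub_L by blast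
  then have "- l - p + 2 * p : big.L" using p(2) by (rule big.L_add)
  then show ?thesis using l(2) by (intro exI[of _ "- l + p"]) (auto simp: algebra_simps)
 qed
 have "l1 = l2" if 1: "l1 : big.L" "z + l1 : sub.D \<union> {z. z - p : sub.D}" and 2: "l2 : big.L" "z + l2 : sub.D \<union> {z. z - p : sub.D}" for l1 l2
 proof -
  have *: "EX m. (m = l | m = l - p) & m : sub.L & z - - m : sub.D" if "l : big.L" "z + l : sub.D \<union> {z. z - p : sub.D}" for l
  proof -
   have "l - p : sub.L" using big.L_diff[OF that(1) p(2)] sub_L by (simp add: algebra_simps)
   moreover have "l : sub.L" using that(1) sub_L by blast
   ultimately show ?thesis using that(2) by (cases "z + l : sub.D") (auto simp: add_diff_eq intro: exI[of _ l] exI[of _ "l - p"])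
  qed
  obtain m1 m2 where m: "m1 = l1 | m1 = l1 - p" "m2 = l2 | m2 = l2 - p" "m1 : sub.L" "m2 : sub.L" "z - - m1 : sub.D" "z - - m2 : sub.D"
   using *[OF 1] *[OF 2] by blast
  have "m1 = m2" using sub.lattice_shift_unique[OF sub.L_minus[OF m(3)] sub.L_minus[OF m(4)] m(5,6)] by simp
  moreover have "l1 - l2 : big.L" "l2 - l1 : big.L" using 1 2 big.L_diff by auto
  ultimately show ?thesis using m(1,2) p(1) by (auto simp: algebra_simps)
 qed
 with ex show ?thesis by blast
qed

lemma fold_nn:
 fixes h :: "complex => ennreal"
 assumes [measurable]: "h : borel_measurable borel" and per: "big.Per h"
 shows "(\<integral>\<^sup>+z. h z \<partial>big.M) = (\<integral>\<^sup>+z. h z \<partial>sub.M) + (\<integral>\<^sup>+z. h (z + p) \<partial>sub.M)"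
proof -
 have [measurable]: "{z. z - p : sub.D} : sets borel" by measurable
 have dis: "z \<notin> sub.D | z - p \<notin> sub.D" for z
 proof (rule ccontr)
  assume "\<not> (z \<notin> sub.D | z - p \<notin> sub.D)"
  moreover have "p : sub.L" using sub_L[of p] big.L_0 by simp
  ultimately have "0 = p" using sub.lattice_shift_unique[of 0 p z] sub.L_0 by simp
  then show False using p(1) big.L_0 by simp
 qed
 have "(\<integral>\<^sup>+z. h z \<partial>big.M) = (\<integral>\<^sup>+z. h z * indicator (sub.D \<union> {z. z - p : sub.D}) z \<partial>lborel)"
  by (rule big.nn_integral_fundamental[symmetric]) (use per fundamental in \<open>auto simp: assms\<close>)
 also have "... = (\<integral>\<^sup>+z. h z * indicator sub.D z + h z * indicator {z. z - p : sub.D} z \<partial>lborel)"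
  using dis by (intro nn_integral_cong) (auto simp: indicator_def)
 also have "... = (\<integral>\<^sup>+z. h z * indicator sub.D z \<partial>lborel) + (\<integral>\<^sup>+z. h z * indicator {z. z - p : sub.D} z \<partial>lborel)"
  by (rule nn_integral_add) measurable
 also have "(\<integral>\<^sup>+z. h z * indicator {z. z - p : sub.D} z \<partial>lborel) = (\<integral>\<^sup>+z. h (p + z) * indicator {z. z - p : sub.D} (p + z) \<partial>lborel)"
  by (rule sub.nn_integral_shift[symmetric]) measurable
 also have "... = (\<integral>\<^sup>+z. h (z + p) * indicator sub.D z \<partial>lborel)" by (intro nn_integral_cong) (auto simp: indicator_def add.commute)
 finally show ?thesis by (simp add: sub.nn_integral_M)
qed

text \<open>The nonnegative case comes from \<open>fold_nn\<close>; a general \<open>h\<close> is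
  bounded, so adding a constant \<open>B\<close> reduces to it.\<close>

lemma fold:
 fixes h :: "complex => real"
 assumes c: "cont h" and per: "big.Per h"
 shows "(\<integral>z. h z \<partial>big.M) = (\<integral>z. h z + h (z + p) \<partial>sub.M)"
proof -
 have nn: "(\<integral>z. h z \<partial>big.M) = (\<integral>z. h z + h (z + p) \<partial>sub.M)" if c: "cont h" and per: "big.Per h" and h: "!!z. 0 <= h z" for h :: "complex => real"
 proof -
  have c2: "cont (%z. h (z + p))" by (rule continuous_on_compose2[OF c]) (auto intro!: continuous_intros)
  have [measurable]: "h : borel_measurable borel" using c by (rule borel_measurable_continuous_onI)
  have pe: "big.Per (%z. ennreal (h z))" using per by (simp add: Per_def)
  have "ennreal (\<integral>z. h z \<partial>big.M) = (\<integral>\<^sup>+z. ennreal (h z) \<partial>big.M)"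
   by (rule nn_integral_eq_integral[symmetric]) (auto intro: big.int_cont c h)
  also have "... = (\<integral>\<^sup>+z. ennreal (h z) \<partial>sub.M) + (\<integral>\<^sup>+z. ennreal (h (z + p)) \<partial>sub.M)" by (rule fold_nn[OF _ pe]) measurable
  also have "... = ennreal (\<integral>z. h z \<partial>sub.M) + ennreal (\<integral>z. h (z + p) \<partial>sub.M)"
   by (subst (1 2) nn_integral_eq_integral) (auto intro: sub.int_cont c c2 h)
  also have "... = ennreal ((\<integral>z. h z \<partial>sub.M) + (\<integral>z. h (z + p) \<partial>sub.M))" using h by (simp add: ennreal_plus)
  finally have "(\<integral>z. h z \<partial>big.M) = (\<integral>z. h z \<partial>sub.M) + (\<integral>z. h (z + p) \<partial>sub.M)"
   using h by (subst (asm) ennreal_inj) (auto intro!: add_nonneg_nonneg)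
  then show ?thesis using sub.int_cont[OF c] sub.int_cont[OF c2] by simp
 qed
 obtain B where B: "B > 0" "!!z. abs (h z) <= B" using big.Per_compact_bounded[OF c per] by blast
 have c2: "cont (%z. h (z + p))" by (rule continuous_on_compose2[OF c]) (auto intro!: continuous_intros)
 have "0 <= h z + B" for z using B(2)[of z] by linarith
 then have "(\<integral>z. h z + B \<partial>big.M) = (\<integral>z. (h z + B) + (h (z + p) + B) \<partial>sub.M)"
  by (intro nn continuous_intros c) (use per in \<open>auto simp: Per_def\<close>)
 moreover have "(\<integral>z. B \<partial>big.M) = (\<integral>z. B + B \<partial>sub.M)" by (rule nn) (use B in \<open>auto simp: Per_def\<close>)
 ultimately show ?thesis
  using big.int_cont[OF c] sub.int_cont[OF c] sub.int_cont[OF c2] B(1) by (auto simp: algebra_simps)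
qed

lemma area_half: "big.area = 2 * sub.area"
 using fold[of "%_. 1"] by (simp add: Per_def big.measure_space_M sub.measure_space_M)

text \<open>\<open>x exp (- x)\<close> takes the value \<open>exp (-1)\<close> at 1 and tends to 0,
  so smaller positive values are attained beyond 1, on the branch where \<open>lam\<close> is
  large.\<close>

lemma lam_exists:
 assumes "0 < ep" "ep < 32 * pi * exp (-1)"
 shows "EX x>1. ep = 32 * pi * x * exp (- x :: real)"
proof -
 have "((%x. 32 * pi * x * exp (- x :: real)) \<longlongrightarrow> 0) at_top" by real_asymp
 then have "\<forall>\<^sub>F x in at_top. 32 * pi * x * exp (- x) < ep" using assms by (intro order_tendstoD) auto
 then have "\<forall>\<^sub>F x in at_top. 32 * pi * x * exp (- x) < ep & x >= 1" using eventually_ge_at_top[of 1] by eventually_elim auto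
 then obtain b where b: "32 * pi * b * exp (- b) < ep" "b >= 1" using eventually_happens'[OF trivial_limit_at_top_linorder] by blast
 have "EX x>=1. x <= b & 32 * pi * x * exp (- x) = ep"
  by (rule IVT2') (use b assms in \<open>auto intro!: continuous_intros\<close>)
 then obtain x where x: "x >= 1" "32 * pi * x * exp (- x) = ep" by blast
 then have "x ~= 1" using assms by auto
 then show ?thesis using x by (intro exI[of _ x]) auto
qed

end

text \<open>Bases of the finer lattice: halve \<open>o1\<close>, halve \<open>o2\<close>, or replace
  \<open>o1\<close> by \<open>(o1 + o2) / 2\<close>. Membership is compared in the coordinates
  \<open>cx\<close>, \<open>cy\<close>.\<close>

lemma half_lattice_cases:
 assumes "Im (o2 / o1) > 0" "p : {o1 / 2, o2 / 2, (o1 + o2) / 2}"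
 shows "EX w1 w2. half_lattice o1 o2 w1 w2 p"
proof -
 interpret torus o1 o2 by unfold_locales (rule assms(1))
 have \<omega>: "cx o1 = 1" "cy o1 = 0" "cx o2 = 0" "cy o2 = 1"
  using cxy_lincomb[of 1 0] cxy_lincomb[of 0 1] by simp_all
 have half: "cx (z / 2) = cx z / 2" "cy (z / 2) = cy z / 2" for z
  using cxy_add[of "z / 2" "z / 2"] by simp_all
 have nh: "(1 / 2 :: real) \<notin> \<int>"
 proof
  assume "(1 / 2 :: real) : \<int>"
  then obtain k :: int where "1 / 2 = (of_int k :: real)" by (rule Ints_cases)
  then have "of_int (2 * k) = (1 :: real)" by simp
  then have "2 * k = 1" by (simp only: of_int_eq_1_iff)
  then show False by presburger
 qed
 from assms(2) have c: "p = o1 / 2 | p = o2 / 2 | p = (o1 + o2) / 2" by blast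
 have "o1 / 2 \<notin> L & 2 * (o1 / 2) : L" "o2 / 2 \<notin> L & 2 * (o2 / 2) : L"
  "(o1 + o2) / 2 \<notin> L & 2 * ((o1 + o2) / 2) : L"
  unfolding mult_2 by (simp_all add: L_iff half cxy_add \<omega> nh)
 then have p: "p \<notin> L" "2 * p : L" using c by metis+
 have half_Ints: "2 * x : \<int> \<longleftrightarrow> x : \<int> | x - 1 / 2 : \<int>" for x :: real
 proof
  assume "2 * x : \<int>"
  then obtain k :: int where k: "2 * x = of_int k" by (rule Ints_cases)
  then have "x = of_int (k div 2) | x - 1 / 2 = of_int (k div 2)"
   by (cases "even k") (auto elim!: evenE oddE)
  then show "x : \<int> | x - 1 / 2 : \<int>" using Ints_of_int by metis
 next
  have "2 * (x - 1 / 2) + 1 : \<int>" if "x - 1 / 2 : \<int>" using that by (intro Ints_add Ints_mult) auto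
  then show "x : \<int> | x - 1 / 2 : \<int> ==> 2 * x : \<int>" by auto
 qed
 have mk: "half_lattice o1 o2 w1 w2 p" if pos: "Im (w2 / w1) > 0" and eq: "!!z. z : lattice w1 w2 \<longleftrightarrow> z : L | z - p : L" for w1 w2
  using pos eq p by unfold_locales auto
 from c show ?thesis
 proof (elim disjE)
  assume 1: "p = o1 / 2"
  have "o2 / (o1 / 2) = 2 *\<^sub>R (o2 / o1)" by (simp add: scaleR_conv_of_real)
  then have pos: "Im (o2 / (o1 / 2)) > 0" using assms(1) by (simp only: scaleR_complex.sel; simp?)
  interpret T: torus "o1 / 2" o2 by unfold_locales (rule pos)
  have a: "T.area = area / 2" by (simp add: T.area_def area_def)
  have "T.cx z = 2 * cx z" "T.cy z = cy z" for z
   using area_pos by (auto simp: T.cx_def T.cy_def a cx_def cy_def field_simps)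
  then have "z : T.L \<longleftrightarrow> 2 * cx z : \<int> & cy z : \<int>" for z by (simp add: T.L_iff)
  then have "z : T.L \<longleftrightarrow> z : L | z - p : L" for z
   unfolding 1 by (auto simp: L_iff cxy_diff half \<omega> half_Ints)
  from mk[OF pos this] show ?thesis by blast
 next
  assume 2: "p = o2 / 2"
  have "(o2 / 2) / o1 = (1 / 2) *\<^sub>R (o2 / o1)" by (simp add: scaleR_conv_of_real)
  then have pos: "Im ((o2 / 2) / o1) > 0" using assms(1) by (simp only: scaleR_complex.sel; simp?)
  interpret T: torus o1 "o2 / 2" by unfold_locales (rule pos)
  have a: "T.area = area / 2" by (simp add: T.area_def area_def)
  have "T.cx z = cx z" "T.cy z = 2 * cy z" for z
   using area_pos by (auto simp: T.cx_def T.cy_def a cx_def cy_def field_simps)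
  then have "z : T.L \<longleftrightarrow> cx z : \<int> & 2 * cy z : \<int>" for z by (simp add: T.L_iff)
  then have "z : T.L \<longleftrightarrow> z : L | z - p : L" for z
   unfolding 2 by (auto simp: L_iff cxy_diff half \<omega> half_Ints)
  from mk[OF pos this] show ?thesis by blast
 next
  assume 3: "p = (o1 + o2) / 2"
  \<comment> \<open>The summand \<open>o2\<close> of the new generator adds nothing to the
    determinant with \<open>o2\<close>, so the area is halved as in the other two cases.\<close>
  have a0: "Im (cnj ((o1 + o2) / 2) * o2) = area / 2" by (simp add: area_def algebra_simps)
  have pos: "Im (o2 / ((o1 + o2) / 2)) > 0"
  proof -
   have "Im (o2 / ((o1 + o2) / 2)) = Im (cnj ((o1 + o2) / 2) * o2) / (norm ((o1 + o2) / 2))^2"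
    by (subst complex_div_cnj) (simp add: mult.commute flip: of_real_power)
   moreover have "(o1 + o2) / 2 ~= 0"
   proof
    assume eq: "(o1 + o2) / 2 = 0"
    show False using a0[unfolded eq] area_pos by simp
   qed
   ultimately show ?thesis using a0 area_pos by simp
  qed
  interpret T: torus "(o1 + o2) / 2" o2 by unfold_locales (rule pos)
  have a: "T.area = area / 2" using a0 by (simp add: T.area_def)
  have cxT: "T.cx z = 2 * cx z" "T.cy z = cy z - cx z" for z
   using area_pos by (auto simp: T.cx_def T.cy_def a cx_def cy_def field_simps)
  have "z : T.L \<longleftrightarrow> 2 * cx z : \<int> & cy z - cx z : \<int>" for z by (simp add: T.L_iff cxT)
  moreover have "z - p : L \<longleftrightarrow> cx z - 1 / 2 : \<int> & cy z - 1 / 2 : \<int>" for z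
   unfolding 3 by (simp add: L_iff cxy_diff half cxy_add \<omega>)
  moreover have "y : \<int> \<longleftrightarrow> y - x : \<int>" if "x : \<int>" for x y :: real using Ints_add[of "y - x" x] Ints_diff that by auto
  from this[of "cx z" "cy z" for z] this[of "cx z - 1 / 2" "cy z - 1 / 2" for z]
  have "cx z : \<int> ==> cy z : \<int> \<longleftrightarrow> cy z - cx z : \<int>" "cx z - 1 / 2 : \<int> ==> cy z - 1 / 2 : \<int> \<longleftrightarrow> cy z - cx z : \<int>" for z by simp_all
  ultimately have "z : T.L \<longleftrightarrow> z : L | z - p : L" for z unfolding L_iff half_Ints by metis
  from mk[OF pos this] show ?thesis by blast
 qed
qed

theorem theorem1p2:
  fixes \<omega>1 \<omega>2 p1 p2 :: complex
  assumes "Im (\<omega>2 / \<omega>1) > 0"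
    and "measure (torus_measure \<omega>1 \<omega>2) (cell \<omega>1 \<omega>2) = 1"
    and "p1 = 0"
    and "p2 \<in> {\<omega>1 / 2, \<omega>2 / 2, (\<omega>1 + \<omega>2) / 2}"
  shows "\<exists>\<epsilon>0 > 0. \<exists>(lam :: real \<Rightarrow> real) (u :: real \<Rightarrow> complex \<Rightarrow> real) (r :: real \<Rightarrow> real).
     (\<forall>\<epsilon> \<in> {0<..<\<epsilon>0}.
        lam \<epsilon> > 0 \<and>
        torus_mean_field_solution \<omega>1 \<omega>2 (16 * pi + \<epsilon>) (u (lam \<epsilon>)) \<and>
        (\<forall>z. u (lam \<epsilon>) z = u (lam \<epsilon>) (- z)) \<and>
        \<epsilon> = (32 * pi + r \<epsilon>) * lam \<epsilon> * exp (- lam \<epsilon>)) \<and>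
     (r \<longlongrightarrow> 0) (at_right 0) \<and>
     (\<forall>p \<in> {p1, p2}. filterlim (\<lambda>\<epsilon>. u (lam \<epsilon>) p) at_top (at_right 0)) \<and>
     (\<forall>x. x - p1 \<notin> lattice \<omega>1 \<omega>2 \<and> x - p2 \<notin> lattice \<omega>1 \<omega>2 \<longrightarrow>
        filterlim (\<lambda>\<epsilon>. u (lam \<epsilon>) x) at_bot (at_right 0)) \<and>
     torus_measures_tendsto \<omega>1 \<omega>2
       (\<lambda>\<epsilon>. density (torus_measure \<omega>1 \<omega>2)
          (\<lambda>z. ennreal ((16 * pi + \<epsilon>) / (\<integral>w. exp (u (lam \<epsilon>) w) \<partial>torus_measure \<omega>1 \<omega>2)
                         * exp (u (lam \<epsilon>) z))))
       (point_measure {p1, p2} (\<lambda>_. 8 * ennreal pi))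
       (at_right 0)"
proof -
  obtain w1 w2 where "half_lattice \<omega>1 \<omega>2 w1 w2 p2" using half_lattice_cases[OF assms(1,4)] by blast
  then interpret half_lattice \<omega>1 \<omega>2 w1 w2 p2 .
  define kp where "kp = 4 * pi / sub.area"
 have a2: "sub.area = 1 / 2" using area_half assms(2) big.measure_M by simp
 obtain P where "weight w1 w2 P kp"
 proof (rule weight_exists[OF sub.Im_pos, of kp])
  show "kp = 4 * pi / Im (cnj w1 * w2)" by (simp add: kp_def sub.area_def)
  fix P assume "lattice_periodic w1 w2 P" "!!z. P (- z) = P z" "!!z. 0 <= P z"
   "!!z. P z = 0 \<longleftrightarrow> z : lattice w1 w2" "C2 P" "C2 (lap P)"
   "!!z. (dx P z)^2 + (dy P z)^2 = P z * (lap P z + kp * P z)"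
   "lap P 0 = 4" "lap (lap P) 0 = - 16 * kp"
   "EX C>0. ALL z. norm z <= 1 --> abs (P z - (norm z)\<^sup>2) <= C * (norm z) ^ 4"
  then have "weight w1 w2 P kp" by unfold_locales (auto simp: kp_def)
  then show thesis by (rule that)
 qed
 then interpret W: weight w1 w2 P kp .
 obtain ep1 sf v where e: "ep1 > 0" "!!ep. 0 < ep ==> ep < ep1 ==> 0 < sf ep & C2 (v ep) & sub.Per (v ep) & (ALL z. v ep (- z) = v ep z)
   & (ALL z. abs (v ep z - W.V (sf ep) z) <= 1) & (ALL z. lap (v ep) z + exp (v ep z) = 2 * kp + ep)"
  "(sf \<longlongrightarrow> 0) (at_right 0)" using W.bubble_solutions by blast
 \<comment> \<open>Half the area doubles the density: \<open>8 pi\<close> on the half torus is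
   \<open>16 pi\<close> per unit area, the constant term of the given equation.\<close>
 have k: "2 * kp = 16 * pi" by (simp add: kp_def a2)
 define ep0 where "ep0 = min ep1 (32 * pi * exp (-1))"
 have ep0: "ep0 > 0" using e(1) by (simp add: ep0_def)
 define lam where "lam ep = (SOME x. x > 1 & ep = 32 * pi * x * exp (- x :: real))" for ep
 have lam: "lam ep > 1 & ep = 32 * pi * lam ep * exp (- lam ep)" if "0 < ep" "ep < ep0" for ep
  unfolding lam_def by (rule someI_ex) (use lam_exists[of ep] that in \<open>auto simp: ep0_def\<close>)
 \<comment> \<open>The statement indexes the solutions by \<open>lam\<close>, so \<open>v\<close> is
   reparametrised through the exact relation between \<open>ep\<close> and
   \<open>lam\<close>.\<close>
 define u where "u x = v (32 * pi * x * exp (- x))" for x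
 have u: "u (lam ep) = v ep" if "0 < ep" "ep < ep0" for ep using lam[OF that] by (simp add: u_def)
 have ev: "\<forall>\<^sub>F ep in at_right 0. v ep = u (lam ep)" unfolding eventually_at_right_field using ep0 u by metis
 have e': "0 < sf ep & C2 (v ep) & sub.Per (v ep) & (ALL z. abs (v ep z - W.V (sf ep) z) <= 1) & (ALL z. lap (v ep) z + exp (v ep z) = 2 * kp + ep)"
  if "0 < ep" "ep < ep1" for ep using e(2)[OF that] by blast
 then have e'': "ALL ep. 0 < ep --> ep < ep1 --> 0 < sf ep & C2 (v ep) & sub.Per (v ep) & (ALL z. abs (v ep z - W.V (sf ep) z) <= 1) & (ALL z. lap (v ep) z + exp (v ep z) = 2 * kp + ep)"
  by blast
 note bm = W.bubble_measure[OF e(1) e'' e(3)]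
 have pS: "p2 : sub.L" using sub_L[of p2] big.L_0 by simp
 have vp: "v ep (z + p2) = v ep z" if "0 < ep" "ep < ep1" for ep z using e'[OF that] sub.Per_add[OF _ pS] by blast
 have int: "(\<integral>z. exp (v ep z) \<partial>big.M) = 16 * pi + ep" if "0 < ep" "ep < ep1" for ep
 proof -
  have c: "cont (%z. exp (v ep z))" using e'[OF that] by (intro continuous_intros C2_cont) blast
  have "big.Per (%z. exp (v ep z))" by (rule Per_sub[OF sub.Per_compose]) (use e'[OF that] in blast)
  from fold[OF c this] have "(\<integral>z. exp (v ep z) \<partial>big.M) = (\<integral>z. 2 * exp (v ep z) \<partial>sub.M)" using vp[OF that] by simp
  also have "... = 2 * (sub.area * (2 * kp + ep))" using bm(2)[OF continuous_on_const sub.Per_const that] by simp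
  finally show ?thesis by (simp add: k a2)
 qed
 show ?thesis unfolding assms(3)
 \<comment> \<open>The correction \<open>r\<close> is the zero function, because \<open>lam\<close>
   solves the relation exactly.\<close>
 proof (rule exI[of _ ep0], rule conjI[OF ep0], rule exI[of _ lam], rule exI[of _ u], rule exI[of _ "%_. 0"], intro conjI ballI allI impI)
  fix ep assume "ep : {0<..<ep0}"
  then have ep: "0 < ep" "ep < ep0" "ep < ep1" by (auto simp: ep0_def)
  note v = e(2)[OF ep(1,3)] and l = lam[OF ep(1,2)]
  show "0 < lam ep" using l by simp
  show "ep = (32 * pi + 0) * lam ep * exp (- lam ep)" using l by simp
  show "u (lam ep) z = u (lam ep) (- z)" for z unfolding u[OF ep(1,2)] using v by simp
  have n: "16 * pi + ep ~= 0" using ep(1) pi_gt_zero by linarith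
  have "lap (v ep) z + (16 * pi + ep) * (exp (v ep z) / (16 * pi + ep) - 1) = 0" for z
  proof -
   have "lap (v ep) z + exp (v ep z) = 16 * pi + ep" using v unfolding k by blast
   then show ?thesis using n by (simp add: right_diff_distrib)
  qed
  then show "torus_mean_field_solution \<omega>1 \<omega>2 (16 * pi + ep) (u (lam ep))"
   unfolding torus_mean_field_solution_def u[OF ep(1,2)] int[OF ep(1,3)]
   using v Per_sub C2_C2_map by auto
 next
  fix q assume "q : {0, p2}"
  then have "\<forall>\<^sub>F ep in at_right 0. v ep q = v ep 0"
   unfolding eventually_at_right_field using vp[of _ 0] e(1) by (intro exI[of _ ep1]) auto
  then have q: "\<forall>\<^sub>F ep in at_right 0. v ep 0 = u (lam ep) q" using ev by eventually_elim simp
  show "filterlim (%ep. u (lam ep) q) at_top (at_right 0)"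
   using filterlim_cong[OF refl refl q] bm(3)[OF continuous_on_const sub.Per_const] by blast
 next
  fix x assume x: "x - 0 \<notin> big.L & x - p2 \<notin> big.L"
  have q: "\<forall>\<^sub>F ep in at_right 0. v ep x = u (lam ep) x" using ev by eventually_elim simp
  have "x \<notin> sub.L" using x sub_L[of x] by simp
  then show "filterlim (%ep. u (lam ep) x) at_bot (at_right 0)"
   using filterlim_cong[OF refl refl q] bm(4)[OF continuous_on_const sub.Per_const] by blast
 next
  show "torus_measures_tendsto \<omega>1 \<omega>2
   (%ep. density big.M (%z. ennreal ((16 * pi + ep) / (\<integral>w. exp (u (lam ep) w) \<partial>big.M) * exp (u (lam ep) z))))
   (point_measure {0, p2} (%_. 8 * ennreal pi)) (at_right 0)"
   unfolding torus_measures_tendsto_def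
  proof (intro allI impI)
   fix f :: "complex => real" assume "cont f & big.Per f"
   then have f: "cont f" "big.Per f" by auto
   \<comment> \<open>The test function folded onto the half torus; its value at 0 collects the point
     masses at 0 and \<open>p2\<close>.\<close>
   define F where "F z = f z + f (z + p2)" for z
   have f2: "cont (%z. f (z + p2))" by (rule continuous_on_compose2[OF f(1)]) (auto intro!: continuous_intros)
   have F: "cont F" unfolding F_def[abs_def] by (intro continuous_intros f f2)
   have "F (z + l) = F z" if "l : sub.L" for z l
   proof (cases "l : big.L")
    case True
    then show ?thesis using big.Per_add[OF f(2), of l z] big.Per_add[OF f(2), of l "z + p2"] by (simp add: F_def ac_simps)
   next
    case False
    then have l: "l - p2 : big.L" using that sub_L by blast
    have "l - p2 + 2 * p2 : big.L" by (rule big.L_add[OF l p(2)])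
    then have "f (z + (l + p2)) = f z" using big.Per_add[OF f(2), of "l + p2" z] by (simp add: algebra_simps)
    moreover have "f (z + p2 + (l - p2)) = f (z + p2)" by (rule big.Per_add[OF f(2) l])
    ultimately show ?thesis by (simp add: F_def add.assoc)
   qed
   then have FP: "sub.Per F" by (simp add: Per_def)
   have pt: "(\<integral>z. f z \<partial>point_measure {0, p2} (%_. 8 * ennreal pi)) = 8 * pi * F 0"
   proof -
    have "p2 ~= 0" using p(1) big.L_0 by auto
    moreover have "8 * ennreal pi = ennreal (8 * pi)" by (simp add: ennreal_mult)
    ultimately show ?thesis by (simp add: lebesgue_integral_point_measure_finite F_def distrib_left)
   qed
   have q: "\<forall>\<^sub>F ep in at_right 0. (\<integral>z. F z * exp (v ep z) \<partial>sub.M) =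
    (\<integral>z. f z \<partial>density big.M (%z. ennreal ((16 * pi + ep) / (\<integral>w. exp (u (lam ep) w) \<partial>big.M) * exp (u (lam ep) z))))"
    unfolding eventually_at_right_field
   proof (intro exI[of _ ep0] conjI allI impI ep0)
    fix ep assume ep: "0 < ep" "ep < ep0"
    then have ep1: "ep < ep1" by (simp add: ep0_def)
    have vc: "cont (v ep)" using e'[OF ep(1) ep1] C2_cont by blast
    have n: "16 * pi + ep ~= 0" using ep(1) pi_gt_zero by linarith
    have "big.Per (v ep)" using e'[OF ep(1) ep1] Per_sub by blast
    then have per: "big.Per (%z. f z * exp (v ep z))" using f(2) by (simp add: Per_def)
    have "(\<integral>z. f z \<partial>density big.M (%z. ennreal (exp (v ep z)))) = (\<integral>z. exp (v ep z) * f z \<partial>big.M)"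
     using integral_density[of f big.M "%z. exp (v ep z)"] by (simp add: big.cont_M f vc continuous_intros)
    also have "... = (\<integral>z. f z * exp (v ep z) + f (z + p2) * exp (v ep (z + p2)) \<partial>sub.M)"
     using fold[OF _ per] by (simp add: continuous_intros f vc mult.commute)
    finally show "(\<integral>z. F z * exp (v ep z) \<partial>sub.M) =
     (\<integral>z. f z \<partial>density big.M (%z. ennreal ((16 * pi + ep) / (\<integral>w. exp (u (lam ep) w) \<partial>big.M) * exp (u (lam ep) z))))"
     unfolding u[OF ep] int[OF ep(1) ep1] using n vp[OF ep(1) ep1] by (simp add: F_def distrib_right)
   qed
   show "((%ep. \<integral>z. f z \<partial>density big.M (%z. ennreal ((16 * pi + ep) / (\<integral>w. exp (u (lam ep) w) \<partial>big.M) * exp (u (lam ep) z))))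
    \<longlongrightarrow> (\<integral>z. f z \<partial>point_measure {0, p2} (%_. 8 * ennreal pi))) (at_right 0)"
    unfolding pt using tendsto_cong[OF q] bm(1)[OF F FP] by blast
  qed
 qed simp
qed

end
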